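(* Let $T:(0,1]\to[0,1]$ be an EMR interval map with superlinear branch expansion. Then there exist sets $A_k\subset\mathcal{B}_k$, $k\in\mathbb{N}$, such that $$\lim_{k\to\infty}\frac{\#A_k}{\#\mathcal{B}_k}=1,$$ and, for every sequence $(b_k)_k$ (defined for all sufficiently large $k$) with $b_k\in A_k$, the following hold: (1) the sequence of measures $(\mu_{b_k})_k$ converges in the weak$^*$ topology to the equilibrium measure $\mu_1$ of $-\log|T'|$; (2) $$\lim_{k\to\infty}\frac{1}{\ell(b_k)}\log\left|\left(T^{\ell(b_k)}\right)'(b_k)\right|=\int\log|T'|\,d\mu_1.$$
   Context: **EMR maps with superlinear branch expansion.** Let $(d_n)_{n\ge1}$ be a strictly decreasing sequence of reals with $d_1=1$, $\lim_nd_n=0$, and $I_n=(d_{n+1},d_n]$. Consider $T:(0,1]\to[0,1]$ such that each branch $T|_{I_n}$ is monotone and admits a continuous extension to $\overline{I_n}$ whose image is $[0,1]$. $T$ is an expanding-Markov-Renyi (EMR) map if: (1) $T$ is $C^2$ on $\bigcup_n\mathrm{int}(I_n)$; (2) there are $\xi>1$ and $n_0\ge1$ such that $|(T^{n_0})'(x)|\ge\xi$ for every $x\in\bigcup_n\mathrm{int}(I_n)$ (where defined); (3) (Renyi condition) there is $K>0$ with $\sup_{n\ge1}\sup_{x,y,z\in I_n}\frac{|T''(x)|}{|T'(y)||T'(z)|}\le K$. It is an EMR map with superlinear branch expansion if moreover (4) there are $c>0$ and $\alpha>1$ such that for every $n\ge1$, $|T'(x)|\ge cn^\alpha$ for every $x\in\mathrm{int}(I_n)$.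 **Boundary points.** $\mathcal{B}=\bigcup_{n\ge1}T^{-n}(0)$. For $b\in\mathcal{B}$, $\ell(b)\in\mathbb{N}$ is the integer with $T^{\ell(b)}(b)=0$ and $T^{\ell(b)-1}(b)>0$ (the length of the finite code $b=(a_0,\ldots,a_{\ell(b)-1})$, $T^ib\in I_{a_i}$). $\mu_b=\frac1{\ell(b)}\sum_{i=0}^{\ell(b)-1}\delta_{T^ib}$. For $k\in\mathbb{N}$, $\mathcal{B}_k=\{b\in\mathcal{B}:|(T^{\ell(b)})'(b)|<k\}$, where derivatives at boundary points are one-sided derivatives along the corresponding finite branch. **Equilibrium measure.** $\mu_1$ denotes the unique equilibrium measure of the geometric potential $-\log|T'|$ (it exists and is unique under these assumptions): the $T$-invariant Borel probability measure maximizing $h_\mu(T)-\int\log|T'|\,d\mu$ among $T$-invariant Borel probability measures $\mu$ with $\int\log|T'|\,d\mu<\infty$.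
   Formalization: The formal theorem additionally assumes that the set B of boundary points is nonempty; if every branch is increasing on its half-open interval, T never takes the value 0, B and all B_k are empty, and the quotient #A_k/#B_k is undefined (0/0) for every k. *)

theory Defs
  imports "HOL-Probability.Probability"
begin

text \<open>The partition of \<open>(0,1]\<close> is given by points \<open>d 1 = 1 > d 2 > \<dots>\<close>; the value \<open>d 0\<close> is
  irrelevant.  Maps \<open>(0,1] \<rightarrow> [0,1]\<close> are total functions \<open>real \<Rightarrow> real\<close> whose values outside
  \<open>(0,1]\<close> are irrelevant.  In particular \<open>T 0\<close> is not part of the map, and orbits stop when they
  reach \<open>0\<close>.\<close>

definition branch_dom :: "(nat \<Rightarrow> real) \<Rightarrow> nat \<Rightarrow> real set" where
  "branch_dom d n = {d (Suc n)<..d n}"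

definition branch_interiors :: "(nat \<Rightarrow> real) \<Rightarrow> real set" where
  "branch_interiors d = (\<Union>n\<in>{1..}. interior (branch_dom d n))"

definition full_branch_map :: "(nat \<Rightarrow> real) \<Rightarrow> (real \<Rightarrow> real) \<Rightarrow> bool" where
  "full_branch_map d T \<longleftrightarrow>
     strict_antimono_on {1..} d \<and> d 1 = 1 \<and> d \<longlonglongrightarrow> 0 \<and>
     T \<in> {0<..1} \<rightarrow> {0..1} \<and>
     (\<forall>n\<ge>1. (mono_on (branch_dom d n) T \<or> antimono_on (branch_dom d n) T) \<and>
        (\<exists>g. continuous_on (closure (branch_dom d n)) g \<and>
             (\<forall>x\<in>branch_dom d n. g x = T x) \<and>
             g ` closure (branch_dom d n) = {0..1}))"

text \<open>In the expansion condition, \<open>T ^^ n0\<close> is differentiable at \<open>x\<close> when the first \<open>n0\<close> points of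
  the orbit of \<open>x\<close> lie in the interiors of the branches; the condition is imposed at these
  points.  The Renyi condition is cleared of denominators, to avoid division by zero.\<close>

definition EMR_map :: "(nat \<Rightarrow> real) \<Rightarrow> (real \<Rightarrow> real) \<Rightarrow> bool" where
  "EMR_map d T \<longleftrightarrow>
     full_branch_map d T \<and>
     T C1_differentiable_on branch_interiors d \<and>
     deriv T C1_differentiable_on branch_interiors d \<and>
     (\<exists>\<xi>>1. \<exists>n0\<ge>1. \<forall>x. (\<forall>i<n0. (T ^^ i) x \<in> branch_interiors d) \<longrightarrow>
        \<bar>deriv (T ^^ n0) x\<bar> \<ge> \<xi>) \<and>
     (\<exists>K>0. \<forall>n\<ge>1. \<forall>x\<in>interior (branch_dom d n). \<forall>y\<in>interior (branch_dom d n).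
        \<forall>z\<in>interior (branch_dom d n).
        \<bar>deriv (deriv T) x\<bar> \<le> K * (\<bar>deriv T y\<bar> * \<bar>deriv T z\<bar>))"

definition superlinear_EMR_map :: "(nat \<Rightarrow> real) \<Rightarrow> (real \<Rightarrow> real) \<Rightarrow> bool" where
  "superlinear_EMR_map d T \<longleftrightarrow>
     EMR_map d T \<and>
     (\<exists>c>0. \<exists>\<alpha>>1. \<forall>n\<ge>1. \<forall>x\<in>interior (branch_dom d n). \<bar>deriv T x\<bar> \<ge> c * real n powr \<alpha>)"

text \<open>The set of points whose code has the same first \<open>n\<close> digits as that of \<open>x\<close>.\<close>

definition cylinder :: "(nat \<Rightarrow> real) \<Rightarrow> (real \<Rightarrow> real) \<Rightarrow> nat \<Rightarrow> real \<Rightarrow> real set" where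
  "cylinder d T n x =
     {y. \<forall>i<n. \<exists>m\<ge>1. (T ^^ i) x \<in> branch_dom d m \<and> (T ^^ i) y \<in> branch_dom d m}"

text \<open>\<open>(T\<^sup>n)'(x)\<close> as derivative of the restriction of \<open>T ^^ n\<close> to the branch of \<open>T ^^ n\<close> through
  \<open>x\<close>: the usual derivative in the interior of the cylinder, and the one-sided derivative along
  the branch if \<open>x\<close> is an endpoint of it.\<close>

definition iter_deriv :: "(nat \<Rightarrow> real) \<Rightarrow> (real \<Rightarrow> real) \<Rightarrow> nat \<Rightarrow> real \<Rightarrow> real" where
  "iter_deriv d T n x = vector_derivative (T ^^ n) (at x within cylinder d T n x)"

text \<open>Before reaching \<open>0\<close> an orbit that starts in \<open>(0,1]\<close> stays in \<open>(0,1]\<close>.  So the first time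
  the orbit of \<open>b\<close> reaches \<open>0\<close> is the \<open>n\<close> with \<open>T\<^sup>n b = 0\<close> and \<open>T\<^sup>n\<^sup>-\<^sup>1 b > 0\<close>.\<close>

definition boundary_points :: "(real \<Rightarrow> real) \<Rightarrow> real set" where
  "boundary_points T =
     {b. \<exists>n\<ge>1. (\<forall>i<n. (T ^^ i) b \<in> {0<..1}) \<and> (T ^^ n) b = 0}"

definition code_length :: "(real \<Rightarrow> real) \<Rightarrow> real \<Rightarrow> nat" where
  "code_length T b = (LEAST n. (T ^^ n) b = 0)"

definition boundary_points_below ::
    "(nat \<Rightarrow> real) \<Rightarrow> (real \<Rightarrow> real) \<Rightarrow> nat \<Rightarrow> real set" where
  "boundary_points_below d T k =
     {b \<in> boundary_points T. \<bar>iter_deriv d T (code_length T b) b\<bar> < real k}"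

abbreviation unit_borel :: "real measure" where
  "unit_borel \<equiv> restrict_space borel {0<..1}"

text \<open>\<open>(1/\<ell>) (\<Sum>i<\<ell>. \<delta>(T\<^sup>i b))\<close> with \<open>\<ell>\<close> the code length of \<open>b\<close>, as image of the uniform
  distribution on \<open>{..<\<ell>}\<close>.\<close>

definition orbit_measure :: "(real \<Rightarrow> real) \<Rightarrow> real \<Rightarrow> real measure" where
  "orbit_measure T b =
     distr (uniform_count_measure {..<code_length T b}) unit_borel (\<lambda>i. (T ^^ i) b)"

definition weak_star_conv :: "(nat \<Rightarrow> real measure) \<Rightarrow> real measure \<Rightarrow> bool" where
  "weak_star_conv M N \<longleftrightarrow>
     (\<forall>f :: real \<Rightarrow> real. continuous_on {0<..1} f \<and> bounded (f ` {0<..1}) \<longrightarrow>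
        (\<lambda>k. LINT x|M k. f x) \<longlonglongrightarrow> (LINT x|N. f x))"

text \<open>Since \<open>A\<close> ranges over subsets of \<open>(0,1]\<close> and \<open>\<mu>\<close> has total mass \<open>1\<close>, invariance entails that
  almost every point is mapped into \<open>(0,1]\<close>.\<close>

definition invariant_prob :: "(real \<Rightarrow> real) \<Rightarrow> real measure \<Rightarrow> bool" where
  "invariant_prob T \<mu> \<longleftrightarrow>
     prob_space \<mu> \<and> sets \<mu> = sets unit_borel \<and>
     (\<forall>A\<in>sets \<mu>. T -` A \<inter> space \<mu> \<in> sets \<mu> \<and> emeasure \<mu> (T -` A \<inter> space \<mu>) = emeasure \<mu> A)"

definition finite_partition :: "'a measure \<Rightarrow> 'a set set \<Rightarrow> bool" where
  "finite_partition \<mu> P \<longleftrightarrow> finite P \<and> P \<subseteq> sets \<mu> \<and> partition_on (space \<mu>) P"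

definition partition_entropy :: "'a measure \<Rightarrow> 'a set set \<Rightarrow> real" where
  "partition_entropy \<mu> P = - (\<Sum>A\<in>P. measure \<mu> A * ln (measure \<mu> A))"

text \<open>The join of \<open>P, T\<^sup>-\<^sup>1 P, \<dots>, T\<^sup>-\<^sup>n\<^sup>+\<^sup>1 P\<close>.  If \<open>T\<close> is an interval map as above and \<open>\<mu>\<close>
  is invariant, the points whose orbit reaches \<open>0\<close> form a null set, so that it does not matter
  to which cell, if any, they belong.\<close>

definition dynamical_join :: "('a \<Rightarrow> 'a) \<Rightarrow> 'a measure \<Rightarrow> nat \<Rightarrow> 'a set set \<Rightarrow> 'a set set" where
  "dynamical_join T \<mu> n P =
     (\<lambda>C. {x \<in> space \<mu>. \<forall>i<n. (T ^^ i) x \<in> C i}) ` ({..<n} \<rightarrow>\<^sub>E P)"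

text \<open>Kolmogorov-Sinai entropy.\<close>

definition KS_entropy :: "('a \<Rightarrow> 'a) \<Rightarrow> 'a measure \<Rightarrow> ereal" where
  "KS_entropy T \<mu> =
     (SUP P\<in>Collect (finite_partition \<mu>).
        ereal (lim (\<lambda>n. partition_entropy \<mu> (dynamical_join T \<mu> n P) / real n)))"

definition lyapunov_exponent :: "(nat \<Rightarrow> real) \<Rightarrow> (real \<Rightarrow> real) \<Rightarrow> real measure \<Rightarrow> real" where
  "lyapunov_exponent d T \<mu> = (LINT x|\<mu>. ln \<bar>iter_deriv d T 1 x\<bar>)"

text \<open>Under superlinear branch expansion \<open>ln \<bar>T'\<bar>\<close> is bounded from below, so that integrability
  says that its integral, which always exists, is less than infinity.\<close>

definition admissible_measure :: "(nat \<Rightarrow> real) \<Rightarrow> (real \<Rightarrow> real) \<Rightarrow> real measure \<Rightarrow> bool" where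
  "admissible_measure d T \<mu> \<longleftrightarrow>
     invariant_prob T \<mu> \<and> integrable \<mu> (\<lambda>x. ln \<bar>iter_deriv d T 1 x\<bar>)"

definition equilibrium_measure :: "(nat \<Rightarrow> real) \<Rightarrow> (real \<Rightarrow> real) \<Rightarrow> real measure \<Rightarrow> bool" where
  "equilibrium_measure d T \<mu> \<longleftrightarrow>
     admissible_measure d T \<mu> \<and>
     (\<forall>\<nu>. admissible_measure d T \<nu> \<longrightarrow>
        KS_entropy T \<nu> - ereal (lyapunov_exponent d T \<nu>)
          \<le> KS_entropy T \<mu> - ereal (lyapunov_exponent d T \<mu>))"

end

theory Submission
  imports Defs
begin

text \<open>Points are coded by their itineraries, and everything is reduced to counting words. A boundary
  point \<open>b\<close> with \<open>T\<^sup>n b = 0\<close> is determined by its code \<open>w = (a\<^sub>0, \<dots>, a\<^sub>n\<^sub>-\<^sub>1)\<close>, and by the Renyi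
  condition \<open>\<bar>(T\<^sup>n)'(b)\<bar>\<close> equals, up to a bounded factor, \<open>1 / q w\<close>, where \<open>q w\<close> is the Lebesgue
  measure of the cylinder of \<open>w\<close>. So the boundary points with derivative below \<open>k\<close> are, up to a
  constant factor in \<open>k\<close>, the words with \<open>q w \<ge> 1 / k\<close>: see \<open>word_big\<close> for one direction, and
  \<open>card_below_ge\<close> for the other, where a fixed boundary point is pulled back along an arbitrary
  word.

  \<^bold>\<open>Concentration.\<close> Bounded distortion makes Lebesgue measure almost multiplicative on
  concatenated words; the locale \<open>gibbs_coding\<close> records just this. A Doeblin argument then shows
  that, given the first \<open>n\<close> digits, the distribution of \<open>T\<^sup>n\<^sup>+\<^sup>g x\<close> tends to a limit as \<open>g \<rightarrow> \<infinity>\<close>,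
  with a \<^emph>\<open>relative\<close> error that is uniform in the digits (\<open>mixing\<close>). The limit \<open>acim\<close> is an
  invariant measure with density between two positive constants. Relative mixing bounds the
  exponential moments of Birkhoff sums (\<open>mgf\<close>). Hence the probability that a Birkhoff average of
  length \<open>n\<close> is \<open>\<delta>\<close>-far from its \<open>acim\<close>-mean is exponentially small in \<open>n\<close>, for indicators of
  cylinders and for \<open>log \<bar>T'\<bar>\<close> (\<open>concentrates\<close>); superlinear branch expansion enters here, as it
  gives \<open>log \<bar>T'\<bar>\<close> exponential moments.

  \<^bold>\<open>Counting.\<close> The cylinders of the words of length \<open>n\<close> with a deviating Birkhoff average lie in a
  set of measure \<open>O(exp (- \<eta> n))\<close>, so at most \<open>O(K exp (- \<eta> n))\<close> of them can have measure at least
  \<open>1 / K\<close>. This is small only for \<open>n \<ge> a log K\<close>; the shorter words are few for a different reason,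
  a Chebyshev bound for \<open>q w powr - t\<close>. Together there are \<open>O(K powr (1 - \<eta>))\<close> bad words
  (\<open>card_bad_words\<close>). On the other hand most points have initial words of length about \<open>log K /
  \<lambda>\<close>, with \<open>\<lambda>\<close> the Lyapunov exponent, whose cylinders have measure about \<open>1 / K\<close>; so there are at
  least \<open>K powr (1 - \<eta>')\<close> words in all, for every \<open>\<eta>' > 0\<close> (\<open>card_big_ge\<close>). Thus the proportion of
  bad words tends to \<open>0\<close> for each observable and each \<open>\<delta>\<close>, and \<open>diagonal_selection\<close> treats
  countably many pairs at once.

  \<^bold>\<open>Identification of the equilibrium measure.\<close> The entropy of \<open>acim\<close> is at least its Lyapunov
  exponent (\<open>acim_entropy_ge\<close>), so an equilibrium measure \<open>\<nu>\<close> has entropy at least \<open>\<integral> log \<bar>T'\<bar>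
  d\<nu>\<close>. For such \<open>\<nu>\<close>, Gibbs' inequality is tested against Lebesgue measure with the density \<open>exp (t
  (S\<^sub>n f - n acim(f)))\<close>, normalized. Its normalizing constant is at most \<open>B exp (n t \<delta> / 2)\<close> by
  the bound on exponential moments, and the result is \<open>\<nu>(f) \<le> acim(f) + \<delta>\<close> for all functions \<open>f\<close>
  of finitely many digits (\<open>entropy_ge_imp_integral_le\<close>). Hence \<open>\<nu> = acim\<close> (\<open>equilibrium_unique\<close>).

  \<^bold>\<open>Convergence of the orbit measures.\<close> Since cylinders shrink, a continuous function has small
  oscillation on suitable disjoint cylinders, finitely many of which carry almost all the mass;
  convergence of the cylinder frequencies therefore suffices (\<open>weak_star_conv_cylinders\<close>),
  although neither the set of digits nor the phase space is compact.\<close>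

section \<open>Itineraries and cylinders\<close>

definition itin :: "('a \<Rightarrow> 'a) \<Rightarrow> ('a \<Rightarrow> nat) \<Rightarrow> nat \<Rightarrow> 'a \<Rightarrow> nat list" where
  "itin T l n x = map (\<lambda>i. l ((T ^^ i) x)) [0..<n]"

lemma length_itin [simp]: "length (itin T l n x) = n"
  by (simp add: itin_def)

lemma itin_0 [simp]: "itin T l 0 x = []"
  by (simp add: itin_def)

lemma nth_itin: "i < n \<Longrightarrow> itin T l n x ! i = l ((T ^^ i) x)"
  by (simp add: itin_def)

lemma itin_Suc: "itin T l (Suc n) x = l x # itin T l n (T x)"
  by (rule nth_equalityI) (auto simp: nth_itin nth_Cons funpow_swap1 split: nat.split)

lemma itin_add: "itin T l (m + n) x = itin T l m x @ itin T l n ((T ^^ m) x)"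
proof (rule nth_equalityI)
  fix i assume "i < length (itin T l (m + n) x)"
  then show "itin T l (m + n) x ! i = (itin T l m x @ itin T l n ((T ^^ m) x)) ! i"
    using funpow_add[of "i - m" m T]
    by (auto simp: nth_itin nth_append)
qed simp

lemma take_itin: "m \<le> n \<Longrightarrow> take m (itin T l n x) = itin T l m x"
  using itin_add[of T l m "n - m" x] by simp

lemma drop_itin: "m \<le> n \<Longrightarrow> drop m (itin T l n x) = itin T l (n - m) ((T ^^ m) x)"
  using itin_add[of T l m "n - m" x] by simp

lemma take_drop_itin: "i + m \<le> n \<Longrightarrow> take m (drop i (itin T l n x)) = itin T l m ((T ^^ i) x)"
  by (simp add: drop_itin take_itin)

lemma measurable_itin [measurable]:
  assumes [measurable]: "T \<in> M \<rightarrow>\<^sub>M M" "l \<in> M \<rightarrow>\<^sub>M count_space UNIV"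
  shows "itin T l n \<in> M \<rightarrow>\<^sub>M count_space UNIV"
proof (induction n)
  case 0
  have "itin T l 0 = (\<lambda>x. [])" by auto
  then show ?case by simp
next
  case (Suc n)
  note Suc.IH [measurable]
  have *: "(\<lambda>x. a # itin T l n (T x)) \<in> M \<rightarrow>\<^sub>M count_space UNIV" for a
    using measurable_compose[OF measurable_compose[OF assms(1) Suc.IH] measurable_count_space] 
    by simp
  have "(\<lambda>x. l x # itin T l n (T x)) \<in> M \<rightarrow>\<^sub>M count_space UNIV"
    by (rule measurable_compose_countable[where f="\<lambda>a x. a # itin T l n (T x)", OF * assms(2)])
  moreover have "itin T l (Suc n) = (\<lambda>x. l x # itin T l n (T x))" by (auto simp: itin_Suc)
  ultimately show ?case by simp
qed

lemma countable_lists_length [simp]: "countable {w :: nat list. length w = n}"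
  by simp

definition cylset :: "'a measure \<Rightarrow> ('a \<Rightarrow> 'a) \<Rightarrow> ('a \<Rightarrow> nat) \<Rightarrow> nat list \<Rightarrow> 'a set" where
  "cylset M T dig w = {x \<in> space M. itin T dig (length w) x = w}"

lemma (in finite_measure) measure_countable_split:
  assumes [measurable]: "X \<in> M \<rightarrow>\<^sub>M count_space UNIV" and B[measurable]: "B \<in> sets M"
    and K: "X ` B \<subseteq> K" "countable K"
  shows "integrable (count_space K) (\<lambda>u. measure M {x \<in> B. X x = u})"
    and "measure M B = (LINT u|count_space K. measure M {x \<in> B. X x = u})"
proof -
  have Bs: "{x \<in> B. X x = u} = {x \<in> space M. x \<in> B \<and> X x = u}" for u
    using sets.sets_into_space[OF B] by auto
  have [measurable]: "{x \<in> B. X x = u} \<in> sets M" for u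
    unfolding Bs by measurable
  have d: "disjoint_family_on (\<lambda>u. {x \<in> B. X x = u}) K"
    by (auto simp: disjoint_family_on_def)
  have U: "(\<Union>u\<in>K. {x \<in> B. X x = u}) = B" using K by auto
  show i: "integrable (count_space K) (\<lambda>u. measure M {x \<in> B. X x = u})"
    by (rule integrable_measure[OF d K(2)])
  have "emeasure M B = (\<integral>\<^sup>+u. emeasure M {x \<in> B. X x = u} \<partial>count_space K)"
    using emeasure_UN_countable[OF _ K(2) d] U by simp
  also have "\<dots> = (\<integral>\<^sup>+u. ennreal (measure M {x \<in> B. X x = u}) \<partial>count_space K)"
    by (simp add: emeasure_eq_measure)
  also have "\<dots> = ennreal (LINT u|count_space K. measure M {x \<in> B. X x = u})"
    by (rule nn_integral_eq_integral[OF i]) auto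
  finally show "measure M B = (LINT u|count_space K. measure M {x \<in> B. X x = u})"
    by (simp add: emeasure_eq_measure)
qed

text \<open>Two probability weights \<open>a\<close> and \<open>b\<close> with a common part \<open>c\<close> of mass \<open>s\<close> differ only by mass \<open>1 -
  s\<close>, and this is all that can distinguish their means of \<open>H\<close>.\<close>

lemma doeblin_sum:
  fixes a b c H :: "'b \<Rightarrow> real"
  assumes ia: "integrable (count_space K) a" and ib: "integrable (count_space K) b"
    and ic: "integrable (count_space K) c"
    and a1: "(LINT u|count_space K. a u) = 1" and b1: "(LINT u|count_space K. b u) = 1"
    and cs: "(LINT u|count_space K. c u) = s"
    and ca: "\<And>u. u \<in> K \<Longrightarrow> c u \<le> a u" and cb: "\<And>u. u \<in> K \<Longrightarrow> c u \<le> b u"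
    and osc: "\<And>u v. u \<in> K \<Longrightarrow> v \<in> K \<Longrightarrow> H u - H v \<le> \<Delta>"
  shows "(LINT u|count_space K. a u * H u) - (LINT u|count_space K. b u * H u) \<le> (1 - s) * \<Delta>"
proof -
  have "K \<noteq> {}" using a1 by (auto simp: lebesgue_integral_count_space_finite)
  then obtain u0 where u0: "u0 \<in> K" by auto
  have bd: "bdd_below (H ` K)"
    by (rule bdd_belowI[of _ "H u0 - \<Delta>"]) (use osc[OF u0] in \<open>auto simp: algebra_simps\<close>)
  define lo where "lo = Inf (H ` K)"
  have lo: "lo \<le> H u" if "u \<in> K" for u
    unfolding lo_def using bd that by (auto intro: cInf_lower)
  have hi: "H u \<le> lo + \<Delta>" if "u \<in> K" for u
  proof -
    have "H u - \<Delta> \<le> lo"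
      unfolding lo_def using \<open>K \<noteq> {}\<close> osc[OF that] by (intro cInf_greatest) (auto simp: algebra_simps)
    then show ?thesis by simp
  qed
  have int: "integrable (count_space K) (\<lambda>u. f u * H u)" if "integrable (count_space K) f" for f :: "'b \<Rightarrow> real"
  proof (rule Bochner_Integration.integrable_bound)
    show "integrable (count_space K) (\<lambda>u. (\<bar>lo\<bar> + \<bar>lo + \<Delta>\<bar>) * f u)" using that by simp
    show "AE u in count_space K. norm (f u * H u) \<le> norm ((\<bar>lo\<bar> + \<bar>lo + \<Delta>\<bar>) * f u)"
    proof (rule AE_I2)
      fix u assume "u \<in> space (count_space K)"
      then have "\<bar>H u\<bar> \<le> \<bar>lo\<bar> + \<bar>lo + \<Delta>\<bar>" using lo[of u] hi[of u] by auto
      then have "\<bar>f u\<bar> * \<bar>H u\<bar> \<le> \<bar>f u\<bar> * \<bar>\<bar>lo\<bar> + \<bar>lo + \<Delta>\<bar>\<bar>" by (intro mult_left_mono) auto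
      then show "norm (f u * H u) \<le> norm ((\<bar>lo\<bar> + \<bar>lo + \<Delta>\<bar>) * f u)"
        by (simp add: abs_mult mult.commute)
    qed
  qed auto
  have "(LINT u|count_space K. (a u - c u) * H u) \<le> (LINT u|count_space K. (a u - c u) * (lo + \<Delta>))"
    using hi ca by (intro integral_mono int Bochner_Integration.integrable_diff ia ic integrable_mult_left)
      (auto intro: mult_left_mono)
  moreover have "(LINT u|count_space K. (b u - c u) * lo) \<le> (LINT u|count_space K. (b u - c u) * H u)"
    using lo cb by (intro integral_mono int Bochner_Integration.integrable_diff ib ic integrable_mult_left)
      (auto intro: mult_left_mono)
  moreover have "(LINT u|count_space K. (a u - c u) * H u) =
    (LINT u|count_space K. a u * H u) - (LINT u|count_space K. c u * H u)"
    using int[OF ia] int[OF ic] by (simp add: left_diff_distrib)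
  moreover have "(LINT u|count_space K. (b u - c u) * H u) =
    (LINT u|count_space K. b u * H u) - (LINT u|count_space K. c u * H u)"
    using int[OF ib] int[OF ic] by (simp add: left_diff_distrib)
  moreover have "(LINT u|count_space K. (a u - c u) * (lo + \<Delta>)) = (1 - s) * (lo + \<Delta>)"
    using ia ic a1 cs by simp
  moreover have "(LINT u|count_space K. (b u - c u) * lo) = (1 - s) * lo"
    using ib ic b1 cs by simp
  ultimately show ?thesis by (simp add: algebra_simps)
qed

section \<open>Almost multiplicative measures and their invariant limit\<close>

text \<open>The two Gibbs inequalities say that, on the cylinder of \<open>w @ u\<close>, the map \<open>T\<^bsup>length w\<^esup>\<close> carries
  the normalized measure \<open>M\<close> to that on the cylinder of \<open>u\<close> with a density in \<open>[exp (- \<kappa>), exp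
  \<kappa>]\<close>, where \<open>\<kappa>\<close> depends on \<open>length u\<close> only. They are cleared of denominators. For \<open>u = []\<close> this
  is bounded distortion; that \<open>\<kappa> m \<rightarrow> 0\<close> expresses that a long common continuation makes the
  distortion negligible.\<close>

locale gibbs_coding = prob_space M for M :: "'a measure" +
  fixes T :: "'a \<Rightarrow> 'a" and dig :: "'a \<Rightarrow> nat" and \<kappa> :: "nat \<Rightarrow> real"
  assumes T_measurable [measurable]: "T \<in> M \<rightarrow>\<^sub>M M"
    and dig_measurable [measurable]: "dig \<in> M \<rightarrow>\<^sub>M count_space UNIV"
    and kappa_nonneg: "0 \<le> \<kappa> m"
    and kappa_tendsto: "\<kappa> \<longlonglongrightarrow> 0"
    and cylset_pos: "0 < measure M (cylset M T dig w)"
    and gibbs_upper: "A \<in> sets M \<Longrightarrow> A \<subseteq> cylset M T dig u \<Longrightarrow>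
      measure M {x \<in> cylset M T dig w. (T ^^ length w) x \<in> A} * measure M (cylset M T dig u)
        \<le> exp (\<kappa> (length u)) * (measure M (cylset M T dig (w @ u)) * measure M A)"
    and gibbs_lower: "A \<in> sets M \<Longrightarrow> A \<subseteq> cylset M T dig u \<Longrightarrow>
      measure M (cylset M T dig (w @ u)) * measure M A
        \<le> exp (\<kappa> (length u)) *
          (measure M {x \<in> cylset M T dig w. (T ^^ length w) x \<in> A} * measure M (cylset M T dig u))"
    and cyl_generate: "sets M = sigma_sets (space M) (range (cylset M T dig))"
begin

abbreviation "code \<equiv> itin T dig"
abbreviation "cyl \<equiv> cylset M T dig"
abbreviation "q w \<equiv> prob (cyl w)"

definition C\<^sub>0 :: real where "C\<^sub>0 = exp (\<kappa> 0)"

text \<open>The conditional probability that \<open>T\<^sup>g\<close> of the remaining orbit lies in \<open>A\<close>, given that \<open>w\<close> has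
  been read.\<close>

definition tail_prob :: "nat \<Rightarrow> nat list \<Rightarrow> 'a set \<Rightarrow> real" where
  "tail_prob g w A = prob {x \<in> cyl w. (T ^^ (length w + g)) x \<in> A} / q w"

lemma C0_ge_1: "1 \<le> C\<^sub>0" using kappa_nonneg[of 0] by (simp add: C\<^sub>0_def)

lemma funpow_measurable [measurable]: "(T ^^ n) \<in> M \<rightarrow>\<^sub>M M"
  by (induction n) (auto simp: id_def)

lemma funpow_space: "x \<in> space M \<Longrightarrow> (T ^^ n) x \<in> space M"
  using measurable_space[OF funpow_measurable] by auto

lemma cyl_sets [measurable]: "cyl w \<in> sets M"
  unfolding cylset_def by measurable

lemma cyl_iff: "x \<in> cyl w \<longleftrightarrow> x \<in> space M \<and> code (length w) x = w"
  by (simp add: cylset_def)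

lemma cyl_Nil [simp]: "cyl [] = space M"
  by (auto simp: cylset_def)

lemma q_pos [simp]: "0 < q w" using cylset_pos .

lemma cyl_append: "cyl (w @ u) = {x \<in> cyl w. (T ^^ length w) x \<in> cyl u}"
  by (auto simp: cyl_iff itin_add funpow_space)

lemma q_append_ge: "q w * q u \<le> C\<^sub>0 * q (w @ u)"
  using gibbs_lower[of "cyl u" "[]" w] sets.sets_into_space[OF cyl_sets, of u]
  by (simp add: C\<^sub>0_def cyl_append prob_space)

lemma tail_prob_bounds:
  assumes A: "A \<in> sets M"
  shows "tail_prob 0 w A \<le> C\<^sub>0 * prob A" and "prob A \<le> C\<^sub>0 * tail_prob 0 w A"
  using gibbs_upper[OF A, of "[]" w] gibbs_lower[OF A, of "[]" w] sets.sets_into_space[OF A]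
  by (simp_all add: tail_prob_def C\<^sub>0_def pos_divide_le_eq pos_le_divide_eq prob_space mult_ac)

lemma tail_prob_nonneg: "0 \<le> tail_prob g w A" by (simp add: tail_prob_def)

text \<open>Given that \<open>u\<close> is read next, what was read before matters only by the distortion over \<open>u\<close>.\<close>

lemma tail_prob_append:
  assumes A: "A \<in> sets M"
  shows "tail_prob g (w @ u) A \<le> exp (\<kappa> (length u)) * tail_prob g u A"
    and "tail_prob g u A \<le> exp (\<kappa> (length u)) * tail_prob g (w @ u) A"
proof -
  let ?B = "{x \<in> cyl u. (T ^^ (length u + g)) x \<in> A}"
  have B: "?B \<in> sets M" using A by simp
  have e: "{x \<in> cyl (w @ u). (T ^^ (length (w @ u) + g)) x \<in> A} =
     {x \<in> cyl w. (T ^^ length w) x \<in> ?B}"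
    using funpow_add[of "length u + g" "length w" T] by (auto simp: cyl_append ac_simps)
  have "?B \<subseteq> cyl u" by auto
  from gibbs_upper[OF B this, of w] gibbs_lower[OF B this, of w]
  have "prob {x \<in> cyl (w @ u). (T ^^ (length (w @ u) + g)) x \<in> A} * q u
     \<le> exp (\<kappa> (length u)) * (q (w @ u) * prob ?B)"
    and "q (w @ u) * prob ?B \<le> exp (\<kappa> (length u)) *
     (prob {x \<in> cyl (w @ u). (T ^^ (length (w @ u) + g)) x \<in> A} * q u)"
    unfolding e by auto
  then show "tail_prob g (w @ u) A \<le> exp (\<kappa> (length u)) * tail_prob g u A"
    and "tail_prob g u A \<le> exp (\<kappa> (length u)) * tail_prob g (w @ u) A"
    by (simp_all add: tail_prob_def divide_simps del: length_append) (simp_all add: mult_ac)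
qed

lemma cyl_split:
  assumes A: "A \<in> sets M"
  shows "integrable (count_space {u. length u = m}) (\<lambda>u. prob {x \<in> cyl (w @ u). (T ^^ n) x \<in> A})"
    and "prob {x \<in> cyl w. (T ^^ n) x \<in> A} =
      (LINT u|count_space {u. length u = m}. prob {x \<in> cyl (w @ u). (T ^^ n) x \<in> A})"
proof -
  let ?X = "\<lambda>x. code m ((T ^^ length w) x)" and ?B = "{x \<in> cyl w. (T ^^ n) x \<in> A}"
  have X: "?X \<in> M \<rightarrow>\<^sub>M count_space UNIV" by measurable
  have e: "prob {x \<in> ?B. ?X x = u} = prob {x \<in> cyl (w @ u). (T ^^ n) x \<in> A}"
    if "u \<in> space (count_space {u. length u = m})" for u
    using that by (intro arg_cong[of _ _ prob]) (auto simp: cyl_append cyl_iff funpow_space)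
  have K: "?X ` ?B \<subseteq> {u. length u = m}" by auto
  have B: "?B \<in> sets M" using A by simp
  note s = measure_countable_split[OF X B K countable_lists_length]
  show "integrable (count_space {u. length u = m}) (\<lambda>u. prob {x \<in> cyl (w @ u). (T ^^ n) x \<in> A})"
    using s(1) by (rule Bochner_Integration.integrable_cong[THEN iffD1, rotated -1]) (intro refl e)+
  show "prob {x \<in> cyl w. (T ^^ n) x \<in> A} =
      (LINT u|count_space {u. length u = m}. prob {x \<in> cyl (w @ u). (T ^^ n) x \<in> A})"
    unfolding s(2) by (intro Bochner_Integration.integral_cong refl e)
qed

lemma q_split:
  shows "integrable (count_space {u. length u = m}) (\<lambda>u. q (w @ u))"
    and "q w = (LINT u|count_space {u. length u = m}. q (w @ u))"
proof -
  have e: "{x \<in> cyl v. (T ^^ 0) x \<in> space M} = cyl v" for v by (auto simp: cyl_iff)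
  show "integrable (count_space {u. length u = m}) (\<lambda>u. q (w @ u))"
    using cyl_split(1)[OF sets.top, of m w 0] unfolding e .
  show "q w = (LINT u|count_space {u. length u = m}. q (w @ u))"
    using cyl_split(2)[OF sets.top, of w 0 m] unfolding e .
qed

text \<open>Conditioning on the next \<open>m\<close> digits.\<close>

lemma tail_prob_split:
  assumes A: "A \<in> sets M"
  shows "integrable (count_space {u. length u = m}) (\<lambda>u. q (w @ u) / q w * tail_prob g (w @ u) A)"
    and "tail_prob (m + g) w A =
      (LINT u|count_space {u. length u = m}. q (w @ u) / q w * tail_prob g (w @ u) A)"
proof -
  have e: "q (w @ u) / q w * tail_prob g (w @ u) A =
      prob {x \<in> cyl (w @ u). (T ^^ (length w + (m + g))) x \<in> A} / q w"
    if "u \<in> space (count_space {u. length u = m})" for u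
    using that q_pos[of "w @ u", THEN less_imp_neq] by (simp add: tail_prob_def ac_simps del: q_pos)
  have "integrable (count_space {u. length u = m})
      (\<lambda>u. prob {x \<in> cyl (w @ u). (T ^^ (length w + (m + g))) x \<in> A} / q w)"
    using cyl_split(1)[OF A] by simp
  then show "integrable (count_space {u. length u = m}) (\<lambda>u. q (w @ u) / q w * tail_prob g (w @ u) A)"
    by (subst Bochner_Integration.integrable_cong[OF refl e])
  have "tail_prob (m + g) w A =
      (LINT u|count_space {u. length u = m}. prob {x \<in> cyl (w @ u). (T ^^ (length w + (m + g))) x \<in> A}) / q w"
    using cyl_split(2)[OF A, of w "length w + (m + g)" m] by (simp add: tail_prob_def)
  also have "\<dots> = (LINT u|count_space {u. length u = m}. prob {x \<in> cyl (w @ u). (T ^^ (length w + (m + g))) x \<in> A} / q w)"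
    by simp
  also have "\<dots> = (LINT u|count_space {u. length u = m}. q (w @ u) / q w * tail_prob g (w @ u) A)"
    by (intro Bochner_Integration.integral_cong refl e[symmetric])
  finally show "tail_prob (m + g) w A =
      (LINT u|count_space {u. length u = m}. q (w @ u) / q w * tail_prob g (w @ u) A)" .
qed

lemma cond_weights:
  shows "integrable (count_space {u. length u = m}) (\<lambda>u. q (w @ u) / q w)"
    and "(LINT u|count_space {u. length u = m}. q (w @ u) / q w) = 1"
  using q_split[where m=m and w=w] q_pos[of w, THEN less_imp_neq] by (auto simp del: q_pos)

lemma integrable_weight_bounded:
  assumes "\<And>u. length u = m \<Longrightarrow> \<bar>f u\<bar> \<le> B"
  shows "integrable (count_space {u. length u = m}) (\<lambda>u. q (w @ u) / q w * f u)"
proof (rule Bochner_Integration.integrable_bound)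
  show "integrable (count_space {u. length u = m}) (\<lambda>u. B * (q (w @ u) / q w))"
    using cond_weights(1) by (rule integrable_mult_right)
  show "AE u in count_space {u. length u = m}.
      norm (q (w @ u) / q w * f u) \<le> norm (B * (q (w @ u) / q w))"
  proof (rule AE_I2)
    fix u :: "nat list" assume "u \<in> space (count_space {u. length u = m})"
    then have "\<bar>f u\<bar> \<le> \<bar>B\<bar>" using assms[of u] by auto
    then have "\<bar>q (w @ u) / q w\<bar> * \<bar>f u\<bar> \<le> \<bar>q (w @ u) / q w\<bar> * \<bar>B\<bar>" by (rule mult_left_mono) auto
    then show "norm (q (w @ u) / q w * f u) \<le> norm (B * (q (w @ u) / q w))"
      by (simp add: abs_mult mult.commute)
  qed
qed auto

lemma weighted_mean_le:
  assumes "\<And>u. length u = m \<Longrightarrow> \<bar>f u\<bar> \<le> B" "\<And>u. length u = m \<Longrightarrow> f u \<le> c"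
  shows "(LINT u|count_space {u. length u = m}. q (w @ u) / q w * f u) \<le> c"
proof -
  have "(LINT u|count_space {u. length u = m}. q (w @ u) / q w * f u)
      \<le> (LINT u|count_space {u. length u = m}. q (w @ u) / q w * c)"
    using assms(2) cond_weights(1)[of m w]
    by (intro integral_mono integrable_weight_bounded[OF assms(1)] integrable_mult_left)
      (auto intro!: mult_left_mono divide_right_mono)
  also have "\<dots> = c" using cond_weights[of m w] by simp
  finally show ?thesis .
qed

lemma tail_prob_le:
  assumes A: "A \<in> sets M"
  shows "tail_prob g w A \<le> C\<^sub>0 * prob A"
proof -
  have "tail_prob (g + 0) w A \<le> C\<^sub>0 * prob A"
    unfolding tail_prob_split(2)[OF A]
    using tail_prob_bounds(1)[OF A] tail_prob_nonneg
    by (intro weighted_mean_le[where B="C\<^sub>0 * prob A"]) auto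
  then show ?thesis by simp
qed

lemma tail_prob_abs_le: "A \<in> sets M \<Longrightarrow> \<bar>tail_prob g w A\<bar> \<le> C\<^sub>0 * prob A"
  using tail_prob_le tail_prob_nonneg by simp

definition osc_bound :: "nat \<Rightarrow> 'a set \<Rightarrow> real \<Rightarrow> bool" where
  "osc_bound g A \<Delta> \<longleftrightarrow> (\<forall>w w'. tail_prob g w A - tail_prob g w' A \<le> \<Delta>)"

lemma tail_prob_forget:
  assumes A: "A \<in> sets M"
  shows "\<bar>tail_prob g (w @ u) A - tail_prob g u A\<bar> \<le> (exp (\<kappa> (length u)) - 1) * (C\<^sub>0 * prob A)"
proof -
  let ?e = "exp (\<kappa> (length u))"
  have e: "1 \<le> ?e" using kappa_nonneg by simp
  have "tail_prob g (w @ u) A - tail_prob g u A \<le> (?e - 1) * tail_prob g u A"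
    using tail_prob_append(1)[OF A, of g w u] by (simp add: algebra_simps)
  also have "\<dots> \<le> (?e - 1) * (C\<^sub>0 * prob A)"
    using e tail_prob_le[OF A] by (intro mult_left_mono) auto
  finally have 1: "tail_prob g (w @ u) A - tail_prob g u A \<le> (?e - 1) * (C\<^sub>0 * prob A)" .
  have "tail_prob g u A - tail_prob g (w @ u) A \<le> (?e - 1) * tail_prob g (w @ u) A"
    using tail_prob_append(2)[OF A, of g u w] by (simp add: algebra_simps)
  also have "\<dots> \<le> (?e - 1) * (C\<^sub>0 * prob A)"
    using e tail_prob_le[OF A] by (intro mult_left_mono) auto
  finally show ?thesis using 1 by auto
qed

text \<open>After \<open>m\<close> further digits \<open>u\<close> the past \<open>w\<close> is nearly forgotten, so that \<open>tail_prob (m + g) w A\<close>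
  is nearly the mean of \<open>tail_prob g u A\<close> with the weights \<open>q (w @ u) / q w\<close>. For different \<open>w\<close>
  these weights all dominate \<open>q u / C\<^sub>0\<close>, and hence have a common part of mass \<open>1 / C\<^sub>0\<close>.\<close>

lemma osc_step:
  assumes A: "A \<in> sets M" and o: "osc_bound g A \<Delta>"
  shows "osc_bound (m + g) A ((1 - 1 / C\<^sub>0) * \<Delta> + 2 * ((exp (\<kappa> m) - 1) * (C\<^sub>0 * prob A)))"
  unfolding osc_bound_def
proof (intro allI)
  fix w w'
  let ?K = "count_space {u :: nat list. length u = m}"
  let ?\<eta> = "(exp (\<kappa> m) - 1) * (C\<^sub>0 * prob A)"
  have approx: "\<bar>tail_prob (m + g) v A - (LINT u|?K. q (v @ u) / q v * tail_prob g u A)\<bar> \<le> ?\<eta>" for v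
  proof -
    have i: "integrable ?K (\<lambda>u. q (v @ u) / q v * tail_prob g u A)"
      using tail_prob_abs_le[OF A] by (rule integrable_weight_bounded)
    have d: "tail_prob (m + g) v A - (LINT u|?K. q (v @ u) / q v * tail_prob g u A) =
      (LINT u|?K. q (v @ u) / q v * (tail_prob g (v @ u) A - tail_prob g u A))"
      unfolding tail_prob_split(2)[OF A] using i tail_prob_split(1)[OF A, of m v g]
      by (simp add: right_diff_distrib)
    have bd: "\<bar>tail_prob g (v @ u) A - tail_prob g u A\<bar> \<le> ?\<eta>" if "length u = m" for u
      using tail_prob_forget[OF A, of g v u] that by simp
    have "(LINT u|?K. q (v @ u) / q v * (tail_prob g (v @ u) A - tail_prob g u A)) \<le> ?\<eta>"
      using bd by (intro weighted_mean_le[where B="?\<eta>"]) (force simp: abs_le_iff)+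
    moreover have "(LINT u|?K. q (v @ u) / q v * - (tail_prob g (v @ u) A - tail_prob g u A)) \<le> ?\<eta>"
      using bd by (intro weighted_mean_le[where B="?\<eta>"]) (force simp: abs_le_iff)+
    ultimately show ?thesis unfolding d by (simp only: mult_minus_right integral_minus abs_le_iff)
  qed
  have c: "integrable ?K (\<lambda>u. q u / C\<^sub>0)" "(LINT u|?K. q u / C\<^sub>0) = 1 / C\<^sub>0"
    using cond_weights[where m=m and w="[]"] by (simp_all add: prob_space)
  have lower: "q u / C\<^sub>0 \<le> q (v @ u) / q v" for u v
    using q_append_ge[of v u] C0_ge_1 q_pos[of v] by (simp add: divide_simps mult_ac del: q_pos)
  have "(LINT u|?K. q (w @ u) / q w * tail_prob g u A) - (LINT u|?K. q (w' @ u) / q w' * tail_prob g u A)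
    \<le> (1 - 1 / C\<^sub>0) * \<Delta>"
    using o lower unfolding osc_bound_def
    by (intro doeblin_sum[OF cond_weights(1) cond_weights(1) c(1) cond_weights(2) cond_weights(2) c(2)]) auto
  then show "tail_prob (m + g) w A - tail_prob (m + g) w' A
     \<le> (1 - 1 / C\<^sub>0) * \<Delta> + 2 * ?\<eta>"
    using approx[of w] approx[of w'] by linarith
qed

lemma osc_mono: "osc_bound g A \<Delta> \<Longrightarrow> \<Delta> \<le> \<Delta>' \<Longrightarrow> osc_bound g A \<Delta>'"
  unfolding osc_bound_def by (meson order_trans)

text \<open>The geometric series of the errors in \<open>osc_step\<close> has the sum \<open>2 (exp (\<kappa> m) - 1) C\<^sub>0\<^sup>2\<close>, which is
  fixed by the step.\<close>

lemma osc_iterate: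
  assumes A: "A \<in> sets M"
  shows "osc_bound (j * m + r) A (((1 - 1 / C\<^sub>0) ^ j * C\<^sub>0 + 2 * (exp (\<kappa> m) - 1) * C\<^sub>0\<^sup>2) * prob A)"
proof (induction j)
  case 0
  have "osc_bound r A (C\<^sub>0 * prob A)"
    unfolding osc_bound_def
  proof (intro allI)
    fix w w' show "tail_prob r w A - tail_prob r w' A \<le> C\<^sub>0 * prob A"
      using tail_prob_le[OF A, of r w] tail_prob_nonneg[of r w' A] by linarith
  qed
  moreover have "C\<^sub>0 * prob A \<le> ((1 - 1 / C\<^sub>0) ^ 0 * C\<^sub>0 + 2 * (exp (\<kappa> m) - 1) * C\<^sub>0\<^sup>2) * prob A"
    using kappa_nonneg[of m] by (intro mult_right_mono) auto
  ultimately show ?case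
    using osc_mono by simp
next
  case (Suc j)
  let ?\<rho> = "1 - 1 / C\<^sub>0" and ?E = "2 * (exp (\<kappa> m) - 1)"
  have e: "Suc j * m + r = m + (j * m + r)" by simp
  have C: "C\<^sub>0 > 0" using C0_ge_1 by simp
  have "?\<rho> * ((?\<rho> ^ j * C\<^sub>0 + ?E * C\<^sub>0\<^sup>2) * prob A) + 2 * ((exp (\<kappa> m) - 1) * (C\<^sub>0 * prob A))
    = (?\<rho> ^ Suc j * C\<^sub>0 + ?E * C\<^sub>0\<^sup>2) * prob A"
    using C by (simp add: field_simps power2_eq_square)
  then show ?case
    using osc_step[OF A Suc.IH, of m] unfolding e by simp
qed

text \<open>The block length \<open>m\<close> is chosen first, to make the accumulated distortion small, and then the
  number of blocks. The bound is relative to \<open>prob A\<close>; this makes the later comparison with the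
  limit measure multiplicative.\<close>

lemma osc_vanishes:
  assumes "\<epsilon> > 0"
  shows "\<exists>g0. \<forall>g\<ge>g0. \<forall>A\<in>sets M. osc_bound g A (\<epsilon> * prob A)"
proof -
  have C: "C\<^sub>0 > 0" using C0_ge_1 by simp
  have "(\<lambda>m. 2 * (exp (\<kappa> m) - 1) * C\<^sub>0\<^sup>2) \<longlonglongrightarrow> 2 * (exp 0 - 1) * C\<^sub>0\<^sup>2"
    by (intro tendsto_intros kappa_tendsto)
  then have "\<forall>\<^sub>F m in sequentially. 2 * (exp (\<kappa> m) - 1) * C\<^sub>0\<^sup>2 < \<epsilon> / 2"
    using assms by (intro order_tendstoD(2)) auto
  then obtain m0 where m0: "\<And>m. m \<ge> m0 \<Longrightarrow> 2 * (exp (\<kappa> m) - 1) * C\<^sub>0\<^sup>2 < \<epsilon> / 2"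
    unfolding eventually_sequentially by auto
  define m where "m = Suc m0"
  have m: "2 * (exp (\<kappa> m) - 1) * C\<^sub>0\<^sup>2 < \<epsilon> / 2" "m > 0" using m0[of m] by (auto simp: m_def)
  have "(\<lambda>j. (1 - 1 / C\<^sub>0) ^ j * C\<^sub>0) \<longlonglongrightarrow> 0 * C\<^sub>0"
    using C0_ge_1 by (intro tendsto_intros LIMSEQ_power_zero) (auto simp: abs_less_iff field_simps)
  then have "\<forall>\<^sub>F j in sequentially. (1 - 1 / C\<^sub>0) ^ j * C\<^sub>0 < \<epsilon> / 2"
    using assms by (intro order_tendstoD(2)) auto
  then obtain j0 where j0: "(1 - 1 / C\<^sub>0) ^ j0 * C\<^sub>0 < \<epsilon> / 2"
    unfolding eventually_sequentially by auto
  show ?thesis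
  proof (intro exI[of _ "j0 * m"] allI impI ballI)
    fix g A assume g: "g \<ge> j0 * m" and A: "A \<in> sets M"
    have "osc_bound (j0 * m + (g - j0 * m)) A
       (((1 - 1 / C\<^sub>0) ^ j0 * C\<^sub>0 + 2 * (exp (\<kappa> m) - 1) * C\<^sub>0\<^sup>2) * prob A)"
      by (rule osc_iterate[OF A])
    moreover have "((1 - 1 / C\<^sub>0) ^ j0 * C\<^sub>0 + 2 * (exp (\<kappa> m) - 1) * C\<^sub>0\<^sup>2) * prob A \<le> \<epsilon> * prob A"
      using m(1) j0 by (intro mult_right_mono) auto
    ultimately show "osc_bound g A (\<epsilon> * prob A)"
      using g osc_mono by fastforce
  qed
qed

lemma weighted_mean_ge:
  assumes "\<And>u. length u = m \<Longrightarrow> \<bar>f u\<bar> \<le> B" "\<And>u. length u = m \<Longrightarrow> c \<le> f u"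
  shows "c \<le> (LINT u|count_space {u. length u = m}. q (w @ u) / q w * f u)"
  using weighted_mean_le[of m "\<lambda>u. - f u" B "- c" w] assms by simp

lemma tail_prob_Nil: "tail_prob g [] A = prob {x \<in> space M. (T ^^ g) x \<in> A}"
  by (simp add: tail_prob_def prob_space)

lemma tail_prob_ge:
  assumes A: "A \<in> sets M"
  shows "prob A / C\<^sub>0 \<le> tail_prob g w A"
proof -
  have "prob A / C\<^sub>0 \<le> tail_prob (g + 0) w A"
    unfolding tail_prob_split(2)[OF A]
    using tail_prob_bounds(2)[OF A] tail_prob_abs_le[OF A] C0_ge_1
    by (intro weighted_mean_ge[where B="C\<^sub>0 * prob A"]) (auto simp: divide_simps mult_ac)
  then show ?thesis by simp
qed

text \<open>For \<open>r\<close> further digits in front, \<open>tail_prob (r + g) []\<close> is a mean of values \<open>tail_prob g u\<close>.\<close>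

lemma tail_prob_near:
  assumes A: "A \<in> sets M" and o: "osc_bound g A \<Delta>"
  shows "\<bar>tail_prob (r + g) [] A - tail_prob g w A\<bar> \<le> \<Delta>"
proof -
  have o': "tail_prob g u A - tail_prob g v A \<le> \<Delta>" for u v using o by (simp add: osc_bound_def)
  have "tail_prob (r + g) [] A \<le> tail_prob g w A + \<Delta>"
    unfolding tail_prob_split(2)[OF A]
    using tail_prob_abs_le[OF A] o'[of _ w] by (intro weighted_mean_le) (auto simp: algebra_simps)
  moreover have "tail_prob g w A - \<Delta> \<le> tail_prob (r + g) [] A"
    unfolding tail_prob_split(2)[OF A]
    using tail_prob_abs_le[OF A] o'[of w] by (intro weighted_mean_ge) (auto simp: algebra_simps)
  ultimately show ?thesis by simp
qed

definition lim_prob :: "'a set \<Rightarrow> real" where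
  "lim_prob A = lim (\<lambda>g. tail_prob g [] A)"

lemma lim_prob_tendsto:
  assumes A: "A \<in> sets M"
  shows "(\<lambda>g. tail_prob g [] A) \<longlonglongrightarrow> lim_prob A"
proof -
  have "Cauchy (\<lambda>g. tail_prob g [] A)"
  proof (rule CauchyI')
    fix e :: real assume e: "0 < e"
    then obtain g0 where g0: "\<And>g. g \<ge> g0 \<Longrightarrow> osc_bound g A (e / 2 * prob A)"
      using osc_vanishes[of "e / 2"] A by auto
    show "\<exists>K. \<forall>m\<ge>K. \<forall>n>m. dist (tail_prob m [] A) (tail_prob n [] A) < e"
    proof (intro exI[of _ g0] allI impI)
      fix m n assume mn: "g0 \<le> m" "m < n"
      have "\<bar>tail_prob (n - m + m) [] A - tail_prob m [] A\<bar> \<le> e / 2 * prob A"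
        by (rule tail_prob_near[OF A g0[OF mn(1)]])
      also have "\<dots> \<le> e / 2 * 1" using e by (intro mult_left_mono) auto
      finally show "dist (tail_prob m [] A) (tail_prob n [] A) < e"
        using mn e by (simp add: dist_real_def abs_minus_commute)
    qed
  qed
  then show ?thesis
    unfolding lim_prob_def by (rule convergent_LIMSEQ_iff[THEN iffD1, OF Cauchy_convergent])
qed

lemma lim_prob_near:
  assumes A: "A \<in> sets M" and o: "osc_bound g A \<Delta>"
  shows "\<bar>lim_prob A - tail_prob g w A\<bar> \<le> \<Delta>"
proof (rule LIMSEQ_le_const2)
  show "(\<lambda>r. \<bar>tail_prob (r + g) [] A - tail_prob g w A\<bar>) \<longlonglongrightarrow> \<bar>lim_prob A - tail_prob g w A\<bar>"
    by (intro tendsto_intros LIMSEQ_ignore_initial_segment lim_prob_tendsto[OF A])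
qed (use tail_prob_near[OF A o] in auto)

lemma lim_prob_le: "A \<in> sets M \<Longrightarrow> lim_prob A \<le> C\<^sub>0 * prob A"
  by (rule LIMSEQ_le_const2[OF lim_prob_tendsto]) (auto intro: tail_prob_le)

lemma lim_prob_ge: "A \<in> sets M \<Longrightarrow> prob A / C\<^sub>0 \<le> lim_prob A"
  by (rule LIMSEQ_le_const[OF lim_prob_tendsto]) (auto intro: tail_prob_ge)

lemma lim_prob_nonneg: "A \<in> sets M \<Longrightarrow> 0 \<le> lim_prob A"
  by (rule LIMSEQ_le_const[OF lim_prob_tendsto]) (auto intro: tail_prob_nonneg)

lemma lim_prob_Un:
  assumes [measurable]: "A \<in> sets M" "B \<in> sets M" and d: "A \<inter> B = {}"
  shows "lim_prob (A \<union> B) = lim_prob A + lim_prob B"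
proof (rule LIMSEQ_unique)
  show "(\<lambda>g. tail_prob g [] (A \<union> B)) \<longlonglongrightarrow> lim_prob (A \<union> B)"
    by (rule lim_prob_tendsto) auto
  have "tail_prob g [] (A \<union> B) = tail_prob g [] A + tail_prob g [] B" for g
  proof -
    have "{x \<in> space M. (T ^^ g) x \<in> A \<union> B} =
        {x \<in> space M. (T ^^ g) x \<in> A} \<union> {x \<in> space M. (T ^^ g) x \<in> B}" by auto
    then show ?thesis unfolding tail_prob_Nil
      using d by (simp, intro finite_measure_Union) auto
  qed
  then show "(\<lambda>g. tail_prob g [] (A \<union> B)) \<longlonglongrightarrow> lim_prob A + lim_prob B"
    using tendsto_add[OF lim_prob_tendsto lim_prob_tendsto, of A B] by simp
qed

text \<open>The limit measure. It is the absolutely continuous invariant measure: \<open>lim_prob_le\<close> and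
  \<open>lim_prob_ge\<close> bound its density with respect to \<open>M\<close> by \<open>C\<^sub>0\<close> and \<open>1 / C\<^sub>0\<close>.\<close>

definition acim :: "'a measure" where
  "acim = measure_of (space M) (sets M) (\<lambda>A. ennreal (lim_prob A))"

lemma space_acim [simp]: "space acim = space M" by (simp add: acim_def)

lemma sets_acim [simp, measurable_cong]: "sets acim = sets M" by (simp add: acim_def)

text \<open>Domination by \<open>C\<^sub>0 * prob\<close> transfers continuity at the empty set from \<open>M\<close>.\<close>

lemma countably_additive_lim_prob:
  "countably_additive (sets M) (\<lambda>A. ennreal (lim_prob A))"
proof (rule sets.empty_continuous_imp_countably_additive)
  have "lim_prob {} = 0" using lim_prob_le[of "{}"] lim_prob_nonneg[of "{}"] by simp
  then show "positive (sets M) (\<lambda>A. ennreal (lim_prob A))" by (simp add: positive_def)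
  show "additive (sets M) (\<lambda>A. ennreal (lim_prob A))"
    unfolding additive_def
  proof (intro ballI impI)
    fix A B assume "A \<in> sets M" "B \<in> sets M" "A \<inter> B = {}"
    then show "ennreal (lim_prob (A \<union> B)) = ennreal (lim_prob A) + ennreal (lim_prob B)"
      by (simp add: lim_prob_Un lim_prob_nonneg)
  qed
  fix A :: "nat \<Rightarrow> 'a set" assume A: "range A \<subseteq> sets M" "decseq A" "(\<Inter>i. A i) = {}"
  have Ai: "A i \<in> sets M" for i using A(1) by auto
  have "(\<lambda>i. prob (A i)) \<longlonglongrightarrow> prob (\<Inter>i. A i)"
    by (rule finite_Lim_measure_decseq[OF A(1,2)])
  then have "(\<lambda>i. C\<^sub>0 * prob (A i)) \<longlonglongrightarrow> C\<^sub>0 * 0"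
    unfolding A(3) by (intro tendsto_intros) simp
  then have u: "(\<lambda>i. C\<^sub>0 * prob (A i)) \<longlonglongrightarrow> 0" by simp
  have "(\<lambda>i. lim_prob (A i)) \<longlonglongrightarrow> 0"
    by (rule tendsto_sandwich[OF _ _ tendsto_const u])
      (simp_all add: lim_prob_nonneg[OF Ai] lim_prob_le[OF Ai])
  then show "(\<lambda>i. ennreal (lim_prob (A i))) \<longlonglongrightarrow> 0"
    using tendsto_ennrealI by fastforce
qed simp

lemma emeasure_acim: "A \<in> sets M \<Longrightarrow> emeasure acim A = ennreal (lim_prob A)"
proof (rule emeasure_measure_of[OF acim_def])
  have "lim_prob {} = 0" using lim_prob_le[of "{}"] lim_prob_nonneg[of "{}"] by simp
  then show "positive (sets acim) (\<lambda>A. ennreal (lim_prob A))" by (simp add: positive_def)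
  show "countably_additive (sets acim) (\<lambda>A. ennreal (lim_prob A))"
    using countably_additive_lim_prob by simp
  show "sets M \<subseteq> Pow (space M)" by (rule sets.space_closed)
qed simp

lemma measure_acim: "A \<in> sets M \<Longrightarrow> measure acim A = lim_prob A"
  by (simp add: measure_def emeasure_acim lim_prob_nonneg)

lemma prob_space_acim: "prob_space acim"
proof
  have "tail_prob g [] (space M) = 1" for g
  proof -
    have "{x \<in> space M. (T ^^ g) x \<in> space M} = space M" by (auto simp: funpow_space)
    then show ?thesis by (simp add: tail_prob_Nil prob_space)
  qed
  then have "(\<lambda>_. 1) \<longlonglongrightarrow> lim_prob (space M)"
    using lim_prob_tendsto[OF sets.top] by simp
  then have "lim_prob (space M) = 1"
    by (rule LIMSEQ_unique) simp
  then show "emeasure acim (space acim) = 1" by (simp add: emeasure_acim)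
qed

lemma acim_invariant:
  assumes A: "A \<in> sets M"
  shows "measure acim {x \<in> space M. T x \<in> A} = measure acim A"
proof -
  have B: "{x \<in> space M. T x \<in> A} \<in> sets M" using A by measurable
  have "tail_prob g [] {x \<in> space M. T x \<in> A} = tail_prob (Suc g) [] A" for g
    unfolding tail_prob_Nil by (rule arg_cong[where f=prob]) (auto simp: funpow_space)
  then have "(\<lambda>g. tail_prob g [] {x \<in> space M. T x \<in> A}) \<longlonglongrightarrow> lim_prob A"
    using LIMSEQ_Suc[OF lim_prob_tendsto[OF A]] by simp
  then show ?thesis
    unfolding measure_acim[OF A] measure_acim[OF B]
    using LIMSEQ_unique lim_prob_tendsto[OF B] by blast
qed

text \<open>Since \<open>prob A \<le> C\<^sub>0 * measure acim A\<close>, an error relative to \<open>prob A\<close> is one relative to the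
  limit. A factor \<open>1 + \<epsilon>\<close>, unlike an additive error, can be iterated along many blocks.\<close>

lemma mixing:
  assumes "\<epsilon> > 0"
  shows "\<exists>g0. \<forall>g\<ge>g0. \<forall>w. \<forall>A\<in>sets M.
    prob {x \<in> cyl w. (T ^^ (length w + g)) x \<in> A} \<le> (1 + \<epsilon>) * (q w * measure acim A)"
proof -
  have C: "C\<^sub>0 > 0" using C0_ge_1 by simp
  with assms obtain g0 where g0: "\<And>g A. g \<ge> g0 \<Longrightarrow> A \<in> sets M \<Longrightarrow> osc_bound g A (\<epsilon> / C\<^sub>0 * prob A)"
    using osc_vanishes[of "\<epsilon> / C\<^sub>0"] by auto
  show ?thesis
  proof (intro exI[of _ g0] allI impI ballI)
    fix g w A assume g: "g0 \<le> g" and A: "A \<in> sets M"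
    have "tail_prob g w A \<le> lim_prob A + \<epsilon> / C\<^sub>0 * prob A"
      using lim_prob_near[OF A g0[OF g A], of w] by (simp add: abs_le_iff)
    also have "\<epsilon> / C\<^sub>0 * prob A \<le> \<epsilon> * lim_prob A"
      using mult_left_mono[OF lim_prob_ge[OF A], of \<epsilon>] assms by simp
    finally have "tail_prob g w A \<le> (1 + \<epsilon>) * lim_prob A" by (simp add: algebra_simps)
    then show "prob {x \<in> cyl w. (T ^^ (length w + g)) x \<in> A} \<le> (1 + \<epsilon>) * (q w * measure acim A)"
      by (simp add: tail_prob_def pos_divide_le_eq measure_acim[OF A] mult_ac)
  qed
qed

end

section \<open>Exponential concentration of Birkhoff sums\<close>

lemma exp_le_quadratic: "exp y \<le> 1 + y + y\<^sup>2 * exp \<bar>y :: real\<bar>"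
proof -
  have a: "1 - y \<le> exp (- y)" using exp_ge_add_one_self[of "- y"] by simp
  have "(1 - y) * exp y \<le> exp (- y) * exp y" by (rule mult_right_mono[OF a]) simp
  then have 1: "exp y - 1 \<le> y * exp y" by (simp add: exp_minus algebra_simps)
  show ?thesis
  proof (cases "y \<ge> 0")
    case True
    have "exp y \<le> 1 + y * exp y" using 1 by simp
    have "y * (exp y - 1) \<le> y * (y * exp y)" by (rule mult_left_mono[OF 1 True])
    then show ?thesis using True 1 by (simp add: power2_eq_square algebra_simps)
  next
    case False
    have 2: "1 - exp y \<le> - y" using exp_ge_add_one_self[of y] by linarith
    have "- y * (1 - exp y) \<le> - y * - y" by (rule mult_left_mono[OF 2]) (use False in simp)
    moreover have "y\<^sup>2 * 1 \<le> y\<^sup>2 * exp \<bar>y\<bar>" by (intro mult_left_mono) auto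
    ultimately show ?thesis using 1 by (simp add: power2_eq_square algebra_simps)
  qed
qed

lemma square_le_exp: "0 \<le> (y :: real) \<Longrightarrow> y\<^sup>2 \<le> 2 * exp y"
  using exp_lower_Taylor_quadratic[of y] by (simp add: field_simps)

definition birk :: "('a \<Rightarrow> 'a) \<Rightarrow> ('a \<Rightarrow> real) \<Rightarrow> nat \<Rightarrow> 'a \<Rightarrow> real" where
  "birk T f n x = (\<Sum>i<n. f ((T ^^ i) x))"

lemma exp_mean_le:
  fixes f :: "nat \<Rightarrow> real"
  assumes "G > 0"
  shows "exp ((\<Sum>r<G. f r) / real G) \<le> (\<Sum>r<G. exp (f r)) / real G"
proof -
  have "exp (\<Sum>r<G. (1 / real G) *\<^sub>R f r) \<le> (\<Sum>r<G. (1 / real G) * exp (f r))"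
    using assms by (intro convex_on_sum[OF _ _ exp_convex]) auto
  then show ?thesis by (simp add: sum_divide_distrib)
qed

lemma sum_residues:
  fixes b :: "nat \<Rightarrow> real"
  shows "(\<Sum>i<J * G. b i) = (\<Sum>r<G. \<Sum>j<J. b (r + j * G))"
proof -
  have "(\<Sum>i<J * G. b i) = (\<Sum>j<J. sum b {j * G..<j * G + G})"
    by (rule sum.nat_group[symmetric])
  also have "\<dots> = (\<Sum>j<J. \<Sum>r<G. b (r + j * G))"
  proof (rule sum.cong)
    fix j
    have "sum b {j * G..<j * G + G} = sum b {0 + j * G..<G + j * G}" by (simp add: add.commute)
    also have "\<dots> = (\<Sum>r = 0..<G. b (r + j * G))" by (rule sum.shift_bounds_nat_ivl)
    finally show "sum b {j * G..<j * G + G} = (\<Sum>r<G. b (r + j * G))"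
      by (simp add: atLeast0LessThan)
  qed simp
  also have "\<dots> = (\<Sum>r<G. \<Sum>j<J. b (r + j * G))" by (rule sum.swap)
  finally show ?thesis .
qed

context gibbs_coding
begin

interpretation acim: prob_space acim by (rule prob_space_acim)

lemma measure_acim_space [simp]: "measure acim (space M) = 1"
  using acim.prob_space by simp

lemma nn_code_split:
  assumes N [measurable_cong]: "sets N = sets M" and h [measurable]: "h \<in> borel_measurable N"
  shows "(\<integral>\<^sup>+x. h x \<partial>N) = (\<integral>\<^sup>+w. (\<integral>\<^sup>+x. h x * indicator (cyl w) x \<partial>N) \<partial>count_space {w. length w = n})"
proof -
  have spN: "space N = space M" using N by (rule sets_eq_imp_space_eq)
  let ?W = "count_space {w :: nat list. length w = n}"
  have "(\<integral>\<^sup>+w. h x * indicator (cyl w) x \<partial>?W) = h x" if "x \<in> space N" for x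
  proof -
    have "(\<integral>\<^sup>+w. h x * indicator (cyl w) x \<partial>?W) = (\<integral>\<^sup>+w. h x * indicator {code n x} w \<partial>?W)"
      using that spN by (intro nn_integral_cong arg_cong2[where f="(*)"]) (auto simp: indicator_def cyl_iff)
    also have "\<dots> = h x * emeasure ?W {code n x}"
      by (subst nn_integral_cmult_indicator) auto
    finally show ?thesis by simp
  qed
  then have "(\<integral>\<^sup>+x. h x \<partial>N) = (\<integral>\<^sup>+x. (\<integral>\<^sup>+w. h x * indicator (cyl w) x \<partial>?W) \<partial>N)"
    by (intro nn_integral_cong) auto
  also have "\<dots> = (\<integral>\<^sup>+w. (\<integral>\<^sup>+x. h x * indicator (cyl w) x \<partial>N) \<partial>?W)"
    by (rule nn_integral_count_space_nn_integral) auto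
  finally show ?thesis .
qed

lemma nn_code_const:
  fixes f :: "nat list \<Rightarrow> ennreal"
  assumes N [measurable_cong]: "sets N = sets M" and [measurable]: "h \<in> borel_measurable N" and "length w = n"
  shows "(\<integral>\<^sup>+x. f (code n x) * h x * indicator (cyl w) x \<partial>N) = f w * (\<integral>\<^sup>+x. h x * indicator (cyl w) x \<partial>N)"
proof -
  have "(\<integral>\<^sup>+x. f (code n x) * h x * indicator (cyl w) x \<partial>N) =
    (\<integral>\<^sup>+x. f w * (h x * indicator (cyl w) x) \<partial>N)"
    using assms(3) by (intro nn_integral_cong) (auto simp: indicator_def cyl_iff mult.assoc)
  then show ?thesis by (simp add: nn_integral_cmult)
qed

lemma measurable_code_fun:
  fixes f :: "nat list \<Rightarrow> 'c"
  assumes "\<And>w. f w \<in> space N"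
  shows "(\<lambda>x. f (code n x)) \<in> M \<rightarrow>\<^sub>M N"
  using assms by (intro measurable_compose[OF measurable_itin[OF T_measurable dig_measurable]]) simp

text \<open>Functions of the first \<open>n\<close> digits are integrated by summing over words.\<close>

lemma nn_code_expand:
  fixes f :: "nat list \<Rightarrow> ennreal"
  assumes N [measurable_cong]: "sets N = sets M" and [measurable]: "h \<in> borel_measurable N"
  shows "(\<integral>\<^sup>+x. f (code n x) * h x \<partial>N) =
    (\<integral>\<^sup>+w. f w * (\<integral>\<^sup>+x. h x * indicator (cyl w) x \<partial>N) \<partial>count_space {w. length w = n})"
proof -
  have [measurable]: "(\<lambda>x. f (code n x)) \<in> borel_measurable M" by (rule measurable_code_fun) simp
  show ?thesis
    by (subst nn_code_split[OF N, where n=n]) (auto intro!: nn_integral_cong simp: nn_code_const[OF N])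
qed

text \<open>After a gap of \<open>g\<close> digits the orbit is distributed at most like \<open>c * acim\<close>, whatever was read
  before the gap.\<close>

definition gap_bound :: "real \<Rightarrow> nat \<Rightarrow> bool" where
  "gap_bound c g \<longleftrightarrow> (\<forall>w. \<forall>A\<in>sets M.
    prob {x \<in> cyl w. (T ^^ (length w + g)) x \<in> A} \<le> c * (q w * measure acim A))"

lemma nn_gap_cyl:
  assumes gb: "gap_bound c g" and c: "0 \<le> c" and [measurable]: "F \<in> borel_measurable M"
  shows "(\<integral>\<^sup>+x. F ((T ^^ (length w + g)) x) * indicator (cyl w) x \<partial>M) \<le> ennreal (c * q w) * (\<integral>\<^sup>+x. F x \<partial>acim)"
proof -
  let ?D = "density M (indicator (cyl w))"
  let ?N = "distr ?D M (T ^^ (length w + g))"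
  have le: "?N \<le> scale_measure (ennreal (c * q w)) acim"
  proof (subst le_measure)
    show "\<forall>A\<in>sets ?N. emeasure ?N A \<le> emeasure (scale_measure (ennreal (c * q w)) acim) A"
    proof
      fix A assume "A \<in> sets ?N"
      then have A [measurable]: "A \<in> sets M" by simp
      have "emeasure ?N A = emeasure ?D ((T ^^ (length w + g)) -` A \<inter> space M)"
        by (subst emeasure_distr) auto
      also have "\<dots> = (\<integral>\<^sup>+x. indicator (cyl w) x * indicator ((T ^^ (length w + g)) -` A \<inter> space M) x \<partial>M)"
        by (subst emeasure_density) auto
      also have "\<dots> = (\<integral>\<^sup>+x. indicator {x \<in> cyl w. (T ^^ (length w + g)) x \<in> A} x \<partial>M)"
        by (intro nn_integral_cong) (auto simp: indicator_def)
      also have "\<dots> = ennreal (prob {x \<in> cyl w. (T ^^ (length w + g)) x \<in> A})"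
        by (subst nn_integral_indicator) (auto simp: emeasure_eq_measure)
      also have "\<dots> \<le> ennreal (c * (q w * measure acim A))"
        using gb A by (intro ennreal_leI) (auto simp: gap_bound_def)
      also have "\<dots> = ennreal (c * q w) * emeasure acim A"
        using c by (simp add: acim.emeasure_eq_measure ennreal_mult'' mult.assoc)
      finally show "emeasure ?N A \<le> emeasure (scale_measure (ennreal (c * q w)) acim) A" by simp
    qed
  qed simp
  have "(\<integral>\<^sup>+x. F ((T ^^ (length w + g)) x) * indicator (cyl w) x \<partial>M) = (\<integral>\<^sup>+x. F ((T ^^ (length w + g)) x) \<partial>?D)"
    by (subst nn_integral_density) (auto simp: mult.commute)
  also have "\<dots> = (\<integral>\<^sup>+x. F x \<partial>?N)" by (subst nn_integral_distr) auto
  also have "\<dots> \<le> (\<integral>\<^sup>+x. F x \<partial>scale_measure (ennreal (c * q w)) acim)"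
    by (rule nn_integral_mono_measure[OF _ le]) simp
  also have "\<dots> = ennreal (c * q w) * (\<integral>\<^sup>+x. F x \<partial>acim)"
    by (rule nn_integral_scale_measure) simp
  finally show ?thesis .
qed

lemma nn_gap_product:
  fixes f :: "nat list \<Rightarrow> ennreal"
  assumes gb: "gap_bound c g" and c: "0 \<le> c" and [measurable]: "F \<in> borel_measurable M"
  shows "(\<integral>\<^sup>+x. f (code n x) * F ((T ^^ (n + g)) x) \<partial>M)
     \<le> ennreal c * (\<integral>\<^sup>+x. F x \<partial>acim) * (\<integral>\<^sup>+x. f (code n x) \<partial>M)"
proof -
  let ?I = "\<integral>\<^sup>+x. F x \<partial>acim" and ?W = "count_space {w :: nat list. length w = n}"
  have q: "(\<integral>\<^sup>+x. 1 * indicator (cyl w) x \<partial>M) = ennreal (q w)" for w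
    by (simp add: emeasure_eq_measure)
  have "(\<integral>\<^sup>+x. f (code n x) * F ((T ^^ (n + g)) x) \<partial>M) =
    (\<integral>\<^sup>+w. f w * (\<integral>\<^sup>+x. F ((T ^^ (n + g)) x) * indicator (cyl w) x \<partial>M) \<partial>?W)"
    by (rule nn_code_expand[OF refl]) simp
  also have "\<dots> \<le> (\<integral>\<^sup>+w. f w * (ennreal (c * q w) * ?I) \<partial>?W)"
    using nn_gap_cyl[OF gb c, of F] by (intro nn_integral_mono mult_left_mono) auto
  also have "\<dots> = (\<integral>\<^sup>+w. (ennreal c * ?I) * (f w * (\<integral>\<^sup>+x. 1 * indicator (cyl w) x \<partial>M)) \<partial>?W)"
    unfolding q using c by (intro nn_integral_cong) (simp add: ennreal_mult' mult_ac)
  also have "\<dots> = ennreal c * ?I * (\<integral>\<^sup>+w. f w * (\<integral>\<^sup>+x. 1 * indicator (cyl w) x \<partial>M) \<partial>?W)"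
    by (subst nn_integral_cmult) auto
  also have "(\<integral>\<^sup>+w. f w * (\<integral>\<^sup>+x. 1 * indicator (cyl w) x \<partial>M) \<partial>?W) = (\<integral>\<^sup>+x. f (code n x) * 1 \<partial>M)"
    by (rule nn_code_expand[OF refl, symmetric]) simp
  finally show ?thesis by simp
qed

text \<open>Bounded distortion alone gives a constant for every gap. It is used once, for the first block.\<close>

lemma gap_bound_crude: "gap_bound (C\<^sub>0\<^sup>2) g"
  unfolding gap_bound_def
proof (intro allI ballI)
  fix w A assume A: "A \<in> sets M"
  have "tail_prob g w A \<le> C\<^sub>0 * prob A" by (rule tail_prob_le[OF A])
  also have "\<dots> \<le> C\<^sub>0 * (C\<^sub>0 * lim_prob A)"
    using lim_prob_ge[OF A] C0_ge_1 by (intro mult_left_mono) (auto simp: divide_simps mult_ac)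
  finally show "prob {x \<in> cyl w. (T ^^ (length w + g)) x \<in> A} \<le> C\<^sub>0\<^sup>2 * (q w * measure acim A)"
    by (simp add: tail_prob_def pos_divide_le_eq measure_acim[OF A] power2_eq_square mult_ac)
qed

text \<open>Blocks of length \<open>m\<close> at distance \<open>G = m + g0\<close> are separated by gaps of \<open>g0\<close> digits, so each
  block contributes a factor of at most \<open>V\<close>; only the first one, which may start at once, costs
  \<open>C\<^sub>0\<^sup>2\<close>.\<close>

lemma nn_spaced_product:
  fixes \<phi> :: "nat list \<Rightarrow> ennreal" and V c :: real
  assumes gb: "gap_bound c g0" and c: "0 \<le> c" and V: "1 \<le> V"
    and I1: "(\<integral>\<^sup>+x. \<phi> (code m x) \<partial>acim) \<le> ennreal V"
    and I2: "ennreal c * (\<integral>\<^sup>+x. \<phi> (code m x) \<partial>acim) \<le> ennreal V"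
    and G: "G = m + g0"
  shows "(\<integral>\<^sup>+x. (\<Prod>j<J. if r + j * G < n then \<phi> (code m ((T ^^ (r + j * G)) x)) else 1) \<partial>M)
    \<le> ennreal (C\<^sub>0\<^sup>2 * V ^ J)"
proof (induction J)
  case 0
  then show ?case using C0_ge_1 by (simp add: emeasure_space_1)
next
  case (Suc J)
  define P where "P J x = (\<Prod>j<J. if r + j * G < n then \<phi> (code m ((T ^^ (r + j * G)) x)) else 1)" for J x
  have IH: "(\<integral>\<^sup>+x. P J x \<partial>M) \<le> ennreal (C\<^sub>0\<^sup>2 * V ^ J)" using Suc by (simp add: P_def)
  have F [measurable]: "(\<lambda>x. \<phi> (code m x)) \<in> borel_measurable M" by (rule measurable_code_fun) simp
  show ?case
  proof (cases "r + J * G < n")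
    case False
    then have "(\<integral>\<^sup>+x. P (Suc J) x \<partial>M) = (\<integral>\<^sup>+x. P J x \<partial>M)" by (simp add: P_def)
    also have "\<dots> \<le> ennreal (C\<^sub>0\<^sup>2 * V ^ J)" by (rule IH)
    also have "\<dots> \<le> ennreal (C\<^sub>0\<^sup>2 * V ^ Suc J)"
      using V by (intro ennreal_leI mult_left_mono) (auto simp: mult_le_cancel_right1)
    finally show ?thesis by (simp add: P_def)
  next
    case True
    show ?thesis
    proof (cases J)
      case 0
      have "(\<integral>\<^sup>+x. P (Suc J) x \<partial>M) = (\<integral>\<^sup>+x. (\<lambda>w. 1) (code 0 x) * \<phi> (code m ((T ^^ (0 + r)) x)) \<partial>M)"
        using 0 True by (simp add: P_def)
      also have "\<dots> \<le> ennreal (C\<^sub>0\<^sup>2) * (\<integral>\<^sup>+x. \<phi> (code m x) \<partial>acim) * (\<integral>\<^sup>+x. (\<lambda>w. 1) (code 0 x) \<partial>M)"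
        by (rule nn_gap_product[OF gap_bound_crude _ F]) simp
      also have "\<dots> \<le> ennreal (C\<^sub>0\<^sup>2) * ennreal V"
        using I1 by (simp add: emeasure_space_1 mult_left_mono)
      finally show ?thesis using 0 V by (simp add: P_def ennreal_mult'' cong: if_cong)
    next
      case (Suc J')
      define n' where "n' = r + J' * G + m"
      have n': "n' + g0 = r + J * G" using Suc G by (simp add: n'_def)
      define f where "f w = (\<Prod>j<J. if r + j * G < n then \<phi> (take m (drop (r + j * G) w)) else 1)" for w
      have f: "f (code n' x) = P J x" for x
        unfolding f_def P_def
      proof (intro prod.cong refl if_cong arg_cong[where f=\<phi>])
        fix j assume "j \<in> {..<J}"
        then have "j \<le> J'" using Suc by simp
        then have "r + j * G + m \<le> n'" by (simp add: n'_def)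
        then show "take m (drop (r + j * G) (code n' x)) = code m ((T ^^ (r + j * G)) x)"
          by (rule take_drop_itin)
      qed
      have "(\<integral>\<^sup>+x. P (Suc J) x \<partial>M) = (\<integral>\<^sup>+x. f (code n' x) * \<phi> (code m ((T ^^ (n' + g0)) x)) \<partial>M)"
        unfolding f n' using True by (simp add: P_def)
      also have "\<dots> \<le> ennreal c * (\<integral>\<^sup>+x. \<phi> (code m x) \<partial>acim) * (\<integral>\<^sup>+x. f (code n' x) \<partial>M)"
        by (rule nn_gap_product[OF gb c F])
      also have "\<dots> \<le> ennreal V * ennreal (C\<^sub>0\<^sup>2 * V ^ J)"
        unfolding f by (rule mult_mono[OF I2 IH]) auto
      also have "\<dots> = ennreal (C\<^sub>0\<^sup>2 * V ^ Suc J)"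
        using V by (simp add: mult_ac flip: ennreal_mult')
      finally show ?thesis by (simp add: P_def)
    qed
  qed
qed

lemma birk_measurable [measurable (raw)]:
  assumes [measurable]: "f \<in> borel_measurable M"
  shows "birk T f n \<in> borel_measurable M"
  unfolding birk_def by measurable

lemma acim_exp_integrable:
  fixes u :: "nat list \<Rightarrow> real"
  assumes "(\<integral>\<^sup>+x. ennreal (f x) \<partial>M) < \<infinity>" and [measurable]: "f \<in> borel_measurable M" and "\<And>x. 0 \<le> f x"
  shows "integrable acim f"
proof (rule integrableI_nonneg)
  show "(\<integral>\<^sup>+x. ennreal (f x) \<partial>acim) < \<infinity>"
  proof -
    have "acim \<le> scale_measure (ennreal C\<^sub>0) M"
    proof (subst le_measure)
      show "\<forall>A\<in>sets acim. emeasure acim A \<le> emeasure (scale_measure (ennreal C\<^sub>0) M) A"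
        using C0_ge_1 by (auto simp: emeasure_acim emeasure_eq_measure lim_prob_le simp flip: ennreal_mult'
            intro!: ennreal_leI)
    qed simp
    then have "(\<integral>\<^sup>+x. ennreal (f x) \<partial>acim) \<le> (\<integral>\<^sup>+x. ennreal (f x) \<partial>scale_measure (ennreal C\<^sub>0) M)"
      by (intro nn_integral_mono_measure) auto
    also have "\<dots> = ennreal C\<^sub>0 * (\<integral>\<^sup>+x. ennreal (f x) \<partial>M)"
      by (rule nn_integral_scale_measure) simp
    also have "\<dots> < \<infinity>" using assms(1) by (simp add: ennreal_mult_less_top)
    finally show ?thesis .
  qed
qed (use assms in auto)

text \<open>For a function \<open>U\<close> of \<open>m\<close> digits with mean \<open>0\<close> one has \<open>\<integral> exp (\<theta> U) d acim = 1 + O(\<theta>\<^sup>2)\<close>, so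
  small \<open>\<theta>\<close> costs at most \<open>exp (\<theta> \<delta>)\<close> per block. A Birkhoff sum is split into \<open>G\<close> sums over
  arithmetic progressions with difference \<open>G\<close>, whose terms are separated by gaps; convexity of
  \<open>exp\<close> reduces the exponential moment of the sum to the moments of these parts, with \<open>t = \<theta> / G\<close>.\<close>

lemma mgf_centered:
  fixes u :: "nat list \<Rightarrow> real"
  assumes s: "0 < s" and fin: "(\<integral>\<^sup>+x. ennreal (exp (s * \<bar>u (code m x)\<bar>)) \<partial>M) < \<infinity>"
    and mean: "(LINT x|acim. u (code m x)) = 0" and \<delta>: "0 < \<delta>"
  shows "\<exists>t B. 0 < t \<and> t \<le> s \<and> 0 < B \<and> (\<forall>n. (\<integral>\<^sup>+x. ennreal (exp (t * birk T (\<lambda>x. u (code m x)) n x)) \<partial>M)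
     \<le> ennreal (B * exp (real n * (t * \<delta>))))"
proof -
  let ?U = "\<lambda>x. u (code m x)"
  have [measurable]: "?U \<in> borel_measurable M" by (rule measurable_code_fun) simp
  have iE: "integrable acim (\<lambda>x. exp (s * \<bar>?U x\<bar>))"
    using fin by (intro acim_exp_integrable) auto
  have Ub: "\<bar>?U x\<bar> \<le> 1 / s * exp (s * \<bar>?U x\<bar>)" for x
  proof -
    have "s * \<bar>?U x\<bar> \<le> exp (s * \<bar>?U x\<bar>)"
      using exp_ge_add_one_self[of "s * \<bar>?U x\<bar>"] by linarith
    then show ?thesis using s by (simp add: field_simps)
  qed
  have iU: "integrable acim ?U"
    by (rule Bochner_Integration.integrable_bound[OF integrable_mult_right[OF iE, of "1 / s"]])
      (use Ub s in \<open>auto\<close>)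
  define A where "A = 8 / s\<^sup>2 * (LINT x|acim. exp (s * \<bar>?U x\<bar>))"
  have A0: "0 \<le> A" using s by (auto simp: A_def intro!: mult_nonneg_nonneg divide_nonneg_nonneg)
  have expU: "(\<integral>\<^sup>+x. ennreal (exp (\<theta> * ?U x)) \<partial>acim) \<le> ennreal (1 + A * \<theta>\<^sup>2)" if \<theta>: "0 < \<theta>" "\<theta> \<le> s / 2" for \<theta>
  proof -
    have pt: "exp (\<theta> * ?U x) \<le> 1 + \<theta> * ?U x + \<theta>\<^sup>2 * (8 / s\<^sup>2 * exp (s * \<bar>?U x\<bar>))" for x
    proof -
      let ?a = "\<bar>?U x\<bar>"
      have "(s * ?a / 2)\<^sup>2 \<le> 2 * exp (s * ?a / 2)" using s by (intro square_le_exp) auto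
      then have a2: "?a\<^sup>2 \<le> 8 / s\<^sup>2 * exp (s * ?a / 2)"
        using s by (simp add: power2_eq_square field_simps)
      have "exp (\<bar>\<theta> * ?U x\<bar>) \<le> exp (s * ?a / 2)"
        using \<theta> mult_right_mono[OF \<theta>(2), of ?a] by (simp add: abs_mult)
      then have "(\<theta> * ?U x)\<^sup>2 * exp \<bar>\<theta> * ?U x\<bar> \<le> \<theta>\<^sup>2 * (8 / s\<^sup>2 * exp (s * ?a / 2)) * exp (s * ?a / 2)"
        using mult_left_mono[OF a2, of "\<theta>\<^sup>2"] by (intro mult_mono) (simp_all add: power_mult_distrib)
      also have "\<dots> = \<theta>\<^sup>2 * (8 / s\<^sup>2 * exp (s * ?a))"
        by (simp flip: exp_add)
      finally show ?thesis using exp_le_quadratic[of "\<theta> * ?U x"] by linarith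
    qed
    have "(\<integral>\<^sup>+x. ennreal (exp (\<theta> * ?U x)) \<partial>acim) \<le>
        (\<integral>\<^sup>+x. ennreal (1 + \<theta> * ?U x + \<theta>\<^sup>2 * (8 / s\<^sup>2 * exp (s * \<bar>?U x\<bar>))) \<partial>acim)"
      using pt by (intro nn_integral_mono ennreal_leI)
    also have "\<dots> = ennreal (LINT x|acim. 1 + \<theta> * ?U x + \<theta>\<^sup>2 * (8 / s\<^sup>2 * exp (s * \<bar>?U x\<bar>)))"
    proof (rule nn_integral_eq_integral)
      show "AE x in acim. 0 \<le> 1 + \<theta> * ?U x + \<theta>\<^sup>2 * (8 / s\<^sup>2 * exp (s * \<bar>?U x\<bar>))"
        by (rule AE_I2) (rule order_trans[OF exp_ge_zero pt])
    qed (use iU iE in simp)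
    also have "(LINT x|acim. 1 + \<theta> * ?U x + \<theta>\<^sup>2 * (8 / s\<^sup>2 * exp (s * \<bar>?U x\<bar>))) = 1 + A * \<theta>\<^sup>2"
      using iU iE mean by (simp add: A_def acim.prob_space)
    finally show ?thesis .
  qed
  \<comment> \<open>half of \<open>\<theta> \<delta>\<close> absorbs the quadratic term \<open>A \<theta>\<^sup>2\<close>, the other half the mixing error \<open>\<epsilon>\<close>\<close>
  define \<theta> where "\<theta> = min (s / 2) (\<delta> / (2 * (A + 1)))"
  have \<theta>: "0 < \<theta>" "\<theta> \<le> s / 2" using s \<delta> A0 unfolding \<theta>_def by (simp, intro min.cobounded1)
  have "\<theta> * (2 * (A + 1)) \<le> \<delta>"
  proof -
    have "\<theta> \<le> \<delta> / (2 * (A + 1))" by (simp add: \<theta>_def)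
    then show ?thesis using A0 by (simp add: pos_le_divide_eq)
  qed
  then have A\<theta>: "A * \<theta> \<le> \<delta> / 2" using \<theta>(1) by (simp add: algebra_simps)
  define \<epsilon> where "\<epsilon> = \<theta> * \<delta> / 2"
  have \<epsilon>: "0 < \<epsilon>" using \<theta> \<delta> by (simp add: \<epsilon>_def)
  obtain g1 where g1: "\<And>g. g \<ge> g1 \<Longrightarrow> gap_bound (1 + \<epsilon>) g"
    using mixing[OF \<epsilon>] unfolding gap_bound_def by blast
  define g0 where "g0 = Suc g1"
  define G where "G = m + g0"
  have G: "G > 0" by (simp add: G_def g0_def)
  define V where "V = exp (\<theta> * \<delta>)"
  have V: "1 \<le> V" using \<theta> \<delta> by (simp add: V_def)
  have quad: "(1 + \<epsilon>) * (1 + A * \<theta>\<^sup>2) \<le> V"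
  proof -
    have "(1 + \<epsilon>) * (1 + A * \<theta>\<^sup>2) \<le> exp \<epsilon> * exp (A * \<theta>\<^sup>2)"
      using A0 \<epsilon> by (intro mult_mono) (auto simp: exp_ge_add_one_self)
    also have "\<dots> = exp (\<epsilon> + A * \<theta>\<^sup>2)" by (simp add: exp_add)
    also have "A * \<theta>\<^sup>2 \<le> \<delta> / 2 * \<theta>"
      using mult_right_mono[OF A\<theta>, of \<theta>] \<theta>(1) by (simp add: power2_eq_square mult_ac)
    finally show ?thesis by (simp add: V_def \<epsilon>_def mult_ac)
  qed
  define \<phi> where "\<phi> w = ennreal (exp (\<theta> * u w))" for w
  have I: "(\<integral>\<^sup>+x. \<phi> (code m x) \<partial>acim) \<le> ennreal (1 + A * \<theta>\<^sup>2)"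
    unfolding \<phi>_def using expU[OF \<theta>] by simp
  have I2: "ennreal (1 + \<epsilon>) * (\<integral>\<^sup>+x. \<phi> (code m x) \<partial>acim) \<le> ennreal V"
  proof -
    have "ennreal (1 + \<epsilon>) * (\<integral>\<^sup>+x. \<phi> (code m x) \<partial>acim) \<le> ennreal (1 + \<epsilon>) * ennreal (1 + A * \<theta>\<^sup>2)"
      by (rule mult_left_mono[OF I]) simp
    also have "\<dots> = ennreal ((1 + \<epsilon>) * (1 + A * \<theta>\<^sup>2))"
      using A0 by (intro ennreal_mult''[symmetric]) simp
    also have "\<dots> \<le> ennreal V" using quad by (rule ennreal_leI)
    finally show ?thesis .
  qed
  have I1: "(\<integral>\<^sup>+x. \<phi> (code m x) \<partial>acim) \<le> ennreal V"
  proof -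
    have "1 * (1 + A * \<theta>\<^sup>2) \<le> (1 + \<epsilon>) * (1 + A * \<theta>\<^sup>2)"
      using A0 \<epsilon> by (intro mult_right_mono) auto
    then have "1 + A * \<theta>\<^sup>2 \<le> V" using quad by simp
    then show ?thesis by (rule order_trans[OF I ennreal_leI])
  qed
  define t where "t = \<theta> / real G"
  have t: "0 < t" "t \<le> s"
  proof -
    show "0 < t" using \<theta> G by (simp add: t_def)
    have "\<theta> / real G \<le> \<theta> / 1" using \<theta> G by (intro divide_left_mono) auto
    then show "t \<le> s" using \<theta> s by (simp add: t_def)
  qed
  have main: "(\<integral>\<^sup>+x. ennreal (exp (t * birk T ?U n x)) \<partial>M) \<le> ennreal (C\<^sub>0\<^sup>2 * V * exp (real n * (t * \<delta>)))" for n
  proof -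
    \<comment> \<open>the terms beyond \<open>n\<close> are set to \<open>0\<close>, so that all progressions have \<open>J\<close> terms\<close>
    define J where "J = n div G + 1"
    have JG: "n \<le> J * G" using G by (simp add: J_def) (metis div_mult_mod_eq add.commute add_le_mono mod_le_divisor order_refl)
    define b where "b x i = (if i < n then ?U ((T ^^ i) x) else 0)" for x i
    have S: "birk T ?U n x = (\<Sum>r<G. \<Sum>j<J. b x (r + j * G))" for x
    proof -
      have "birk T ?U n x = (\<Sum>i<J * G. b x i)"
        unfolding birk_def b_def using JG by (intro sum.mono_neutral_cong_left) auto
      then show ?thesis by (simp add: sum_residues)
    qed
    have pr: "ennreal (exp (\<theta> * (\<Sum>j<J. b x (r + j * G)))) =
      (\<Prod>j<J. if r + j * G < n then \<phi> (code m ((T ^^ (r + j * G)) x)) else 1)" for x r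
    proof -
      have "exp (\<theta> * (\<Sum>j<J. b x (r + j * G))) = (\<Prod>j<J. exp (\<theta> * b x (r + j * G)))"
        by (simp add: sum_distrib_left exp_sum)
      then show ?thesis
        by (auto simp: \<phi>_def b_def prod_ennreal[symmetric] intro!: prod.cong)
    qed
    have "(\<integral>\<^sup>+x. ennreal (exp (t * birk T ?U n x)) \<partial>M) \<le>
      (\<integral>\<^sup>+x. (\<Sum>r<G. ennreal (1 / real G) * (\<Prod>j<J. if r + j * G < n then \<phi> (code m ((T ^^ (r + j * G)) x)) else 1)) \<partial>M)"
    proof (rule nn_integral_mono)
      fix x
      have "exp (t * birk T ?U n x) = exp ((\<Sum>r<G. \<theta> * (\<Sum>j<J. b x (r + j * G))) / real G)"
        by (simp add: S t_def sum_distrib_left sum_divide_distrib)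
      also have "\<dots> \<le> (\<Sum>r<G. exp (\<theta> * (\<Sum>j<J. b x (r + j * G)))) / real G"
        by (rule exp_mean_le[OF G])
      also have "\<dots> = (\<Sum>r<G. 1 / real G * exp (\<theta> * (\<Sum>j<J. b x (r + j * G))))"
        by (simp add: sum_divide_distrib)
      finally have "ennreal (exp (t * birk T ?U n x)) \<le> ennreal (\<Sum>r<G. 1 / real G * exp (\<theta> * (\<Sum>j<J. b x (r + j * G))))"
        by (rule ennreal_leI)
      also have "\<dots> = (\<Sum>r<G. ennreal (1 / real G) * ennreal (exp (\<theta> * (\<Sum>j<J. b x (r + j * G)))))"
      proof -
        have "(\<Sum>r<G. ennreal (1 / real G) * ennreal (exp (\<theta> * (\<Sum>j<J. b x (r + j * G)))))
          = (\<Sum>r<G. ennreal (1 / real G * exp (\<theta> * (\<Sum>j<J. b x (r + j * G)))))"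
          by (intro sum.cong refl ennreal_mult''[symmetric]) simp
        also have "\<dots> = ennreal (\<Sum>r<G. 1 / real G * exp (\<theta> * (\<Sum>j<J. b x (r + j * G))))"
          by (rule sum_ennreal) simp
        finally show ?thesis ..
      qed
      finally show "ennreal (exp (t * birk T ?U n x)) \<le> (\<Sum>r<G. ennreal (1 / real G) *
          (\<Prod>j<J. if r + j * G < n then \<phi> (code m ((T ^^ (r + j * G)) x)) else 1))"
        unfolding pr .
    qed
    also have "\<dots> = (\<Sum>r<G. ennreal (1 / real G) * (\<integral>\<^sup>+x. (\<Prod>j<J. if r + j * G < n then \<phi> (code m ((T ^^ (r + j * G)) x)) else 1) \<partial>M))"
    proof -
      have m\<phi> [measurable]: "(\<lambda>x. \<phi> (code m x)) \<in> borel_measurable M" by (rule measurable_code_fun) simp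
      have [measurable]: "(\<lambda>x. \<phi> (code m ((T ^^ i) x))) \<in> borel_measurable M" for i
        by (rule measurable_compose[OF funpow_measurable m\<phi>])
      show ?thesis
        by (subst nn_integral_sum) (auto intro!: sum.cong nn_integral_cmult)
    qed
    also have "\<dots> \<le> (\<Sum>r<G. ennreal (1 / real G) * ennreal (C\<^sub>0\<^sup>2 * V ^ J))"
      using g1[of g0] \<epsilon> I1 I2 V
      by (intro sum_mono mult_left_mono nn_spaced_product[where c="1 + \<epsilon>" and ?g0.0=g0]) (auto simp: g0_def G_def)
    also have "\<dots> = ennreal (C\<^sub>0\<^sup>2 * V ^ J)"
    proof -
      have "(\<Sum>r<G. ennreal (1 / real G) * ennreal (C\<^sub>0\<^sup>2 * V ^ J)) = ennreal (\<Sum>r<G. 1 / real G * (C\<^sub>0\<^sup>2 * V ^ J))"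
      proof -
        have "ennreal (1 / real G) * ennreal (C\<^sub>0\<^sup>2 * V ^ J) = ennreal (1 / real G * (C\<^sub>0\<^sup>2 * V ^ J))"
          using V by (intro ennreal_mult''[symmetric]) simp
        moreover have "(\<Sum>r<G. ennreal (1 / real G * (C\<^sub>0\<^sup>2 * V ^ J))) = ennreal (\<Sum>r<G. 1 / real G * (C\<^sub>0\<^sup>2 * V ^ J))"
          using V by (intro sum_ennreal) simp
        ultimately show ?thesis by (simp only:)
      qed
      then show ?thesis using G by simp
    qed
    also have "\<dots> \<le> ennreal (C\<^sub>0\<^sup>2 * V * exp (real n * (t * \<delta>)))"
    proof (rule ennreal_leI)
      have "V ^ J = exp (real J * (\<theta> * \<delta>))" by (simp add: V_def exp_of_nat_mult)
      also have "\<dots> \<le> exp ((real n / real G + 1) * (\<theta> * \<delta>))"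
      proof -
        have "real (n div G) \<le> real n / real G" by (rule of_nat_div_le_of_nat)
        then show ?thesis using \<theta> \<delta> by (simp add: J_def mult_right_mono)
      qed
      also have "\<dots> = V * exp (real n * (t * \<delta>))"
        by (simp add: V_def t_def algebra_simps flip: exp_add)
      finally show "C\<^sub>0\<^sup>2 * V ^ J \<le> C\<^sub>0\<^sup>2 * V * exp (real n * (t * \<delta>))"
        by (simp add: mult_left_mono mult.assoc)
    qed
    finally show ?thesis .
  qed
  show ?thesis
    using t main C0_ge_1 V by (intro exI[of _ t] exI[of _ "C\<^sub>0\<^sup>2 * V"]) auto
qed

text \<open>The observables for which large deviations are controlled. Indicators of cylinders and \<open>log
  \<bar>T'\<bar>\<close> are the instances.\<close>

definition exp_cyl_approx :: "real \<Rightarrow> ('a \<Rightarrow> real) \<Rightarrow> bool" where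
  "exp_cyl_approx s f \<longleftrightarrow> f \<in> borel_measurable M \<and>
     (\<integral>\<^sup>+x. ennreal (exp (s * \<bar>f x\<bar>)) \<partial>M) < \<infinity> \<and>
     (\<forall>\<epsilon>>0. \<exists>m u. \<forall>x\<in>space M. \<bar>f x - u (code m x)\<bar> \<le> \<epsilon>)"

lemma exp_cyl_approx_uminus:
  assumes "exp_cyl_approx s f"
  shows "exp_cyl_approx s (\<lambda>x. - f x)"
  unfolding exp_cyl_approx_def
proof (intro conjI allI impI)
  fix \<epsilon> :: real assume "\<epsilon> > 0"
  then obtain m u where "\<forall>x\<in>space M. \<bar>f x - u (code m x)\<bar> \<le> \<epsilon>"
    using assms by (auto simp: exp_cyl_approx_def)
  then show "\<exists>m u. \<forall>x\<in>space M. \<bar>- f x - u (code m x)\<bar> \<le> \<epsilon>"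
    by (intro exI[of _ m] exI[of _ "\<lambda>w. - u w"]) (auto simp: abs_minus_commute)
qed (use assms in \<open>auto simp: exp_cyl_approx_def\<close>)

lemma exp_moment_integrable:
  assumes s: "0 < s" and fin: "(\<integral>\<^sup>+x. ennreal (exp (s * \<bar>f x\<bar>)) \<partial>M) < \<infinity>"
    and [measurable]: "f \<in> borel_measurable M"
  shows "integrable acim f"
proof (rule Bochner_Integration.integrable_bound)
  show "integrable acim (\<lambda>x. 1 / s * exp (s * \<bar>f x\<bar>))"
    using fin by (intro integrable_mult_right acim_exp_integrable) auto
  have "\<bar>f x\<bar> \<le> 1 / s * exp (s * \<bar>f x\<bar>)" for x
  proof -
    have "s * \<bar>f x\<bar> \<le> exp (s * \<bar>f x\<bar>)"
      using exp_ge_add_one_self[of "s * \<bar>f x\<bar>"] by linarith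
    then show ?thesis using s by (simp add: field_simps)
  qed
  then show "AE x in acim. norm (f x) \<le> norm (1 / s * exp (s * \<bar>f x\<bar>))"
    using s by auto
qed auto

lemma birk_diff_le:
  assumes "\<And>x. x \<in> space M \<Longrightarrow> \<bar>f x - h x\<bar> \<le> \<epsilon>" "x \<in> space M"
  shows "\<bar>birk T f n x - birk T h n x\<bar> \<le> real n * \<epsilon>"
proof -
  have "\<bar>birk T f n x - birk T h n x\<bar> \<le> (\<Sum>i<n. \<bar>f ((T ^^ i) x) - h ((T ^^ i) x)\<bar>)"
    unfolding birk_def sum_subtractf[symmetric] by (rule sum_abs)
  also have "\<dots> \<le> (\<Sum>i<n. \<epsilon>)"
    using assms funpow_space by (intro sum_mono) auto
  finally show ?thesis by simp
qed

lemma mgf: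
  assumes s: "0 < s" and f: "exp_cyl_approx s f" and \<delta>: "0 < \<delta>"
  shows "\<exists>t B. 0 < t \<and> t \<le> s \<and> 0 < B \<and>
    (\<forall>n. (\<integral>\<^sup>+x. ennreal (exp (t * (birk T f n x - real n * (LINT x|acim. f x)))) \<partial>M)
       \<le> ennreal (B * exp (real n * (t * \<delta>))))"
proof -
  have [measurable]: "f \<in> borel_measurable M"
    and fin: "(\<integral>\<^sup>+x. ennreal (exp (s * \<bar>f x\<bar>)) \<partial>M) < \<infinity>" using f by (auto simp: exp_cyl_approx_def)
  have "\<delta> / 4 > 0" using \<delta> by simp
  then obtain m u where u: "\<And>x. x \<in> space M \<Longrightarrow> \<bar>f x - u (code m x)\<bar> \<le> \<delta> / 4"
    using f unfolding exp_cyl_approx_def by meson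
  define \<epsilon> where "\<epsilon> = \<delta> / 4"
  let ?U = "\<lambda>x. u (code m x)"
  have [measurable]: "?U \<in> borel_measurable M" by (rule measurable_code_fun) simp
  define a where "a = (LINT x|acim. ?U x)"
  define v where "v w = u w - a" for w
  have bound: "\<bar>v (code m x)\<bar> \<le> \<bar>f x\<bar> + (\<epsilon> + \<bar>a\<bar>)" "\<bar>?U x\<bar> \<le> \<bar>f x\<bar> + \<epsilon>" if "x \<in> space M" for x
    using u[OF that] unfolding v_def \<epsilon>_def by linarith+
  have finK: "(\<integral>\<^sup>+x. ennreal (exp (s * h x)) \<partial>M) < \<infinity>" if h: "\<And>x. x \<in> space M \<Longrightarrow> h x \<le> \<bar>f x\<bar> + K" for h K
  proof -
    have "(\<integral>\<^sup>+x. ennreal (exp (s * h x)) \<partial>M) \<le> (\<integral>\<^sup>+x. ennreal (exp (s * K)) * ennreal (exp (s * \<bar>f x\<bar>)) \<partial>M)"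
    proof (rule nn_integral_mono)
      fix x assume "x \<in> space M"
      then have "s * h x \<le> s * K + s * \<bar>f x\<bar>"
        using mult_left_mono[OF h, of x s] s by (simp add: algebra_simps)
      then show "ennreal (exp (s * h x)) \<le> ennreal (exp (s * K)) * ennreal (exp (s * \<bar>f x\<bar>))"
        by (simp add: exp_add[symmetric] flip: ennreal_mult'')
    qed
    also have "\<dots> = ennreal (exp (s * K)) * (\<integral>\<^sup>+x. ennreal (exp (s * \<bar>f x\<bar>)) \<partial>M)"
      by (rule nn_integral_cmult) simp
    also have "\<dots> < \<infinity>" using fin by (simp add: ennreal_mult_less_top)
    finally show ?thesis .
  qed
  have iU: "integrable acim ?U"
    using finK[OF bound(2)] by (intro exp_moment_integrable[OF s]) auto
  have i_f: "integrable acim f" using fin by (intro exp_moment_integrable[OF s]) auto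
  have "(LINT x|acim. v (code m x)) = 0"
    using iU by (simp add: v_def a_def acim.prob_space)
  from mgf_centered[OF s finK[OF bound(1)] this, of "\<delta> / 2"] \<delta>
  obtain t B where t: "0 < t" "t \<le> s" and B: "0 < B"
    and tB: "\<And>n. (\<integral>\<^sup>+x. ennreal (exp (t * birk T (\<lambda>x. v (code m x)) n x)) \<partial>M)
     \<le> ennreal (B * exp (real n * (t * (\<delta> / 2))))" by auto
  have mean: "\<bar>(LINT x|acim. f x) - a\<bar> \<le> \<epsilon>"
  proof -
    have "\<bar>(LINT x|acim. f x) - a\<bar> = \<bar>LINT x|acim. f x - ?U x\<bar>"
      using i_f iU by (simp add: a_def)
    also have "\<dots> \<le> (LINT x|acim. \<bar>f x - ?U x\<bar>)" by (rule integral_abs_bound)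
    also have "\<dots> \<le> (LINT x|acim. \<epsilon>)"
      using i_f iU u by (intro integral_mono) (auto simp: \<epsilon>_def)
    finally show ?thesis by (simp add: acim.prob_space)
  qed
  have "(\<integral>\<^sup>+x. ennreal (exp (t * (birk T f n x - real n * (LINT x|acim. f x)))) \<partial>M)
       \<le> ennreal (B * exp (real n * (t * \<delta>)))" for n
  proof -
    have "(\<integral>\<^sup>+x. ennreal (exp (t * (birk T f n x - real n * (LINT x|acim. f x)))) \<partial>M)
      \<le> (\<integral>\<^sup>+x. ennreal (exp (real n * (t * (\<delta> / 2)))) * ennreal (exp (t * birk T (\<lambda>x. v (code m x)) n x)) \<partial>M)"
    proof (rule nn_integral_mono)
      fix x assume x: "x \<in> space M"
      have "birk T (\<lambda>x. v (code m x)) n x = birk T ?U n x - real n * a"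
        by (simp add: birk_def v_def sum_subtractf)
      moreover have "birk T f n x - birk T ?U n x \<le> real n * \<epsilon>"
        using birk_diff_le[where f=f and h="?U" and n=n, OF u x] unfolding \<epsilon>_def by linarith
      moreover have "real n * (a - (LINT x|acim. f x)) \<le> real n * \<epsilon>"
        using mean by (intro mult_left_mono) auto
      ultimately have "birk T f n x - real n * (LINT x|acim. f x)
        \<le> real n * (\<delta> / 2) + birk T (\<lambda>x. v (code m x)) n x"
        by (simp add: \<epsilon>_def algebra_simps)
      from mult_left_mono[OF this, of t] t(1)
      have "t * (birk T f n x - real n * (LINT x|acim. f x))
        \<le> real n * (t * (\<delta> / 2)) + t * birk T (\<lambda>x. v (code m x)) n x"
        by (simp add: algebra_simps)
      then show "ennreal (exp (t * (birk T f n x - real n * (LINT x|acim. f x))))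
        \<le> ennreal (exp (real n * (t * (\<delta> / 2)))) * ennreal (exp (t * birk T (\<lambda>x. v (code m x)) n x))"
        by (simp add: exp_add[symmetric] flip: ennreal_mult'')
    qed
    also have "\<dots> = ennreal (exp (real n * (t * (\<delta> / 2)))) * (\<integral>\<^sup>+x. ennreal (exp (t * birk T (\<lambda>x. v (code m x)) n x)) \<partial>M)"
    proof (rule nn_integral_cmult)
      have [measurable]: "(\<lambda>x. v (code m x)) \<in> borel_measurable M" by (rule measurable_code_fun) simp
      show "(\<lambda>x. ennreal (exp (t * birk T (\<lambda>x. v (code m x)) n x))) \<in> borel_measurable M" by measurable
    qed
    also have "\<dots> \<le> ennreal (exp (real n * (t * (\<delta> / 2)))) * ennreal (B * exp (real n * (t * (\<delta> / 2))))"
      by (rule mult_left_mono[OF tB]) simp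
    also have "\<dots> = ennreal (B * (exp (real n * (t * (\<delta> / 2))) * exp (real n * (t * (\<delta> / 2)))))"
      using B by (simp add: mult_ac flip: ennreal_mult'')
    also have "\<dots> = ennreal (B * exp (real n * (t * \<delta>)))"
      by (simp add: mult_ac flip: exp_add)
    finally show ?thesis .
  qed
  then show ?thesis using t B by blast
qed

text \<open>Markov's inequality for the exponential moment.\<close>

lemma upper_tail:
  assumes s: "0 < s" and f: "exp_cyl_approx s f" and \<delta>: "0 < \<delta>"
  shows "\<exists>B \<eta>. 0 < B \<and> 0 < \<eta> \<and> (\<forall>n.
    prob {x \<in> space M. real n * \<delta> \<le> birk T f n x - real n * (LINT x|acim. f x)} \<le> B * exp (- (\<eta> * real n)))"
proof -
  have [measurable]: "f \<in> borel_measurable M" using f by (auto simp: exp_cyl_approx_def)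
  obtain t B where t: "0 < t" and B: "0 < B"
    and tB: "\<And>n. (\<integral>\<^sup>+x. ennreal (exp (t * (birk T f n x - real n * (LINT x|acim. f x)))) \<partial>M)
       \<le> ennreal (B * exp (real n * (t * (\<delta> / 2))))"
    using mgf[OF s f, of "\<delta> / 2"] \<delta> by auto
  have "prob {x \<in> space M. real n * \<delta> \<le> birk T f n x - real n * (LINT x|acim. f x)}
    \<le> B * exp (- (t * (\<delta> / 2) * real n))" for n
  proof -
    let ?S = "{x \<in> space M. real n * \<delta> \<le> birk T f n x - real n * (LINT x|acim. f x)}"
    let ?g = "\<lambda>x. ennreal (exp (t * (birk T f n x - real n * (LINT x|acim. f x))))"
    let ?c = "ennreal (exp (- (t * (real n * \<delta>))))"
    have "?S = {x \<in> space M. 1 \<le> ?c * ?g x}"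
    proof (rule Collect_cong, rule conj_cong[OF refl])
      fix x
      have "1 \<le> ?c * ?g x \<longleftrightarrow> 0 \<le> t * (birk T f n x - real n * (LINT x|acim. f x)) - t * (real n * \<delta>)"
        by (simp add: exp_add[symmetric] flip: ennreal_mult'')
      also have "\<dots> \<longleftrightarrow> real n * \<delta> \<le> birk T f n x - real n * (LINT x|acim. f x)"
        using t by (simp add: zero_le_mult_iff flip: right_diff_distrib)
      finally show "real n * \<delta> \<le> birk T f n x - real n * (LINT x|acim. f x) \<longleftrightarrow> 1 \<le> ?c * ?g x" ..
    qed
    then have "emeasure M ?S \<le> ?c * (\<integral>\<^sup>+x. ?g x * indicator (space M) x \<partial>M)"
      using nn_integral_Markov_inequality[of ?g "space M" M ?c] by simp
    also have "(\<integral>\<^sup>+x. ?g x * indicator (space M) x \<partial>M) = (\<integral>\<^sup>+x. ?g x \<partial>M)"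
      by (intro nn_integral_cong) simp
    also have "?c * \<dots> \<le> ?c * ennreal (B * exp (real n * (t * (\<delta> / 2))))"
      by (rule mult_left_mono[OF tB]) simp
    also have "\<dots> = ennreal (B * (exp (- (t * (real n * \<delta>))) * exp (real n * (t * (\<delta> / 2)))))"
      using B by (simp add: mult_ac flip: ennreal_mult'')
    also have "exp (- (t * (real n * \<delta>))) * exp (real n * (t * (\<delta> / 2))) = exp (- (t * (\<delta> / 2) * real n))"
      by (simp flip: exp_add)
    finally show ?thesis using B by (simp add: emeasure_eq_measure)
  qed
  moreover have "0 < t * (\<delta> / 2)" using t \<delta> by simp
  ultimately show ?thesis using B by blast
qed

definition concentrates :: "('a \<Rightarrow> real) \<Rightarrow> bool" where
  "concentrates f \<longleftrightarrow> (\<forall>\<delta>>0. \<exists>B \<eta>. 0 < B \<and> 0 < \<eta> \<and> (\<forall>n.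
    prob {x \<in> space M. real n * \<delta> \<le> \<bar>birk T f n x - real n * (LINT x|acim. f x)\<bar>} \<le> B * exp (- (\<eta> * real n))))"

lemma concentrates:
  assumes s: "0 < s" and f: "exp_cyl_approx s f"
  shows "concentrates f"
  unfolding concentrates_def
proof (intro allI impI)
  fix \<delta> :: real assume \<delta>: "0 < \<delta>"
  have [measurable]: "f \<in> borel_measurable M" using f by (auto simp: exp_cyl_approx_def)
  obtain B1 \<eta>1 where 1: "0 < B1" "0 < \<eta>1" "\<And>n.
    prob {x \<in> space M. real n * \<delta> \<le> birk T f n x - real n * (LINT x|acim. f x)} \<le> B1 * exp (- (\<eta>1 * real n))"
    using upper_tail[OF s f \<delta>] by auto
  obtain B2 \<eta>2 where 2: "0 < B2" "0 < \<eta>2" "\<And>n.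
    prob {x \<in> space M. real n * \<delta> \<le> birk T (\<lambda>x. - f x) n x - real n * (LINT x|acim. - f x)} \<le> B2 * exp (- (\<eta>2 * real n))"
    using upper_tail[OF s exp_cyl_approx_uminus[OF f] \<delta>] by auto
  define \<eta> where "\<eta> = min \<eta>1 \<eta>2"
  have "prob {x \<in> space M. real n * \<delta> \<le> \<bar>birk T f n x - real n * (LINT x|acim. f x)\<bar>} \<le> (B1 + B2) * exp (- (\<eta> * real n))" for n
  proof -
    let ?A = "{x \<in> space M. real n * \<delta> \<le> birk T f n x - real n * (LINT x|acim. f x)}"
    let ?B = "{x \<in> space M. real n * \<delta> \<le> birk T (\<lambda>x. - f x) n x - real n * (LINT x|acim. - f x)}"
    have "{x \<in> space M. real n * \<delta> \<le> \<bar>birk T f n x - real n * (LINT x|acim. f x)\<bar>} = ?A \<union> ?B"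
      by (auto simp: birk_def sum_negf abs_if split: if_splits)
    then have "prob {x \<in> space M. real n * \<delta> \<le> \<bar>birk T f n x - real n * (LINT x|acim. f x)\<bar>} \<le> prob ?A + prob ?B"
      by (simp, intro measure_Un_le) auto
    also have "\<dots> \<le> B1 * exp (- (\<eta>1 * real n)) + B2 * exp (- (\<eta>2 * real n))"
      using 1(3) 2(3) by (rule add_mono)
    also have "\<dots> \<le> B1 * exp (- (\<eta> * real n)) + B2 * exp (- (\<eta> * real n))"
      using 1 2 by (intro add_mono mult_left_mono) (auto simp: \<eta>_def intro!: mult_right_mono)
    finally show ?thesis by (simp add: algebra_simps)
  qed
  moreover have "0 < B1 + B2" "0 < \<eta>" using 1 2 by (auto simp: \<eta>_def)
  ultimately show "\<exists>B \<eta>. 0 < B \<and> 0 < \<eta> \<and> (\<forall>n.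
    prob {x \<in> space M. real n * \<delta> \<le> \<bar>birk T f n x - real n * (LINT x|acim. f x)\<bar>} \<le> B * exp (- (\<eta> * real n)))"
    by blast
qed

lemma exp_cyl_approx_indicator: "exp_cyl_approx s (indicator (cyl v))"
  unfolding exp_cyl_approx_def
proof (intro conjI allI impI)
  have "(\<integral>\<^sup>+x. ennreal (exp (s * \<bar>indicator (cyl v) x\<bar>)) \<partial>M) \<le> (\<integral>\<^sup>+x. ennreal (exp \<bar>s\<bar>) \<partial>M)"
    by (intro nn_integral_mono ennreal_leI) (auto simp: indicator_def)
  also have "\<dots> < \<infinity>" by (simp add: emeasure_space_1)
  finally show "(\<integral>\<^sup>+x. ennreal (exp (s * \<bar>indicator (cyl v) x\<bar>)) \<partial>M) < \<infinity>" .
  fix \<epsilon> :: real assume "0 < \<epsilon>"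
  then show "\<exists>m u. \<forall>x\<in>space M. \<bar>indicator (cyl v) x - u (code m x)\<bar> \<le> \<epsilon>"
    by (intro exI[of _ "length v"] exI[of _ "\<lambda>w. if w = v then 1 else 0"])
      (auto simp: indicator_def cyl_iff)
qed simp

end

text \<open>Here \<open>L\<close> stands for \<open>log \<bar>T'\<bar>\<close>: its Birkhoff sums are the logarithms of inverse cylinder
  measures up to a bounded error. Along a word of length \<open>n\<close> they exceed \<open>n log (1 / \<theta>)\<close> up to a
  constant, by the last assumption.\<close>

locale gibbs_lyapunov = gibbs_coding +
  fixes L :: "'a \<Rightarrow> real" and C\<^sub>1 s \<theta> C\<^sub>2 :: real
  assumes L_measurable [measurable]: "L \<in> borel_measurable M"
    and L_gibbs: "x \<in> space M \<Longrightarrow> \<bar>birk T L n x + ln (q (code n x))\<bar> \<le> C\<^sub>1"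
    and L_approx: "\<epsilon> > 0 \<Longrightarrow> \<exists>m. \<forall>x\<in>space M. \<forall>y\<in>space M. code m x = code m y \<longrightarrow> \<bar>L x - L y\<bar> \<le> \<epsilon>"
    and s_pos: "0 < s" and L_exp: "(\<integral>\<^sup>+x. ennreal (exp (s * \<bar>L x\<bar>)) \<partial>M) < \<infinity>"
    and theta: "0 < \<theta>" "\<theta> < 1" and q_le: "q w \<le> C\<^sub>2 * \<theta> ^ length w"
begin

lemma exp_cyl_approx_L: "exp_cyl_approx s L"
  unfolding exp_cyl_approx_def
proof (intro conjI allI impI L_exp L_measurable)
  fix \<epsilon> :: real assume "0 < \<epsilon>"
  then obtain m where m: "\<And>x y. x \<in> space M \<Longrightarrow> y \<in> space M \<Longrightarrow> code m x = code m y \<Longrightarrow> \<bar>L x - L y\<bar> \<le> \<epsilon>"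
    using L_approx by blast
  define u where "u w = L (SOME y. y \<in> cyl w)" for w
  have "\<bar>L x - u (code m x)\<bar> \<le> \<epsilon>" if x: "x \<in> space M" for x
  proof -
    let ?y = "SOME y. y \<in> cyl (code m x)"
    have "?y \<in> cyl (code m x)" by (rule someI[of _ x]) (use x in \<open>simp add: cyl_iff\<close>)
    then have "?y \<in> space M" "code m x = code m ?y" by (auto simp: cyl_iff)
    then show ?thesis unfolding u_def using m[OF x] by blast
  qed
  then show "\<exists>m u. \<forall>x\<in>space M. \<bar>L x - u (code m x)\<bar> \<le> \<epsilon>" by blast
qed

lemma integrable_acim_L: "integrable acim L"
  by (rule exp_moment_integrable[OF s_pos L_exp]) simp

end

section \<open>Entropy of finitely labelled systems\<close>

lemma gibbs_inequality:
  fixes p r :: "'b \<Rightarrow> real"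
  assumes "finite S" and p: "\<And>w. w \<in> S \<Longrightarrow> 0 \<le> p w" and r: "\<And>w. w \<in> S \<Longrightarrow> 0 \<le> r w"
    and z: "\<And>w. w \<in> S \<Longrightarrow> r w = 0 \<Longrightarrow> p w = 0" and le: "sum r S \<le> sum p S"
  shows "(\<Sum>w\<in>S. - (p w * ln (p w))) \<le> (\<Sum>w\<in>S. - (p w * ln (r w)))"
proof -
  have "p w * ln (r w) - p w * ln (p w) \<le> r w - p w" if w: "w \<in> S" for w
  proof (cases "p w = 0")
    case True then show ?thesis using r[OF w] by simp
  next
    case False
    then have pos: "0 < p w" "0 < r w" using p[OF w] r[OF w] z[OF w] by (auto simp: less_le)
    then have "ln (r w) - ln (p w) \<le> r w / p w - 1"
      using ln_le_minus_one[of "r w / p w"] by (simp add: ln_div)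
    from mult_left_mono[OF this, of "p w"] pos show ?thesis by (simp add: algebra_simps)
  qed
  then have "(\<Sum>w\<in>S. p w * ln (r w) - p w * ln (p w)) \<le> (\<Sum>w\<in>S. r w - p w)"
    by (rule sum_mono)
  then show ?thesis using le by (simp add: sum_subtractf sum_negf)
qed

text \<open>The infimum of \<open>a n / n\<close> is the limit: dividing \<open>n\<close> by a nearly optimal \<open>m\<close> leaves a bounded
  remainder.\<close>

lemma fekete:
  fixes a :: "nat \<Rightarrow> real"
  assumes sub: "\<And>m n. a (m + n) \<le> a m + a n" and nn: "\<And>n. 0 \<le> a n"
  shows "\<exists>l. (\<lambda>n. a n / real n) \<longlonglongrightarrow> l \<and> (\<forall>n\<ge>1. l \<le> a n / real n)"
proof -
  define l where "l = Inf ((\<lambda>n. a n / real n) ` {1..})"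
  have bdd: "bdd_below ((\<lambda>n. a n / real n) ` {1..})"
    by (rule bdd_belowI[of _ 0]) (use nn in auto)
  have low: "l \<le> a n / real n" if "n \<ge> 1" for n
    unfolding l_def using that bdd by (auto intro: cInf_lower)
  have mult: "a (q * m + r) \<le> real q * a m + a r" for q m r
  proof (induction q)
    case (Suc q)
    have "a (Suc q * m + r) \<le> a m + a (q * m + r)" using sub[of m "q * m + r"] by (simp add: add.assoc)
    then show ?case using Suc by (simp add: algebra_simps)
  qed simp
  have "(\<lambda>n. a n / real n) \<longlonglongrightarrow> l"
  proof (rule LIMSEQ_I)
    fix e :: real assume e: "0 < e"
    have "\<exists>m\<ge>1. a m / real m < l + e / 2"
    proof (rule ccontr)
      assume "\<not> ?thesis"
      then have "l + e / 2 \<le> Inf ((\<lambda>n. a n / real n) ` {1..})" by (intro cInf_greatest) (auto simp: not_less)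
      then show False using e by (simp add: l_def)
    qed
    then obtain m where m: "m \<ge> 1" "a m / real m < l + e / 2" by auto
    define B where "B = (\<Sum>r<m. a r)"
    have B: "a r \<le> B" if "r < m" for r
      unfolding B_def using that nn by (intro member_le_sum) auto
    obtain n0 where n0: "real n0 > 2 * B / e" using reals_Archimedean2 by auto
    show "\<exists>no. \<forall>n\<ge>no. norm (a n / real n - l) < e"
    proof (intro exI[of _ "Suc n0"] allI impI)
      fix n assume n: "Suc n0 \<le> n"
      then have npos: "0 < real n" by simp
      have "a n = a (n div m * m + n mod m)" by simp
      also have "\<dots> \<le> real (n div m) * a m + a (n mod m)" by (rule mult)
      also have "\<dots> \<le> real n / real m * a m + B"
        using m nn[of m] B[of "n mod m"] of_nat_div_le_of_nat[of n m, where 'a=real]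
        by (intro add_mono mult_right_mono) auto
      finally have "a n / real n \<le> (real n / real m * a m + B) / real n"
        using npos by (simp add: divide_right_mono)
      also have "\<dots> = a m / real m + B / real n" using npos by (simp add: field_simps)
      also have "B / real n < e / 2"
      proof -
        have "2 * B / e < real n" using n0 n by linarith
        then show ?thesis using e npos by (simp add: field_simps)
      qed
      finally have "a n / real n < l + e" using m(2) by linarith
      moreover have "l \<le> a n / real n" using low n by simp
      ultimately show "norm (a n / real n - l) < e" by simp
    qed
  qed
  then show ?thesis using low by blast
qed

text \<open>Superadditivity with defect \<open>c\<close> yields \<open>j (a m - c) \<le> a (j m) - c\<close>.\<close>

lemma superadditive_limit_ge:
  fixes a :: "nat \<Rightarrow> real"
  assumes super: "\<And>m n. a m + a n - c \<le> a (m + n)" and lim: "(\<lambda>n. a n / real n) \<longlonglongrightarrow> l"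
    and m: "m \<ge> 1"
  shows "(a m - c) / real m \<le> l"
proof -
  have 1: "real (Suc j) * (a m - c) \<le> a (Suc j * m) - c" for j
  proof (induction j)
    case (Suc j)
    have "a m + a (Suc j * m) - c \<le> a (Suc (Suc j) * m)" using super[of m "Suc j * m"] by simp
    then show ?case using Suc by (simp add: algebra_simps)
  qed simp
  have lim': "(\<lambda>j. a (Suc j * m) / real (Suc j * m)) \<longlonglongrightarrow> l"
    using m by (intro LIMSEQ_subseq_LIMSEQ[OF lim, unfolded comp_def]) (auto simp: strict_mono_Suc_iff)
  have lim'': "(\<lambda>j. c / real m * inverse (real (Suc j))) \<longlonglongrightarrow> c / real m * 0"
    by (intro tendsto_intros LIMSEQ_inverse_real_of_nat)
  have "(\<lambda>j. a (Suc j * m) / real (Suc j * m) - c / real m * inverse (real (Suc j))) \<longlonglongrightarrow> l - c / real m * 0"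
    by (rule tendsto_diff[OF lim' lim''])
  moreover have "(a m - c) / real m \<le> a (Suc j * m) / real (Suc j * m) - c / real m * inverse (real (Suc j))" for j
  proof -
    have "(a m - c) / real m = real (Suc j) * (a m - c) / real (Suc j * m)"
      using m by (simp only: of_nat_mult mult_divide_mult_cancel_left_if) simp
    also have "\<dots> \<le> (a (Suc j * m) - c) / real (Suc j * m)"
      using 1[of j] by (rule divide_right_mono) simp
    also have "\<dots> = a (Suc j * m) / real (Suc j * m) - c / real m * inverse (real (Suc j))"
      by (simp add: diff_divide_distrib field_simps)
    finally show ?thesis .
  qed
  ultimately show ?thesis using LIMSEQ_le_const by fastforce
qed

definition words :: "nat \<Rightarrow> nat \<Rightarrow> nat list set" where
  "words r n = {w. set w \<subseteq> {..<r} \<and> length w = n}"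

lemma finite_words [simp]: "finite (words r n)"
  unfolding words_def by (rule finite_lists_length_eq) simp

lemma words_0 [simp]: "words r 0 = {[]}" by (auto simp: words_def)

lemma sum_words_add: "sum f (words r (m + n)) = (\<Sum>w\<in>words r m. \<Sum>v\<in>words r n. f (w @ v))"
proof -
  have "sum f (words r (m + n)) = sum (\<lambda>(w, v). f (w @ v)) (words r m \<times> words r n)"
  proof (rule sum.reindex_bij_witness[where i="\<lambda>(w, v). w @ v" and j="\<lambda>w. (take m w, drop m w)"])
    fix w assume "w \<in> words r (m + n)"
    then show "(take m w, drop m w) \<in> words r m \<times> words r n"
      by (auto simp: words_def dest!: in_set_takeD in_set_dropD)
  qed (auto simp: words_def)
  then show ?thesis by (simp add: sum.cartesian_product)
qed

lemma sum_words_Suc: "sum f (words r (Suc n)) = (\<Sum>x<r. \<Sum>v\<in>words r n. f (x # v))"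
proof -
  have 1: "words r 1 = (\<lambda>x. [x]) ` {..<r}"
    by (auto simp: words_def length_Suc_conv image_iff)
  have "sum f (words r (1 + n)) = (\<Sum>w\<in>words r 1. \<Sum>v\<in>words r n. f (w @ v))" by (rule sum_words_add)
  then show ?thesis by (simp add: 1[unfolded One_nat_def] sum.reindex inj_on_def)
qed

text \<open>Products of subprobability kernels are subprobabilities on words, also when the kernel changes
  with the position.\<close>

lemma sum_words_prod_le_1:
  fixes k :: "nat \<Rightarrow> nat \<Rightarrow> real"
  assumes "\<And>b. (\<Sum>x<r. k x b) \<le> 1" and pos: "\<And>x b. 0 \<le> k x b"
  shows "(\<Sum>w\<in>words r n. \<Prod>i<n. k (w ! i) (b i)) \<le> 1"
proof (induction n arbitrary: b)
  case (Suc n)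
  have "(\<Sum>w\<in>words r (Suc n). \<Prod>i<Suc n. k (w ! i) (b i)) =
    (\<Sum>x<r. k x (b 0) * (\<Sum>v\<in>words r n. \<Prod>i<n. k (v ! i) (b (Suc i))))"
    by (simp add: sum_words_Suc prod.lessThan_Suc_shift sum_distrib_left del: prod.lessThan_Suc)
  also have "\<dots> \<le> (\<Sum>x<r. k x (b 0) * 1)"
    using Suc pos by (intro sum_mono mult_left_mono) auto
  also have "\<dots> \<le> 1" using assms(1) by simp
  finally show ?case .
qed simp

text \<open>A partition into \<open>r\<close> measurable cells is given by the label \<open>l\<close> of the cell of each point, so
  that the cells of its joins are indexed by words.\<close>

locale labelled_mpt = prob_space N for N :: "'a measure" +
  fixes T :: "'a \<Rightarrow> 'a" and l :: "'a \<Rightarrow> nat" and r :: nat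
  assumes T_meas [measurable]: "T \<in> N \<rightarrow>\<^sub>M N"
    and T_inv: "A \<in> sets N \<Longrightarrow> measure N {x \<in> space N. T x \<in> A} = measure N A"
    and l_meas [measurable]: "l \<in> N \<rightarrow>\<^sub>M count_space UNIV"
    and l_less: "x \<in> space N \<Longrightarrow> l x < r"
begin

definition cell :: "nat list \<Rightarrow> 'a set" where
  "cell w = {x \<in> space N. itin T l (length w) x = w}"

definition cell_entropy :: "nat \<Rightarrow> real" where
  "cell_entropy n = (\<Sum>w\<in>words r n. - (prob (cell w) * ln (prob (cell w))))"

lemma cell_sets [measurable]: "cell w \<in> sets N"
  unfolding cell_def by measurable

lemma Tn_meas [measurable]: "(T ^^ n) \<in> N \<rightarrow>\<^sub>M N"
  by (induction n) (auto simp: id_def)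

lemma Tn_space: "x \<in> space N \<Longrightarrow> (T ^^ n) x \<in> space N"
  using measurable_space[OF Tn_meas] by auto

lemma Tn_inv: "A \<in> sets N \<Longrightarrow> measure N {x \<in> space N. (T ^^ n) x \<in> A} = measure N A"
proof (induction n)
  case 0
  then show ?case using sets.sets_into_space by (auto intro!: arg_cong[where f="measure N"])
next
  case (Suc n)
  have "{x \<in> space N. (T ^^ Suc n) x \<in> A} = {x \<in> space N. T x \<in> {y \<in> space N. (T ^^ n) y \<in> A}}"
    using measurable_space[OF T_meas] by (auto simp: funpow_swap1)
  then show ?case using Suc T_inv[of "{y \<in> space N. (T ^^ n) y \<in> A}"] by simp
qed

lemma distr_Tn: "distr N N (T ^^ n) = N"
proof (rule measure_eqI)
  fix A assume "A \<in> sets (distr N N (T ^^ n))"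
  then have A: "A \<in> sets N" by simp
  have "(T ^^ n) -` A \<inter> space N = {x \<in> space N. (T ^^ n) x \<in> A}" by auto
  then show "emeasure (distr N N (T ^^ n)) A = emeasure N A"
    using Tn_inv[OF A, of n] A by (simp add: emeasure_distr emeasure_eq_measure)
qed simp

lemma integral_Tn:
  assumes [measurable]: "f \<in> borel_measurable N"
  shows "(LINT x|N. f ((T ^^ n) x)) = (LINT x|N. (f x :: real))"
  using integral_distr[of "T ^^ n" N N f] by (simp add: distr_Tn)

lemma integrable_Tn:
  assumes "integrable N f"
  shows "integrable N (\<lambda>x. (f ((T ^^ n) x) :: real))"
  using integrable_distr_eq[of "T ^^ n" N N f] assms by (simp add: distr_Tn)

lemma integral_birk:
  assumes f: "integrable N f"
  shows "integrable N (birk T f n)" "(LINT x|N. birk T f n x) = real n * (LINT x|N. f x)"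
  unfolding birk_def using integrable_Tn[OF f] integral_Tn[of f] f by auto

lemma itin_words: "x \<in> space N \<Longrightarrow> itin T l n x \<in> words r n"
  by (auto simp: words_def itin_def Tn_space l_less)

lemma sum_cells:
  assumes B: "B \<in> sets N"
  shows "(\<Sum>w\<in>words r n. prob {x \<in> B. itin T l n x = w}) = prob B"
proof -
  have Bs: "x \<in> B \<Longrightarrow> x \<in> space N" for x using sets.sets_into_space[OF B] by auto
  have "(\<Sum>w\<in>words r n. prob {x \<in> B. itin T l n x = w}) = prob (\<Union>w\<in>words r n. {x \<in> B. itin T l n x = w})"
  proof (rule finite_measure_finite_Union[symmetric])
    have "{x \<in> B. itin T l n x = w} = {x \<in> space N. x \<in> B \<and> itin T l n x = w}" for w using Bs by auto
    then have "{x \<in> B. itin T l n x = w} \<in> sets N" for w using B by simp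
    then show "(\<lambda>w. {x \<in> B. itin T l n x = w}) ` words r n \<subseteq> sets N" by auto
  qed (auto simp: disjoint_family_on_def)
  also have "(\<Union>w\<in>words r n. {x \<in> B. itin T l n x = w}) = B" using Bs itin_words by auto
  finally show ?thesis .
qed

lemma cell_append: "cell (w @ v) = {x \<in> cell w. (T ^^ length w) x \<in> cell v}"
  by (auto simp: cell_def itin_add Tn_space)

lemma sum_prob_cell: "(\<Sum>w\<in>words r n. prob (cell w)) = 1"
proof -
  have "cell w = {x \<in> space N. itin T l n x = w}" if "w \<in> words r n" for w
    using that by (auto simp: cell_def words_def)
  then show ?thesis using sum_cells[OF sets.top, of n] by (simp add: prob_space)
qed

lemma marginal_right: "(\<Sum>v\<in>words r n. prob (cell (w @ v))) = prob (cell w)"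
proof -
  have [measurable]: "{x \<in> space N. itin T l n ((T ^^ length w) x) = v} \<in> sets N" for v
    by measurable
  have "cell (w @ v) = {x \<in> cell w. itin T l n ((T ^^ length w) x) = v}" if "v \<in> words r n" for v
    using that by (auto simp: cell_append) (auto simp: cell_def words_def Tn_space)
  then have "(\<Sum>v\<in>words r n. prob (cell (w @ v))) =
    (\<Sum>v\<in>words r n. prob {x \<in> cell w. itin T l n ((T ^^ length w) x) = v})" by simp
  also have "\<dots> = prob (\<Union>v\<in>words r n. {x \<in> cell w. itin T l n ((T ^^ length w) x) = v})"
  proof (rule finite_measure_finite_Union[symmetric])
    have "{x \<in> cell w. itin T l n ((T ^^ length w) x) = v} = cell w \<inter> {x \<in> space N. itin T l n ((T ^^ length w) x) = v}" for v
      by (auto simp: cell_def)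
    then show "(\<lambda>v. {x \<in> cell w. itin T l n ((T ^^ length w) x) = v}) ` words r n \<subseteq> sets N" by auto
  qed (auto simp: disjoint_family_on_def)
  also have "(\<Union>v\<in>words r n. {x \<in> cell w. itin T l n ((T ^^ length w) x) = v}) = cell w"
    using itin_words Tn_space by (auto simp: cell_def)
  finally show ?thesis .
qed

lemma marginal_left: "(\<Sum>w\<in>words r m. prob (cell (w @ v))) = prob (cell v)"
proof -
  let ?B = "{x \<in> space N. (T ^^ m) x \<in> cell v}"
  have "cell (w @ v) = {x \<in> ?B. itin T l m x = w}" if "w \<in> words r m" for w
    using that by (auto simp: cell_append) (auto simp: cell_def words_def)
  then have "(\<Sum>w\<in>words r m. prob (cell (w @ v))) = prob ?B"
    using sum_cells[of ?B m] by simp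
  then show ?thesis by (simp add: Tn_inv)
qed

lemma prob_cell_append_le: "prob (cell (w @ v)) \<le> prob (cell w)" "prob (cell (w @ v)) \<le> prob (cell v)"
proof -
  show "prob (cell (w @ v)) \<le> prob (cell w)"
    by (rule finite_measure_mono) (auto simp: cell_append)
  have "prob (cell (w @ v)) \<le> prob {x \<in> space N. (T ^^ length w) x \<in> cell v}"
    unfolding cell_append by (rule finite_measure_mono) (auto simp: cell_def)
  then show "prob (cell (w @ v)) \<le> prob (cell v)" by (simp add: Tn_inv)
qed

lemma prob_cell_zero:
  "prob (cell w) = 0 \<Longrightarrow> prob (cell (w @ v)) = 0" "prob (cell v) = 0 \<Longrightarrow> prob (cell (w @ v)) = 0"
  using prob_cell_append_le[of w v] measure_nonneg[of N "cell (w @ v)"] by linarith+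

text \<open>The marginals of \<open>w @ v\<close> on both sides are the measures of \<open>w\<close> and \<open>v\<close>, by invariance.\<close>

lemma cross_entropy:
  "(\<Sum>w\<in>words r m. \<Sum>v\<in>words r n. - (prob (cell (w @ v)) * ln (prob (cell w) * prob (cell v))))
     = cell_entropy m + cell_entropy n"
proof -
  have "- (prob (cell (w @ v)) * ln (prob (cell w) * prob (cell v))) =
    - (ln (prob (cell w)) * prob (cell (w @ v))) + - (ln (prob (cell v)) * prob (cell (w @ v)))" for w v
  proof (cases "prob (cell w) = 0 \<or> prob (cell v) = 0")
    case True
    then show ?thesis using prob_cell_zero[where w=w and v=v] by auto
  next
    case False
    then show ?thesis by (simp add: ln_mult zero_less_measure_iff algebra_simps)
  qed
  then have "(\<Sum>w\<in>words r m. \<Sum>v\<in>words r n. - (prob (cell (w @ v)) * ln (prob (cell w) * prob (cell v))))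
    = (\<Sum>w\<in>words r m. \<Sum>v\<in>words r n. - (ln (prob (cell w)) * prob (cell (w @ v))))
    + (\<Sum>w\<in>words r m. \<Sum>v\<in>words r n. - (ln (prob (cell v)) * prob (cell (w @ v))))"
    by (simp add: sum_subtractf sum_negf)
  also have "(\<Sum>w\<in>words r m. \<Sum>v\<in>words r n. - (ln (prob (cell w)) * prob (cell (w @ v)))) = cell_entropy m"
    by (simp add: cell_entropy_def sum_negf marginal_right mult.commute flip: sum_distrib_left)
  also have "(\<Sum>w\<in>words r m. \<Sum>v\<in>words r n. - (ln (prob (cell v)) * prob (cell (w @ v)))) = cell_entropy n"
    by (subst sum.swap) (simp add: cell_entropy_def sum_negf marginal_left mult.commute flip: sum_distrib_left)
  finally show ?thesis .
qed

text \<open>Gibbs' inequality against the product of the two marginals.\<close>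

lemma cell_entropy_add_le: "cell_entropy (m + n) \<le> cell_entropy m + cell_entropy n"
proof -
  let ?S = "words r m \<times> words r n"
  let ?p = "\<lambda>(w, v). prob (cell (w @ v))" and ?r = "\<lambda>(w, v). prob (cell w) * prob (cell v)"
  have "(\<Sum>x\<in>?S. - (?p x * ln (?p x))) \<le> (\<Sum>x\<in>?S. - (?p x * ln (?r x)))"
  proof (rule gibbs_inequality)
    have "sum ?r ?S = (\<Sum>w\<in>words r m. prob (cell w)) * (\<Sum>v\<in>words r n. prob (cell v))"
      by (simp add: sum_product sum.cartesian_product)
    moreover have "sum ?p ?S = (\<Sum>w\<in>words r m. \<Sum>v\<in>words r n. prob (cell (w @ v)))"
      by (simp add: sum.cartesian_product)
    ultimately show "sum ?r ?S \<le> sum ?p ?S" by (simp add: sum_prob_cell marginal_right)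
  qed (auto dest: prob_cell_zero)
  moreover have "(\<Sum>x\<in>?S. - (?p x * ln (?p x))) = cell_entropy (m + n)"
    unfolding cell_entropy_def sum_words_add by (simp add: sum.cartesian_product split_def)
  moreover have "(\<Sum>x\<in>?S. - (?p x * ln (?r x))) = cell_entropy m + cell_entropy n"
    unfolding cross_entropy[symmetric] by (simp add: sum.cartesian_product split_def)
  ultimately show ?thesis by simp
qed

lemma cell_entropy_nonneg: "0 \<le> cell_entropy n"
  unfolding cell_entropy_def
proof (rule sum_nonneg)
  fix w
  have "ln (prob (cell w)) \<le> 0"
    by (cases "prob (cell w) = 0") (auto simp: zero_less_measure_iff)
  then show "0 \<le> - (prob (cell w) * ln (prob (cell w)))"
    by (simp add: mult_nonneg_nonpos)
qed

lemma cell_entropy_limit: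
  "\<exists>h. (\<lambda>n. cell_entropy n / real n) \<longlonglongrightarrow> h \<and> (\<forall>n\<ge>1. h \<le> cell_entropy n / real n)"
  by (rule fekete[OF cell_entropy_add_le cell_entropy_nonneg])

text \<open>Almost independence of successive blocks makes entropy superadditive up to a constant.\<close>

lemma cell_entropy_add_ge:
  assumes "1 \<le> C" and le: "\<And>w v. prob (cell (w @ v)) \<le> C * (prob (cell w) * prob (cell v))"
  shows "cell_entropy m + cell_entropy n - ln C \<le> cell_entropy (m + n)"
proof -
  have "- (prob (cell (w @ v)) * ln (prob (cell w) * prob (cell v))) - ln C * prob (cell (w @ v))
    \<le> - (prob (cell (w @ v)) * ln (prob (cell (w @ v))))" for w v
  proof (cases "prob (cell (w @ v)) = 0")
    case False
    then have pos: "0 < prob (cell (w @ v))" by (simp add: zero_less_measure_iff)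
    then have pos': "0 < prob (cell w)" "0 < prob (cell v)"
      using prob_cell_append_le[of w v] by linarith+
    have "ln (prob (cell (w @ v))) \<le> ln (C * (prob (cell w) * prob (cell v)))"
      using le[of w v] pos by simp
    also have "\<dots> = ln C + ln (prob (cell w) * prob (cell v))"
      using pos' assms(1) by (subst ln_mult) auto
    finally have "prob (cell (w @ v)) * ln (prob (cell (w @ v))) \<le>
        prob (cell (w @ v)) * (ln C + ln (prob (cell w) * prob (cell v)))"
      by (rule mult_left_mono) simp
    then show ?thesis by (simp add: algebra_simps)
  qed simp
  then have "(\<Sum>w\<in>words r m. \<Sum>v\<in>words r n. - (prob (cell (w @ v)) * ln (prob (cell w) * prob (cell v))) - ln C * prob (cell (w @ v)))
    \<le> cell_entropy (m + n)"
    unfolding cell_entropy_def sum_words_add by (intro sum_mono)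
  moreover have "(\<Sum>w\<in>words r m. \<Sum>v\<in>words r n. ln C * prob (cell (w @ v))) = ln C"
    by (simp add: marginal_right sum_prob_cell flip: sum_distrib_left)
  ultimately show ?thesis using cross_entropy[of n m] by (simp add: sum_subtractf)
qed

lemma cell_entropy_integral:
  "integrable N (\<lambda>x. - ln (prob (cell (itin T l n x))))"
  "cell_entropy n = (LINT x|N. - ln (prob (cell (itin T l n x))))"
proof -
  let ?g = "\<lambda>w. - ln (prob (cell w))"
  have e: "?g (itin T l n x) = (\<Sum>w\<in>words r n. ?g w * indicator (cell w) x)" if x: "x \<in> space N" for x
  proof -
    have "(\<Sum>w\<in>words r n. ?g w * indicator (cell w) x) = (\<Sum>w\<in>words r n. if w = itin T l n x then ?g w else 0)"
      using x by (intro sum.cong) (auto simp: indicator_def cell_def words_def)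
    then show ?thesis using itin_words[OF x] by simp
  qed
  have i: "integrable N (\<lambda>x. \<Sum>w\<in>words r n. ?g w * indicator (cell w) x)"
    by (intro Bochner_Integration.integrable_sum integrable_mult_right integrable_real_indicator)
      (auto simp: less_top[symmetric])
  then show "integrable N (\<lambda>x. ?g (itin T l n x))"
    by (rule Bochner_Integration.integrable_cong[THEN iffD2, rotated 2, OF _ refl]) (rule e)
  have "(LINT x|N. ?g (itin T l n x)) = (LINT x|N. (\<Sum>w\<in>words r n. ?g w * indicator (cell w) x))"
    by (intro Bochner_Integration.integral_cong refl e)
  also have "\<dots> = (\<Sum>w\<in>words r n. (LINT x|N. ?g w * indicator (cell w) x))"
    by (intro Bochner_Integration.integral_sum integrable_mult_right integrable_real_indicator)
      (auto simp: less_top[symmetric])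
  also have "\<dots> = cell_entropy n"
    by (simp add: cell_entropy_def mult.commute)
  finally show "cell_entropy n = (LINT x|N. ?g (itin T l n x))" ..
qed

end

section \<open>Uniqueness of the measure with entropy at least its Lyapunov exponent\<close>

lemma ln_weight:
  fixes a z p x :: real
  assumes "0 < a" "0 < z" "0 < p"
  shows "ln (a * (exp x / z * p)) = ln a + (x - ln z) + ln p"
  using assms by (simp add: ln_mult ln_div)

context gibbs_coding
begin

lemma code_fun_measurable:
  assumes N: "sets N = sets M"
  shows "(\<lambda>x. f (code n x) :: real) \<in> borel_measurable N"
proof -
  have "(\<lambda>x. f (code n x)) \<in> borel_measurable M" by (rule measurable_code_fun) simp
  then show ?thesis by (simp cong: measurable_cong_sets add: N)
qed

text \<open>Gibbs' inequality for a joint distribution of words of labels and of digits. On digit words \<open>c\<close>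
  of length \<open>K\<close> the reference weight is \<open>q c * exp (\<rho> c) / Z\<close>; given \<open>c\<close>, a label word \<open>a\<close> gets
  the weight \<open>\<Prod>i<n. k (a ! i) (\<gamma> (\<dots>))\<close>, where \<open>\<gamma>\<close> guesses a label from \<open>m\<close> digits and \<open>k\<close> is a
  kernel. The total is at most \<open>1\<close>. The entropy of the labels is at most the joint entropy of
  labels and digits, and so at most the mean of minus the logarithm of the reference weight. As
  there are infinitely many digit words, joint entropies are avoided: \<open>W x / \<Phi> x\<close> is the reference
  weight divided by the measure of the label word alone, and its integral is still at most \<open>1\<close>.\<close>

lemma entropy_test:
  fixes k :: "nat \<Rightarrow> nat \<Rightarrow> real" and \<rho> :: "nat list \<Rightarrow> real"
  assumes lm: "labelled_mpt N T l r" and sN [measurable_cong]: "sets N = sets M"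
    and K: "n + m \<le> K"
    and k0: "\<And>a b. 0 < k a b" and k1: "\<And>b. (\<Sum>a<r. k a b) \<le> 1"
    and Z: "0 < Z" "(\<integral>\<^sup>+x. ennreal (exp (\<rho> (code K x))) \<partial>M) \<le> ennreal Z"
    and iq: "integrable N (\<lambda>x. ln (q (code K x)))" and i\<rho>: "integrable N (\<lambda>x. \<rho> (code K x))"
    and ik: "integrable N (\<lambda>x. \<Sum>i<n. ln (k (l ((T ^^ i) x)) (\<gamma> (code m ((T ^^ i) x)))))"
  shows "labelled_mpt.cell_entropy N T l r n \<le>
    (LINT x|N. - ln (q (code K x)) - \<rho> (code K x) + ln Z
       - (\<Sum>i<n. ln (k (l ((T ^^ i) x)) (\<gamma> (code m ((T ^^ i) x))))))"
proof -
  interpret N: labelled_mpt N T l r by (rule lm)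
  let ?p = "\<lambda>a. measure N (N.cell a)"
  define s where "s a c = exp (\<rho> c) / Z * (\<Prod>i<n. k (a ! i) (\<gamma> (take m (drop i c))))" for a c
  have s0: "0 < s a c" for a c unfolding s_def using Z(1) k0 by (intro mult_pos_pos divide_pos_pos prod_pos) auto
  define h where "h a c = q c * s a c" for a c
  have h0: "0 < h a c" for a c using s0 by (simp add: h_def)
  define W where "W x = h (itin T l n x) (code K x)" for x
  define \<Phi> where "\<Phi> x = ?p (itin T l n x)" for x
  have W0: "0 < W x" for x using h0 by (simp add: W_def)
  have \<Phi>0: "0 \<le> \<Phi> x" for x by (simp add: \<Phi>_def)
  have expand: "W x / \<Phi> x = (\<Sum>a\<in>words r n. h a (code K x) / ?p a * indicator (N.cell a) x)"
    if x: "x \<in> space N" for x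
  proof -
    have "(\<Sum>a\<in>words r n. h a (code K x) / ?p a * indicator (N.cell a) x) =
      (\<Sum>a\<in>words r n. if a = itin T l n x then h a (code K x) / ?p a else 0)"
      using x by (intro sum.cong) (auto simp: indicator_def N.cell_def words_def)
    then show ?thesis using N.itin_words[OF x] by (simp add: W_def \<Phi>_def)
  qed
  have mh [measurable]: "(\<lambda>x. h a (code K x)) \<in> borel_measurable N" for a
    by (rule code_fun_measurable[OF sN])
  have mS: "(\<lambda>x. \<Sum>a\<in>words r n. h a (code K x) / ?p a * indicator (N.cell a) x) \<in> borel_measurable N"
    by measurable
  have mW: "(\<lambda>x. W x / \<Phi> x) \<in> borel_measurable N"
    by (rule measurable_cong[THEN iffD2, OF expand mS])
  have one: "(\<integral>\<^sup>+x. ennreal (h a (code K x) / ?p a * indicator (N.cell a) x) \<partial>N)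
    \<le> (\<integral>\<^sup>+x. ennreal (s a (code K x)) \<partial>M)" for a
  proof -
    let ?C = "count_space {c :: nat list. length c = K}"
    let ?f = "\<lambda>c. ennreal (h a c / ?p a)"
    have "(\<integral>\<^sup>+x. ennreal (h a (code K x) / ?p a * indicator (N.cell a) x) \<partial>N) =
      (\<integral>\<^sup>+x. ?f (code K x) * indicator (N.cell a) x \<partial>N)"
      by (intro nn_integral_cong) (auto simp: indicator_def)
    also have "\<dots> = (\<integral>\<^sup>+c. ?f c * (\<integral>\<^sup>+x. indicator (N.cell a) x * indicator (cyl c) x \<partial>N) \<partial>?C)"
      by (rule nn_code_expand[OF sN]) simp
    also have "\<dots> \<le> (\<integral>\<^sup>+c. ennreal (s a c) * (\<integral>\<^sup>+x. 1 * indicator (cyl c) x \<partial>M) \<partial>?C)"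
    proof (rule nn_integral_mono)
      fix c
      have "(\<integral>\<^sup>+x. indicator (N.cell a) x * indicator (cyl c) x \<partial>N) \<le> (\<integral>\<^sup>+x. indicator (N.cell a) x \<partial>N)"
        by (intro nn_integral_mono) (auto simp: indicator_def)
      also have "\<dots> = ennreal (?p a)" by (simp add: N.emeasure_eq_measure)
      finally have "?f c * (\<integral>\<^sup>+x. indicator (N.cell a) x * indicator (cyl c) x \<partial>N) \<le> ?f c * ennreal (?p a)"
        by (rule mult_left_mono) simp
      also have "\<dots> = ennreal (h a c / ?p a * ?p a)" by (intro ennreal_mult''[symmetric]) simp
      also have "\<dots> \<le> ennreal (h a c)" using h0[of a c] by (intro ennreal_leI) auto
      also have "\<dots> = ennreal (s a c) * ennreal (q c)"
        by (simp add: h_def mult.commute flip: ennreal_mult'')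
      also have "ennreal (q c) = (\<integral>\<^sup>+x. 1 * indicator (cyl c) x \<partial>M)"
        by (simp add: emeasure_eq_measure)
      finally show "?f c * (\<integral>\<^sup>+x. indicator (N.cell a) x * indicator (cyl c) x \<partial>N)
        \<le> ennreal (s a c) * (\<integral>\<^sup>+x. 1 * indicator (cyl c) x \<partial>M)" .
    qed
    also have "\<dots> = (\<integral>\<^sup>+x. ennreal (s a (code K x)) * 1 \<partial>M)"
      by (rule nn_code_expand[OF refl, symmetric]) simp
    finally show ?thesis by simp
  qed
  have ms [measurable]: "(\<lambda>x. s a (code K x)) \<in> borel_measurable M" for a
    by (rule code_fun_measurable[OF refl])
  have m\<rho> [measurable]: "(\<lambda>x. \<rho> (code K x)) \<in> borel_measurable M"
    by (rule code_fun_measurable[OF refl])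
  have nn: "(\<integral>\<^sup>+x. ennreal (W x / \<Phi> x) \<partial>N) \<le> 1"
  proof -
    have "(\<integral>\<^sup>+x. ennreal (W x / \<Phi> x) \<partial>N) =
      (\<integral>\<^sup>+x. (\<Sum>a\<in>words r n. ennreal (h a (code K x) / ?p a * indicator (N.cell a) x)) \<partial>N)"
      using h0 by (intro nn_integral_cong, subst sum_ennreal) (auto simp: expand less_imp_le)
    also have "\<dots> = (\<Sum>a\<in>words r n. (\<integral>\<^sup>+x. ennreal (h a (code K x) / ?p a * indicator (N.cell a) x) \<partial>N))"
      by (rule nn_integral_sum) measurable
    also have "\<dots> \<le> (\<Sum>a\<in>words r n. (\<integral>\<^sup>+x. ennreal (s a (code K x)) \<partial>M))"
      by (rule sum_mono) (rule one)
    also have "\<dots> = (\<integral>\<^sup>+x. (\<Sum>a\<in>words r n. ennreal (s a (code K x))) \<partial>M)"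
      by (rule nn_integral_sum[symmetric]) measurable
    also have "\<dots> \<le> (\<integral>\<^sup>+x. ennreal (1 / Z) * ennreal (exp (\<rho> (code K x))) \<partial>M)"
    proof (rule nn_integral_mono)
      fix x
      have "(\<Sum>a\<in>words r n. s a (code K x)) =
        exp (\<rho> (code K x)) / Z * (\<Sum>a\<in>words r n. \<Prod>i<n. k (a ! i) (\<gamma> (take m (drop i (code K x)))))"
        by (simp add: s_def sum_distrib_left)
      also have "\<dots> \<le> exp (\<rho> (code K x)) / Z * 1"
        using Z(1) k0 by (intro mult_left_mono sum_words_prod_le_1[OF k1]) (auto simp: less_imp_le)
      finally have "ennreal (\<Sum>a\<in>words r n. s a (code K x)) \<le> ennreal (1 / Z * exp (\<rho> (code K x)))"
        by (intro ennreal_leI) simp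
      also have "\<dots> = ennreal (1 / Z) * ennreal (exp (\<rho> (code K x)))" by (rule ennreal_mult'') simp
      finally show "(\<Sum>a\<in>words r n. ennreal (s a (code K x))) \<le> ennreal (1 / Z) * ennreal (exp (\<rho> (code K x)))"
        using s0 by (subst sum_ennreal) (auto simp: less_imp_le)
    qed
    also have "\<dots> = ennreal (1 / Z) * (\<integral>\<^sup>+x. ennreal (exp (\<rho> (code K x))) \<partial>M)"
      by (rule nn_integral_cmult) measurable
    also have "\<dots> \<le> ennreal (1 / Z) * ennreal Z" by (rule mult_left_mono[OF Z(2)]) simp
    also have "\<dots> = 1" using Z(1) by (simp flip: ennreal_mult'')
    finally show ?thesis .
  qed
  have iW: "integrable N (\<lambda>x. W x / \<Phi> x)"
    by (rule integrableI_nonneg[OF mW]) (use nn W0 \<Phi>0 in \<open>auto intro!: AE_I2 divide_nonneg_nonneg simp: less_imp_le order.strict_trans1\<close>)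
  have "ennreal (LINT x|N. W x / \<Phi> x) = (\<integral>\<^sup>+x. ennreal (W x / \<Phi> x) \<partial>N)"
    using W0 \<Phi>0 by (intro nn_integral_eq_integral[symmetric] iW AE_I2) (auto simp: less_imp_le)
  then have "ennreal (LINT x|N. W x / \<Phi> x) \<le> 1" using nn by simp
  then have le1: "(LINT x|N. W x / \<Phi> x) \<le> 1" by (simp add: ennreal_le_1)
  have AE\<Phi>: "AE x in N. 0 < \<Phi> x"
  proof -
    have "AE x in N. \<forall>a\<in>words r n. x \<in> N.cell a \<longrightarrow> ?p a \<noteq> 0"
    proof (rule AE_finite_allI)
      fix a assume "a \<in> words r n"
      show "AE x in N. x \<in> N.cell a \<longrightarrow> ?p a \<noteq> 0"
      proof (cases "?p a = 0")
        case True
        then have "N.cell a \<in> null_sets N" by (simp add: N.emeasure_eq_measure null_sets_def)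
        then show ?thesis using AE_not_in by fastforce
      qed simp
    qed simp
    then show ?thesis
    proof (rule AE_mp, intro AE_I2 impI)
      fix x assume x: "x \<in> space N" and a: "\<forall>a\<in>words r n. x \<in> N.cell a \<longrightarrow> ?p a \<noteq> 0"
      have "x \<in> N.cell (itin T l n x)" using x by (simp add: N.cell_def)
      then show "0 < \<Phi> x" using a N.itin_words[OF x] by (auto simp: \<Phi>_def zero_less_measure_iff)
    qed
  qed
  define E where "E x = - ln (q (code K x)) - \<rho> (code K x) + ln Z
       - (\<Sum>i<n. ln (k (l ((T ^^ i) x)) (\<gamma> (code m ((T ^^ i) x)))))" for x
  have lnW: "ln (W x) = - E x" for x
  proof -
    have "W x = q (code K x) * (exp (\<rho> (code K x)) / Z * (\<Prod>i<n. k (l ((T ^^ i) x)) (\<gamma> (code m ((T ^^ i) x)))))"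
      unfolding W_def h_def s_def using K
      by (intro arg_cong2[where f="(*)"] refl prod.cong arg_cong2[where f=k] arg_cong[where f=\<gamma>])
        (auto simp: nth_itin take_drop_itin)
    moreover have "0 < (\<Prod>i<n. k (l ((T ^^ i) x)) (\<gamma> (code m ((T ^^ i) x))))" using k0 by (intro prod_pos) auto
    moreover have "ln (\<Prod>i<n. k (l ((T ^^ i) x)) (\<gamma> (code m ((T ^^ i) x)))) =
      (\<Sum>i<n. ln (k (l ((T ^^ i) x)) (\<gamma> (code m ((T ^^ i) x)))))"
      by (intro ln_prod) (auto simp: k0[THEN less_imp_neq, THEN not_sym] k0)
    ultimately show ?thesis using ln_weight[OF q_pos Z(1)] by (simp add: E_def)
  qed
  have iE: "integrable N E" unfolding E_def using iq i\<rho> ik by simp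
  note H = N.cell_entropy_integral[of n]
  \<comment> \<open>\<open>ln y \<le> y - 1\<close> for \<open>y = W x / \<Phi> x\<close>, where \<open>AE\<Phi>\<close> excludes the words of measure zero\<close>
  have "(LINT x|N. ln (W x) - ln (\<Phi> x)) \<le> (LINT x|N. W x / \<Phi> x - 1)"
  proof (rule integral_mono_AE)
    show "integrable N (\<lambda>x. ln (W x) - ln (\<Phi> x))"
      using Bochner_Integration.integrable_add[OF integrable_minus[OF iE] H(1)] by (simp add: lnW \<Phi>_def)
    show "integrable N (\<lambda>x. W x / \<Phi> x - 1)" using iW by simp
    show "AE x in N. ln (W x) - ln (\<Phi> x) \<le> W x / \<Phi> x - 1"
      using AE\<Phi>
    proof (rule AE_mp, intro AE_I2 impI)
      fix x assume "0 < \<Phi> x"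
      then show "ln (W x) - ln (\<Phi> x) \<le> W x / \<Phi> x - 1"
        using ln_le_minus_one[of "W x / \<Phi> x"] W0[of x] by (simp add: ln_div)
    qed
  qed
  also have "\<dots> \<le> 0" using iW le1 by (simp add: N.prob_space)
  finally have "(LINT x|N. - E x + - ln (\<Phi> x)) \<le> 0" by (simp add: lnW)
  then have "- (LINT x|N. E x) + (LINT x|N. - ln (\<Phi> x)) \<le> 0"
    using Bochner_Integration.integral_add[OF integrable_minus[OF iE] H(1)] by (simp add: \<Phi>_def)
  then have "N.cell_entropy n \<le> (LINT x|N. E x)" unfolding H(2) \<Phi>_def by simp
  then show ?thesis unfolding E_def .
qed

text \<open>The sets that are approximated by unions of cylinders of equal length form a \<open>\<sigma>\<close>-algebra.\<close>

lemma cyl_approx_set: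
  assumes N: "finite_measure N" and sN [measurable_cong]: "sets N = sets M" and A: "A \<in> sets M"
  shows "\<delta> > 0 \<Longrightarrow> \<exists>m W. measure N {x \<in> space M. (x \<in> A) \<noteq> (code m x \<in> W)} \<le> \<delta>"
proof -
  interpret N: finite_measure N by (rule N)
  have spN: "space N = space M" using sN by (rule sets_eq_imp_space_eq)
  have mc [measurable]: "Measurable.pred N (\<lambda>x. code m x \<in> W)" for m W
    by measurable
  have "A \<in> sigma_sets (space M) (range cyl)" using A cyl_generate by simp
  then show "\<delta> > 0 \<Longrightarrow> \<exists>m W. measure N {x \<in> space M. (x \<in> A) \<noteq> (code m x \<in> W)} \<le> \<delta>"
  proof (induction arbitrary: \<delta> rule: sigma_sets.induct)
    case (Basic A)
    then obtain w where w: "A = cyl w" by auto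
    have e: "{x \<in> space M. (x \<in> A) \<noteq> (code (length w) x \<in> {w})} = {}" by (auto simp: w cyl_iff)
    then have "measure N {x \<in> space M. (x \<in> A) \<noteq> (code (length w) x \<in> {w})} \<le> \<delta>"
      unfolding e using Basic by simp
    then show ?case by blast
  next
    case Empty
    have e: "{x \<in> space M. (x \<in> {}) \<noteq> (code 0 x \<in> {})} = {}" by auto
    then have "measure N {x \<in> space M. (x \<in> {}) \<noteq> (code 0 x \<in> {})} \<le> \<delta>"
      unfolding e using Empty by simp
    then show ?case by blast
  next
    case (Compl A)
    then obtain m W where "measure N {x \<in> space M. (x \<in> A) \<noteq> (code m x \<in> W)} \<le> \<delta>" by blast
    moreover have "{x \<in> space M. (x \<in> space M - A) \<noteq> (code m x \<in> - W)} = {x \<in> space M. (x \<in> A) \<noteq> (code m x \<in> W)}"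
      by auto
    ultimately have "measure N {x \<in> space M. (x \<in> space M - A) \<noteq> (code m x \<in> - W)} \<le> \<delta>" by simp
    then show ?case by blast
  next
    case (Union A)
    have A [measurable]: "A i \<in> sets N" for i
      using Union(1) cyl_generate sN by auto
    let ?U = "\<Union>i. A i"
    have "(\<lambda>k. measure N (\<Union>i<k. A i)) \<longlonglongrightarrow> measure N (\<Union>k. \<Union>i<k. A i)"
      by (rule N.finite_Lim_measure_incseq) (force simp: incseq_def)+
    also have "(\<Union>k. \<Union>i<k. A i) = ?U" by auto
    finally have "\<forall>\<^sub>F k in sequentially. measure N ?U - \<delta> / 2 < measure N (\<Union>i<k. A i)"
      using Union.prems by (intro order_tendstoD(1)) auto
    then obtain k where k: "measure N ?U - \<delta> / 2 < measure N (\<Union>i<k. A i)"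
      unfolding eventually_sequentially by auto
    have "\<exists>m W. measure N {x \<in> space M. (x \<in> A i) \<noteq> (code m x \<in> W)} \<le> \<delta> / (2 * real (Suc k))" for i
      using Union.IH[of "\<delta> / (2 * real (Suc k))" i] Union.prems by simp
    then obtain m where "\<forall>i. \<exists>W. measure N {x \<in> space M. (x \<in> A i) \<noteq> (code (m i) x \<in> W)} \<le> \<delta> / (2 * real (Suc k))"
      by (rule choice[OF allI, THEN exE])
    from choice[OF this] obtain W where
      mW: "\<And>i. measure N {x \<in> space M. (x \<in> A i) \<noteq> (code (m i) x \<in> W i)} \<le> \<delta> / (2 * real (Suc k))"
      by blast
    \<comment> \<open>one common length for the first \<open>k\<close> approximations; prefixes recover the individual ones\<close>
    define m' where "m' = (\<Sum>i<k. m i)"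
    define W' where "W' = {w. \<exists>i<k. take (m i) w \<in> W i}"
    have m': "m i \<le> m'" if "i < k" for i
      unfolding m'_def using that by (intro member_le_sum) auto
    have W': "code m' x \<in> W' \<longleftrightarrow> (\<exists>i<k. code (m i) x \<in> W i)" for x
      using m' by (auto simp: W'_def take_itin)
    let ?D = "\<lambda>i. {x \<in> space M. (x \<in> A i) \<noteq> (code (m i) x \<in> W i)}"
    have D [measurable]: "?D i \<in> sets N" for i unfolding spN[symmetric] by measurable
    have "measure N {x \<in> space M. (x \<in> ?U) \<noteq> (code m' x \<in> W')} \<le>
      measure N ((?U - (\<Union>i<k. A i)) \<union> (\<Union>i<k. ?D i))"
      by (rule N.finite_measure_mono) (auto simp: W')
    also have "\<dots> \<le> measure N (?U - (\<Union>i<k. A i)) + measure N (\<Union>i<k. ?D i)"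
      by (rule measure_Un_le) auto
    also have "measure N (?U - (\<Union>i<k. A i)) = measure N ?U - measure N (\<Union>i<k. A i)"
      by (rule N.finite_measure_Diff) auto
    also have "measure N (\<Union>i<k. ?D i) \<le> (\<Sum>i<k. measure N (?D i))"
      by (rule measure_UNION_le) auto
    also have "\<dots> \<le> (\<Sum>i<k. \<delta> / (2 * real (Suc k)))" by (rule sum_mono) (rule mW)
    also have "\<dots> = (\<delta> / 2) * (real k / real (Suc k))" by simp
    also have "\<dots> \<le> (\<delta> / 2) * 1" using Union.prems by (intro mult_left_mono) auto
    finally have "measure N {x \<in> space M. (x \<in> ?U) \<noteq> (code m' x \<in> W')} \<le> \<delta>"
      using k by simp
    then show ?case by blast
  qed
qed

lemma cyl_approx_label:
  assumes N: "finite_measure N" and sN [measurable_cong]: "sets N = sets M"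
    and l [measurable]: "l \<in> M \<rightarrow>\<^sub>M count_space UNIV" and less: "\<And>x. x \<in> space M \<Longrightarrow> l x < (r :: nat)"
    and \<delta>: "\<delta> > 0"
  shows "\<exists>m \<gamma>. measure N {x \<in> space M. l x \<noteq> \<gamma> (code m x)} \<le> \<delta>"
proof -
  interpret N: finite_measure N by (rule N)
  let ?A = "\<lambda>a. {x \<in> space M. l x = a}"
  have "\<exists>m W. measure N {x \<in> space M. (x \<in> ?A a) \<noteq> (code m x \<in> W)} \<le> \<delta> / real (Suc r)" for a
    by (rule cyl_approx_set[OF N sN]) (use \<delta> in auto)
  then obtain m where "\<forall>a. \<exists>W. measure N {x \<in> space M. (x \<in> ?A a) \<noteq> (code (m a) x \<in> W)} \<le> \<delta> / real (Suc r)"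
    by (rule choice[OF allI, THEN exE])
  from choice[OF this] obtain W where
    mW: "\<And>a. measure N {x \<in> space M. (x \<in> ?A a) \<noteq> (code (m a) x \<in> W a)} \<le> \<delta> / real (Suc r)"
    by blast
  define m' where "m' = (\<Sum>i<r. m i)"
  have m': "m i \<le> m'" if "i < r" for i
    unfolding m'_def using that by (intro member_le_sum) auto
  define \<gamma> where "\<gamma> w = (LEAST a. a < r \<and> take (m a) w \<in> W a)" for w
  let ?D = "\<lambda>a. {x \<in> space M. (x \<in> ?A a) \<noteq> (code (m a) x \<in> W a)}"
  have D [measurable]: "?D a \<in> sets N" for a
  proof -
    have "?D a = {x \<in> space M. (l x = a) \<noteq> (code (m a) x \<in> W a)}" by auto
    then show ?thesis unfolding sN by simp
  qed
  have "measure N {x \<in> space M. l x \<noteq> \<gamma> (code m' x)} \<le> measure N (\<Union>a<r. ?D a)"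
  proof (rule N.finite_measure_mono)
    show "{x \<in> space M. l x \<noteq> \<gamma> (code m' x)} \<subseteq> (\<Union>a<r. ?D a)"
    proof
      fix x assume x: "x \<in> {x \<in> space M. l x \<noteq> \<gamma> (code m' x)}"
      show "x \<in> (\<Union>a<r. ?D a)"
      proof (rule ccontr)
        assume "x \<notin> (\<Union>a<r. ?D a)"
        then have "a < r \<Longrightarrow> code (m a) x \<in> W a \<longleftrightarrow> l x = a" for a using x by auto
        then have "a < r \<and> take (m a) (code m' x) \<in> W a \<longleftrightarrow> a = l x" for a
          using m' less x by (auto simp: take_itin)
        then have "\<gamma> (code m' x) = l x" unfolding \<gamma>_def by (simp add: Least_equality)
        then show False using x by simp
      qed
    qed
  qed auto
  also have "\<dots> \<le> (\<Sum>a<r. measure N (?D a))" by (rule measure_UNION_le) auto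
  also have "\<dots> \<le> (\<Sum>a<r. \<delta> / real (Suc r))" by (rule sum_mono) (rule mW)
  also have "\<dots> = \<delta> * (real r / real (Suc r))" by simp
  also have "\<dots> \<le> \<delta> * 1" using \<delta> by (intro mult_left_mono) auto
  finally show ?thesis by auto
qed

text \<open>For an invariant measure \<open>N\<close> this says that its Kolmogorov-Sinai entropy is at least \<open>c\<close>; by
  subadditivity the bound for all \<open>n\<close> follows from that for the limit.\<close>

definition entropy_ge :: "'a measure \<Rightarrow> real \<Rightarrow> bool" where
  "entropy_ge N c \<longleftrightarrow> (\<forall>\<epsilon>>0. \<exists>l r. labelled_mpt N T l r \<and>
     (\<forall>n\<ge>1. real n * (c - \<epsilon>) \<le> labelled_mpt.cell_entropy N T l r n))"

end

lemma le_zero_of_multiples_bounded: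
  fixes x c :: real
  assumes "\<And>n. n \<ge> 1 \<Longrightarrow> real n * x \<le> c"
  shows "x \<le> 0"
proof (rule ccontr)
  assume "\<not> x \<le> 0"
  then have "x > 0" by simp
  then obtain n where n: "c < real n * x" using reals_Archimedean3 by blast
  have "real n * x \<le> real (Suc n) * x" using \<open>x > 0\<close> by (intro mult_right_mono) auto
  then show False using assms[of "Suc n"] n by simp
qed

context gibbs_lyapunov
begin

text \<open>Let \<open>\<Lambda> = \<integral> L dN\<close>. The reference weight has density \<open>exp (t (S\<^sub>n f - n a))\<close> with respect to \<open>M\<close>
  and mass at most \<open>B exp (n t \<delta> / 2)\<close>, so Gibbs' inequality gives, up to bounded terms, \<open>n \<Lambda> \<le> n
  \<Lambda> - n t (\<integral> f dN - a) + n t \<delta> / 2\<close>, and dividing by \<open>n\<close> leaves \<open>\<integral> f dN - a \<le> \<delta>\<close>. Labels that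
  almost attain the entropy are not functions of the digits; they are approximated by such
  functions \<open>\<gamma>\<close>, and the kernel \<open>k\<close> charges little for a correct guess and a bounded amount for a
  wrong one, which is rare.\<close>

lemma entropy_ge_imp_integral_le:
  assumes sN [measurable_cong]: "sets N = sets M" and iL: "integrable N L"
    and h: "entropy_ge N (LINT x|N. L x)"
    and f: "\<And>x. f x = u (code m0 x)" and ubd: "\<And>w. \<bar>u w\<bar> \<le> (1::real)"
    and \<delta>: "\<delta> > 0"
  shows "(LINT x|N. f x) \<le> (LINT x|acim. f x) + \<delta>"
proof -
  have spN: "space N = space M" using sN by (rule sets_eq_imp_space_eq)
  have fM [measurable]: "f \<in> borel_measurable M" unfolding f by (rule code_fun_measurable[OF refl])
  have fa: "exp_cyl_approx 1 f"
    unfolding exp_cyl_approx_def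
  proof (intro conjI allI impI fM)
    have "(\<integral>\<^sup>+x. ennreal (exp (1 * \<bar>f x\<bar>)) \<partial>M) \<le> (\<integral>\<^sup>+x. ennreal (exp 1) \<partial>M)"
      using ubd by (intro nn_integral_mono ennreal_leI) (auto simp: f)
    also have "\<dots> < \<infinity>" by (simp add: emeasure_space_1)
    finally show "(\<integral>\<^sup>+x. ennreal (exp (1 * \<bar>f x\<bar>)) \<partial>M) < \<infinity>" .
    fix \<epsilon> :: real assume "\<epsilon> > 0"
    then show "\<exists>m v. \<forall>x\<in>space M. \<bar>f x - v (code m x)\<bar> \<le> \<epsilon>"
      by (intro exI[of _ m0] exI[of _ u]) (auto simp: f)
  qed
  define a where "a = (LINT x|acim. f x)"
  obtain t B where t: "0 < t" and B: "0 < B" and mgf: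
    "\<And>n. (\<integral>\<^sup>+x. ennreal (exp (t * (birk T f n x - real n * a))) \<partial>M) \<le> ennreal (B * exp (real n * (t * (\<delta> / 2))))"
    using mgf[OF _ fa, of "\<delta> / 2"] \<delta> unfolding a_def by auto
  define \<epsilon> where "\<epsilon> = t * \<delta> / 4"
  have \<epsilon>: "0 < \<epsilon>" using t \<delta> by (simp add: \<epsilon>_def)
  define \<Lambda> where "\<Lambda> = (LINT x|N. L x)"
  obtain l r where lm: "labelled_mpt N T l r" and
    ent: "\<And>n. n \<ge> 1 \<Longrightarrow> real n * (\<Lambda> - \<epsilon>) \<le> labelled_mpt.cell_entropy N T l r n"
    using h \<epsilon> unfolding entropy_ge_def \<Lambda>_def by blast
  interpret N: labelled_mpt N T l r by (rule lm)
  have lM [measurable]: "l \<in> M \<rightarrow>\<^sub>M count_space UNIV"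
    using N.l_meas by (simp cong: measurable_cong_sets add: sN)
  \<comment> \<open>a correct guess costs \<open>- ln (1 - \<eta>) = \<epsilon> / 2\<close>, a wrong one at most \<open>\<epsilon> / 2 + c\<close>, and \<open>c * \<delta>' \<le> \<epsilon> / 2\<close>\<close>
  define \<eta> where "\<eta> = 1 - exp (- (\<epsilon> / 2))"
  have \<eta>: "0 < \<eta>" "\<eta> < 1" using \<epsilon> by (auto simp: \<eta>_def)
  define c where "c = \<bar>ln ((real r + 1) / \<eta>)\<bar>"
  define \<delta>' where "\<delta>' = \<epsilon> / (2 * (c + 1))"
  have c0: "0 \<le> c" by (simp add: c_def)
  have \<delta>': "0 < \<delta>'" using \<epsilon> c0 by (simp add: \<delta>'_def)
  have c\<delta>': "c * \<delta>' \<le> \<epsilon> / 2"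
  proof -
    have "c / (c + 1) \<le> 1" using c0 by simp
    then have "\<epsilon> / 2 * (c / (c + 1)) \<le> \<epsilon> / 2 * 1" using \<epsilon> by (intro mult_left_mono) auto
    then show ?thesis by (simp add: \<delta>'_def mult_ac)
  qed
  obtain m \<gamma> where bad: "measure N {x \<in> space M. l x \<noteq> \<gamma> (code m x)} \<le> \<delta>'"
    using cyl_approx_label[OF N.finite_measure_axioms sN lM _ \<delta>', of r] N.l_less spN by auto
  define k where "k x b = (if x = b then 1 - \<eta> else \<eta> / (real r + 1))" for x b :: nat
  have k0: "0 < k x b" for x b using \<eta> by (simp add: k_def)
  have k1: "(\<Sum>x<r. k x b) \<le> 1" for b
  proof -
    have "(\<Sum>x<r. k x b) \<le> (\<Sum>x<r. (if x = b then 1 - \<eta> else 0) + \<eta> / (real r + 1))"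
      using \<eta> by (intro sum_mono) (auto simp: k_def)
    also have "\<dots> = (if b < r then 1 - \<eta> else 0) + \<eta> * (real r / (real r + 1))"
      by (simp add: sum.distrib)
    also have "\<dots> \<le> (1 - \<eta>) + \<eta> * 1"
      using \<eta> by (intro add_mono mult_left_mono) auto
    finally show ?thesis by simp
  qed
  define F where "F x = ln (k (l x) (\<gamma> (code m x)))" for x
  have F_ge: "- F x \<le> \<epsilon> / 2 + c * indicator {x \<in> space M. l x \<noteq> \<gamma> (code m x)} x"
    and F_abs: "\<bar>F x\<bar> \<le> \<epsilon> / 2 + c" if "x \<in> space M" for x
  proof -
    have 1: "ln (1 - \<eta>) = - (\<epsilon> / 2)" by (simp add: \<eta>_def)
    have 2: "ln (\<eta> / (real r + 1)) = - ln ((real r + 1) / \<eta>)"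
      using \<eta> by (simp add: ln_div)
    show "- F x \<le> \<epsilon> / 2 + c * indicator {x \<in> space M. l x \<noteq> \<gamma> (code m x)} x"
      using that \<epsilon> c0 by (auto simp: F_def k_def 1 2 c_def)
    show "\<bar>F x\<bar> \<le> \<epsilon> / 2 + c" using \<epsilon> c0 by (auto simp: F_def k_def 1 2 c_def)
  qed
  have bad_sets [measurable]: "{x \<in> space M. l x \<noteq> \<gamma> (code m x)} \<in> sets M"
  proof (rule predE)
    show "Measurable.pred M (\<lambda>x. l x \<noteq> \<gamma> (code m x))"
      by (rule measurable_compose_countable[where f="\<lambda>w x. l x \<noteq> \<gamma> w" and g="code m"]) measurable
  qed
  have FM [measurable]: "F \<in> borel_measurable M"
  proof -
    have "(\<lambda>x. (\<lambda>b. ln (k b (\<gamma> (code m x)))) (l x)) \<in> borel_measurable M"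
      by (rule measurable_compose_countable[OF _ lM]) (rule code_fun_measurable[OF refl])
    then show ?thesis by (simp add: F_def[abs_def])
  qed
  have iF: "integrable N F"
    using F_abs by (intro N.integrable_const_bound[of _ "\<epsilon> / 2 + c"]) (auto simp: spN)
  have mF: "(LINT x|N. - F x) \<le> \<epsilon>"
  proof -
    have "(LINT x|N. - F x) \<le> (LINT x|N. \<epsilon> / 2 + c * indicator {x \<in> space M. l x \<noteq> \<gamma> (code m x)} x)"
      using F_ge iF by (intro integral_mono) (auto simp: spN less_top[symmetric])
    also have "\<dots> = \<epsilon> / 2 + c * measure N {x \<in> space M. l x \<noteq> \<gamma> (code m x)}"
      using N.prob_space spN by (simp add: less_top[symmetric])
    also have "\<dots> \<le> \<epsilon> / 2 + c * \<delta>'" using bad c0 by (intro add_left_mono mult_left_mono)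
    finally show ?thesis using c\<delta>' by simp
  qed
  have if': "integrable N f"
    by (rule N.integrable_const_bound[of _ 1]) (use ubd f in auto)
  define b where "b = (LINT x|N. f x)"
  \<comment> \<open>\<open>K0\<close> additional digits determine \<open>f\<close> and the guesses along the whole label word\<close>
  define K0 where "K0 = m0 + m"
  have main: "real n * (t * (b - a) - t * \<delta> / 2 - 2 * \<epsilon>) \<le> real K0 * \<Lambda> + C\<^sub>1 + ln B" if n: "n \<ge> 1" for n
  proof -
    define K where "K = n + K0"
    have K: "n + m \<le> K" "n + m0 \<le> K" by (auto simp: K_def K0_def)
    define \<rho> where "\<rho> w = t * ((\<Sum>i<n. u (take m0 (drop i w))) - real n * a)" for w
    have \<rho>: "\<rho> (code K x) = t * (birk T f n x - real n * a)" for x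
      unfolding \<rho>_def birk_def f using K(2) by (simp add: take_drop_itin)
    define Z where "Z = B * exp (real n * (t * (\<delta> / 2)))"
    have Z: "0 < Z" "(\<integral>\<^sup>+x. ennreal (exp (\<rho> (code K x))) \<partial>M) \<le> ennreal Z"
      using B mgf unfolding \<rho> Z_def by auto
    note ib = N.integral_birk[OF if', of n] and iLK = N.integral_birk[OF iL, of K]
    have i\<rho>: "integrable N (\<lambda>x. \<rho> (code K x))" unfolding \<rho> using ib(1) by simp
    have iq: "integrable N (\<lambda>x. ln (q (code K x)))"
    proof (rule Bochner_Integration.integrable_bound)
      show "integrable N (\<lambda>x. \<bar>birk T L K x\<bar> + C\<^sub>1)" using iLK(1) by simp
      show "AE x in N. norm (ln (q (code K x))) \<le> norm (\<bar>birk T L K x\<bar> + C\<^sub>1)"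
      proof (rule AE_I2)
        fix x assume "x \<in> space N"
        then show "norm (ln (q (code K x))) \<le> norm (\<bar>birk T L K x\<bar> + C\<^sub>1)"
          using L_gibbs[of x K] spN by (simp add: abs_le_iff) linarith
      qed
    qed (rule code_fun_measurable[OF sN])
    have F_birk: "birk T F n x = (\<Sum>i<n. ln (k (l ((T ^^ i) x)) (\<gamma> (code m ((T ^^ i) x)))))" for x
      by (simp add: birk_def F_def)
    note iFn = N.integral_birk[OF iF, of n]
    have ik: "integrable N (\<lambda>x. \<Sum>i<n. ln (k (l ((T ^^ i) x)) (\<gamma> (code m ((T ^^ i) x)))))"
      using iFn(1) unfolding F_birk[abs_def] .
    have "real n * (\<Lambda> - \<epsilon>) \<le> N.cell_entropy n" by (rule ent[OF n])
    also have "\<dots> \<le> (LINT x|N. - ln (q (code K x)) - \<rho> (code K x) + ln Z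
       - (\<Sum>i<n. ln (k (l ((T ^^ i) x)) (\<gamma> (code m ((T ^^ i) x))))))"
      by (rule entropy_test[OF lm sN K(1) k0 k1 Z iq i\<rho> ik])
    also have "\<dots> = (LINT x|N. - ln (q (code K x)) - \<rho> (code K x) + ln Z - birk T F n x)"
      unfolding F_birk ..
    also have "\<dots> \<le> (LINT x|N. birk T L K x + C\<^sub>1 - \<rho> (code K x) + ln Z - birk T F n x)"
    proof (rule integral_mono)
      fix x assume "x \<in> space N"
      then show "- ln (q (code K x)) - \<rho> (code K x) + ln Z - birk T F n x
        \<le> birk T L K x + C\<^sub>1 - \<rho> (code K x) + ln Z - birk T F n x"
        using L_gibbs[of x K] spN by (simp add: abs_le_iff)
    qed (use iq i\<rho> iLK iFn in auto)
    also have "\<dots> = real K * \<Lambda> + C\<^sub>1 - t * (real n * b - real n * a) + ln Z - real n * (LINT x|N. F x)"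
      unfolding \<rho> using ib iLK iFn N.prob_space by (simp add: \<Lambda>_def b_def)
    also have "\<dots> \<le> real K * \<Lambda> + C\<^sub>1 - t * (real n * b - real n * a) + ln Z + real n * \<epsilon>"
    proof -
      have "real n * - (LINT x|N. F x) \<le> real n * \<epsilon>" using mF by (intro mult_left_mono) auto
      then show ?thesis by simp
    qed
    also have "ln Z = ln B + real n * (t * (\<delta> / 2))" using B by (simp add: Z_def ln_mult)
    finally show ?thesis by (simp add: K_def algebra_simps)
  qed
  have "t * (b - a) - t * \<delta> / 2 - 2 * \<epsilon> \<le> 0"
    by (rule le_zero_of_multiples_bounded) (rule main)
  then have "t * (b - a) \<le> t * \<delta>" by (simp add: \<epsilon>_def mult.commute)
  then show ?thesis using t by (simp add: a_def b_def)
qed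

text \<open>Testing with the indicator of a cylinder and with its negative gives equality on cylinders,
  which generate.\<close>

theorem equilibrium_unique:
  assumes sN: "sets N = sets M" and pN: "prob_space N" and iL: "integrable N L"
    and h: "entropy_ge N (LINT x|N. L x)"
  shows "N = acim"
proof (rule measure_eqI_generator_eq)
  have spN: "space N = space M" using sN by (rule sets_eq_imp_space_eq)
  interpret N: prob_space N by (rule pN)
  interpret acim: prob_space acim by (rule prob_space_acim)
  let ?E = "insert {} (range cyl)"
  show "Int_stable ?E"
  proof (rule Int_stableI)
    have *: "cyl w \<inter> cyl v \<in> ?E" if "length w \<le> length v" for w v
    proof (cases "take (length w) v = w")
      case True
      have "cyl w \<inter> cyl v = cyl v"
        using that True by (auto simp: cyl_iff) (metis take_itin)
      then show ?thesis by auto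
    next
      case False
      have "cyl w \<inter> cyl v = {}"
        using that False by (auto simp: cyl_iff) (metis take_itin)
      then show ?thesis by auto
    qed
    fix A B assume "A \<in> ?E" "B \<in> ?E"
    then consider "A = {} \<or> B = {}" | w v where "A = cyl w" "B = cyl v" by blast
    then show "A \<inter> B \<in> ?E"
    proof cases
      case (2 w v)
      show ?thesis
      proof (cases "length w \<le> length v")
        case True
        then show ?thesis unfolding 2 by (rule *)
      next
        case False
        then have "cyl v \<inter> cyl w \<in> ?E" by (intro *) simp
        then show ?thesis unfolding 2 by (subst Int_commute)
      qed
    qed auto
  qed
  show E: "?E \<subseteq> Pow (space M)" by (auto simp: cyl_iff)
  have "sigma_sets (space M) ?E = sets M"
  proof
    show "sigma_sets (space M) ?E \<subseteq> sets M" by (rule sets.sigma_sets_subset) auto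
    show "sets M \<subseteq> sigma_sets (space M) ?E"
      unfolding cyl_generate by (rule sigma_sets_mono') auto
  qed
  then show "sets N = sigma_sets (space M) ?E" "sets acim = sigma_sets (space M) ?E" using sN by auto
  show "range (\<lambda>_::nat. space M) \<subseteq> ?E" using cyl_Nil by (metis image_subset_iff insertCI rangeI)
  show "(\<Union>i::nat. space M) = space M" by simp
  show "emeasure N (space M) \<noteq> \<infinity>" by simp
  fix A assume "A \<in> ?E"
  then consider "A = {}" | v where "A = cyl v" by auto
  then show "emeasure N A = emeasure acim A"
  proof cases
    case (2 v)
    have i: "(LINT x|N'. indicator (cyl v) x) = measure N' (cyl v)" if "finite_measure N'" "sets N' = sets M" for N'
      using that sets_eq_imp_space_eq[OF that(2)] by (simp add: Int_absorb2 cyl_iff subset_eq)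
    define f where "f x = (if code (length v) x = v then 1 else 0 :: real)" for x
    have f: "indicator (cyl v) x = f x" if "x \<in> space M" for x
      using that by (simp add: indicator_def cyl_iff f_def)
    have fN: "(LINT x|N. f x) = measure N (cyl v)" "(LINT x|acim. f x) = measure acim (cyl v)"
      using i[OF N.finite_measure_axioms sN] i[OF prob_space.finite_measure[OF prob_space_acim] sets_acim] f spN
        Bochner_Integration.integral_cong[OF refl, of N "indicator (cyl v)" f]
        Bochner_Integration.integral_cong[OF refl, of acim "indicator (cyl v)" f]
      by simp_all
    have "(LINT x|N. f x) \<le> (LINT x|acim. f x) + \<delta>" if "\<delta> > 0" for \<delta>
      by (rule entropy_ge_imp_integral_le[OF sN iL h _ _ that, where u="\<lambda>w. if w = v then 1 else 0"])
        (auto simp: f_def)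
    then have 1: "measure N (cyl v) \<le> measure acim (cyl v)" unfolding fN by (rule field_le_epsilon)
    have "(LINT x|N. - f x) \<le> (LINT x|acim. - f x) + \<delta>" if "\<delta> > 0" for \<delta>
      by (rule entropy_ge_imp_integral_le[OF sN iL h _ _ that, where u="\<lambda>w. if w = v then - 1 else 0"])
        (auto simp: f_def)
    then have "- measure N (cyl v) \<le> - measure acim (cyl v)"
      unfolding integral_minus fN by (rule field_le_epsilon)
    then show ?thesis using 1 2 by (simp add: N.emeasure_eq_measure acim.emeasure_eq_measure)
  qed simp
qed

section \<open>Entropy of the limit measure\<close>

lemma acim_labelled:
  assumes [measurable]: "l \<in> M \<rightarrow>\<^sub>M count_space UNIV" and "\<And>x. x \<in> space M \<Longrightarrow> l x < r"
  shows "labelled_mpt acim T l r"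
proof -
  interpret acim: prob_space acim by (rule prob_space_acim)
  show ?thesis
    by unfold_locales (use assms acim_invariant in \<open>auto simp: measurable_cong_sets[OF sets_acim sets_acim] cong: measurable_cong_sets\<close>)
qed

text \<open>The Gibbs inequality for \<open>u = []\<close>, summed over the words in \<open>W\<close>.\<close>

lemma quasi_independence:
  assumes B [measurable]: "B \<in> sets M"
  shows "prob {x \<in> space M. code m x \<in> W \<and> (T ^^ m) x \<in> B} \<le> C\<^sub>0 * (prob {x \<in> space M. code m x \<in> W} * prob B)"
proof -
  let ?A = "{x \<in> space M. code m x \<in> W}" and ?S = "{x \<in> space M. code m x \<in> W \<and> (T ^^ m) x \<in> B}"
  let ?K = "{u :: nat list. length u = m}"
  have c: "code m \<in> M \<rightarrow>\<^sub>M count_space UNIV" by measurable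
  have S [measurable]: "?A \<in> sets M" "?S \<in> sets M" by measurable
  note sp = measure_countable_split[OF c _ _ countable_lists_length[of m]]
  have K: "code m ` X \<subseteq> ?K" for X by auto
  have "prob ?S = (LINT u|count_space ?K. prob {x \<in> ?S. code m x = u})"
    by (rule sp(2)[OF S(2) K])
  also have "\<dots> \<le> (LINT u|count_space ?K. C\<^sub>0 * prob B * prob {x \<in> ?A. code m x = u})"
  proof (rule integral_mono)
    fix u assume "u \<in> space (count_space ?K)"
    then have u: "length u = m" by simp
    show "prob {x \<in> ?S. code m x = u} \<le> C\<^sub>0 * prob B * prob {x \<in> ?A. code m x = u}"
    proof (cases "u \<in> W")
      case True
      have "{x \<in> ?S. code m x = u} = {x \<in> cyl u. (T ^^ (length u + 0)) x \<in> B}"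
        "{x \<in> ?A. code m x = u} = cyl u"
        using True u by (auto simp: cyl_iff)
      then show ?thesis
        using tail_prob_bounds(1)[OF B, of u] by (simp add: tail_prob_def pos_divide_le_eq)
    next
      case False
      then have "{x \<in> ?S. code m x = u} = {}" by auto
      then show ?thesis using C0_ge_1 by (simp only: measure_empty) simp
    qed
  qed (use sp(1)[OF S(2) K] sp(1)[OF S(1) K] in auto)
  also have "\<dots> = C\<^sub>0 * prob B * prob ?A"
    using sp(1)[OF S(1) K] sp(2)[OF S(1) K] by simp
  finally show ?thesis by (simp add: mult_ac)
qed

lemma acim_quasi_independence:
  assumes B [measurable]: "B \<in> sets M"
  shows "measure acim {x \<in> space M. code m x \<in> W \<and> (T ^^ m) x \<in> B}
    \<le> C\<^sub>0 ^ 4 * (measure acim {x \<in> space M. code m x \<in> W} * measure acim B)"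
proof -
  let ?A = "{x \<in> space M. code m x \<in> W}" and ?S = "{x \<in> space M. code m x \<in> W \<and> (T ^^ m) x \<in> B}"
  have S [measurable]: "?A \<in> sets M" "?S \<in> sets M" by measurable
  have C: "0 < C\<^sub>0" using C0_ge_1 by simp
  have ge: "prob X \<le> C\<^sub>0 * lim_prob X" if "X \<in> sets M" for X
    using lim_prob_ge[OF that] C by (simp add: divide_simps mult_ac)
  have "lim_prob ?S \<le> C\<^sub>0 * prob ?S" by (rule lim_prob_le) simp
  also have "\<dots> \<le> C\<^sub>0 * (C\<^sub>0 * (prob ?A * prob B))"
    using quasi_independence[OF B] C by (intro mult_left_mono) auto
  also have "\<dots> \<le> C\<^sub>0 * (C\<^sub>0 * ((C\<^sub>0 * lim_prob ?A) * (C\<^sub>0 * lim_prob B)))"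
    using ge[OF S(1)] ge[OF B] C lim_prob_nonneg[OF S(1)] by (intro mult_left_mono mult_mono) auto
  finally show ?thesis using S B by (simp add: measure_acim power4_eq_xxxx mult_ac)
qed

text \<open>The partition into digits is infinite, so the digits are truncated at \<open>N\<close>; the truncated
  partitions are finite. For a fixed block length \<open>m\<close> and \<open>N \<rightarrow> \<infinity>\<close> the entropy of blocks comes
  close to \<open>\<integral> - ln q(code m x)\<close>, that is, to \<open>m * \<integral> L\<close> up to a constant. By almost independence
  the entropy per digit is smaller than that of a block divided by \<open>m\<close> by at most a multiple of \<open>1
  / m\<close>.\<close>

theorem acim_entropy_ge:
  assumes \<epsilon>: "\<epsilon> > 0"
  shows "\<exists>N h. (\<lambda>n. labelled_mpt.cell_entropy acim T (\<lambda>x. min (dig x) N) (Suc N) n / real n) \<longlonglongrightarrow> h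
    \<and> (LINT x|acim. L x) - \<epsilon> \<le> h"
proof -
  define \<Lambda> where "\<Lambda> = (LINT x|acim. L x)"
  have lm: "labelled_mpt acim T (\<lambda>x. min (dig x) N) (Suc N)" for N
    by (rule acim_labelled) auto
  have C4: "1 \<le> C\<^sub>0 ^ 4" using C0_ge_1 by (rule one_le_power)
  define c where "c = C\<^sub>1 + ln C\<^sub>0 + 1 + ln (C\<^sub>0 ^ 4)"
  obtain m where m: "real m > \<bar>c\<bar> / \<epsilon> + 1" using reals_Archimedean2 by auto
  have m1: "m \<ge> 1" "\<bar>c\<bar> / real m \<le> \<epsilon>"
  proof -
    have "0 \<le> \<bar>c\<bar> / \<epsilon>" using \<epsilon> by simp
    then have m0: "real m > 0" "\<bar>c\<bar> / \<epsilon> \<le> real m" using m by linarith+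
    then show "m \<ge> 1" by simp
    show "\<bar>c\<bar> / real m \<le> \<epsilon>" using m0 \<epsilon> by (simp add: field_simps)
  qed
  have itin_min: "itin T (\<lambda>x. min (dig x) N) n x = map (\<lambda>a. min a N) (code n x)" for N n x
    by (simp add: itin_def)
  let ?g = "\<lambda>N x. indicator {x \<in> space M. \<forall>a\<in>set (code m x). a < N} x * (birk T L m x - C\<^sub>1 - ln C\<^sub>0) :: real"
  have H: "(LINT x|acim. ?g N x) \<le> labelled_mpt.cell_entropy acim T (\<lambda>x. min (dig x) N) (Suc N) m" for N
  proof -
    interpret N: labelled_mpt acim T "\<lambda>x. min (dig x) N" "Suc N" by (rule lm)
    have gs: "{x \<in> space M. \<forall>a\<in>set (code m x). a < N} \<in> sets M"
    proof -
      have "{x \<in> space M. \<forall>a\<in>set (code m x). a < N} = {x \<in> space M. code m x \<in> {w. \<forall>a\<in>set w. a < N}}" by simp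
      also have "\<dots> \<in> sets M" by measurable
      finally show ?thesis .
    qed
    show ?thesis
      unfolding N.cell_entropy_integral(2)
    proof (rule integral_mono)
      show "integrable acim (?g N)"
        using integrable_mult_indicator[of "{x \<in> space M. \<forall>a\<in>set (code m x). a < N}" acim "\<lambda>x. birk T L m x - C\<^sub>1 - ln C\<^sub>0"]
          N.integral_birk(1)[OF integrable_acim_L, of m] gs by simp
      show "integrable acim (\<lambda>x. - ln (N.prob (N.cell (itin T (\<lambda>x. min (dig x) N) m x))))"
        by (rule N.cell_entropy_integral(1))
      fix x assume "x \<in> space acim"
      then have x: "x \<in> space M" by simp
      let ?p = "N.prob (N.cell (itin T (\<lambda>x. min (dig x) N) m x))"
      have nn: "0 \<le> - ln ?p"
        by (cases "?p = 0") (auto simp: zero_less_measure_iff)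
      show "?g N x \<le> - ln ?p"
      proof (cases "\<forall>a\<in>set (code m x). a < N")
        case False then show ?thesis using nn by simp
      next
        case True
        let ?c = "code m x"
        have 1: "map (\<lambda>a. min a N) ?c = ?c" using True by (intro map_idI) (auto simp: min_def)
        have "N.cell ?c = cyl ?c"
        proof -
          have "map (\<lambda>a. min a N) w = ?c \<longleftrightarrow> w = ?c" for w
          proof
            assume w: "map (\<lambda>a. min a N) w = ?c"
            show "w = ?c"
            proof (rule nth_equalityI)
              show "length w = length ?c" using arg_cong[OF w, of length] by simp
              fix i assume i: "i < length w"
              have "?c ! i = min (w ! i) N" using i by (subst w[symmetric]) simp
              moreover have "?c ! i < N" using True i arg_cong[OF w, of length] by simp
              ultimately show "w ! i = ?c ! i" by (auto simp: min_def split: if_splits)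
            qed
          qed (use 1 in simp)
          then show ?thesis unfolding N.cell_def cylset_def itin_min space_acim by (simp only: length_itin)
        qed
        then have p: "?p = measure acim (cyl ?c)" unfolding itin_min 1 by simp
        have "measure acim (cyl ?c) \<le> C\<^sub>0 * q ?c" by (simp add: measure_acim lim_prob_le)
        moreover have pos: "0 < measure acim (cyl ?c)"
        proof -
          have "0 < q ?c / C\<^sub>0" using C0_ge_1 by simp
          also have "\<dots> \<le> lim_prob (cyl ?c)" by (rule lim_prob_ge) simp
          finally show ?thesis by (simp add: measure_acim)
        qed
        ultimately have "ln (measure acim (cyl ?c)) \<le> ln (C\<^sub>0 * q ?c)" by simp
        also have "\<dots> = ln C\<^sub>0 + ln (q ?c)" using C0_ge_1 q_pos[of ?c, THEN less_imp_neq] by (simp add: ln_mult del: q_pos)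
        finally have "birk T L m x - C\<^sub>1 - ln C\<^sub>0 \<le> - ln (measure acim (cyl ?c))"
          using L_gibbs[OF x, of m] by (simp add: abs_le_iff)
        then show ?thesis unfolding p using x True by simp
      qed
    qed
  qed
  have lim: "(\<lambda>N. LINT x|acim. ?g N x) \<longlonglongrightarrow> (LINT x|acim. birk T L m x - C\<^sub>1 - ln C\<^sub>0)"
  proof -
    interpret N: labelled_mpt acim T "\<lambda>x. min (dig x) 0" "Suc 0" by (rule lm)
    note ib = N.integral_birk[OF integrable_acim_L, of m]
    show ?thesis
    proof (rule integral_dominated_convergence)
      show "integrable acim (\<lambda>x. \<bar>birk T L m x - C\<^sub>1 - ln C\<^sub>0\<bar>)" using ib(1) by simp
      show "AE x in acim. (\<lambda>N. ?g N x) \<longlonglongrightarrow> birk T L m x - C\<^sub>1 - ln C\<^sub>0"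
      proof (rule AE_I2)
        fix x assume x: "x \<in> space acim"
        have "\<forall>\<^sub>F N in sequentially. ?g N x = birk T L m x - C\<^sub>1 - ln C\<^sub>0"
          unfolding eventually_sequentially
        proof (intro exI[of _ "Suc (sum_list (code m x))"] allI impI)
          fix N assume "Suc (sum_list (code m x)) \<le> N"
          then have "\<forall>a\<in>set (code m x). a < N" using member_le_sum_list[of _ "code m x"] by fastforce
          then show "?g N x = birk T L m x - C\<^sub>1 - ln C\<^sub>0" using x by simp
        qed
        then show "(\<lambda>N. ?g N x) \<longlonglongrightarrow> birk T L m x - C\<^sub>1 - ln C\<^sub>0" by (rule tendsto_eventually)
      qed
      show "(\<lambda>x. birk T L m x - C\<^sub>1 - ln C\<^sub>0) \<in> borel_measurable acim" using ib(1) by auto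
      fix N
      have [measurable]: "{x \<in> space M. \<forall>a\<in>set (code m x). a < N} \<in> sets M"
      proof -
        have "{x \<in> space M. \<forall>a\<in>set (code m x). a < N} = {x \<in> space M. code m x \<in> {w. \<forall>a\<in>set w. a < N}}" by simp
        also have "\<dots> \<in> sets M" by measurable
        finally show ?thesis .
      qed
      have [measurable]: "birk T L m \<in> borel_measurable acim" using ib(1) by auto
      show "?g N \<in> borel_measurable acim" by measurable
      show "AE x in acim. norm (?g N x) \<le> \<bar>birk T L m x - C\<^sub>1 - ln C\<^sub>0\<bar>"
        by (rule AE_I2) (simp add: indicator_def)
    qed
  qed
  have mean: "(LINT x|acim. birk T L m x - C\<^sub>1 - ln C\<^sub>0) = real m * \<Lambda> - C\<^sub>1 - ln C\<^sub>0"
  proof -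
    interpret N: labelled_mpt acim T "\<lambda>x. min (dig x) 0" "Suc 0" by (rule lm)
    show ?thesis
      using N.integral_birk[OF integrable_acim_L, of m] N.prob_space by (simp add: \<Lambda>_def)
  qed
  have "\<forall>\<^sub>F N in sequentially. real m * \<Lambda> - C\<^sub>1 - ln C\<^sub>0 - 1 < (LINT x|acim. ?g N x)"
    using lim unfolding mean by (rule order_tendstoD(1)) simp
  then obtain N where N: "real m * \<Lambda> - C\<^sub>1 - ln C\<^sub>0 - 1 < (LINT x|acim. ?g N x)"
    unfolding eventually_sequentially by auto
  interpret N: labelled_mpt acim T "\<lambda>x. min (dig x) N" "Suc N" by (rule lm)
  obtain h where h: "(\<lambda>n. N.cell_entropy n / real n) \<longlonglongrightarrow> h" using N.cell_entropy_limit by blast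
  have quasi: "N.prob (N.cell (w @ v)) \<le> C\<^sub>0 ^ 4 * (N.prob (N.cell w) * N.prob (N.cell v))" for w v
  proof -
    let ?W = "{c. map (\<lambda>a. min a N) c = w}"
    have cw: "N.cell w = {x \<in> space M. code (length w) x \<in> ?W}"
      by (simp add: N.cell_def itin_min)
    moreover have "N.cell (w @ v) = {x \<in> space M. code (length w) x \<in> ?W \<and> (T ^^ length w) x \<in> N.cell v}"
      unfolding N.cell_append[of w v] cw by (simp add: conj_assoc)
    moreover have "N.cell v \<in> sets M" using N.cell_sets[of v] by simp
    ultimately show ?thesis using acim_quasi_independence[of "N.cell v" "length w" ?W] by simp
  qed
  have "(N.cell_entropy m - ln (C\<^sub>0 ^ 4)) / real m \<le> h"
    by (rule superadditive_limit_ge[OF N.cell_entropy_add_ge[OF C4 quasi] h m1(1)])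
  moreover have "(real m * \<Lambda> - c) / real m \<le> (N.cell_entropy m - ln (C\<^sub>0 ^ 4)) / real m"
    using N H[of N] by (intro divide_right_mono) (auto simp: c_def)
  moreover have "(real m * \<Lambda> - c) / real m = \<Lambda> - c / real m" using m1(1) by (simp add: field_simps)
  moreover have "c / real m \<le> \<bar>c\<bar> / real m" by (intro divide_right_mono) auto
  ultimately have "\<Lambda> - \<epsilon> \<le> h" using m1(2) by linarith
  then show ?thesis using h unfolding \<Lambda>_def by blast
qed

section \<open>Counting words with large cylinders\<close>

definition big :: "real \<Rightarrow> nat list set" where
  "big K = {w. 1 / K \<le> q w}"

text \<open>The deviation is required on the whole cylinder, so that distinct bad words of length \<open>n\<close> occupy
  disjoint parts of one set of exponentially small measure.\<close>

definition bad :: "('a \<Rightarrow> real) \<Rightarrow> real \<Rightarrow> nat list \<Rightarrow> bool" where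
  "bad f \<delta> w \<longleftrightarrow> (\<forall>x\<in>cyl w. real (length w) * \<delta> \<le>
     \<bar>birk T f (length w) x - real (length w) * (LINT x|acim. f x)\<bar>)"

lemma sum_q_le:
  assumes "finite F" and F: "F \<subseteq> {w. length w = n}" and S: "S \<in> sets M" "\<And>w. w \<in> F \<Longrightarrow> cyl w \<subseteq> S"
  shows "(\<Sum>w\<in>F. q w) \<le> prob S"
proof -
  have "(\<Sum>w\<in>F. q w) = prob (\<Union>w\<in>F. cyl w)"
  proof (rule finite_measure_finite_Union[symmetric, OF \<open>finite F\<close>])
    have "length w = n" if "w \<in> F" for w using F that by auto
    then show "disjoint_family_on cyl F" by (auto simp: disjoint_family_on_def cyl_iff)
  qed auto
  also have "\<dots> \<le> prob S" using S by (intro finite_measure_mono) auto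
  finally show ?thesis .
qed

lemma finite_big_length:
  assumes K: "K > 0" shows "finite {w \<in> big K. length w = n}"
proof (rule ccontr)
  assume inf: "infinite {w \<in> big K. length w = n}"
  obtain j :: nat where j: "K < real j" using reals_Archimedean2 by auto
  obtain F where F: "F \<subseteq> {w \<in> big K. length w = n}" "finite F" "card F = j"
    using infinite_arbitrarily_large[OF inf, of j] by auto
  have "real j * (1 / K) \<le> (\<Sum>w\<in>F. q w)"
    using F by (subst F(3)[symmetric], intro sum_bounded_below) (auto simp: big_def)
  also have "\<dots> \<le> prob (space M)"
    using F by (intro sum_q_le[of _ n]) (auto simp: cyl_iff)
  finally have "real j \<le> K" using K by (simp add: prob_space field_simps)
  then show False using j by simp
qed

lemma C2_pos: "0 < C\<^sub>2" using q_le[of "[]"] by (simp add: prob_space)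

lemma big_length_bounded:
  assumes K: "K > 0" shows "\<exists>n0. \<forall>w\<in>big K. length w < n0"
proof -
  have "(\<lambda>n. C\<^sub>2 * \<theta> ^ n) \<longlonglongrightarrow> C\<^sub>2 * 0"
    using theta by (intro tendsto_intros LIMSEQ_power_zero) auto
  then have "\<forall>\<^sub>F n in sequentially. C\<^sub>2 * \<theta> ^ n < 1 / K"
    using K by (intro order_tendstoD(2)) auto
  then obtain n0 where n0: "\<And>n. n \<ge> n0 \<Longrightarrow> C\<^sub>2 * \<theta> ^ n < 1 / K"
    unfolding eventually_sequentially by auto
  show ?thesis
  proof (intro exI[of _ n0] ballI, rule ccontr)
    fix w assume w: "w \<in> big K" "\<not> length w < n0"
    then have "q w < 1 / K" using n0[of "length w"] q_le[of w] by simp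
    then show False using w by (simp add: big_def)
  qed
qed

lemma finite_big: assumes K: "K > 0" shows "finite (big K)"
proof -
  obtain n0 where n0: "\<And>w. w \<in> big K \<Longrightarrow> length w < n0" using big_length_bounded[OF K] by auto
  have "big K \<subseteq> (\<Union>n<n0. {w \<in> big K. length w = n})" using n0 by auto
  then show ?thesis by (rule finite_subset) (auto intro!: finite_big_length[OF K])
qed

lemma exp_cyl_approx_smaller:
  assumes "exp_cyl_approx s1 f" "0 \<le> s2" "s2 \<le> s1"
  shows "exp_cyl_approx s2 f"
  unfolding exp_cyl_approx_def
proof (intro conjI)
  have "(\<integral>\<^sup>+x. ennreal (exp (s2 * \<bar>f x\<bar>)) \<partial>M) \<le> (\<integral>\<^sup>+x. ennreal (exp (s1 * \<bar>f x\<bar>)) \<partial>M)"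
    using assms by (intro nn_integral_mono ennreal_leI) (auto intro!: mult_right_mono)
  also have "\<dots> < \<infinity>" using assms by (simp add: exp_cyl_approx_def)
  finally show "(\<integral>\<^sup>+x. ennreal (exp (s2 * \<bar>f x\<bar>)) \<partial>M) < \<infinity>" .
qed (use assms in \<open>auto simp: exp_cyl_approx_def\<close>)

text \<open>Chebyshev's inequality with exponent \<open>1 - t\<close>: if \<open>q w \<ge> 1 / K\<close> then \<open>1 \<le> (K q w) powr (1 - t)\<close>.
  Summing over words gives \<open>K powr (1 - t)\<close> times the mean of \<open>q (code n x) powr - t\<close>, which is an
  exponential moment of the Birkhoff sum of \<open>L\<close>.\<close>

lemma card_big_length_le:
  "\<exists>t B \<Lambda>. 0 < t \<and> t < 1 \<and> 0 < B \<and> 0 < \<Lambda> \<and> (\<forall>K>0. \<forall>n.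
     real (card {w \<in> big K. length w = n}) \<le> B * K powr (1 - t) * exp (real n * \<Lambda>))"
proof -
  define \<mu> where "\<mu> = (LINT x|acim. L x)"
  have s': "0 < min s (1 / 2)" using s_pos by simp
  have "exp_cyl_approx (min s (1 / 2)) L"
    by (rule exp_cyl_approx_smaller[OF exp_cyl_approx_L]) (use s_pos in auto)
  from mgf[OF s' this, of 1] obtain t B where t: "0 < t" "t \<le> min s (1 / 2)" and B: "0 < B"
    and mgf: "\<And>n. (\<integral>\<^sup>+x. ennreal (exp (t * (birk T L n x - real n * \<mu>))) \<partial>M) \<le> ennreal (B * exp (real n * (t * 1)))"
    unfolding \<mu>_def by auto
  define B' where "B' = exp (t * C\<^sub>1) * B"
  define \<Lambda> where "\<Lambda> = \<bar>t * (\<mu> + 1)\<bar> + 1"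
  have "real (card {w \<in> big K. length w = n}) \<le> B' * K powr (1 - t) * exp (real n * \<Lambda>)" if K: "K > 0" for K n
  proof -
    let ?F = "{w \<in> big K. length w = n}"
    have fin: "finite ?F" by (rule finite_big_length[OF K])
    have "real (card ?F) = (\<Sum>w\<in>?F. 1)" by simp
    also have "\<dots> \<le> (\<Sum>w\<in>?F. K powr (1 - t) * (q w powr (- t) * q w))"
    proof (rule sum_mono)
      fix w assume "w \<in> ?F"
      then have "1 \<le> K * q w" using K by (simp add: big_def field_simps)
      then have "1 \<le> (K * q w) powr (1 - t)" using t by (intro ge_one_powr_ge_zero) auto
      also have "\<dots> = K powr (1 - t) * (q w powr (- t) * q w)"
        using K q_pos[of w] by (simp add: powr_mult powr_diff powr_minus field_simps del: q_pos)
      finally show "1 \<le> K powr (1 - t) * (q w powr (- t) * q w)" .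
    qed
    also have "\<dots> = K powr (1 - t) * (\<Sum>w\<in>?F. q w powr (- t) * q w)" by (simp add: sum_distrib_left)
    also have "(\<Sum>w\<in>?F. q w powr (- t) * q w) \<le> B' * exp (real n * \<Lambda>)"
    proof -
      have "ennreal (\<Sum>w\<in>?F. q w powr (- t) * q w) = (\<Sum>w\<in>?F. ennreal (q w powr (- t)) * emeasure M (cyl w))"
        by (subst sum_ennreal[symmetric]) (auto simp: ennreal_mult'' emeasure_eq_measure)
      also have "\<dots> = (\<Sum>w\<in>?F. \<integral>\<^sup>+x. ennreal (q w powr (- t)) * indicator (cyl w) x \<partial>M)"
        by (intro sum.cong refl nn_integral_cmult_indicator[symmetric]) simp
      also have "\<dots> = (\<integral>\<^sup>+x. (\<Sum>w\<in>?F. ennreal (q w powr (- t)) * indicator (cyl w) x) \<partial>M)"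
        by (rule nn_integral_sum[symmetric]) simp
      also have "\<dots> \<le> (\<integral>\<^sup>+x. ennreal (exp (t * C\<^sub>1 + real n * (t * \<mu>))) * ennreal (exp (t * (birk T L n x - real n * \<mu>))) \<partial>M)"
      proof (rule nn_integral_mono)
        fix x assume x: "x \<in> space M"
        have "(\<Sum>w\<in>?F. ennreal (q w powr (- t)) * indicator (cyl w) x) =
          (\<Sum>w\<in>?F. if w = code n x then ennreal (q w powr (- t)) else 0)"
          using x by (intro sum.cong) (auto simp: indicator_def cyl_iff)
        also have "\<dots> \<le> ennreal (q (code n x) powr (- t))" using fin by simp
        also have "q (code n x) powr (- t) \<le> exp (t * C\<^sub>1 + real n * (t * \<mu>)) * exp (t * (birk T L n x - real n * \<mu>))"
        proof -
          have "- t * ln (q (code n x)) \<le> t * (birk T L n x + C\<^sub>1)"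
            using mult_left_mono[of "- ln (q (code n x))" "birk T L n x + C\<^sub>1" t] L_gibbs[OF x, of n] t by simp
          then show ?thesis
            using q_pos[of "code n x", THEN less_imp_neq] by (simp add: powr_def algebra_simps flip: exp_add del: q_pos)
        qed
        finally show "(\<Sum>w\<in>?F. ennreal (q w powr (- t)) * indicator (cyl w) x) \<le>
          ennreal (exp (t * C\<^sub>1 + real n * (t * \<mu>))) * ennreal (exp (t * (birk T L n x - real n * \<mu>)))"
          by (simp add: ennreal_leI ennreal_mult'')
      qed
      also have "\<dots> = ennreal (exp (t * C\<^sub>1 + real n * (t * \<mu>))) * (\<integral>\<^sup>+x. ennreal (exp (t * (birk T L n x - real n * \<mu>))) \<partial>M)"
        by (rule nn_integral_cmult) measurable
      also have "\<dots> \<le> ennreal (exp (t * C\<^sub>1 + real n * (t * \<mu>))) * ennreal (B * exp (real n * (t * 1)))"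
        by (rule mult_left_mono[OF mgf]) simp
      also have "\<dots> = ennreal (exp (t * C\<^sub>1 + real n * (t * \<mu>)) * (B * exp (real n * (t * 1))))"
        using B by (intro ennreal_mult''[symmetric]) simp
      also have "exp (t * C\<^sub>1 + real n * (t * \<mu>)) * (B * exp (real n * (t * 1))) = B' * exp (real n * (t * (\<mu> + 1)))"
        by (simp add: B'_def exp_add[symmetric] algebra_simps)
      also have "ennreal (B' * exp (real n * (t * (\<mu> + 1)))) \<le> ennreal (B' * exp (real n * \<Lambda>))"
        using B by (intro ennreal_leI mult_left_mono) (auto simp: B'_def \<Lambda>_def intro!: mult_left_mono)
      finally show ?thesis using B by (simp add: B'_def)
    qed
    finally show ?thesis using K by (simp add: mult_left_mono mult_ac)
  qed
  moreover have "0 < t" "t < 1" "0 < B'" "0 < \<Lambda>" using t B by (auto simp: B'_def \<Lambda>_def)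
  ultimately show ?thesis by blast
qed

lemma card_bad_length_le:
  assumes f [measurable]: "f \<in> borel_measurable M" and K: "K > 0"
    and p: "prob {x \<in> space M. real n * \<delta> \<le> \<bar>birk T f n x - real n * (LINT x|acim. f x)\<bar>} \<le> p"
  shows "real (card {w \<in> big K. length w = n \<and> bad f \<delta> w}) \<le> K * p"
proof -
  let ?F = "{w \<in> big K. length w = n \<and> bad f \<delta> w}"
  let ?S = "{x \<in> space M. real n * \<delta> \<le> \<bar>birk T f n x - real n * (LINT x|acim. f x)\<bar>}"
  have fin: "finite ?F" using finite_big_length[OF K, of n] by (rule finite_subset[rotated]) auto
  have "real (card ?F) * (1 / K) \<le> (\<Sum>w\<in>?F. q w)"
    by (intro sum_bounded_below) (auto simp: big_def)
  also have "\<dots> \<le> prob ?S"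
  proof (rule sum_q_le[OF fin, of n])
    show "cyl w \<subseteq> ?S" if "w \<in> ?F" for w using that by (auto simp: bad_def cyl_iff)
  qed auto
  finally have "real (card ?F) * (1 / K) \<le> p" using p by simp
  then show ?thesis using K by (simp add: field_simps)
qed

lemma sum_exp_tail:
  assumes "0 < (\<eta>::real)"
  shows "(\<Sum>n\<in>{a..<b}. exp (- (\<eta> * real n))) \<le> exp (- (\<eta> * real a)) / (1 - exp (- \<eta>))"
proof -
  have r: "0 < exp (- \<eta>)" "exp (- \<eta>) < 1" using assms by auto
  have "(\<Sum>n\<in>{a..<b}. exp (- (\<eta> * real n))) = (\<Sum>n\<in>{a..<b}. exp (- \<eta>) ^ n)"
    by (intro sum.cong refl) (simp add: exp_of_nat_mult[symmetric] mult.commute)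
  also have "\<dots> \<le> exp (- \<eta>) ^ a / (1 - exp (- \<eta>))"
  proof (cases "a \<le> b")
    case True
    have "(\<Sum>n\<in>{a..<b}. exp (- \<eta>) ^ n) = (exp (- \<eta>) ^ a - exp (- \<eta>) ^ b) / (1 - exp (- \<eta>))"
      using True
    proof (induction b rule: dec_induct)
      case (step n)
      then have "(\<Sum>n\<in>{a..<Suc n}. exp (- \<eta>) ^ n) =
        (exp (- \<eta>) ^ a - exp (- \<eta>) ^ n) / (1 - exp (- \<eta>)) + exp (- \<eta>) ^ n" by simp
      also have "\<dots> = (exp (- \<eta>) ^ a - exp (- \<eta>) ^ Suc n) / (1 - exp (- \<eta>))"
        using r by (simp add: field_simps)
      finally show ?case .
    qed simp
    also have "\<dots> \<le> exp (- \<eta>) ^ a / (1 - exp (- \<eta>))" using r by (intro divide_right_mono) auto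
    finally show ?thesis .
  next
    case False
    then show ?thesis using r by simp
  qed
  also have "exp (- \<eta>) ^ a = exp (- (\<eta> * real a))" by (simp add: exp_of_nat_mult[symmetric] mult.commute)
  finally show ?thesis .
qed

text \<open>Words shorter than \<open>N \<approx> a ln K\<close> are bounded by \<open>card_big_length_le\<close>, as \<open>exp (N * \<Lambda>)\<close> is only a
  small power of \<open>K\<close>; for the others the exponential factor of \<open>card_bad_length_le\<close> is a negative
  power of \<open>K\<close>.\<close>

lemma card_bad_words:
  assumes f: "f \<in> borel_measurable M" and conc: "concentrates f" and \<delta>: "\<delta> > 0"
  shows "\<exists>A \<eta>. 0 < \<eta> \<and> \<eta> < 1 \<and> 0 < A \<and> (\<forall>K\<ge>1.
    real (card {w \<in> big K. length w < n1 \<or> bad f \<delta> w}) \<le> A * K powr (1 - \<eta>))"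
proof -
  obtain t B \<Lambda> where t: "0 < t" "t < 1" and B: "0 < B" and \<Lambda>: "0 < \<Lambda>"
    and short: "\<And>K n. K > 0 \<Longrightarrow> real (card {w \<in> big K. length w = n}) \<le> B * K powr (1 - t) * exp (real n * \<Lambda>)"
    using card_big_length_le by blast
  obtain B1 \<eta>1 where B1: "0 < B1" and \<eta>1: "0 < \<eta>1" and ld: "\<And>n.
    prob {x \<in> space M. real n * \<delta> \<le> \<bar>birk T f n x - real n * (LINT x|acim. f x)\<bar>} \<le> B1 * exp (- (\<eta>1 * real n))"
    using conc \<delta> unfolding concentrates_def by blast
  \<comment> \<open>then \<open>exp (N * (\<Lambda> + 1))\<close> is at most a constant times \<open>K powr (t / 2)\<close>, while \<open>K powr t\<close> is available\<close>
  define a where "a = t / (2 * (\<Lambda> + 1))"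
  have a: "0 < a" using t \<Lambda> by (simp add: a_def)
  define \<eta> where "\<eta> = min (t / 2) (min (a * \<eta>1) (1 / 2))"
  have \<eta>: "0 < \<eta>" "\<eta> < 1" using t a \<eta>1 by (auto simp: \<eta>_def)
  define A1 where "A1 = B * exp (real (n1 + 1) * (\<Lambda> + 1))"
  define A2 where "A2 = B1 / (1 - exp (- \<eta>1))"
  have A: "0 < A1" "0 < A2" using B B1 \<eta>1 by (auto simp: A1_def A2_def)
  have "real (card {w \<in> big K. length w < n1 \<or> bad f \<delta> w}) \<le> (A1 + A2) * K powr (1 - \<eta>)" if K: "K \<ge> 1" for K
  proof -
    have K0: "K > 0" using K by simp
    define N where "N = nat \<lceil>a * ln K\<rceil> + n1"
    have lnK: "0 \<le> a * ln K" using K a by simp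
    have N_ge: "a * ln K \<le> real N" unfolding N_def using lnK by linarith
    have N_le: "real N \<le> a * ln K + real (n1 + 1)" unfolding N_def using lnK by linarith
    obtain b where b: "\<And>w. w \<in> big K \<Longrightarrow> length w < b" using big_length_bounded[OF K0] by auto
    let ?S = "\<lambda>n. {w \<in> big K. length w = n}" and ?L = "\<lambda>n. {w \<in> big K. length w = n \<and> bad f \<delta> w}"
    have fL: "finite (?L n)" for n using finite_big_length[OF K0, of n] by (rule finite_subset[rotated]) auto
    have sub: "{w \<in> big K. length w < n1 \<or> bad f \<delta> w} \<subseteq> (\<Union>n<N. ?S n) \<union> (\<Union>n\<in>{N..<b}. ?L n)"
    proof
      fix w assume w: "w \<in> {w \<in> big K. length w < n1 \<or> bad f \<delta> w}"
      show "w \<in> (\<Union>n<N. ?S n) \<union> (\<Union>n\<in>{N..<b}. ?L n)"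
      proof (cases "length w < N")
        case False
        then have "bad f \<delta> w" "length w \<in> {N..<b}" using w b by (auto simp: N_def)
        then show ?thesis using w by auto
      qed (use w in auto)
    qed
    have "card {w \<in> big K. length w < n1 \<or> bad f \<delta> w} \<le> card ((\<Union>n<N. ?S n) \<union> (\<Union>n\<in>{N..<b}. ?L n))"
      using sub finite_big_length[OF K0] fL by (intro card_mono) auto
    also have "\<dots> \<le> card (\<Union>n<N. ?S n) + card (\<Union>n\<in>{N..<b}. ?L n)" by (rule card_Un_le)
    also have "\<dots> \<le> (\<Sum>n<N. card (?S n)) + (\<Sum>n\<in>{N..<b}. card (?L n))"
      by (intro add_mono card_UN_le) auto
    finally have "real (card {w \<in> big K. length w < n1 \<or> bad f \<delta> w})
      \<le> real ((\<Sum>n<N. card (?S n)) + (\<Sum>n\<in>{N..<b}. card (?L n)))"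
      by (rule of_nat_mono)
    then have "real (card {w \<in> big K. length w < n1 \<or> bad f \<delta> w})
      \<le> (\<Sum>n<N. real (card (?S n))) + (\<Sum>n\<in>{N..<b}. real (card (?L n)))" by simp
    moreover have "(\<Sum>n<N. real (card (?S n))) \<le> A1 * K powr (1 - \<eta>)"
    proof -
      have "(\<Sum>n<N. real (card (?S n))) \<le> (\<Sum>n<N. B * K powr (1 - t) * exp (real N * \<Lambda>))"
      proof (rule sum_mono)
        fix n assume "n \<in> {..<N}"
        then have "exp (real n * \<Lambda>) \<le> exp (real N * \<Lambda>)" using \<Lambda> by simp
        then have "B * K powr (1 - t) * exp (real n * \<Lambda>) \<le> B * K powr (1 - t) * exp (real N * \<Lambda>)"
          using B by (intro mult_left_mono) auto
        then show "real (card (?S n)) \<le> B * K powr (1 - t) * exp (real N * \<Lambda>)"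
          using short[OF K0, of n] by linarith
      qed
      also have "\<dots> = B * K powr (1 - t) * (real N * exp (real N * \<Lambda>))" by simp
      also have "\<dots> \<le> B * K powr (1 - t) * (exp (real N) * exp (real N * \<Lambda>))"
      proof -
        have "real N \<le> exp (real N)" using exp_ge_add_one_self[of "real N"] by linarith
        then show ?thesis using B by (intro mult_left_mono mult_right_mono) auto
      qed
      also have "exp (real N) * exp (real N * \<Lambda>) = exp (real N * (\<Lambda> + 1))"
        by (simp add: exp_add[symmetric] algebra_simps)
      also have "B * K powr (1 - t) * exp (real N * (\<Lambda> + 1)) \<le>
          B * K powr (1 - t) * exp ((a * ln K + real (n1 + 1)) * (\<Lambda> + 1))"
        using B N_le \<Lambda> by (intro mult_left_mono) (auto intro!: mult_right_mono)
      also have "\<dots> = A1 * (K powr (1 - t) * K powr (t / 2))"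
      proof -
        have "(a * ln K + real (n1 + 1)) * (\<Lambda> + 1) = t / 2 * ln K + real (n1 + 1) * (\<Lambda> + 1)"
          using \<Lambda> by (simp add: a_def field_simps)
        then show ?thesis using K0 by (simp only: exp_add) (simp add: A1_def powr_def mult_ac)
      qed
      also have "K powr (1 - t) * K powr (t / 2) = K powr (1 - t / 2)"
        by (simp add: powr_add[symmetric])
      also have "A1 * K powr (1 - t / 2) \<le> A1 * K powr (1 - \<eta>)"
        using A K by (intro mult_left_mono powr_mono) (auto simp: \<eta>_def)
      finally show ?thesis .
    qed
    moreover have "(\<Sum>n\<in>{N..<b}. real (card (?L n))) \<le> A2 * K powr (1 - \<eta>)"
    proof -
      have "(\<Sum>n\<in>{N..<b}. real (card (?L n))) \<le> (\<Sum>n\<in>{N..<b}. K * (B1 * exp (- (\<eta>1 * real n))))"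
        by (intro sum_mono card_bad_length_le[OF f K0 ld])
      also have "\<dots> = K * B1 * (\<Sum>n\<in>{N..<b}. exp (- (\<eta>1 * real n)))"
        by (simp add: sum_distrib_left mult.assoc)
      also have "\<dots> \<le> K * B1 * (exp (- (\<eta>1 * real N)) / (1 - exp (- \<eta>1)))"
        using K0 B1 by (intro mult_left_mono sum_exp_tail[OF \<eta>1]) auto
      also have "\<dots> = A2 * (K * exp (- (\<eta>1 * real N)))" by (simp add: A2_def)
      also have "\<dots> \<le> A2 * (K * exp (- (\<eta>1 * (a * ln K))))"
        using A K0 \<eta>1 N_ge by (intro mult_left_mono) auto
      also have "K * exp (- (\<eta>1 * (a * ln K))) = K powr (1 - a * \<eta>1)"
      proof -
        have "K * exp (- (\<eta>1 * (a * ln K))) = exp (ln K) * exp (- (\<eta>1 * (a * ln K)))" using K0 by simp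
        also have "\<dots> = exp ((1 - a * \<eta>1) * ln K)" by (simp add: exp_add[symmetric] algebra_simps)
        finally show ?thesis using K0 by (simp add: powr_def)
      qed
      also have "A2 * K powr (1 - a * \<eta>1) \<le> A2 * K powr (1 - \<eta>)"
        using A K by (intro mult_left_mono powr_mono) (auto simp: \<eta>_def)
      finally show ?thesis .
    qed
    ultimately show ?thesis by (simp add: algebra_simps)
  qed
  then show ?thesis using \<eta> A by (intro exI[of _ "A1 + A2"] exI[of _ \<eta>]) auto
qed

text \<open>Cylinders shrink at the rate \<open>\<theta>\<close>, so \<open>\<integral> S\<^sub>n L \<ge> n ln (1 / \<theta>)\<close> up to a constant.\<close>

lemma lyapunov_pos: "0 < (LINT x|acim. L x)"
proof -
  define \<mu> where "\<mu> = (LINT x|acim. L x)"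
  have lm: "labelled_mpt acim T (\<lambda>_. 0) 1" by (rule acim_labelled) auto
  interpret N: labelled_mpt acim T "\<lambda>_. 0" 1 by (rule lm)
  have "real n * (ln (1 / \<theta>) - \<mu>) \<le> C\<^sub>1 + ln C\<^sub>2" for n
  proof -
    note ib = N.integral_birk[OF integrable_acim_L, of n]
    have "real n * ln (1 / \<theta>) - ln C\<^sub>2 - C\<^sub>1 = (LINT x|acim. real n * ln (1 / \<theta>) - ln C\<^sub>2 - C\<^sub>1)"
      using N.prob_space by simp
    also have "\<dots> \<le> (LINT x|acim. birk T L n x)"
    proof (rule integral_mono)
      fix x assume "x \<in> space acim"
      then have x: "x \<in> space M" by simp
      have "0 < C\<^sub>2 * \<theta> ^ n" using C2_pos theta by simp
      then have "ln (q (code n x)) \<le> ln (C\<^sub>2 * \<theta> ^ n)" using q_le[of "code n x"] by simp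
      also have "\<dots> = ln C\<^sub>2 - real n * ln (1 / \<theta>)"
        using C2_pos theta by (simp add: ln_mult ln_realpow ln_div)
      finally show "real n * ln (1 / \<theta>) - ln C\<^sub>2 - C\<^sub>1 \<le> birk T L n x"
        using L_gibbs[OF x, of n] by (simp add: abs_le_iff)
    qed (use ib in auto)
    also have "\<dots> = real n * \<mu>" using ib by (simp add: \<mu>_def)
    finally show ?thesis by (simp add: algebra_simps)
  qed
  then have "ln (1 / \<theta>) - \<mu> \<le> 0" by (rule le_zero_of_multiples_bounded)
  moreover have "0 < ln (1 / \<theta>)" using theta by simp
  ultimately show ?thesis by (simp add: \<mu>_def)
qed

text \<open>For \<open>n \<approx> ln K / (\<mu> + 2 \<delta>)\<close> half of the points have an initial word of length \<open>n\<close> with measure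
  between \<open>1 / K\<close> and \<open>exp (C\<^sub>1 - n (\<mu> - \<delta>))\<close>; there must be at least \<open>exp (n (\<mu> - \<delta>))\<close> such
  words, up to a constant.\<close>

lemma card_big_ge:
  assumes \<eta>: "0 < \<eta>"
  shows "\<exists>a K0. 0 < a \<and> 1 \<le> K0 \<and> (\<forall>K\<ge>K0. a * K powr (1 - \<eta>) \<le> real (card (big K)))"
proof -
  define \<mu> where "\<mu> = (LINT x|acim. L x)"
  have \<mu>: "0 < \<mu>" using lyapunov_pos by (simp add: \<mu>_def)
  \<comment> \<open>ensures \<open>(1 - \<eta>) (\<mu> + 2 \<delta>) \<le> \<mu> - \<delta>\<close>, the comparison of exponents at the end\<close>
  define \<delta> where "\<delta> = min (\<mu> / 2) (\<eta> * \<mu> / 3)"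
  have \<delta>: "0 < \<delta>" "\<delta> < \<mu>" "3 * \<delta> \<le> \<eta> * \<mu>" using \<mu> \<eta> by (auto simp: \<delta>_def min_def)
  have conc: "concentrates L" by (rule concentrates[OF s_pos exp_cyl_approx_L])
  obtain B \<eta>1 where B: "0 < B" and \<eta>1: "0 < \<eta>1" and ld: "\<And>n.
    prob {x \<in> space M. real n * \<delta> \<le> \<bar>birk T L n x - real n * \<mu>\<bar>} \<le> B * exp (- (\<eta>1 * real n))"
    using conc \<delta> unfolding concentrates_def \<mu>_def by blast
  have "(\<lambda>n. B * exp (- \<eta>1) ^ n) \<longlonglongrightarrow> B * 0"
    using \<eta>1 by (intro tendsto_intros LIMSEQ_power_zero) auto
  then have "\<forall>\<^sub>F n in sequentially. B * exp (- \<eta>1) ^ n < 1 / 2" by (intro order_tendstoD(2)) auto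
  then obtain n2 where n2: "\<And>n. n \<ge> n2 \<Longrightarrow> B * exp (- \<eta>1) ^ n < 1 / 2"
    unfolding eventually_sequentially by auto
  obtain n3 :: nat where n3: "C\<^sub>1 / \<delta> < real n3" using reals_Archimedean2 by auto
  define K0 where "K0 = exp ((\<mu> + 2 * \<delta>) * (real (n2 + n3) + 1))"
  \<comment> \<open>the second factor pays for rounding \<open>ln K / (\<mu> + 2 \<delta>)\<close> down to an integer\<close>
  define a where "a = exp (- C\<^sub>1) * exp (- (\<mu> - \<delta>)) / 2"
  have "a * K powr (1 - \<eta>) \<le> real (card (big K))" if K: "K \<ge> K0" for K
  proof -
    have "1 \<le> K0" using \<mu> \<delta> by (simp add: K0_def)
    then have Kp: "K > 0" "1 \<le> K" using K by linarith+
    have lnK: "(\<mu> + 2 * \<delta>) * (real (n2 + n3) + 1) \<le> ln K"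
      using K Kp by (simp add: K0_def ln_ge_iff)
    define y where "y = ln K / (\<mu> + 2 * \<delta>)"
    have y: "real (n2 + n3) + 1 \<le> y" using lnK \<mu> \<delta> by (simp add: y_def pos_le_divide_eq mult.commute)
    define n where "n = nat \<lfloor>y\<rfloor>"
    have n: "real n \<le> y" "y \<le> real n + 1" "n \<ge> n2 + n3" unfolding n_def using y by linarith+
    have ln_n: "real n * (\<mu> + 2 * \<delta>) \<le> ln K"
      using mult_right_mono[OF n(1), of "\<mu> + 2 * \<delta>"] \<mu> \<delta> by (simp add: y_def)
    have nC: "C\<^sub>1 \<le> real n * \<delta>"
    proof -
      have "C\<^sub>1 / \<delta> \<le> real n" using n3 n(3) by linarith
      then show ?thesis using \<delta> by (simp add: field_simps)
    qed
    let ?S = "{x \<in> space M. real n * \<delta> \<le> \<bar>birk T L n x - real n * \<mu>\<bar>}"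
    let ?F = "{w \<in> big K. length w = n \<and> q w \<le> exp (C\<^sub>1 - real n * (\<mu> - \<delta>))}"
    have fin: "finite ?F" using finite_big[OF Kp(1)] by (rule finite_subset[rotated]) auto
    have S [measurable]: "?S \<in> sets M" by measurable
    have "prob ?S < 1 / 2"
    proof -
      have "exp (- (\<eta>1 * real n)) = exp (- \<eta>1) ^ n" by (simp add: exp_of_nat_mult[symmetric] mult.commute)
      then show ?thesis using ld[of n] n2[of n] n(3) by simp
    qed
    then have "1 / 2 \<le> prob (space M - ?S)" by (subst prob_compl) auto
    also have "\<dots> \<le> prob (\<Union>w\<in>?F. cyl w)"
    proof (rule finite_measure_mono)
      show "space M - ?S \<subseteq> (\<Union>w\<in>?F. cyl w)"
      proof
        fix x assume x: "x \<in> space M - ?S"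
        then have xs: "x \<in> space M" and d: "\<bar>birk T L n x - real n * \<mu>\<bar> < real n * \<delta>" by auto
        let ?w = "code n x"
        have g: "\<bar>birk T L n x + ln (q ?w)\<bar> \<le> C\<^sub>1" by (rule L_gibbs[OF xs])
        have "ln (q ?w) \<le> C\<^sub>1 - real n * (\<mu> - \<delta>)" using g d by (simp add: algebra_simps abs_le_iff abs_less_iff)
        then have "exp (ln (q ?w)) \<le> exp (C\<^sub>1 - real n * (\<mu> - \<delta>))" by (simp only: exp_le_cancel_iff)
        then have 1: "q ?w \<le> exp (C\<^sub>1 - real n * (\<mu> - \<delta>))" by simp
        have "- ln K \<le> ln (q ?w)" using g d ln_n nC by (simp add: algebra_simps abs_le_iff abs_less_iff)
        then have "exp (- ln K) \<le> exp (ln (q ?w))" by (simp only: exp_le_cancel_iff)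
        then have "1 / K \<le> q ?w" using Kp by (simp add: exp_minus inverse_eq_divide)
        then have "?w \<in> ?F" using 1 by (simp add: big_def)
        moreover have "x \<in> cyl ?w" using xs by (simp add: cyl_iff)
        ultimately show "x \<in> (\<Union>w\<in>?F. cyl w)" by blast
      qed
      show "(\<Union>w\<in>?F. cyl w) \<in> sets M" using fin by (intro sets.finite_UN) auto
    qed
    also have "\<dots> \<le> (\<Sum>w\<in>?F. q w)" using fin by (intro measure_UNION_le) auto
    also have "\<dots> \<le> real (card ?F) * exp (C\<^sub>1 - real n * (\<mu> - \<delta>))" by (intro sum_bounded_above) auto
    also have "\<dots> \<le> real (card (big K)) * exp (C\<^sub>1 - real n * (\<mu> - \<delta>))"
      using finite_big[OF Kp(1)] by (intro mult_right_mono of_nat_mono card_mono) auto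
    finally have c: "exp (- C\<^sub>1 + real n * (\<mu> - \<delta>)) / 2 \<le> real (card (big K))"
      by (simp add: exp_diff exp_add exp_minus field_simps)
    have "a * K powr (1 - \<eta>) \<le> a * exp (y * (\<mu> - \<delta>))"
    proof -
      have "(1 - \<eta>) * (\<mu> + 2 * \<delta>) \<le> \<mu> - \<delta>"
      proof -
        have "0 \<le> \<eta> * \<delta>" using \<eta> \<delta> by simp
        then show ?thesis using \<delta>(3) by (simp add: algebra_simps)
      qed
      moreover have "0 \<le> y" using y by linarith
      ultimately have "y * ((1 - \<eta>) * (\<mu> + 2 * \<delta>)) \<le> y * (\<mu> - \<delta>)" by (intro mult_left_mono) auto
      moreover have "ln K = y * (\<mu> + 2 * \<delta>)" using \<mu> \<delta> by (simp add: y_def)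
      ultimately have "(1 - \<eta>) * ln K \<le> y * (\<mu> - \<delta>)" by (simp add: mult_ac)
      then show ?thesis using Kp by (simp add: powr_def a_def)
    qed
    also have "\<dots> \<le> a * exp ((real n + 1) * (\<mu> - \<delta>))"
      using n(2) \<delta> by (auto simp: a_def intro!: mult_right_mono)
    also have "\<dots> = exp (- C\<^sub>1 + real n * (\<mu> - \<delta>)) / 2"
      by (simp add: a_def algebra_simps flip: exp_add)
    also have "\<dots> \<le> real (card (big K))" by (rule c)
    finally show ?thesis .
  qed
  moreover have "0 < a" by (simp add: a_def)
  moreover have "1 \<le> K0" using \<mu> \<delta> by (simp add: K0_def)
  ultimately show ?thesis by blast
qed

theorem bad_words_negligible:
  assumes f: "f \<in> borel_measurable M" and conc: "concentrates f" and \<delta>: "\<delta> > 0" and c: "0 < c1" "0 < c2"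
  shows "(\<lambda>k. real (card {w \<in> big (c1 * real k). length w < n1 \<or> bad f \<delta> w}) /
     real (card (big (c2 * real k)))) \<longlonglongrightarrow> 0"
proof -
  obtain A \<eta> where \<eta>: "0 < \<eta>" "\<eta> < 1" and A: "0 < A" and up: "\<And>K. K \<ge> 1 \<Longrightarrow>
    real (card {w \<in> big K. length w < n1 \<or> bad f \<delta> w}) \<le> A * K powr (1 - \<eta>)"
    using card_bad_words[OF f conc \<delta>, of n1] by blast
  obtain a K0 where a: "0 < a" "1 \<le> K0" and low: "\<And>K. K \<ge> K0 \<Longrightarrow> a * K powr (1 - \<eta> / 2) \<le> real (card (big K))"
    using card_big_ge[of "\<eta> / 2"] \<eta> by auto
  define D where "D = A * c1 powr (1 - \<eta>) / (a * c2 powr (1 - \<eta> / 2))"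
  have ev: "\<forall>\<^sub>F k in sequentially. norm (real (card {w \<in> big (c1 * real k). length w < n1 \<or> bad f \<delta> w}) /
     real (card (big (c2 * real k)))) \<le> D * real k powr (- (\<eta> / 2))"
  proof -
    have "\<forall>\<^sub>F k in sequentially. real k \<ge> max (1 / c1) (max 1 (K0 / c2))"
      by (rule eventually_sequentiallyI[of "nat \<lceil>max (1 / c1) (max 1 (K0 / c2))\<rceil>"]) linarith
    then show ?thesis
    proof eventually_elim
      case (elim k)
      then have k: "1 \<le> c1 * real k" "K0 \<le> c2 * real k" "0 < real k" using c by (auto simp: field_simps)
      have lo: "0 < a * (c2 * real k) powr (1 - \<eta> / 2)" using a k c by simp
      have "real (card {w \<in> big (c1 * real k). length w < n1 \<or> bad f \<delta> w}) / real (card (big (c2 * real k)))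
        \<le> (A * (c1 * real k) powr (1 - \<eta>)) / (a * (c2 * real k) powr (1 - \<eta> / 2))"
        using up[OF k(1)] low[OF k(2)] lo A by (intro frac_le) auto
      also have "\<dots> = D * (real k powr (1 - \<eta>) / real k powr (1 - \<eta> / 2))"
        using c k by (simp add: D_def powr_mult)
      also have "real k powr (1 - \<eta>) / real k powr (1 - \<eta> / 2) = real k powr (- (\<eta> / 2))"
        by (simp add: powr_diff[symmetric])
      finally show ?case by simp
    qed
  qed
  have "(\<lambda>k. D * real k powr (- (\<eta> / 2))) \<longlonglongrightarrow> D * 0"
    using \<eta> by (intro tendsto_intros tendsto_neg_powr filterlim_real_sequentially) auto
  then have "(\<lambda>k. D * real k powr (- (\<eta> / 2))) \<longlonglongrightarrow> 0" by simp
  then show ?thesis by (rule Lim_null_comparison[OF ev])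
qed

end

section \<open>Branches up to their endpoints\<close>

text \<open>A Lipschitz derivative extends continuously to the closed interval, and the fundamental theorem
  of calculus shows that the extension consists of one-sided derivatives at the endpoints.\<close>

lemma one_sided_derivative_extension:
  fixes g g' :: "real \<Rightarrow> real"
  assumes lr: "l < r" and cont: "continuous_on {l..r} g"
    and der: "\<And>x. l < x \<Longrightarrow> x < r \<Longrightarrow> (g has_real_derivative g' x) (at x)"
    and lip: "\<And>x y. l < x \<Longrightarrow> x < r \<Longrightarrow> l < y \<Longrightarrow> y < r \<Longrightarrow> \<bar>g' x - g' y\<bar> \<le> B * \<bar>x - y\<bar>" and B: "0 \<le> B"
  obtains h where "continuous_on {l..r} h" "\<And>x. l < x \<Longrightarrow> x < r \<Longrightarrow> h x = g' x"
    "\<And>x. x \<in> {l..r} \<Longrightarrow> (g has_vector_derivative h x) (at x within {l..r})"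
proof -
  have "B-lipschitz_on {l<..<r} g'"
    using lip B by (intro lipschitz_onI) (auto simp: dist_real_def)
  then have "uniformly_continuous_on {l<..<r} g'" by (rule lipschitz_on_uniformly_continuous)
  then obtain h where uh: "uniformly_continuous_on (closure {l<..<r}) h"
    and h: "\<And>x. x \<in> {l<..<r} \<Longrightarrow> g' x = h x"
    using uniformly_continuous_on_extension_on_closure by metis
  have ch: "continuous_on {l..r} h"
    using uniformly_continuous_imp_continuous[OF uh] lr by simp
  define G where "G x = integral {l..x} h" for x
  have G: "(G has_vector_derivative h x) (at x within {l..r})" if "x \<in> {l..r}" for x
    unfolding G_def using integral_has_vector_derivative[OF ch that] .
  have cG: "continuous_on {l..r} G"
    using G by (meson continuous_on_vector_derivative)
  have const: "(\<lambda>x. g x - G x) x = (\<lambda>x. g x - G x) l" if x: "x \<in> {l..r}" for x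
  proof (rule DERIV_isconst2[OF lr])
    show "continuous_on {l..r} (\<lambda>x. g x - G x)" by (intro continuous_intros cont cG)
    fix y assume y: "l < y" "y < r"
    have "(G has_vector_derivative h y) (at y)"
      using G[of y] y by (simp add: at_within_Icc_at)
    then have "(G has_real_derivative h y) (at y)" by (simp add: has_real_derivative_iff_has_vector_derivative)
    from DERIV_diff[OF der[OF y] this] h[of y] y
    show "((\<lambda>x. g x - G x) has_real_derivative 0) (at y)" by simp
  qed (use x in auto)
  have "(g has_vector_derivative h x) (at x within {l..r})" if x: "x \<in> {l..r}" for x
  proof (rule has_vector_derivative_transform[OF x])
    show "g y = G y + (g l - G l)" if "y \<in> {l..r}" for y using const[OF that] by simp
    show "((\<lambda>y. G y + (g l - G l)) has_vector_derivative h x) (at x within {l..r})"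
      using G[OF x] by (auto intro!: derivative_eq_intros)
  qed
  then show ?thesis using that[of h] ch h by auto
qed

text \<open>The Renyi condition bounds \<open>(ln g')'\<close> by \<open>K g'\<close>, so \<open>ln g'\<close> is \<open>K\<close>-Lipschitz as a function of \<open>g
  x\<close>. This form of bounded distortion passes to compositions and to the endpoints.\<close>

lemma increasing_branch:
  fixes g g' g'' :: "real \<Rightarrow> real"
  assumes lr: "l < r" and cont: "continuous_on {l..r} g" and img: "g ` {l..r} = {0..1}"
    and der: "\<And>x. l < x \<Longrightarrow> x < r \<Longrightarrow> (g has_real_derivative g' x) (at x)"
    and der2: "\<And>x. l < x \<Longrightarrow> x < r \<Longrightarrow> (g' has_real_derivative g'' x) (at x)"
    and pos: "\<And>x. l < x \<Longrightarrow> x < r \<Longrightarrow> k \<le> g' x" and k: "0 < k" and K: "0 < K"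
    and renyi: "\<And>x y z. l < x \<Longrightarrow> x < r \<Longrightarrow> l < y \<Longrightarrow> y < r \<Longrightarrow> l < z \<Longrightarrow> z < r \<Longrightarrow>
       \<bar>g'' x\<bar> \<le> K * (\<bar>g' y\<bar> * \<bar>g' z\<bar>)"
  shows "\<exists>h. continuous_on {l..r} h \<and> (\<forall>x\<in>{l<..<r}. h x = g' x) \<and>
     (\<forall>x\<in>{l..r}. (g has_vector_derivative h x) (at x within {l..r}) \<and> k \<le> \<bar>h x\<bar>) \<and>
     (\<forall>x\<in>{l..r}. \<forall>y\<in>{l..r}. \<bar>ln \<bar>h x\<bar> - ln \<bar>h y\<bar>\<bar> \<le> K * \<bar>g x - g y\<bar>) \<and>
     (\<forall>x\<in>{l..r}. \<forall>y\<in>{l..r}. x < y \<longrightarrow> g x < g y) \<and> g ` {l<..<r} = {0<..<1}"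
proof -
  have mono: "g x < g y" if xy: "x \<in> {l..r}" "y \<in> {l..r}" "x < y" for x y
  proof (rule DERIV_pos_imp_increasing_open[OF xy(3)])
    fix z assume "x < z" "z < y"
    then have z: "l < z" "z < r" using xy by auto
    show "\<exists>d. (g has_real_derivative d) (at z) \<and> 0 < d"
      using der[OF z] pos[OF z] k by (intro exI[of _ "g' z"]) auto
  next
    show "continuous_on {x..y} g" using xy by (intro continuous_on_subset[OF cont]) auto
  qed
  define m where "m = (l + r) / 2"
  have m: "l < m" "m < r" using lr by (auto simp: m_def)
  \<comment> \<open>the Renyi condition at the midpoint bounds \<open>g''\<close>, so that \<open>g'\<close> is Lipschitz and extends\<close>
  define B where "B = K * (\<bar>g' m\<bar> * \<bar>g' m\<bar>)"
  have B: "0 \<le> B" using K by (simp add: B_def)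
  have lip1: "\<bar>g' y - g' x\<bar> \<le> B * \<bar>y - x\<bar>" if xy: "l < x" "x < y" "y < r" for x y
  proof -
    obtain z where z: "x < z" "z < y" "g' y - g' x = (y - x) * g'' z"
      using MVT2[of x y g' g''] xy der2 by (metis less_le_trans le_less_trans)
    have "\<bar>g'' z\<bar> \<le> B" unfolding B_def using z xy m by (intro renyi) auto
    then show ?thesis using z xy by (simp add: abs_mult mult.commute mult_right_mono)
  qed
  have lip: "\<bar>g' x - g' y\<bar> \<le> B * \<bar>x - y\<bar>" if "l < x" "x < r" "l < y" "y < r" for x y
    using lip1[of x y] lip1[of y x] that by (cases x y rule: linorder_cases) (auto simp: abs_minus_commute)
  obtain h where ch: "continuous_on {l..r} h" and h: "\<And>x. l < x \<Longrightarrow> x < r \<Longrightarrow> h x = g' x"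
    and dh: "\<And>x. x \<in> {l..r} \<Longrightarrow> (g has_vector_derivative h x) (at x within {l..r})"
    using one_sided_derivative_extension[OF lr cont der lip B] by blast
  have cl: "closure {l<..<r} = {l..r}" using lr by simp
  have hk: "k \<le> h x" if "x \<in> {l..r}" for x
    by (rule continuous_ge_on_closure[of "{l<..<r}"]) (use cl ch that h pos in auto)
  have ln1: "\<bar>ln (g' y) - ln (g' x)\<bar> \<le> K * \<bar>g y - g x\<bar>" if xy: "l < x" "x < y" "y < r" for x y
  proof -
    have "\<exists>z>x. z < y \<and> ln (g' y) - ln (g' x) = (y - x) * (g'' z / g' z)"
    proof (rule MVT2[OF xy(2)])
      fix t assume "x \<le> t" "t \<le> y"
      then have t: "l < t" "t < r" using xy by auto
      show "((\<lambda>t. ln (g' t)) has_real_derivative g'' t / g' t) (at t)"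
        using der2[OF t] pos[OF t] k by (auto intro!: derivative_eq_intros simp: divide_inverse mult.commute)
    qed
    then obtain z where z: "x < z" "z < y" "ln (g' y) - ln (g' x) = (y - x) * (g'' z / g' z)" by auto
    obtain z' where z': "x < z'" "z' < y" "g y - g x = (y - x) * g' z'"
      using MVT2[of x y g g'] xy der by (metis less_le_trans le_less_trans)
    have zp: "0 < g' z" using pos[of z] z xy k by auto
    have "\<bar>g'' z\<bar> \<le> K * (\<bar>g' z\<bar> * \<bar>g' z'\<bar>)" using z z' xy by (intro renyi) auto
    then have "\<bar>g'' z\<bar> / g' z \<le> K * \<bar>g' z'\<bar>" using zp by (simp add: field_simps)
    then have "(y - x) * (\<bar>g'' z\<bar> / g' z) \<le> (y - x) * (K * \<bar>g' z'\<bar>)" using xy by (intro mult_left_mono) auto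
    then show ?thesis unfolding z(3) z'(3) using xy zp by (simp add: abs_mult mult_ac)
  qed
  have ln2: "\<bar>ln (h x) - ln (h y)\<bar> \<le> K * \<bar>g x - g y\<bar>" if xy: "x \<in> {l<..<r}" "y \<in> {l<..<r}" for x y
    using ln1[of x y] ln1[of y x] xy h by (cases x y rule: linorder_cases) (auto simp: abs_minus_commute)
  have h0: "h x \<noteq> 0" "0 < h x" if "x \<in> {l..r}" for x using hk[OF that] k by auto
  have ln3: "0 \<le> K * \<bar>g x - g y\<bar> - \<bar>ln (h x) - ln (h y)\<bar>" if xy: "x \<in> {l..r}" "y \<in> {l<..<r}" for x y
  proof (rule continuous_ge_on_closure[of "{l<..<r}" "\<lambda>x. K * \<bar>g x - g y\<bar> - \<bar>ln (h x) - ln (h y)\<bar>"])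
    show "continuous_on (closure {l<..<r}) (\<lambda>x. K * \<bar>g x - g y\<bar> - \<bar>ln (h x) - ln (h y)\<bar>)"
      unfolding cl by (intro continuous_intros cont ch) (use h0 in auto)
  qed (use xy cl ln2 in auto)
  have ln4: "0 \<le> K * \<bar>g x - g y\<bar> - \<bar>ln (h x) - ln (h y)\<bar>" if xy: "x \<in> {l..r}" "y \<in> {l..r}" for x y
  proof (rule continuous_ge_on_closure[of "{l<..<r}" "\<lambda>y. K * \<bar>g x - g y\<bar> - \<bar>ln (h x) - ln (h y)\<bar>"])
    show "continuous_on (closure {l<..<r}) (\<lambda>y. K * \<bar>g x - g y\<bar> - \<bar>ln (h x) - ln (h y)\<bar>)"
      unfolding cl by (intro continuous_intros cont ch) (use h0 in auto)
  qed (use xy cl ln3 in auto)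
  have rng: "g x \<in> {0..1}" if "x \<in> {l..r}" for x using img that by blast
  have gl: "g l = 0"
  proof -
    have "0 \<in> g ` {l..r}" unfolding img by simp
    then obtain x where x: "x \<in> {l..r}" "g x = 0" by auto
    then show ?thesis using mono[of l x] rng[of l] lr by (cases "x = l") auto
  qed
  have gr: "g r = 1"
  proof -
    have "1 \<in> g ` {l..r}" unfolding img by simp
    then obtain x where x: "x \<in> {l..r}" "g x = 1" by auto
    then show ?thesis using mono[of x r] rng[of r] lr by (cases "x = r") auto
  qed
  have open_img: "g ` {l<..<r} = {0<..<1}"
  proof
    show "g ` {l<..<r} \<subseteq> {0<..<1}" using mono[of l] mono[of _ r] gl gr lr by auto
    show "{0<..<1} \<subseteq> g ` {l<..<r}"
    proof
      fix y :: real assume y: "y \<in> {0<..<1}"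
      then have "y \<in> g ` {l..r}" using img by auto
      then obtain x where x: "x \<in> {l..r}" "g x = y" by auto
      then have "x \<noteq> l" "x \<noteq> r" using y gl gr by auto
      then show "y \<in> g ` {l<..<r}" using x by auto
    qed
  qed
  show ?thesis
  proof (intro exI[of _ h] conjI ballI impI)
    fix x y assume "x \<in> {l..r}" "y \<in> {l..r}"
    then show "\<bar>ln \<bar>h x\<bar> - ln \<bar>h y\<bar>\<bar> \<le> K * \<bar>g x - g y\<bar>" using ln4[of x y] h0[of x] h0[of y] by simp
  qed (use ch h dh hk mono open_img in \<open>fastforce+\<close>)
qed

text \<open>A decreasing branch \<open>g\<close> is reduced to the increasing branch \<open>1 - g\<close>.\<close>

lemma monotone_branch:
  fixes g g' g'' :: "real \<Rightarrow> real"
  assumes lr: "l < r" and cont: "continuous_on {l..r} g" and img: "g ` {l..r} = {0..1}"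
    and der: "\<And>x. l < x \<Longrightarrow> x < r \<Longrightarrow> (g has_real_derivative g' x) (at x)"
    and der2: "\<And>x. l < x \<Longrightarrow> x < r \<Longrightarrow> (g' has_real_derivative g'' x) (at x)"
    and sgn: "(\<forall>x\<in>{l<..<r}. 0 \<le> g' x) \<or> (\<forall>x\<in>{l<..<r}. g' x \<le> 0)"
    and pos: "\<And>x. l < x \<Longrightarrow> x < r \<Longrightarrow> k \<le> \<bar>g' x\<bar>" and k: "0 < k" and K: "0 < K"
    and renyi: "\<And>x y z. l < x \<Longrightarrow> x < r \<Longrightarrow> l < y \<Longrightarrow> y < r \<Longrightarrow> l < z \<Longrightarrow> z < r \<Longrightarrow>
       \<bar>g'' x\<bar> \<le> K * (\<bar>g' y\<bar> * \<bar>g' z\<bar>)"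
  shows "\<exists>h. continuous_on {l..r} h \<and> (\<forall>x\<in>{l<..<r}. h x = g' x) \<and>
     (\<forall>x\<in>{l..r}. (g has_vector_derivative h x) (at x within {l..r}) \<and> k \<le> \<bar>h x\<bar>) \<and>
     (\<forall>x\<in>{l..r}. \<forall>y\<in>{l..r}. \<bar>ln \<bar>h x\<bar> - ln \<bar>h y\<bar>\<bar> \<le> K * \<bar>g x - g y\<bar>) \<and>
     ((\<forall>x\<in>{l..r}. \<forall>y\<in>{l..r}. x < y \<longrightarrow> g x < g y) \<or> (\<forall>x\<in>{l..r}. \<forall>y\<in>{l..r}. x < y \<longrightarrow> g y < g x)) \<and>
     g ` {l<..<r} = {0<..<1}"
  using sgn
proof
  assume s: "\<forall>x\<in>{l<..<r}. 0 \<le> g' x"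
  have "k \<le> g' x" if "l < x" "x < r" for x using pos[OF that] s that by auto
  from increasing_branch[OF lr cont img der der2 this k K renyi] show ?thesis by blast
next
  assume s: "\<forall>x\<in>{l<..<r}. g' x \<le> 0"
  have p: "k \<le> - g' x" if "l < x" "x < r" for x
  proof -
    have "g' x \<le> 0" using s that by simp
    then show ?thesis using pos[OF that] by simp
  qed
  let ?f = "\<lambda>x. 1 - g x"
  have flip: "(\<lambda>y. 1 - y) ` {0..1} = {0..1::real}" "(\<lambda>y. 1 - y) ` {0<..<1} = {0<..<1::real}"
    by (auto simp: image_iff intro!: bexI[of _ "1 - _"])
  have img': "?f ` {l..r} = {0..1}" using img flip(1) by (metis image_image)
  have "\<exists>h. continuous_on {l..r} h \<and> (\<forall>x\<in>{l<..<r}. h x = - g' x) \<and>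
     (\<forall>x\<in>{l..r}. (?f has_vector_derivative h x) (at x within {l..r}) \<and> k \<le> \<bar>h x\<bar>) \<and>
     (\<forall>x\<in>{l..r}. \<forall>y\<in>{l..r}. \<bar>ln \<bar>h x\<bar> - ln \<bar>h y\<bar>\<bar> \<le> K * \<bar>?f x - ?f y\<bar>) \<and>
     (\<forall>x\<in>{l..r}. \<forall>y\<in>{l..r}. x < y \<longrightarrow> ?f x < ?f y) \<and> ?f ` {l<..<r} = {0<..<1}"
  proof (rule increasing_branch[OF lr _ img' _ _ p k K])
    show "continuous_on {l..r} ?f" by (intro continuous_intros cont)
    show "(?f has_real_derivative - g' x) (at x)" if "l < x" "x < r" for x
      using der[OF that] by (auto intro!: derivative_eq_intros)
    show "((\<lambda>x. - g' x) has_real_derivative - g'' x) (at x)" if "l < x" "x < r" for x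
      using der2[OF that] by (auto intro!: derivative_eq_intros)
    show "\<bar>- g'' x\<bar> \<le> K * (\<bar>- g' y\<bar> * \<bar>- g' z\<bar>)" if "l < x" "x < r" "l < y" "y < r" "l < z" "z < r" for x y z
      using renyi[OF that] by simp
  qed
  then show ?thesis
  proof (elim exE conjE)
    fix h
    assume h: "continuous_on {l..r} h" "\<forall>x\<in>{l<..<r}. h x = - g' x"
      "\<forall>x\<in>{l..r}. (?f has_vector_derivative h x) (at x within {l..r}) \<and> k \<le> \<bar>h x\<bar>"
      "\<forall>x\<in>{l..r}. \<forall>y\<in>{l..r}. \<bar>ln \<bar>h x\<bar> - ln \<bar>h y\<bar>\<bar> \<le> K * \<bar>?f x - ?f y\<bar>"
      "\<forall>x\<in>{l..r}. \<forall>y\<in>{l..r}. x < y \<longrightarrow> ?f x < ?f y" "?f ` {l<..<r} = {0<..<1}"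
    have fi: "g ` {l<..<r} = (\<lambda>y. 1 - y) ` (?f ` {l<..<r})" by (simp add: image_image)
    have der_h: "(g has_vector_derivative - h x) (at x within {l..r})" if "x \<in> {l..r}" for x
    proof -
      have "(?f has_vector_derivative h x) (at x within {l..r})" using h(3) that by blast
      from has_vector_derivative_diff[OF has_vector_derivative_const[of 1] this]
      have "((\<lambda>x. 1 - ?f x) has_vector_derivative - h x) (at x within {l..r})" by simp
      then show ?thesis by simp
    qed
    show ?thesis
    proof (intro exI[of _ "\<lambda>x. - h x"] conjI ballI)
      show "continuous_on {l..r} (\<lambda>x. - h x)" by (intro continuous_intros h)
      show "(\<forall>x\<in>{l..r}. \<forall>y\<in>{l..r}. x < y \<longrightarrow> g x < g y) \<or> (\<forall>x\<in>{l..r}. \<forall>y\<in>{l..r}. x < y \<longrightarrow> g y < g x)"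
        using h(5) by simp
      show "g ` {l<..<r} = {0<..<1}" unfolding fi h(6) by (rule flip(2))
      show "\<bar>ln \<bar>- h x\<bar> - ln \<bar>- h y\<bar>\<bar> \<le> K * \<bar>g x - g y\<bar>" if "x \<in> {l..r}" "y \<in> {l..r}" for x y
        using h(4) that by (simp add: abs_minus_commute)
    qed (use h der_h in auto)
  qed
qed

section \<open>Full-branch maps, pullbacks and distortion\<close>

text \<open>The branches are numbered from \<open>0\<close> here, which makes every natural number a digit.\<close>

definition branch :: "(nat \<Rightarrow> real) \<Rightarrow> nat \<Rightarrow> real set" where
  "branch d a = branch_dom d (Suc a)"

text \<open>The points that follow the word and then land in \<open>E\<close>. Cylinders are the case \<open>E = {0..1}\<close>;
  boundary points with a given code are the case \<open>E = {0}\<close>.\<close>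

fun pull :: "(nat \<Rightarrow> real) \<Rightarrow> (real \<Rightarrow> real) \<Rightarrow> nat list \<Rightarrow> real set \<Rightarrow> real set" where
  "pull d T [] E = E"
| "pull d T (a # w) E = {x \<in> branch d a. T x \<in> pull d T w E}"

text \<open>The constants in the definition of an EMR map with superlinear branch expansion are parameters,
  so that later constants can be defined from them.\<close>

locale emr =
  fixes d :: "nat \<Rightarrow> real" and T :: "real \<Rightarrow> real" and K \<xi> c \<alpha> :: real and n0 :: nat
  assumes full: "full_branch_map d T"
    and C1: "T C1_differentiable_on branch_interiors d"
    and C2: "deriv T C1_differentiable_on branch_interiors d"
    and xi: "1 < \<xi>" and n0: "1 \<le> n0"
    and expanding: "\<And>x. (\<And>i. i < n0 \<Longrightarrow> (T ^^ i) x \<in> branch_interiors d) \<Longrightarrow> \<xi> \<le> \<bar>deriv (T ^^ n0) x\<bar>"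
    and K_pos: "0 < K"
    and renyi: "\<And>n x y z. 1 \<le> n \<Longrightarrow> x \<in> interior (branch_dom d n) \<Longrightarrow> y \<in> interior (branch_dom d n) \<Longrightarrow>
      z \<in> interior (branch_dom d n) \<Longrightarrow> \<bar>deriv (deriv T) x\<bar> \<le> K * (\<bar>deriv T y\<bar> * \<bar>deriv T z\<bar>)"
    and c_pos: "0 < c" and alpha: "1 < \<alpha>"
    and superlinear: "\<And>n x. 1 \<le> n \<Longrightarrow> x \<in> interior (branch_dom d n) \<Longrightarrow> c * real n powr \<alpha> \<le> \<bar>deriv T x\<bar>"
begin

abbreviation "J \<equiv> branch d"
abbreviation "lo a \<equiv> d (Suc (Suc a))"
abbreviation "hi a \<equiv> d (Suc a)"

lemma J_eq: "J a = {lo a<..hi a}" by (simp add: branch_def branch_dom_def)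

lemma d_strict: "1 \<le> m \<Longrightarrow> m < n \<Longrightarrow> d n < d m"
  using full unfolding full_branch_map_def monotone_on_def by auto

lemma d_1: "d 1 = 1" and d_lim: "d \<longlonglongrightarrow> 0" and T_range: "x \<in> {0<..1} \<Longrightarrow> T x \<in> {0..1}"
  using full unfolding full_branch_map_def by auto

lemma lo_less_hi: "lo a < hi a" by (rule d_strict) auto

lemma d_pos: "1 \<le> n \<Longrightarrow> 0 < d n"
proof -
  assume n: "1 \<le> n"
  have "0 \<le> d (Suc n)"
    by (rule LIMSEQ_le_const2[OF d_lim]) (use n d_strict[of "Suc n"] in \<open>force intro!: exI[of _ "Suc n"] simp: le_less\<close>)
  then show ?thesis using d_strict[of n "Suc n"] n by simp
qed

lemma d_le_1: "1 \<le> n \<Longrightarrow> d n \<le> 1"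
  using d_strict[of 1 n] d_1 by (cases "n = 1") auto

lemma J_subset: "J a \<subseteq> {0<..1}"
  using d_pos[of "Suc (Suc a)"] d_le_1[of "Suc a"] by (auto simp: J_eq)

lemma J_disjoint: "x \<in> J a \<Longrightarrow> x \<in> J b \<Longrightarrow> a = b"
proof (induction a b rule: linorder_wlog)
  case (le a b)
  show ?case
  proof (rule ccontr)
    assume "a \<noteq> b"
    then have "hi b \<le> lo a" using d_strict[of "Suc (Suc a)" "Suc b"] le by (cases "Suc a = b") auto
    then show False using le by (auto simp: J_eq)
  qed
qed auto

lemma J_cover: "x \<in> {0<..1} \<Longrightarrow> \<exists>a. x \<in> J a"
proof -
  assume x: "x \<in> {0<..1}"
  have "\<forall>\<^sub>F n in sequentially. d n < x" using d_lim x by (intro order_tendstoD(2)) auto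
  then have "\<exists>n. d (Suc n) < x" unfolding eventually_sequentially by (meson le_SucI order_refl)
  define n where "n = (LEAST n. d (Suc n) < x)"
  have n: "d (Suc n) < x" unfolding n_def by (rule LeastI_ex) fact
  have "n \<noteq> 0" using n d_1 x by (cases n) auto
  then obtain a where a: "n = Suc a" by (cases n) auto
  have "\<not> d (Suc a) < x" using not_less_Least[of a "\<lambda>n. d (Suc n) < x"] a by (simp add: n_def)
  then show ?thesis using n a by (intro exI[of _ a]) (auto simp: J_eq)
qed

lemma J_interior: "interior (branch_dom d (Suc a)) = {lo a<..<hi a}"
  by (simp add: branch_dom_def)

lemma interior_iff: "x \<in> branch_interiors d \<longleftrightarrow> (\<exists>a. x \<in> {lo a<..<hi a})"
proof
  assume "x \<in> branch_interiors d"
  then obtain n where n: "n \<ge> 1" "x \<in> interior (branch_dom d n)" by (auto simp: branch_interiors_def)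
  then obtain a where "n = Suc a" by (cases n) auto
  then have "x \<in> {lo a<..<hi a}" using n J_interior by simp
  then show "\<exists>a. x \<in> {lo a<..<hi a}" ..
next
  assume "\<exists>a. x \<in> {lo a<..<hi a}"
  then obtain a where "x \<in> interior (branch_dom d (Suc a))" by (auto simp: J_interior)
  then show "x \<in> branch_interiors d" by (auto simp: branch_interiors_def intro!: bexI[of _ "Suc a"])
qed

lemma C1_imp_deriv:
  assumes "f C1_differentiable_on S" "x \<in> S"
  shows "(f has_real_derivative deriv f x) (at x)"
proof -
  from assms obtain D where "(f has_vector_derivative D x) (at x)"
    by (auto simp: C1_differentiable_on_def)
  then have "(f has_real_derivative D x) (at x)" by (simp add: has_real_derivative_iff_has_vector_derivative)
  then show ?thesis using DERIV_imp_deriv by metis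
qed

text \<open>\<open>monotone_branch\<close> for the continuous extension to the closed interval; the branch itself
  contains the right endpoint only.\<close>

lemma branch_facts:
  "\<exists>h. continuous_on {lo a..hi a} h \<and> (\<forall>x\<in>{lo a<..<hi a}. h x = deriv T x) \<and>
     (\<forall>x\<in>J a. (T has_vector_derivative h x) (at x within J a) \<and> c * real (Suc a) powr \<alpha> \<le> \<bar>h x\<bar>) \<and>
     (\<forall>x\<in>J a. \<forall>y\<in>J a. \<bar>ln \<bar>h x\<bar> - ln \<bar>h y\<bar>\<bar> \<le> K * \<bar>T x - T y\<bar>) \<and>
     ((\<forall>x\<in>J a. \<forall>y\<in>J a. x < y \<longrightarrow> T x < T y) \<or> (\<forall>x\<in>J a. \<forall>y\<in>J a. x < y \<longrightarrow> T y < T x)) \<and>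
     T ` {lo a<..<hi a} = {0<..<1}"
proof -
  let ?l = "lo a" and ?r = "hi a"
  have Jd: "branch_dom d (Suc a) = J a" by (simp add: branch_def)
  have cl: "closure (J a) = {?l..?r}" using lo_less_hi by (simp add: J_eq)
  obtain g where g: "continuous_on {?l..?r} g" "\<And>x. x \<in> J a \<Longrightarrow> g x = T x" "g ` {?l..?r} = {0..1}"
    using full unfolding full_branch_map_def Jd[symmetric] by (metis Jd cl le_add1 plus_1_eq_Suc)
  have mon: "mono_on (J a) T \<or> antimono_on (J a) T"
    using full unfolding full_branch_map_def Jd[symmetric] by auto
  have inB: "x \<in> branch_interiors d" if "?l < x" "x < ?r" for x using interior_iff that by auto
  have inI: "x \<in> interior (J a)" if "?l < x" "x < ?r" for x
    using that J_interior[of a] unfolding Jd by auto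
  have dT: "(T has_real_derivative deriv T x) (at x)" if "?l < x" "x < ?r" for x
    using C1_imp_deriv[OF C1 inB[OF that]] .
  have dg: "(g has_real_derivative deriv T x) (at x)" if x: "?l < x" "x < ?r" for x
  proof (rule has_field_derivative_transform_within_open[OF dT[OF x]])
    show "open {?l<..<?r}" "x \<in> {?l<..<?r}" using x by auto
    show "T y = g y" if "y \<in> {?l<..<?r}" for y using g(2)[of y] that by (simp add: J_eq)
  qed
  have "\<exists>h. continuous_on {?l..?r} h \<and> (\<forall>x\<in>{?l<..<?r}. h x = deriv T x) \<and>
     (\<forall>x\<in>{?l..?r}. (g has_vector_derivative h x) (at x within {?l..?r}) \<and> c * real (Suc a) powr \<alpha> \<le> \<bar>h x\<bar>) \<and>
     (\<forall>x\<in>{?l..?r}. \<forall>y\<in>{?l..?r}. \<bar>ln \<bar>h x\<bar> - ln \<bar>h y\<bar>\<bar> \<le> K * \<bar>g x - g y\<bar>) \<and>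
     ((\<forall>x\<in>{?l..?r}. \<forall>y\<in>{?l..?r}. x < y \<longrightarrow> g x < g y) \<or> (\<forall>x\<in>{?l..?r}. \<forall>y\<in>{?l..?r}. x < y \<longrightarrow> g y < g x)) \<and>
     g ` {?l<..<?r} = {0<..<1}"
  proof (rule monotone_branch[OF lo_less_hi g(1,3) dg])
    show "(deriv T has_real_derivative deriv (deriv T) x) (at x)" if "?l < x" "x < ?r" for x
      using C1_imp_deriv[OF C2 inB[OF that]] .
    show "(\<forall>x\<in>{?l<..<?r}. 0 \<le> deriv T x) \<or> (\<forall>x\<in>{?l<..<?r}. deriv T x \<le> 0)"
      using mon
    proof
      assume m: "mono_on (J a) T"
      have "0 \<le> deriv T x" if "x \<in> {?l<..<?r}" for x
        using mono_on_imp_deriv_nonneg[OF m dT inI] that by auto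
      then show ?thesis by blast
    next
      assume "antimono_on (J a) T"
      then have m: "mono_on (J a) (\<lambda>x. - T x)" by (auto simp: monotone_on_def)
      have "0 \<le> - deriv T x" if "x \<in> {?l<..<?r}" for x
        using mono_on_imp_deriv_nonneg[OF m DERIV_minus[OF dT] inI] that by auto
      then show ?thesis by fastforce
    qed
    show "c * real (Suc a) powr \<alpha> \<le> \<bar>deriv T x\<bar>" if "?l < x" "x < ?r" for x
      using superlinear[of "Suc a" x] that by (simp add: J_interior)
    show "0 < c * real (Suc a) powr \<alpha>" using c_pos by simp
    show "0 < K" by (rule K_pos)
    show "\<bar>deriv (deriv T) x\<bar> \<le> K * (\<bar>deriv T y\<bar> * \<bar>deriv T z\<bar>)"
      if "?l < x" "x < ?r" "?l < y" "y < ?r" "?l < z" "z < ?r" for x y z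
      using renyi[of "Suc a" x y z] that by (simp add: J_interior)
  qed
  then show ?thesis
  proof (elim exE conjE)
    fix h
    assume h: "continuous_on {?l..?r} h" "\<forall>x\<in>{?l<..<?r}. h x = deriv T x"
      "\<forall>x\<in>{?l..?r}. (g has_vector_derivative h x) (at x within {?l..?r}) \<and> c * real (Suc a) powr \<alpha> \<le> \<bar>h x\<bar>"
      "\<forall>x\<in>{?l..?r}. \<forall>y\<in>{?l..?r}. \<bar>ln \<bar>h x\<bar> - ln \<bar>h y\<bar>\<bar> \<le> K * \<bar>g x - g y\<bar>"
      "(\<forall>x\<in>{?l..?r}. \<forall>y\<in>{?l..?r}. x < y \<longrightarrow> g x < g y) \<or> (\<forall>x\<in>{?l..?r}. \<forall>y\<in>{?l..?r}. x < y \<longrightarrow> g y < g x)"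
      "g ` {?l<..<?r} = {0<..<1}"
    have sub: "J a \<subseteq> {?l..?r}" "{?l<..<?r} \<subseteq> J a" by (auto simp: J_eq)
    show ?thesis
    proof (intro exI[of _ h] conjI ballI)
      fix x assume x: "x \<in> J a"
      have "(g has_vector_derivative h x) (at x within J a)"
        using h(3) x sub has_vector_derivative_within_subset by blast
      then show "(T has_vector_derivative h x) (at x within J a)"
        by (rule has_vector_derivative_transform[OF x, rotated]) (simp add: g(2))
      show "c * real (Suc a) powr \<alpha> \<le> \<bar>h x\<bar>" using h(3) x sub by blast
      show "\<bar>ln \<bar>h x\<bar> - ln \<bar>h y\<bar>\<bar> \<le> K * \<bar>T x - T y\<bar>" if "y \<in> J a" for y
      proof -
        have "\<bar>ln \<bar>h x\<bar> - ln \<bar>h y\<bar>\<bar> \<le> K * \<bar>g x - g y\<bar>" using h(4) x that sub(1) by blast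
        then show ?thesis using g(2) x that by simp
      qed
    next
      show "(\<forall>x\<in>J a. \<forall>y\<in>J a. x < y \<longrightarrow> T x < T y) \<or> (\<forall>x\<in>J a. \<forall>y\<in>J a. x < y \<longrightarrow> T y < T x)"
      proof (rule disjE[OF h(5)])
        assume m: "\<forall>x\<in>{?l..?r}. \<forall>y\<in>{?l..?r}. x < y \<longrightarrow> g x < g y"
        have "T x < T y" if "x \<in> J a" "y \<in> J a" "x < y" for x y
          using m sub(1) that unfolding g(2)[OF that(1), symmetric] g(2)[OF that(2), symmetric] by blast
        then show ?thesis by blast
      next
        assume m: "\<forall>x\<in>{?l..?r}. \<forall>y\<in>{?l..?r}. x < y \<longrightarrow> g y < g x"
        have "T y < T x" if "x \<in> J a" "y \<in> J a" "x < y" for x y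
          using m sub(1) that unfolding g(2)[OF that(1), symmetric] g(2)[OF that(2), symmetric] by blast
        then show ?thesis by blast
      qed
      show "T ` {?l<..<?r} = {0<..<1}" unfolding h(6)[symmetric]
        using sub(2) g(2) by (intro image_cong) auto
      show "h x = deriv T x" if "x \<in> {?l<..<?r}" for x using h(2) that by blast
    qed (rule h(1))
  qed
qed

text \<open>The derivative at the right endpoint of a branch is one-sided; for word length \<open>1\<close> the given
  derivative along the cylinder takes care of it.\<close>

definition dT :: "real \<Rightarrow> real" where "dT x = iter_deriv d T 1 x"

lemma cylinder_1: "x \<in> J a \<Longrightarrow> cylinder d T 1 x = J a"
proof -
  assume x: "x \<in> J a"
  have "m = Suc a" if m: "m \<ge> 1" "x \<in> branch_dom d m" for m
  proof -
    obtain b where "m = Suc b" using m by (cases m) auto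
    then show ?thesis using m x J_disjoint[of x a b] by (simp add: branch_def)
  qed
  then show ?thesis using x unfolding cylinder_def branch_def by fastforce
qed

lemma J_nontrivial: "x \<in> J a \<Longrightarrow> at x within J a \<noteq> bot"
proof -
  assume x: "x \<in> J a"
  have "x islimpt J a"
  proof (rule connected_imp_perfect[OF _ x])
    show "connected (J a)" by (simp add: J_eq)
    show "J a \<noteq> {y}" for y
    proof
      assume e: "J a = {y}"
      have "hi a \<in> J a" "(lo a + hi a) / 2 \<in> J a" using lo_less_hi[of a] by (auto simp: J_eq)
      then show False using lo_less_hi[of a] unfolding e by auto
    qed
  qed
  then show ?thesis by (simp add: trivial_limit_within)
qed

lemma branch_derivative:
  shows "x \<in> J a \<Longrightarrow> (T has_vector_derivative dT x) (at x within J a)"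
    and "x \<in> J a \<Longrightarrow> c * real (Suc a) powr \<alpha> \<le> \<bar>dT x\<bar>"
    and "continuous_on (J a) dT"
    and "x \<in> J a \<Longrightarrow> y \<in> J a \<Longrightarrow> \<bar>ln \<bar>dT x\<bar> - ln \<bar>dT y\<bar>\<bar> \<le> K * \<bar>T x - T y\<bar>"
    and "(\<forall>x\<in>J a. \<forall>y\<in>J a. x < y \<longrightarrow> T x < T y) \<or> (\<forall>x\<in>J a. \<forall>y\<in>J a. x < y \<longrightarrow> T y < T x)"
    and "T ` {lo a<..<hi a} = {0<..<1}"
    and "x \<in> {lo a<..<hi a} \<Longrightarrow> dT x = deriv T x"
proof -
  obtain h where h: "continuous_on {lo a..hi a} h" "\<forall>x\<in>{lo a<..<hi a}. h x = deriv T x"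
     "\<forall>x\<in>J a. (T has_vector_derivative h x) (at x within J a) \<and> c * real (Suc a) powr \<alpha> \<le> \<bar>h x\<bar>"
     "\<forall>x\<in>J a. \<forall>y\<in>J a. \<bar>ln \<bar>h x\<bar> - ln \<bar>h y\<bar>\<bar> \<le> K * \<bar>T x - T y\<bar>"
     "(\<forall>x\<in>J a. \<forall>y\<in>J a. x < y \<longrightarrow> T x < T y) \<or> (\<forall>x\<in>J a. \<forall>y\<in>J a. x < y \<longrightarrow> T y < T x)"
     "T ` {lo a<..<hi a} = {0<..<1}"
    using branch_facts[of a] by (elim exE conjE) (rule that)
  have e: "dT x = h x" if x: "x \<in> J a" for x
  proof -
    have hd: "(T has_vector_derivative h x) (at x within J a)" using h(3) x by blast
    have "dT x = vector_derivative T (at x within J a)"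
      unfolding dT_def iter_deriv_def cylinder_1[OF x] by simp
    also have "\<dots> = h x" by (rule vector_derivative_within[OF J_nontrivial[OF x] hd])
    finally show ?thesis .
  qed
  show "x \<in> J a \<Longrightarrow> (T has_vector_derivative dT x) (at x within J a)" using h(3) e by simp
  show "x \<in> J a \<Longrightarrow> c * real (Suc a) powr \<alpha> \<le> \<bar>dT x\<bar>" using h(3) e by simp
  show "continuous_on (J a) dT"
  proof (subst continuous_on_cong[OF refl e])
    show "continuous_on (J a) h" using h(1) by (rule continuous_on_subset) (auto simp: J_eq)
  qed
  show "x \<in> J a \<Longrightarrow> y \<in> J a \<Longrightarrow> \<bar>ln \<bar>dT x\<bar> - ln \<bar>dT y\<bar>\<bar> \<le> K * \<bar>T x - T y\<bar>" using h(4) e by simp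
  show "(\<forall>x\<in>J a. \<forall>y\<in>J a. x < y \<longrightarrow> T x < T y) \<or> (\<forall>x\<in>J a. \<forall>y\<in>J a. x < y \<longrightarrow> T y < T x)" by (rule h(5))
  show "T ` {lo a<..<hi a} = {0<..<1}" by (rule h(6))
  show "x \<in> {lo a<..<hi a} \<Longrightarrow> dT x = deriv T x"
    using h(2) e[of x] by (simp add: J_eq)
qed

lemma dT_ge_c: "x \<in> J a \<Longrightarrow> c \<le> \<bar>dT x\<bar>"
proof -
  assume x: "x \<in> J a"
  have "c * 1 \<le> c * real (Suc a) powr \<alpha>"
    using alpha c_pos by (intro mult_left_mono ge_one_powr_ge_zero) auto
  then show ?thesis using branch_derivative(2)[OF x] by simp
qed

abbreviation "P \<equiv> pull d T"
abbreviation "cy w \<equiv> P w {0..1}"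

lemma P_iff: "x \<in> P w E \<longleftrightarrow> (\<forall>i<length w. (T ^^ i) x \<in> J (w ! i)) \<and> (T ^^ length w) x \<in> E"
proof (induction w arbitrary: x)
  case (Cons a w)
  have "x \<in> P (a # w) E \<longleftrightarrow> x \<in> J a \<and> (\<forall>i<length w. (T ^^ Suc i) x \<in> J (w ! i)) \<and> (T ^^ Suc (length w)) x \<in> E"
    by (simp add: Cons.IH funpow_swap1)
  also have "\<dots> \<longleftrightarrow> (\<forall>i<length (a # w). (T ^^ i) x \<in> J ((a # w) ! i)) \<and> (T ^^ length (a # w)) x \<in> E"
    by (simp add: All_less_Suc2)
  finally show ?case .
qed simp

lemma P_append: "P (w @ u) E = P w (P u E)"
  by (induction w) auto

lemma P_mono: "E \<subseteq> F \<Longrightarrow> P w E \<subseteq> P w F"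
  by (induction w) auto

lemma P_funpow: "x \<in> P w E \<Longrightarrow> (T ^^ length w) x \<in> E" by (simp add: P_iff)

lemma P_subset_unit: "E \<subseteq> {0..1} \<Longrightarrow> P w E \<subseteq> {0..1}"
  using J_subset by (cases w) force+

lemma P_in_cy: "E \<subseteq> {0..1} \<Longrightarrow> P w E \<subseteq> cy w" by (rule P_mono)

definition Dn :: "nat \<Rightarrow> real \<Rightarrow> real" where "Dn n x = (\<Prod>i<n. \<bar>dT ((T ^^ i) x)\<bar>)"

lemma Dn_pos: "x \<in> P w E \<Longrightarrow> 0 < Dn (length w) x"
  unfolding Dn_def
proof (intro prod_pos ballI)
  fix i assume "x \<in> P w E" "i \<in> {..<length w}"
  then have "(T ^^ i) x \<in> J (w ! i)" by (simp add: P_iff)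
  then show "0 < \<bar>dT ((T ^^ i) x)\<bar>" using dT_ge_c c_pos by fastforce
qed

lemma P_derivative:
  "x \<in> cy w \<Longrightarrow> ((T ^^ length w) has_vector_derivative (\<Prod>i<length w. dT ((T ^^ i) x))) (at x within cy w)"
proof (induction w arbitrary: x)
  case Nil
  then show ?case by (simp add: id_def)
next
  case (Cons a w)
  have x: "x \<in> J a" "T x \<in> cy w" using Cons.prems by auto
  have 1: "(T has_vector_derivative dT x) (at x within cy (a # w))"
    using branch_derivative(1)[OF x(1)] by (rule has_vector_derivative_within_subset) auto
  have 2: "((T ^^ length w) has_vector_derivative (\<Prod>i<length w. dT ((T ^^ i) (T x)))) (at (T x) within T ` cy (a # w))"
    using Cons.IH[OF x(2)] by (rule has_vector_derivative_within_subset) auto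
  have "((T ^^ length w \<circ> T) has_vector_derivative dT x *\<^sub>R (\<Prod>i<length w. dT ((T ^^ i) (T x)))) (at x within cy (a # w))"
    by (rule vector_diff_chain_within[OF 1 2])
  moreover have "T ^^ length (a # w) = T ^^ length w \<circ> T" using funpow_Suc_right by simp
  moreover have "dT x *\<^sub>R (\<Prod>i<length w. dT ((T ^^ i) (T x))) = (\<Prod>i<length (a # w). dT ((T ^^ i) x))"
    by (simp add: prod.lessThan_Suc_shift funpow_swap1 del: prod.lessThan_Suc funpow.simps)
       (simp add: funpow_swap1)
  ultimately show ?case by (simp only:)
qed

lemma P_inj: "inj_on (T ^^ length w) (cy w)"
proof (induction w)
  case (Cons a w)
  have injT: "inj_on T (J a)"
    using branch_derivative(5)[of a] by (intro inj_onI) (metis less_irrefl linorder_less_linear)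
  show ?case
  proof (rule inj_onI)
    fix x y assume xy: "x \<in> cy (a # w)" "y \<in> cy (a # w)" "(T ^^ length (a # w)) x = (T ^^ length (a # w)) y"
    then have "(T ^^ length w) (T x) = (T ^^ length w) (T y)" by (simp add: funpow_swap1)
    then have "T x = T y" using Cons xy by (auto dest: inj_onD)
    then show "x = y" using injT xy by (auto dest: inj_onD)
  qed
qed (simp add: id_def)

lemma P_interval: "is_interval E \<Longrightarrow> is_interval (P w E)"
proof (induction w)
  case (Cons a w)
  show ?case
    unfolding is_interval_1
  proof (intro ballI allI impI)
    fix x y z assume x: "x \<in> P (a # w) E" and y: "y \<in> P (a # w) E" and z: "x \<le> z \<and> z \<le> y"
    have Jz: "x \<in> J a" "y \<in> J a" "z \<in> J a" using x y z by (auto simp: J_eq)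
    have m: "T x \<le> T z \<and> T z \<le> T y \<or> T y \<le> T z \<and> T z \<le> T x"
    proof -
      have "x = z \<or> x < z" "z = y \<or> z < y" using z by auto
      then show ?thesis using branch_derivative(5)[of a] Jz by (elim disjE) (auto simp: less_imp_le)
    qed
    have "T x \<in> P w E" "T y \<in> P w E" using x y by auto
    then have "T z \<in> P w E" using Cons m unfolding is_interval_1 by blast
    then show "z \<in> P (a # w) E" using Jz by simp
  qed
qed simp

lemma P_onto: "y \<in> {0<..<1} \<Longrightarrow> \<exists>x\<in>cy w \<inter> {0<..<1}. (T ^^ length w) x = y"
proof (induction w)
  case (Cons a w)
  then obtain x' where x': "x' \<in> cy w" "x' \<in> {0<..<1}" "(T ^^ length w) x' = y" by blast
  then obtain x where x: "x \<in> {lo a<..<hi a}" "T x = x'" using branch_derivative(6)[of a] by (metis imageE)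
  have "x \<in> {0<..<1}" using x(1) d_pos[of "Suc (Suc a)"] d_le_1[of "Suc a"] by auto
  moreover have "x \<in> cy (a # w)" using x x' by (auto simp: J_eq)
  moreover have "(T ^^ length (a # w)) x = y" using x x' by (simp add: funpow_swap1)
  ultimately show ?case by blast
qed auto

lemma P_islimpt: "x \<in> cy w \<Longrightarrow> x islimpt cy w"
proof (rule connected_imp_perfect)
  show "connected (cy w)" using P_interval[of "{0..1}" w] is_interval_connected_1 is_interval_cc by blast
  show "cy w \<noteq> {x}" for x
  proof
    assume e: "cy w = {x}"
    obtain y z where "y \<in> cy w" "(T ^^ length w) y = 1 / 2" "z \<in> cy w" "(T ^^ length w) z = 1 / 3"
      using P_onto[of "1 / 2" w] P_onto[of "1 / 3" w] by auto
    then show False unfolding e by auto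
  qed
qed

text \<open>Identifies the cylinders in the definition of the one-sided derivative with the pullbacks of the
  unit interval.\<close>

lemma cylinder_eq: "x \<in> cy w \<Longrightarrow> w \<noteq> [] \<Longrightarrow> cylinder d T (length w) x = cy w"
proof -
  assume x: "x \<in> cy w" and w: "w \<noteq> []"
  have j: "y' \<in> J (w ! i) \<longleftrightarrow> (\<exists>m\<ge>1. (T ^^ i) x \<in> branch_dom d m \<and> y' \<in> branch_dom d m)" if "i < length w" for i y'
  proof
    have xi: "(T ^^ i) x \<in> J (w ! i)" using x that by (simp add: P_iff)
    then show "y' \<in> J (w ! i) \<Longrightarrow> \<exists>m\<ge>1. (T ^^ i) x \<in> branch_dom d m \<and> y' \<in> branch_dom d m"
      by (intro exI[of _ "Suc (w ! i)"]) (auto simp: branch_def)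
    assume "\<exists>m\<ge>1. (T ^^ i) x \<in> branch_dom d m \<and> y' \<in> branch_dom d m"
    then obtain m where m: "m \<ge> 1" "(T ^^ i) x \<in> branch_dom d m" "y' \<in> branch_dom d m" by auto
    obtain b where "m = Suc b" using m by (cases m) auto
    then show "y' \<in> J (w ! i)" using m J_disjoint[OF xi, of b] by (auto simp: branch_def)
  qed
  have last: "(T ^^ length w) y \<in> {0..1}" if "\<forall>i<length w. (T ^^ i) y \<in> J (w ! i)" for y
  proof -
    obtain n where n: "length w = Suc n" using w by (cases w) auto
    then have "(T ^^ n) y \<in> J (w ! n)" using that by auto
    then have "(T ^^ n) y \<in> {0<..1}" using J_subset by blast
    then show ?thesis using T_range n by simp
  qed
  show ?thesis
  proof (rule set_eqI)
    fix y
    show "y \<in> cylinder d T (length w) x \<longleftrightarrow> y \<in> cy w"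
      using j last[of y] unfolding cylinder_def P_iff by auto
  qed
qed

lemma iter_deriv_eq: "x \<in> cy w \<Longrightarrow> w \<noteq> [] \<Longrightarrow> \<bar>iter_deriv d T (length w) x\<bar> = Dn (length w) x"
proof -
  assume x: "x \<in> cy w" and w: "w \<noteq> []"
  have "at x within cy w \<noteq> bot" using P_islimpt[OF x] by (simp add: trivial_limit_within)
  then have "iter_deriv d T (length w) x = (\<Prod>i<length w. dT ((T ^^ i) x))"
    unfolding iter_deriv_def cylinder_eq[OF x w] using P_derivative[OF x] by (rule vector_derivative_within)
  then show ?thesis by (simp add: Dn_def abs_prod)
qed

lemma P_mvt:
  assumes x: "x \<in> cy w" and y: "y \<in> cy w"
  shows "\<exists>z\<in>cy w. \<bar>(T ^^ length w) x - (T ^^ length w) y\<bar> = Dn (length w) z * \<bar>x - y\<bar>"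
  using assms
proof (induction x y rule: linorder_wlog)
  case (le x y)
  let ?D = "\<lambda>x. \<Prod>i<length w. dT ((T ^^ i) x)"
  have sub: "{x..y} \<subseteq> cy w"
    using mem_is_interval_1_I[OF P_interval[OF is_interval_cc], of x w 0 1 y] le by auto
  have "\<exists>z\<in>{x..y}. (T ^^ length w) y - (T ^^ length w) x = (\<lambda>h. h *\<^sub>R ?D z) (y - x)"
  proof (rule mvt_very_simple[OF le(1)])
    fix z assume "x \<le> z" "z \<le> y"
    then have "z \<in> cy w" using sub by auto
    then have "((T ^^ length w) has_vector_derivative ?D z) (at z within {x..y})"
      using has_vector_derivative_within_subset[OF P_derivative sub] by blast
    then show "((T ^^ length w) has_derivative (\<lambda>h. h *\<^sub>R ?D z)) (at z within {x..y})"
      by (simp add: has_vector_derivative_def)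
  qed
  then obtain z where z: "z \<in> {x..y}" "(T ^^ length w) y - (T ^^ length w) x = (y - x) * ?D z" by auto
  have "\<bar>(T ^^ length w) x - (T ^^ length w) y\<bar> = \<bar>(T ^^ length w) y - (T ^^ length w) x\<bar>" by simp
  also have "\<dots> = Dn (length w) z * \<bar>x - y\<bar>"
    unfolding z(2) by (simp add: abs_mult Dn_def abs_prod mult.commute abs_minus_commute)
  finally show ?case using z sub by blast
next
  case (sym x y)
  then show ?case by (metis abs_minus_commute)
qed

lemma Dn_add: "Dn (m + n) x = Dn m x * Dn n ((T ^^ m) x)"
proof (induction n)
  case (Suc n)
  have "(T ^^ (m + n)) x = (T ^^ n) ((T ^^ m) x)"
    using funpow_add[of n m T] by (simp add: add.commute)
  then show ?case using Suc by (simp add: Dn_def)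
qed (simp add: Dn_def)

lemma P_take_drop: "k \<le> length w \<Longrightarrow> P w E = P (take k w) (P (drop k w) E)"
  by (simp flip: P_append)

lemma cy_take: "k \<le> length w \<Longrightarrow> cy w \<subseteq> cy (take k w)"
  using P_take_drop[of k w "{0..1}"] P_mono[OF P_subset_unit[OF order_refl, of "drop k w"], of "take k w"] by simp

lemma cy_drop: "x \<in> cy w \<Longrightarrow> k \<le> length w \<Longrightarrow> (T ^^ k) x \<in> cy (drop k w)"
  using P_funpow[of x "take k w" "cy (drop k w)"] P_take_drop[of k w "{0..1}"] by (simp add: min_absorb2)

lemma continuous_on_iterate: "i \<le> length w \<Longrightarrow> continuous_on (cy w) (T ^^ i)"
proof -
  assume i: "i \<le> length w"
  have "continuous_on (cy (take i w)) (T ^^ length (take i w))"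
    using P_derivative by (rule continuous_on_vector_derivative)
  then have "continuous_on (cy (take i w)) (T ^^ i)" using i by (simp add: min_absorb2)
  then show ?thesis using cy_take[OF i] by (rule continuous_on_subset)
qed

lemma continuous_on_Dn: "continuous_on (cy w) (Dn (length w))"
  unfolding Dn_def[abs_def]
proof (intro continuous_intros)
  fix i assume i: "i \<in> {..<length w}"
  show "continuous_on (cy w) (\<lambda>x. dT ((T ^^ i) x))"
    by (rule continuous_on_compose2[OF branch_derivative(3)[of "w ! i"] continuous_on_iterate])
      (use i in \<open>auto simp: P_iff\<close>)
qed

lemma interior_iterate_derivative:
  "(\<And>i. i < n \<Longrightarrow> (T ^^ i) x \<in> branch_interiors d) \<Longrightarrow>
    ((T ^^ n) has_real_derivative (\<Prod>i<n. deriv T ((T ^^ i) x))) (at x)"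
proof (induction n)
  case 0
  then show ?case by (simp add: id_def)
next
  case (Suc n)
  have "(T has_real_derivative deriv T ((T ^^ n) x)) (at ((T ^^ n) x))"
    using C1_imp_deriv[OF C1 Suc.prems[of n]] by simp
  moreover have "((T ^^ n) has_real_derivative (\<Prod>i<n. deriv T ((T ^^ i) x))) (at x)"
    using Suc by simp
  ultimately have "(T \<circ> (T ^^ n) has_real_derivative deriv T ((T ^^ n) x) * (\<Prod>i<n. deriv T ((T ^^ i) x))) (at x)"
    by (rule DERIV_chain)
  then show ?case unfolding funpow.simps prod.lessThan_Suc by (simp only: mult.commute)
qed

text \<open>The expansion hypothesis concerns points whose orbit avoids the endpoints of the branches. Only
  finitely many points of a cylinder are excluded, and the derivative along the cylinder is
  continuous.\<close>

lemma Dn_n0_ge: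
  assumes x: "x \<in> cy w" and w: "length w = n0"
  shows "\<xi> \<le> Dn n0 x"
proof -
  define I where "I = {y \<in> cy w. \<forall>i<n0. (T ^^ i) y \<in> {lo (w ! i)<..<hi (w ! i)}}"
  have fin: "finite (cy w - I)"
  proof (rule finite_subset)
    show "cy w - I \<subseteq> (\<Union>i<n0. (T ^^ i) -` {hi (w ! i)} \<inter> cy w)"
    proof
      fix y assume y: "y \<in> cy w - I"
      then obtain i where i: "i < n0" "(T ^^ i) y \<notin> {lo (w ! i)<..<hi (w ! i)}" by (auto simp: I_def)
      have "(T ^^ i) y \<in> J (w ! i)" using y i w by (simp add: P_iff)
      then have "(T ^^ i) y = hi (w ! i)" using i by (auto simp: J_eq)
      then show "y \<in> (\<Union>i<n0. (T ^^ i) -` {hi (w ! i)} \<inter> cy w)" using y i by auto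
    qed
    show "finite (\<Union>i<n0. (T ^^ i) -` {hi (w ! i)} \<inter> cy w)"
    proof (intro finite_UN_I finite_vimage_IntI)
      fix i assume "i \<in> {..<n0}"
      then have i: "i \<le> length w" using w by simp
      have "inj_on (T ^^ length (take i w)) (cy (take i w))" by (rule P_inj)
      then have "inj_on (T ^^ i) (cy (take i w))" using i by (simp add: min_absorb2)
      then show "inj_on (T ^^ i) (cy w)" using cy_take[OF i] by (rule inj_on_subset)
    qed auto
  qed
  have I: "\<xi> \<le> Dn n0 y" if y: "y \<in> I" for y
  proof -
    have int: "(T ^^ i) y \<in> {lo (w ! i)<..<hi (w ! i)}" if "i < n0" for i using y that by (auto simp: I_def)
    then have B: "(T ^^ i) y \<in> branch_interiors d" if "i < n0" for i using interior_iff that by blast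
    have "deriv (T ^^ n0) y = (\<Prod>i<n0. deriv T ((T ^^ i) y))"
      using interior_iterate_derivative[OF B] DERIV_imp_deriv by blast
    also have "\<dots> = (\<Prod>i<n0. dT ((T ^^ i) y))"
      using branch_derivative(7)[OF int] by (intro prod.cong) auto
    finally have "Dn n0 y = \<bar>deriv (T ^^ n0) y\<bar>" by (simp add: Dn_def abs_prod)
    then show ?thesis using expanding[OF B] by simp
  qed
  have "I \<subseteq> cy w" by (auto simp: I_def)
  then have "cy w = (cy w - I) \<union> I" by auto
  then have "x islimpt I" using P_islimpt[OF x] islimpt_Un_finite[OF fin, of x I] by simp
  then have nb: "at x within I \<noteq> bot" by (simp add: trivial_limit_within)
  have "continuous (at x within cy w) (Dn n0)"
    using continuous_on_Dn[of w] x w by (simp add: continuous_on_eq_continuous_within)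
  then have "(Dn n0 \<longlongrightarrow> Dn n0 x) (at x within I)"
    using \<open>I \<subseteq> cy w\<close> by (auto simp: continuous_within intro: tendsto_within_subset)
  then show ?thesis
    by (rule tendsto_lowerbound[OF _ _ nb]) (auto simp: eventually_at_filter I)
qed

definition \<theta> :: real where "\<theta> = \<xi> powr (- 1 / real n0)"
definition c\<^sub>0 :: real where "c\<^sub>0 = min c 1 ^ n0 / \<xi>"

lemma theta_bounds: "0 < \<theta>" "\<theta> < 1" "\<theta> ^ n0 = 1 / \<xi>"
proof -
  show "0 < \<theta>" using xi by (simp add: \<theta>_def)
  have "\<xi> powr (- 1 / real n0) < \<xi> powr 0" using xi n0 by (intro powr_less_mono) auto
  then show "\<theta> < 1" using xi by (simp add: \<theta>_def)
  have "\<theta> ^ n0 = \<xi> powr (- 1 / real n0 * real n0)"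
    using xi by (simp add: \<theta>_def powr_powr flip: powr_realpow)
  then show "\<theta> ^ n0 = 1 / \<xi>" using xi n0 by (simp add: powr_minus divide_inverse)
qed

lemma c0_pos: "0 < c\<^sub>0" using c_pos xi by (simp add: c\<^sub>0_def)

text \<open>Blocks of length \<open>n0\<close> expand by \<open>\<xi>\<close>, and the incomplete block loses at most a constant, since
  every single branch has derivative at least \<open>c\<close>.\<close>

lemma Dn_expanding: "x \<in> cy w \<Longrightarrow> c\<^sub>0 \<le> Dn (length w) x * \<theta> ^ length w"
proof (induction w arbitrary: x rule: measure_induct_rule[of length])
  case (less w)
  show ?case
  proof (cases "length w < n0")
    case True
    have "min c 1 ^ n0 \<le> min c 1 ^ length w"
      using c_pos True by (intro power_decreasing) auto
    also have "\<dots> = (\<Prod>i<length w. min c 1)" by simp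
    also have "\<dots> \<le> Dn (length w) x"
      unfolding Dn_def
    proof (rule prod_mono)
      fix i assume "i \<in> {..<length w}"
      then have "(T ^^ i) x \<in> J (w ! i)" using less.prems by (simp add: P_iff)
      then show "0 \<le> min c 1 \<and> min c 1 \<le> \<bar>dT ((T ^^ i) x)\<bar>" using dT_ge_c c_pos by fastforce
    qed
    finally have 1: "min c 1 ^ n0 \<le> Dn (length w) x" .
    have "1 / \<xi> \<le> \<theta> ^ length w"
      unfolding theta_bounds(3)[symmetric] using theta_bounds True by (intro power_decreasing) auto
    then have "min c 1 ^ n0 * (1 / \<xi>) \<le> Dn (length w) x * \<theta> ^ length w"
      using 1 c_pos xi Dn_pos[OF less.prems] by (intro mult_mono) auto
    then show ?thesis by (simp add: c\<^sub>0_def)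
  next
    case False
    then have n: "n0 \<le> length w" "length w = n0 + (length w - n0)" by auto
    let ?w = "drop n0 w" and ?x = "(T ^^ n0) x"
    have x': "?x \<in> cy ?w" by (rule cy_drop[OF less.prems n(1)])
    have IH: "c\<^sub>0 \<le> Dn (length ?w) ?x * \<theta> ^ length ?w"
      using less.IH[OF _ x'] n n0 by simp
    have "x \<in> cy (take n0 w)" using cy_take[OF n(1)] less.prems by auto
    then have xi': "\<xi> \<le> Dn n0 x" using n(1) by (intro Dn_n0_ge) auto
    have "Dn (length w) x * \<theta> ^ length w = (Dn n0 x * Dn (length ?w) ?x) * (\<theta> ^ n0 * \<theta> ^ length ?w)"
      by (subst (1 2) n(2)) (simp only: Dn_add power_add length_drop)
    also have "\<dots> = (Dn n0 x / \<xi>) * (Dn (length ?w) ?x * \<theta> ^ length ?w)"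
      using theta_bounds(3) by simp
    also have "\<dots> \<ge> 1 * c\<^sub>0"
      using xi' xi IH c0_pos by (intro mult_mono) auto
    finally show ?thesis by simp
  qed
qed

lemma contraction:
  assumes "x \<in> cy w" "y \<in> cy w"
  shows "\<bar>x - y\<bar> \<le> \<theta> ^ length w / c\<^sub>0 * \<bar>(T ^^ length w) x - (T ^^ length w) y\<bar>"
proof -
  obtain z where z: "z \<in> cy w" "\<bar>(T ^^ length w) x - (T ^^ length w) y\<bar> = Dn (length w) z * \<bar>x - y\<bar>"
    using P_mvt[OF assms] by auto
  have "c\<^sub>0 * \<bar>x - y\<bar> \<le> (Dn (length w) z * \<theta> ^ length w) * \<bar>x - y\<bar>"
    using Dn_expanding[OF z(1)] by (rule mult_right_mono) simp
  then show ?thesis unfolding z(2) using c0_pos by (simp add: field_simps)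
qed

lemma diam_cy: "x \<in> cy w \<Longrightarrow> y \<in> cy w \<Longrightarrow> \<bar>x - y\<bar> \<le> \<theta> ^ length w / c\<^sub>0"
proof -
  assume xy: "x \<in> cy w" "y \<in> cy w"
  have "\<bar>(T ^^ length w) x - (T ^^ length w) y\<bar> \<le> 1"
    using P_funpow[OF xy(1)] P_funpow[OF xy(2)] by auto
  then have "\<theta> ^ length w / c\<^sub>0 * \<bar>(T ^^ length w) x - (T ^^ length w) y\<bar> \<le> \<theta> ^ length w / c\<^sub>0 * 1"
    using theta_bounds c0_pos by (intro mult_left_mono) auto
  then show ?thesis using contraction[OF xy] by simp
qed

definition K\<^sub>1 :: real where "K\<^sub>1 = K / (c\<^sub>0 * (1 - \<theta>))"

lemma K1_pos: "0 < K\<^sub>1" using K_pos c0_pos theta_bounds by (simp add: K\<^sub>1_def)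

text \<open>The distortions of the single branches add up to a geometric series, as the images of two points
  are at distance at most \<open>\<theta>\<^sup>j / c\<^sub>0\<close> times the final one when \<open>j\<close> digits remain.\<close>

lemma distortion:
  assumes xy: "x \<in> cy w" "y \<in> cy w"
  shows "\<bar>ln (Dn (length w) x) - ln (Dn (length w) y)\<bar> \<le> K\<^sub>1 * \<bar>(T ^^ length w) x - (T ^^ length w) y\<bar>"
proof -
  have "\<bar>ln (Dn (length w) x) - ln (Dn (length w) y)\<bar>
    \<le> K / c\<^sub>0 * (\<Sum>j<length w. \<theta> ^ j) * \<bar>(T ^^ length w) x - (T ^^ length w) y\<bar>"
    using xy
  proof (induction w arbitrary: x y)
    case Nil
    then show ?case by (simp add: Dn_def)
  next
    case (Cons a w)
    let ?n = "length w"
    let ?\<Delta> = "\<bar>(T ^^ ?n) (T x) - (T ^^ ?n) (T y)\<bar>"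
    have J: "x \<in> J a" "y \<in> J a" and xy': "T x \<in> cy w" "T y \<in> cy w" using Cons.prems by auto
    have D: "Dn (Suc ?n) z = \<bar>dT z\<bar> * Dn ?n (T z)" for z
      using Dn_add[of 1 ?n z] by (simp add: Dn_def)
    have lnD: "ln (Dn (Suc ?n) z) = ln \<bar>dT z\<bar> + ln (Dn ?n (T z))" if "z \<in> J a" "T z \<in> cy w" for z
      using Dn_pos[OF that(2)] dT_ge_c[OF that(1)] c_pos unfolding D by (subst ln_mult) auto
    have "\<bar>ln \<bar>dT x\<bar> - ln \<bar>dT y\<bar>\<bar> \<le> K * \<bar>T x - T y\<bar>" by (rule branch_derivative(4)[OF J])
    also have "\<dots> \<le> K * (\<theta> ^ ?n / c\<^sub>0 * ?\<Delta>)"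
      using contraction[OF xy'] K_pos by (intro mult_left_mono) auto
    finally have 1: "\<bar>ln \<bar>dT x\<bar> - ln \<bar>dT y\<bar>\<bar> \<le> K / c\<^sub>0 * \<theta> ^ ?n * ?\<Delta>" by simp
    have "\<bar>ln (Dn (Suc ?n) x) - ln (Dn (Suc ?n) y)\<bar> \<le>
      K / c\<^sub>0 * \<theta> ^ ?n * ?\<Delta> + K / c\<^sub>0 * (\<Sum>j<?n. \<theta> ^ j) * ?\<Delta>"
      unfolding lnD[OF J(1) xy'(1)] lnD[OF J(2) xy'(2)]
      by (rule order_trans[OF abs_diff_triangle_ineq add_mono[OF 1 Cons.IH[OF xy']]])
    also have "\<dots> = K / c\<^sub>0 * (\<Sum>j<Suc ?n. \<theta> ^ j) * ?\<Delta>" by (simp add: algebra_simps add_divide_distrib)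
    finally show ?case by (simp add: funpow_swap1)
  qed
  also have "\<dots> \<le> K / c\<^sub>0 * (1 / (1 - \<theta>)) * \<bar>(T ^^ length w) x - (T ^^ length w) y\<bar>"
  proof -
    have "(\<Sum>j<length w. \<theta> ^ j) = (1 - \<theta> ^ length w) / (1 - \<theta>)"
      using theta_bounds by (simp add: sum_gp_strict)
    also have "\<dots> \<le> 1 / (1 - \<theta>)" using theta_bounds by (intro divide_right_mono) auto
    finally show ?thesis using K_pos c0_pos by (intro mult_right_mono mult_left_mono) auto
  qed
  finally show ?thesis by (simp add: K\<^sub>1_def)
qed

lemma P_sets: "E \<in> sets borel \<Longrightarrow> P w E \<in> sets borel"
proof (induction w)
  case (Cons a w)
  have "continuous_on (J a) T"
    using branch_derivative(1) by (rule continuous_on_vector_derivative)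
  then have "T \<in> borel_measurable (restrict_space borel (J a))"
    by (rule borel_measurable_continuous_on_restrict)
  then have "T -` P w E \<inter> space (restrict_space borel (J a)) \<in> sets (restrict_space borel (J a))"
    using Cons by (intro measurable_sets) auto
  moreover have "T -` P w E \<inter> space (restrict_space borel (J a)) = P (a # w) E"
    by (auto simp: space_restrict_space)
  moreover have "J a \<in> sets borel" by (simp add: J_eq)
  ultimately show ?case by (simp add: sets_restrict_space_iff)
qed simp

lemma P_lmeasurable: "E \<in> sets borel \<Longrightarrow> E \<subseteq> {0..1} \<Longrightarrow> P w E \<in> lmeasurable"
  by (rule bounded_set_imp_lmeasurable)
    (auto intro!: P_sets bounded_subset[OF bounded_closed_interval[of "0::real" 1]] dest!: P_subset_unit[THEN subsetD, rotated])

text \<open>The change of variables formula for \<open>T\<^bsup>length w\<^esup>\<close> on the pullback, whose image is \<open>E\<close> up to the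
  points \<open>0\<close> and \<open>1\<close>.\<close>

lemma area:
  assumes E: "E \<in> sets borel" "E \<subseteq> {0..1}"
  shows "(\<And>x. x \<in> P w E \<Longrightarrow> a \<le> Dn (length w) x) \<Longrightarrow> a * measure lebesgue (P w E) \<le> measure lebesgue E"
    and "(\<And>x. x \<in> P w E \<Longrightarrow> Dn (length w) x \<le> b) \<Longrightarrow> measure lebesgue E \<le> b * measure lebesgue (P w E)"
proof -
  let ?S = "P w E" and ?g = "T ^^ length w" and ?g' = "\<lambda>x. \<Prod>i<length w. dT ((T ^^ i) x)"
  have Scy: "?S \<subseteq> cy w" using E by (intro P_in_cy)
  have Sl: "?S \<in> lmeasurable" by (rule P_lmeasurable[OF E])
  have El: "E \<in> lmeasurable" using P_lmeasurable[OF E, of "[]"] by simp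
  have img: "?g ` ?S \<subseteq> E" "E - {0, 1} \<subseteq> ?g ` ?S"
  proof -
    show "?g ` ?S \<subseteq> E" using P_funpow by auto
    show "E - {0, 1} \<subseteq> ?g ` ?S"
    proof
      fix y assume y: "y \<in> E - {0, 1}"
      then have "y \<noteq> 0" "y \<noteq> 1" "y \<in> {0..1}" using E by auto
      then have "y \<in> {0<..<1}" by auto
      then obtain x where "x \<in> cy w" "?g x = y" using P_onto by blast
      then show "y \<in> ?g ` ?S" using y by (auto simp: P_iff intro!: image_eqI[of y ?g x])
    qed
  qed
  have neg: "negligible (sym_diff E (?g ` ?S))"
    by (rule negligible_subset[of "{0, 1}"]) (use img in auto)
  have gl: "?g ` ?S \<in> lmeasurable" by (rule lmeasurable_negligible_symdiff[OF El neg])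
  have gm: "measure lebesgue (?g ` ?S) = measure lebesgue E" by (rule measure_negligible_symdiff[OF El neg])
  have der: "(?g has_vector_derivative ?g' x) (at x within ?S)" if "x \<in> ?S" for x
    using P_derivative[of x w] that Scy has_vector_derivative_within_subset by blast
  have inj: "inj_on ?g ?S" using P_inj Scy by (rule inj_on_subset)
  \<comment> \<open>the change of variables theorem concerns vector-valued functions, hence the type \<open>real ^ 1\<close>\<close>
  let ?f = "\<lambda>_::real. (1 :: real ^ 1)"
  have fint: "?f absolutely_integrable_on (?g ` ?S)"
    using gl by (intro absolutely_integrable_on_const) auto
  have "?S \<in> sets lebesgue" using Sl by auto
  from has_absolute_integral_change_of_variables_1[OF this der inj, of ?f "integral (?g ` ?S) ?f"] fint
  have A: "(\<lambda>x. \<bar>?g' x\<bar> *\<^sub>R ?f (?g x)) absolutely_integrable_on ?S"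
    "integral ?S (\<lambda>x. \<bar>?g' x\<bar> *\<^sub>R ?f (?g x)) = integral (?g ` ?S) ?f" by auto
  have bl: "bounded_linear (\<lambda>v :: real ^ 1. v $ 1)" by (rule bounded_linear_vec_nth)
  have DnG: "((\<lambda>v :: real ^ 1. v $ 1) \<circ> (\<lambda>x. \<bar>?g' x\<bar> *\<^sub>R ?f (?g x))) = Dn (length w)"
    by (simp add: fun_eq_iff Dn_def abs_prod)
  have A1: "(\<lambda>x. \<bar>?g' x\<bar> *\<^sub>R ?f (?g x)) integrable_on ?S"
    using A(1) by (simp add: absolutely_integrable_on_def)
  have f1: "?f integrable_on (?g ` ?S)" using fint by (simp add: absolutely_integrable_on_def)
  have iD: "Dn (length w) integrable_on ?S" using integrable_linear[OF A1 bl] unfolding DnG .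
  have "integral ?S (Dn (length w)) = integral (?g ` ?S) ?f $ 1"
    using integral_linear[OF A1 bl] A(2) unfolding DnG by simp
  also have "\<dots> = integral (?g ` ?S) (\<lambda>_. 1)"
    using integral_linear[OF f1 bl] by (simp add: comp_def)
  also have "\<dots> = measure lebesgue E" using lmeasure_integral[OF gl] gm by simp
  finally have D: "integral ?S (Dn (length w)) = measure lebesgue E" .
  have one: "(\<lambda>_. 1 :: real) integrable_on ?S" using Sl lmeasurable_iff_integrable_on by blast
  have c: "integral ?S (\<lambda>_. k) = k * measure lebesgue ?S" for k :: real
    using integral_mult_right[of ?S k "\<lambda>_. 1"] lmeasure_integral[OF Sl] by simp
  have ci: "(\<lambda>_. k :: real) integrable_on ?S" for k using integrable_on_cmult_left[OF one, of k] by simp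
  show "a * measure lebesgue ?S \<le> measure lebesgue E" if "\<And>x. x \<in> ?S \<Longrightarrow> a \<le> Dn (length w) x"
    unfolding D[symmetric] c[symmetric] using that by (intro integral_le ci iD)
  show "measure lebesgue E \<le> b * measure lebesgue ?S" if "\<And>x. x \<in> ?S \<Longrightarrow> Dn (length w) x \<le> b"
    unfolding D[symmetric] c[symmetric] using that by (intro integral_le ci iD)
qed

section \<open>Lebesgue measure on the points with infinite orbit\<close>

text \<open>Only countably many points of the unit interval are excluded, so this set has full measure. All
  orbits stay in it, and digits are defined along them.\<close>

definition X :: "real set" where "X = {x. \<forall>n. (T ^^ n) x \<in> {0<..1}}"

definition dig :: "real \<Rightarrow> nat" where "dig x = (THE a. x \<in> J a)"

definition M :: "real measure" where "M = restrict_space lborel X"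

abbreviation "leb \<equiv> measure lebesgue"

lemma X_subset: "X \<subseteq> {0<..1}" unfolding X_def by (metis (no_types, lifting) funpow_0 mem_Collect_eq subsetI)

lemma X_unit: "X \<subseteq> {0..1}" using X_subset by auto

lemma X_step: "x \<in> X \<longleftrightarrow> x \<in> {0<..1} \<and> T x \<in> X"
proof
  assume x: "x \<in> X"
  have "(T ^^ n) (T x) \<in> {0<..1}" for n
  proof -
    have "(T ^^ Suc n) x \<in> {0<..1}" using x by (simp only: X_def mem_Collect_eq)
    then show ?thesis by (simp add: funpow_swap1)
  qed
  then have "T x \<in> X" unfolding X_def by blast
  then show "x \<in> {0<..1} \<and> T x \<in> X" using x X_subset by blast
next
  assume x: "x \<in> {0<..1} \<and> T x \<in> X"
  have "(T ^^ n) x \<in> {0<..1}" for n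
  proof (cases n)
    case (Suc m)
    have "(T ^^ m) (T x) \<in> {0<..1}" using x unfolding X_def by blast
    then show ?thesis using Suc by (simp add: funpow_swap1)
  qed (use x in simp)
  then show "x \<in> X" unfolding X_def by blast
qed

lemma X_T: "x \<in> X \<Longrightarrow> T x \<in> X" using X_step by blast

lemma X_iterate: "x \<in> X \<Longrightarrow> (T ^^ n) x \<in> X"
  by (induction n) (simp_all add: X_T)

lemma X_iterate_unit: "x \<in> X \<Longrightarrow> (T ^^ n) x \<in> {0<..1}"
  unfolding X_def by blast

lemma exp_minus_mult_le: "exp (- k) * y \<le> z \<Longrightarrow> y \<le> exp k * (z :: real)"
proof -
  assume "exp (- k) * y \<le> z"
  then have "exp k * (exp (- k) * y) \<le> exp k * z" by (rule mult_left_mono) simp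
  moreover have "exp k * (exp (- k) * y) = y" by (simp add: exp_minus)
  ultimately show ?thesis by simp
qed

lemma ln_dist_bounds:
  assumes "0 < a" "0 < b" "\<bar>ln a - ln b\<bar> \<le> (k :: real)"
  shows "exp (- k) * b \<le> a" "a \<le> exp k * b"
proof -
  have "exp (- k + ln b) \<le> exp (ln a)" "exp (ln a) \<le> exp (k + ln b)"
    unfolding exp_le_cancel_iff using assms(3) by (auto simp: abs_le_iff)
  then show "exp (- k) * b \<le> a" "a \<le> exp k * b" unfolding exp_add using assms by auto
qed

lemma dig_eq: "x \<in> J a \<Longrightarrow> dig x = a"
  unfolding dig_def using J_disjoint by blast

lemma J_dig: "x \<in> {0<..1} \<Longrightarrow> x \<in> J (dig x)"
  using J_cover dig_eq by metis

lemma J_dig_X: "x \<in> X \<Longrightarrow> x \<in> J (dig x)"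
  using J_dig X_subset by blast

lemma P_code:
  "(\<And>i. i < n \<Longrightarrow> (T ^^ i) x \<in> {0<..1}) \<Longrightarrow> (T ^^ n) x \<in> E \<Longrightarrow> x \<in> P (itin T dig n x) E"
  by (auto simp: P_iff nth_itin intro!: J_dig simp del: greaterThanAtMost_iff)

lemma P_code_unique: "x \<in> P w E \<Longrightarrow> itin T dig (length w) x = w"
  by (rule nth_equalityI) (auto simp: P_iff nth_itin dig_eq)

lemma P_X_subset: "E \<subseteq> X \<Longrightarrow> P w E \<subseteq> X"
proof (induction w)
  case (Cons a w)
  show ?case
  proof
    fix x assume "x \<in> P (a # w) E"
    then have "x \<in> J a" "T x \<in> X" using Cons by auto
    then show "x \<in> X" using X_step[of x] J_subset[of a] by blast
  qed
qed simp

lemma preimage_zero: "finite (P w {0})"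
proof -
  have "P w {0} \<subseteq> (T ^^ length w) -` {0} \<inter> cy w"
    using P_in_cy[of "{0}" w] by (auto simp: P_iff)
  moreover have "finite ((T ^^ length w) -` {0} \<inter> cy w)"
    by (rule finite_vimage_IntI[OF _ P_inj]) simp
  ultimately show ?thesis by (rule finite_subset)
qed

lemma exceptional_subset: "{0<..1} - X \<subseteq> (\<Union>w. P w {0})"
proof
  fix x assume x: "x \<in> {0<..1} - X"
  define n where "n = (LEAST n. (T ^^ n) x \<notin> {0<..1})"
  have "\<exists>n. (T ^^ n) x \<notin> {0<..1}" using x unfolding X_def by blast
  then have n: "(T ^^ n) x \<notin> {0<..1}" unfolding n_def by (rule LeastI_ex)
  have less: "(T ^^ i) x \<in> {0<..1}" if "i < n" for i using not_less_Least[OF that[unfolded n_def]] by blast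
  obtain m where m: "n = Suc m" using n x by (cases n) auto
  have "(T ^^ n) x \<in> {0..1}" using T_range[OF less[of m]] m by simp
  then have "(T ^^ n) x \<in> {0}" using n by auto
  then show "x \<in> (\<Union>w. P w {0})" using P_code[OF less] by blast
qed

lemma countable_exceptional: "countable ({0<..1} - X)"
  by (rule countable_subset[OF exceptional_subset], rule countable_UN, simp, rule countable_finite, rule preimage_zero)

lemma X_sets [measurable]: "X \<in> sets borel"
proof -
  have "X = {0<..1} - ({0<..1} - X)" using X_subset by auto
  moreover have "{0<..1} - X \<in> sets borel"
    using countable_exceptional by (rule sets.countable[rotated]) auto
  ultimately show ?thesis by (metis sets.Diff borel_closed greaterThanAtMost_borel)
qed

lemma leb_X: "leb X = 1"
proof -
  have n: "negligible (sym_diff {0<..1} X)"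
    by (rule negligible_subset[of "{0<..1} - X"])
      (use X_subset countable_imp_null_set_lborel[OF countable_exceptional] in
        \<open>auto simp: negligible_iff_null_sets intro: null_sets_completionI\<close>)
  have "leb X = leb {0<..1::real}"
    by (rule measure_negligible_symdiff[OF _ n]) (auto intro!: bounded_set_imp_lmeasurable)
  then show ?thesis by (simp add: measure_completion)
qed

lemma space_M [simp]: "space M = X" by (simp add: M_def space_restrict_space)

lemma sets_M: "A \<in> sets M \<longleftrightarrow> A \<in> sets borel \<and> A \<subseteq> X"
  unfolding M_def by (auto simp: sets_restrict_space_iff)

lemma measure_M: "A \<in> sets M \<Longrightarrow> measure M A = leb A"
  unfolding M_def using X_sets by (subst measure_restrict_space) (auto simp: sets_restrict_space_iff measure_completion)

lemma P_sets_M: "A \<in> sets M \<Longrightarrow> P w A \<in> sets M"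
  using P_sets P_X_subset by (auto simp: sets_M)

lemma prob_space_M: "prob_space M"
proof
  have fin: "emeasure M (space M) = emeasure lborel X"
    unfolding M_def by (subst emeasure_restrict_space) (auto simp: space_restrict_space)
  have "emeasure lborel X \<le> emeasure lborel {0..1::real}" using X_unit by (intro emeasure_mono) auto
  then have "emeasure lborel X \<noteq> \<infinity>" by (auto simp: top_unique)
  then have "emeasure lborel X = ennreal (measure lborel X)" by (simp add: emeasure_eq_ennreal_measure)
  also have "measure lborel X = 1" using leb_X by (simp add: measure_completion)
  finally show "emeasure M (space M) = 1" using fin by simp
qed

lemma T_measurable_M: "T \<in> M \<rightarrow>\<^sub>M M"
proof (rule measurableI)
  show "x \<in> space M \<Longrightarrow> T x \<in> space M" for x using X_T by simp
  fix A assume A: "A \<in> sets M"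
  have "T -` A \<inter> space M = (\<Union>a. P [a] A)"
  proof (intro equalityI subsetI)
    fix x assume "x \<in> T -` A \<inter> space M"
    then show "x \<in> (\<Union>a. P [a] A)" using J_dig_X[of x] by auto
  next
    fix x assume "x \<in> (\<Union>a. P [a] A)"
    then obtain a where "x \<in> P [a] A" by auto
    then show "x \<in> T -` A \<inter> space M" using A P_X_subset[of A "[a]"] by (auto simp: sets_M)
  qed
  also have "\<dots> \<in> sets M" using P_sets_M[OF A] by (intro sets.countable_UN) blast
  finally show "T -` A \<inter> space M \<in> sets M" .
qed

lemma J_sets: "J a \<in> sets borel" by (simp add: J_eq)

lemma unit_to_M: "f \<in> unit_borel \<rightarrow>\<^sub>M N \<Longrightarrow> f \<in> M \<rightarrow>\<^sub>M N"
proof (rule measurableI)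
  assume f: "f \<in> unit_borel \<rightarrow>\<^sub>M N"
  show "f x \<in> space N" if "x \<in> space M" for x
    using measurable_space[OF f, of x] that X_subset by (auto simp: space_restrict_space)
  fix A assume "A \<in> sets N"
  then have "f -` A \<inter> space unit_borel \<in> sets unit_borel" using f by (intro measurable_sets)
  then have "f -` A \<inter> {0<..1} \<in> sets borel" by (simp add: sets_restrict_space_iff space_restrict_space)
  then have "(f -` A \<inter> {0<..1}) \<inter> X \<in> sets borel" by (rule sets.Int[OF _ X_sets])
  moreover have "(f -` A \<inter> {0<..1}) \<inter> X = f -` A \<inter> space M" using X_subset by auto
  ultimately show "f -` A \<inter> space M \<in> sets M" by (auto simp: sets_M)
qed

lemma dig_measurable_unit: "dig \<in> unit_borel \<rightarrow>\<^sub>M count_space UNIV"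
proof (rule measurableI)
  fix S :: "nat set"
  have "dig -` S \<inter> space unit_borel = (\<Union>a\<in>S. J a)"
  proof (intro equalityI subsetI)
    fix x assume "x \<in> dig -` S \<inter> space unit_borel"
    then show "x \<in> (\<Union>a\<in>S. J a)" using J_dig[of x] by (auto simp: space_restrict_space)
  next
    fix x assume "x \<in> (\<Union>a\<in>S. J a)"
    then obtain a where "a \<in> S" "x \<in> J a" by blast
    then show "x \<in> dig -` S \<inter> space unit_borel" using J_subset[of a] dig_eq[of x a] by (auto simp: space_restrict_space)
  qed
  also have "\<dots> \<in> sets unit_borel"
    using J_sets J_subset by (intro sets.countable_UN'') (auto simp: sets_restrict_space_iff)
  finally show "dig -` S \<inter> space unit_borel \<in> sets unit_borel" .
qed simp

lemmas dig_measurable_M = unit_to_M[OF dig_measurable_unit]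

lemma cylset_M: "cylset M T dig w = P w X"
proof (rule set_eqI)
  fix x
  show "x \<in> cylset M T dig w \<longleftrightarrow> x \<in> P w X"
  proof
    assume "x \<in> cylset M T dig w"
    then have x: "x \<in> X" "itin T dig (length w) x = w" by (auto simp: cylset_def)
    have "x \<in> P (itin T dig (length w) x) X"
      using X_iterate[OF x(1)] X_iterate_unit[OF x(1)] by (intro P_code)
    then show "x \<in> P w X" using x by simp
  next
    assume x: "x \<in> P w X"
    then show "x \<in> cylset M T dig w" using P_X_subset[of X w] P_code_unique[OF x] by (auto simp: cylset_def)
  qed
qed

lemma leb_P_pos:
  assumes E: "E \<in> sets borel" "E \<subseteq> {0..1}" and pos: "0 < leb E"
  shows "0 < leb (P w E)"
proof -
  obtain b where b: "\<And>x. x \<in> P w E \<Longrightarrow> Dn (length w) x \<le> b"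
  proof (cases "P w E = {}")
    case False
    then obtain z where z: "z \<in> P w E" by auto
    have "Dn (length w) x \<le> exp K\<^sub>1 * Dn (length w) z" if x: "x \<in> P w E" for x
    proof -
      have cy: "x \<in> cy w" "z \<in> cy w" using x z P_in_cy[OF E(2)] by auto
      have "K\<^sub>1 * \<bar>(T ^^ length w) x - (T ^^ length w) z\<bar> \<le> K\<^sub>1 * 1"
        using P_funpow[OF cy(1)] P_funpow[OF cy(2)] K1_pos by (intro mult_left_mono) auto
      then have "\<bar>ln (Dn (length w) x) - ln (Dn (length w) z)\<bar> \<le> K\<^sub>1" using distortion[OF cy] by linarith
      then show ?thesis by (rule ln_dist_bounds(2)[OF Dn_pos[OF x] Dn_pos[OF z]])
    qed
    then show ?thesis using that by blast
  qed (use that[of 0] in auto)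
  have "leb E \<le> b * leb (P w E)" by (rule area(2)[OF E b])
  then show ?thesis using pos by (cases "leb (P w E) = 0") (auto simp: zero_less_measure_iff)
qed

definition \<kappa> :: "nat \<Rightarrow> real" where "\<kappa> m = 2 * (K\<^sub>1 * (\<theta> ^ m / c\<^sub>0))"

text \<open>For points of \<open>P w (P u X)\<close> the images under \<open>T\<^bsup>length w\<^esup>\<close> lie in the cylinder of \<open>u\<close>, whose
  diameter is at most \<open>\<theta>\<^bsup>length u\<^esup> / c\<^sub>0\<close>. The derivative is therefore constant up to the factor
  \<open>exp (K\<^sub>1 \<theta>\<^bsup>length u\<^esup> / c\<^sub>0)\<close>; it is compared with its value at one point in the area formula
  for both pullbacks.\<close>

lemma gibbs_M:
  assumes A: "A \<in> sets M" "A \<subseteq> P u X"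
  shows "leb (P w A) * leb (P u X) \<le> exp (\<kappa> (length u)) * (leb (P (w @ u) X) * leb A)"
    and "leb (P (w @ u) X) * leb A \<le> exp (\<kappa> (length u)) * (leb (P w A) * leb (P u X))"
proof -
  have XM: "X \<in> sets M" by (simp add: sets_M)
  have u: "P u X \<in> sets borel" "P u X \<subseteq> {0..1}" using P_sets_M[OF XM, of u] X_unit by (auto simp: sets_M)
  have Ab: "A \<in> sets borel" "A \<subseteq> {0..1}" using A u by (auto simp: sets_M)
  have "0 < leb (P u X)" by (rule leb_P_pos) (use X_unit leb_X in auto)
  then have "0 < leb (P w (P u X))" by (rule leb_P_pos[OF u])
  then have "P w (P u X) \<noteq> {}" by auto
  then obtain z where z: "z \<in> P w (P u X)" by auto
  let ?n = "length w" and ?k = "K\<^sub>1 * (\<theta> ^ length u / c\<^sub>0)"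
  define D where "D = Dn ?n z"
  have D: "0 < D" using Dn_pos[OF z] by (simp add: D_def)
  have bounds: "exp (- ?k) * D \<le> Dn ?n x \<and> Dn ?n x \<le> exp ?k * D" if x: "x \<in> P w (P u X)" for x
  proof -
    have cy: "x \<in> cy w" "z \<in> cy w" using x z P_in_cy[OF u(2)] by auto
    have "(T ^^ ?n) x \<in> cy u" "(T ^^ ?n) z \<in> cy u"
      using P_funpow[OF x] P_funpow[OF z] P_in_cy[OF X_unit] by auto
    then have "K\<^sub>1 * \<bar>(T ^^ ?n) x - (T ^^ ?n) z\<bar> \<le> ?k"
      using diam_cy K1_pos by (intro mult_left_mono) auto
    then have l: "\<bar>ln (Dn ?n x) - ln D\<bar> \<le> ?k" using distortion[OF cy] by (simp add: D_def)
    then show ?thesis using ln_dist_bounds[OF Dn_pos[OF x] D] by blast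
  qed
  have sub: "P w A \<subseteq> P w (P u X)" by (rule P_mono[OF A(2)])
  have a: "exp (- ?k) * D * leb (P w A) \<le> leb A" "leb A \<le> exp ?k * D * leb (P w A)"
    using area(1)[OF Ab, of w "exp (- ?k) * D"] area(2)[OF Ab, of w "exp ?k * D"] bounds sub by auto
  have b: "exp (- ?k) * D * leb (P w (P u X)) \<le> leb (P u X)" "leb (P u X) \<le> exp ?k * D * leb (P w (P u X))"
    using area(1)[OF u, of w "exp (- ?k) * D"] area(2)[OF u, of w "exp ?k * D"] bounds by auto
  have e: "exp (\<kappa> (length u)) = exp ?k * exp ?k" by (simp add: \<kappa>_def mult_exp_exp)
  have a': "D * leb (P w A) \<le> exp ?k * leb A"
    using a(1) by (intro exp_minus_mult_le) (simp only: mult.assoc)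
  have b': "D * leb (P w (P u X)) \<le> exp ?k * leb (P u X)"
    using b(1) by (intro exp_minus_mult_le) (simp only: mult.assoc)
  have "(D * leb (P w A)) * leb (P u X) \<le> (exp ?k * leb A) * (exp ?k * D * leb (P w (P u X)))"
    by (rule mult_mono[OF a' b(2)]) auto
  then have "D * (leb (P w A) * leb (P u X)) \<le> D * (exp (\<kappa> (length u)) * (leb (P (w @ u) X) * leb A))"
    unfolding e P_append by (simp add: mult_ac)
  then show "leb (P w A) * leb (P u X) \<le> exp (\<kappa> (length u)) * (leb (P (w @ u) X) * leb A)"
    using D by (simp only: mult_le_cancel_left_pos)
  have "(D * leb (P w (P u X))) * leb A \<le> (exp ?k * leb (P u X)) * (exp ?k * D * leb (P w A))"
    by (rule mult_mono[OF b' a(2)]) auto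
  then have "D * (leb (P (w @ u) X) * leb A) \<le> D * (exp (\<kappa> (length u)) * (leb (P w A) * leb (P u X)))"
    unfolding e P_append by (simp add: mult_ac)
  then show "leb (P (w @ u) X) * leb A \<le> exp (\<kappa> (length u)) * (leb (P w A) * leb (P u X))"
    using D by (simp only: mult_le_cancel_left_pos)
qed

lemma cylset_M_sets: "P w X \<in> sets M" by (rule P_sets_M) (simp add: sets_M)

text \<open>The diameters of cylinders tend to \<open>0\<close>, so every open set is a countable union of cylinders up
  to the excluded points.\<close>

lemma generate_M: "sets M = sigma_sets X (range (P' :: nat list \<Rightarrow> real set))" if P': "P' = (\<lambda>w. P w X)"
proof
  show "sigma_sets X (range P') \<subseteq> sets M"
    using sets.sigma_sets_subset[of "range P'" M] cylset_M_sets by (auto simp: P')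
  have op: "U \<inter> X \<in> sigma_sets X (range P')" if U: "open U" for U
  proof -
    have "U \<inter> X = (\<Union>w\<in>{w. P w X \<subseteq> U}. P w X)"
    proof
      show "U \<inter> X \<subseteq> (\<Union>w\<in>{w. P w X \<subseteq> U}. P w X)"
      proof
        fix x assume x: "x \<in> U \<inter> X"
        then obtain e where e: "0 < e" "\<And>y. \<bar>y - x\<bar> < e \<Longrightarrow> y \<in> U"
          using U unfolding open_dist dist_real_def by blast
        have "(\<lambda>n. \<theta> ^ n / c\<^sub>0) \<longlonglongrightarrow> 0 / c\<^sub>0"
          using theta_bounds c0_pos by (intro tendsto_intros LIMSEQ_power_zero) auto
        then have "\<forall>\<^sub>F n in sequentially. \<theta> ^ n / c\<^sub>0 < e" using e by (intro order_tendstoD(2)) auto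
        then obtain n where n: "\<theta> ^ n / c\<^sub>0 < e" unfolding eventually_sequentially by auto
        let ?w = "itin T dig n x"
        have xw: "x \<in> P ?w X" using x X_iterate X_iterate_unit by (intro P_code) blast+
        have "P ?w X \<subseteq> U"
        proof
          fix y assume y: "y \<in> P ?w X"
          have "\<bar>y - x\<bar> \<le> \<theta> ^ length ?w / c\<^sub>0" using xw y P_in_cy[OF X_unit] by (intro diam_cy) auto
          then show "y \<in> U" using e n by auto
        qed
        then show "x \<in> (\<Union>w\<in>{w. P w X \<subseteq> U}. P w X)" using xw by blast
      qed
    qed (use P_X_subset[of X] in auto)
    also have "\<dots> \<in> sigma_sets X (range P')"
      by (rule sigma_sets_UNION) (auto simp: P')
    finally show ?thesis .
  qed
  have sp: "range P' \<subseteq> Pow X" using P_X_subset[of X] by (auto simp: P')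
  interpret S: sigma_algebra X "sigma_sets X (range P')" by (rule sigma_algebra_sigma_sets[OF sp])
  have "B \<inter> X \<in> sigma_sets X (range P')" if "B \<in> sigma_sets UNIV {S. open S}" for B
    using that
  proof induction
    case (Compl B)
    have "(UNIV - B) \<inter> X = X - (B \<inter> X)" by auto
    then show ?case using Compl S.compl_sets by simp
  next
    case (Union B)
    have "(\<Union>i. B i) \<inter> X = (\<Union>i. B i \<inter> X)" by auto
    then show ?case using sigma_sets.Union[of "\<lambda>i. B i \<inter> X"] Union.IH by simp
  qed (auto intro: op)
  note * = this
  show "sets M \<subseteq> sigma_sets X (range P')"
  proof
    fix A assume "A \<in> sets M"
    then have A: "A \<in> sigma_sets UNIV {S. open S}" "A \<inter> X = A"
      by (auto simp: sets_M borel_def)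
    show "A \<in> sigma_sets X (range P')" using *[OF A(1)] A(2) by simp
  qed
qed

definition L :: "real \<Rightarrow> real" where "L x = ln \<bar>dT x\<bar>"

lemma L_measurable_unit: "L \<in> borel_measurable unit_borel"
proof -
  have "(\<lambda>x. indicator (J a) x *\<^sub>R dT x) \<in> borel_measurable borel" for a
    using branch_derivative(3) J_sets by (intro borel_measurable_continuous_on_indicator)
  then have *: "(\<lambda>x. indicator (J a) x *\<^sub>R dT x) \<in> borel_measurable unit_borel" for a
    by (intro measurable_restrict_space1)
  have 1: "(\<lambda>x. indicator (J (dig x)) x *\<^sub>R dT x) \<in> borel_measurable unit_borel"
    by (rule measurable_compose_countable[OF * dig_measurable_unit])
  have "indicator (J (dig x)) x *\<^sub>R dT x = dT x" if "x \<in> space unit_borel" for x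
    using J_dig[of x] that by (simp add: space_restrict_space)
  then have "dT \<in> borel_measurable unit_borel"
    by (rule measurable_cong[THEN iffD1, OF _ 1])
  then show ?thesis unfolding L_def[abs_def] by measurable
qed

lemmas L_measurable_M = unit_to_M[OF L_measurable_unit]

lemma birk_L: "x \<in> P w E \<Longrightarrow> birk T L (length w) x = ln (Dn (length w) x)"
proof -
  assume x: "x \<in> P w E"
  have "0 < \<bar>dT ((T ^^ i) x)\<bar>" if "i < length w" for i
    using x that dT_ge_c[of "(T ^^ i) x" "w ! i"] c_pos by (simp add: P_iff)
  then show ?thesis unfolding birk_def L_def Dn_def by (subst ln_prod) auto
qed

text \<open>The image of the cylinder is the unit interval up to endpoints, so the derivative is the inverse
  of the measure up to distortion.\<close>

lemma leb_P_Dn: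
  assumes x: "x \<in> cy w"
  shows "\<bar>ln (Dn (length w) x) + ln (leb (P w X))\<bar> \<le> K\<^sub>1"
proof -
  let ?n = "length w"
  have D: "0 < Dn ?n x" by (rule Dn_pos[OF x])
  have q: "0 < leb (P w X)" by (rule leb_P_pos) (use X_unit leb_X in auto)
  have bounds: "exp (- K\<^sub>1) * Dn ?n x \<le> Dn ?n y \<and> Dn ?n y \<le> exp K\<^sub>1 * Dn ?n x" if y: "y \<in> P w X" for y
  proof -
    have cy: "y \<in> cy w" using y P_in_cy[OF X_unit] by auto
    have "K\<^sub>1 * \<bar>(T ^^ ?n) y - (T ^^ ?n) x\<bar> \<le> K\<^sub>1 * 1"
      using P_funpow[OF cy] P_funpow[OF x] K1_pos by (intro mult_left_mono) auto
    then have l: "\<bar>ln (Dn ?n y) - ln (Dn ?n x)\<bar> \<le> K\<^sub>1" using distortion[OF cy x] by simp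
    then show ?thesis using ln_dist_bounds[OF Dn_pos[OF y] D] by blast
  qed
  have "exp (- K\<^sub>1) * Dn ?n x * leb (P w X) \<le> 1" "1 \<le> exp K\<^sub>1 * Dn ?n x * leb (P w X)"
    using area(1)[OF X_sets X_unit, of w "exp (- K\<^sub>1) * Dn ?n x"]
      area(2)[OF X_sets X_unit, of w "exp K\<^sub>1 * Dn ?n x"] bounds leb_X by auto
  then have "ln (exp (- K\<^sub>1) * Dn ?n x * leb (P w X)) \<le> 0" "0 \<le> ln (exp K\<^sub>1 * Dn ?n x * leb (P w X))"
    using D q by auto
  then show ?thesis using D q by (simp add: ln_mult abs_le_iff)
qed

lemma leb_P_le: "leb (P w X) \<le> 2 / c\<^sub>0 * \<theta> ^ length w"
proof (cases "P w X = {}")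
  case True
  then show ?thesis using c0_pos theta_bounds by simp
next
  case False
  then obtain z where z: "z \<in> P w X" by auto
  let ?r = "\<theta> ^ length w / c\<^sub>0"
  have r: "0 \<le> ?r" using theta_bounds c0_pos by simp
  have "P w X \<subseteq> {z - ?r..z + ?r}"
  proof
    fix y assume y: "y \<in> P w X"
    have "\<bar>y - z\<bar> \<le> ?r" using y z P_in_cy[OF X_unit] by (intro diam_cy) auto
    then show "y \<in> {z - ?r..z + ?r}" by auto
  qed
  then have "leb (P w X) \<le> leb {z - ?r..z + ?r}"
    using P_lmeasurable[OF X_sets X_unit] by (intro measure_mono_fmeasurable) auto
  also have "\<dots> = 2 * ?r" using r by (simp add: measure_completion)
  finally show ?thesis by simp
qed

text \<open>Chosen such that \<open>\<alpha> (1 - s\<^sub>0) > 1\<close>, for the convergence of the series in \<open>L_exp_moment\<close>.\<close>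

definition s\<^sub>0 :: real where "s\<^sub>0 = (\<alpha> - 1) / (2 * \<alpha>)"

lemma s0: "0 < s\<^sub>0" "s\<^sub>0 < 1" "- \<alpha> * (1 - s\<^sub>0) < - 1"
  using alpha by (auto simp: s\<^sub>0_def field_simps)

lemma leb_branch_le: "leb (P [a] X) \<le> 1 / (c * real (Suc a) powr \<alpha>)"
proof -
  have "c * real (Suc a) powr \<alpha> * leb (P [a] X) \<le> leb X"
  proof (rule area(1)[OF X_sets X_unit])
    fix x assume "x \<in> P [a] X"
    then have "x \<in> J a" by simp
    then show "c * real (Suc a) powr \<alpha> \<le> Dn (length [a]) x" using branch_derivative(2) by (simp add: Dn_def)
  qed
  then show ?thesis using c_pos leb_X by (simp add: field_simps)
qed

lemma L_ge: "x \<in> J a \<Longrightarrow> ln c \<le> L x"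
  unfolding L_def using dT_ge_c[of x a] c_pos by simp

text \<open>On the branch \<open>a\<close>, whose measure \<open>q\<close> is \<open>O((a + 1) powr - \<alpha>)\<close>, the integrand is \<open>O(q powr -
  s\<^sub>0)\<close>. So the integral is dominated by \<open>\<Sum>a. (a + 1) powr (- \<alpha> (1 - s\<^sub>0))\<close>, which converges.\<close>

lemma L_exp_moment: "(\<integral>\<^sup>+x. ennreal (exp (s\<^sub>0 * \<bar>L x\<bar>)) \<partial>M) < \<infinity>"
proof -
  interpret prob_space M by (rule prob_space_M)
  define C where "C = exp (2 * s\<^sub>0 * \<bar>ln c\<bar> + s\<^sub>0 * K\<^sub>1)"
  define b where "b a = C * (1 / (c * real (Suc a) powr \<alpha>)) powr (1 - s\<^sub>0)" for a
  let ?f = "\<lambda>x. ennreal (exp (s\<^sub>0 * \<bar>L x\<bar>))" and ?I = "\<lambda>a. P [a] X"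
  note [measurable] = L_measurable_M cylset_M_sets
  have dj: "disjoint_family ?I" using J_disjoint by (auto simp: disjoint_family_on_def)
  have part: "(\<integral>\<^sup>+x. ?f x * indicator (?I a) x \<partial>M) \<le> ennreal (b a)" for a
  proof -
    define q where "q = leb (?I a)"
    have q: "0 < q" unfolding q_def by (rule leb_P_pos) (use X_unit leb_X in auto)
    have pt: "exp (s\<^sub>0 * \<bar>L x\<bar>) \<le> C * q powr (- s\<^sub>0)" if x: "x \<in> ?I a" for x
    proof -
      have "x \<in> cy [a]" using x P_in_cy[OF X_unit] by blast
      then have "\<bar>ln (Dn (length [a]) x) + ln q\<bar> \<le> K\<^sub>1" unfolding q_def by (rule leb_P_Dn)
      moreover have "ln (Dn (length [a]) x) = L x" by (simp add: Dn_def L_def)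
      ultimately have 1: "L x \<le> K\<^sub>1 - ln q" by (simp add: abs_le_iff)
      have "- \<bar>ln c\<bar> \<le> L x" using L_ge[of x a] x by auto
      then have "\<bar>L x\<bar> \<le> K\<^sub>1 - ln q + 2 * \<bar>ln c\<bar>" using 1 by (simp add: abs_le_iff)
      then have "s\<^sub>0 * \<bar>L x\<bar> \<le> s\<^sub>0 * (K\<^sub>1 - ln q + 2 * \<bar>ln c\<bar>)" using s0 by (intro mult_left_mono) auto
      then have "exp (s\<^sub>0 * \<bar>L x\<bar>) \<le> exp ((2 * s\<^sub>0 * \<bar>ln c\<bar> + s\<^sub>0 * K\<^sub>1) + - s\<^sub>0 * ln q)"
        by (simp add: algebra_simps)
      also have "\<dots> = C * q powr (- s\<^sub>0)" by (subst exp_add) (use q in \<open>simp add: C_def powr_def\<close>)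
      finally show ?thesis .
    qed
    have "(\<integral>\<^sup>+x. ?f x * indicator (?I a) x \<partial>M) \<le> (\<integral>\<^sup>+x. ennreal (C * q powr (- s\<^sub>0)) * indicator (?I a) x \<partial>M)"
      using pt by (intro nn_integral_mono) (auto simp: indicator_def intro!: ennreal_leI)
    also have "\<dots> = ennreal (C * q powr (- s\<^sub>0)) * emeasure M (?I a)"
      by (rule nn_integral_cmult_indicator) (rule cylset_M_sets)
    also have "emeasure M (?I a) = ennreal q"
      using measure_M[OF cylset_M_sets, of "[a]"] by (simp add: emeasure_eq_measure q_def)
    also have "ennreal (C * q powr (- s\<^sub>0)) * ennreal q = ennreal (C * q powr (- s\<^sub>0) * q)"
      using q by (intro ennreal_mult''[symmetric]) simp
    also have "C * q powr (- s\<^sub>0) * q = C * q powr (1 - s\<^sub>0)"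
      using q by (simp add: powr_diff powr_minus divide_inverse)
    also have "ennreal (C * q powr (1 - s\<^sub>0)) \<le> ennreal (b a)"
      unfolding b_def q_def using leb_branch_le[of a] s0
      by (intro ennreal_leI mult_left_mono powr_mono2) (auto simp: C_def)
    finally show ?thesis .
  qed
  have b_eq: "b a = C * c powr - (1 - s\<^sub>0) * real (Suc a) powr (- \<alpha> * (1 - s\<^sub>0))" for a
  proof -
    have inv: "(1 / y) powr e = y powr - e" if "0 < y" for y e :: real
      using that by (simp add: powr_divide powr_minus_divide)
    have "b a = C * (c * real (Suc a) powr \<alpha>) powr - (1 - s\<^sub>0)"
      unfolding b_def using c_pos by (subst inv) auto
    also have "\<dots> = C * (c powr - (1 - s\<^sub>0) * (real (Suc a) powr \<alpha>) powr - (1 - s\<^sub>0))"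
      using c_pos by (subst powr_mult) auto
    also have "(real (Suc a) powr \<alpha>) powr - (1 - s\<^sub>0) = real (Suc a) powr (- \<alpha> * (1 - s\<^sub>0))"
      by (simp only: powr_powr) (simp add: algebra_simps)
    finally show ?thesis by simp
  qed
  have "summable (\<lambda>a. real a powr (- \<alpha> * (1 - s\<^sub>0)))" using s0(3) by (simp only: summable_real_powr_iff)
  then have "summable (\<lambda>a. real (Suc a) powr (- \<alpha> * (1 - s\<^sub>0)))" by (subst summable_Suc_iff)
  then have sb: "summable b" unfolding b_eq[abs_def] by (rule summable_mult)
  have "(\<integral>\<^sup>+x. ?f x \<partial>M) = (\<integral>\<^sup>+x. (\<Sum>a. ?f x * indicator (?I a) x) \<partial>M)"
  proof (rule nn_integral_cong)
    fix x assume "x \<in> space M"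
    then have "x \<in> ?I (dig x)" using J_dig_X X_T by simp
    then show "?f x = (\<Sum>a. ?f x * indicator (?I a) x)" using suminf_cmult_indicator[OF dj, of x "dig x" "\<lambda>_. ?f x"] by simp
  qed
  also have "\<dots> = (\<Sum>a. \<integral>\<^sup>+x. ?f x * indicator (?I a) x \<partial>M)"
    by (rule nn_integral_suminf) measurable
  also have "\<dots> \<le> (\<Sum>a. ennreal (b a))" using part by (intro suminf_le) auto
  also have "\<dots> = ennreal (\<Sum>a. b a)" by (rule suminf_ennreal2[OF _ sb]) (simp add: b_def C_def)
  also have "\<dots> < \<infinity>" by simp
  finally show ?thesis .
qed

lemma pull_cylset: "A \<subseteq> X \<Longrightarrow> {x \<in> P w X. (T ^^ length w) x \<in> A} = P w A"
  by (auto simp: P_iff)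

sublocale G: gibbs_lyapunov M T dig \<kappa> L K\<^sub>1 s\<^sub>0 \<theta> "2 / c\<^sub>0"
proof (intro gibbs_lyapunov.intro gibbs_coding.intro gibbs_coding_axioms.intro gibbs_lyapunov_axioms.intro)
  show "prob_space M" by (rule prob_space_M)
  show "T \<in> M \<rightarrow>\<^sub>M M" by (rule T_measurable_M)
  show "dig \<in> M \<rightarrow>\<^sub>M count_space UNIV" by (rule dig_measurable_M)
  show "0 \<le> \<kappa> m" for m using K1_pos theta_bounds c0_pos by (simp add: \<kappa>_def)
  have "\<kappa> \<longlonglongrightarrow> 2 * (K\<^sub>1 * (0 / c\<^sub>0))"
    unfolding \<kappa>_def[abs_def] using theta_bounds c0_pos by (intro tendsto_intros LIMSEQ_power_zero) auto
  then show "\<kappa> \<longlonglongrightarrow> 0" by simp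
  show "0 < measure M (cylset M T dig w)" for w
    unfolding cylset_M measure_M[OF cylset_M_sets] by (rule leb_P_pos) (use X_unit leb_X in auto)
  fix A :: "real set" and u w assume "A \<in> sets M" "A \<subseteq> cylset M T dig u"
  then have A: "A \<in> sets M" "A \<subseteq> P u X" "A \<subseteq> X" by (auto simp: cylset_M sets_M)
  show "measure M {x \<in> cylset M T dig w. (T ^^ length w) x \<in> A} * measure M (cylset M T dig u)
        \<le> exp (\<kappa> (length u)) * (measure M (cylset M T dig (w @ u)) * measure M A)"
    unfolding cylset_M pull_cylset[OF A(3)] measure_M[OF cylset_M_sets] measure_M[OF A(1)] measure_M[OF P_sets_M[OF A(1)]]
    by (rule gibbs_M(1)[OF A(1,2)])
  show "measure M (cylset M T dig (w @ u)) * measure M A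
        \<le> exp (\<kappa> (length u)) *
          (measure M {x \<in> cylset M T dig w. (T ^^ length w) x \<in> A} * measure M (cylset M T dig u))"
    unfolding cylset_M pull_cylset[OF A(3)] measure_M[OF cylset_M_sets] measure_M[OF A(1)] measure_M[OF P_sets_M[OF A(1)]]
    by (rule gibbs_M(2)[OF A(1,2)])
next
  show "sets M = sigma_sets (space M) (range (cylset M T dig))"
    unfolding space_M by (rule generate_M) (simp add: fun_eq_iff cylset_M)
  show "L \<in> borel_measurable M" by (rule L_measurable_M)
  show "\<bar>birk T L n x + ln (measure M (cylset M T dig (itin T dig n x)))\<bar> \<le> K\<^sub>1" if "x \<in> space M" for x n
  proof -
    let ?w = "itin T dig n x"
    have "x \<in> cylset M T dig ?w" using that by (simp add: cylset_def)
    then have x: "x \<in> P ?w X" by (simp add: cylset_M)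
    have "birk T L n x = ln (Dn n x)" using birk_L[OF x] by simp
    then show ?thesis
      using leb_P_Dn[of x ?w] x P_in_cy[OF X_unit] unfolding cylset_M measure_M[OF cylset_M_sets] by auto
  qed
  show "\<exists>m. \<forall>x\<in>space M. \<forall>y\<in>space M. itin T dig m x = itin T dig m y \<longrightarrow> \<bar>L x - L y\<bar> \<le> \<epsilon>" if "0 < \<epsilon>" for \<epsilon>
  proof -
    have "(\<lambda>n. K * (\<theta> ^ n / c\<^sub>0)) \<longlonglongrightarrow> K * (0 / c\<^sub>0)"
      using theta_bounds c0_pos by (intro tendsto_intros LIMSEQ_power_zero) auto
    then have "\<forall>\<^sub>F n in sequentially. K * (\<theta> ^ n / c\<^sub>0) < \<epsilon>" using that by (intro order_tendstoD(2)) auto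
    then obtain n where n: "K * (\<theta> ^ n / c\<^sub>0) < \<epsilon>" unfolding eventually_sequentially by auto
    show ?thesis
    proof (intro exI[of _ "Suc n"] ballI impI)
      fix x y assume x: "x \<in> space M" and y: "y \<in> space M" and e: "itin T dig (Suc n) x = itin T dig (Suc n) y"
      let ?w = "itin T dig n (T x)"
      have d: "dig x = dig y" "itin T dig n (T y) = ?w" using e by (auto simp: itin_Suc)
      have J: "x \<in> J (dig x)" "y \<in> J (dig x)" using x y J_dig_X[of x] J_dig_X[of y] d(1) by auto
      have "T x \<in> cylset M T dig ?w" "T y \<in> cylset M T dig ?w"
        using x y X_T d(2) by (auto simp: cylset_def)
      then have cyx: "T x \<in> cy ?w" "T y \<in> cy ?w" using P_in_cy[OF X_unit] by (auto simp: cylset_M)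
      have "\<bar>L x - L y\<bar> \<le> K * \<bar>T x - T y\<bar>" unfolding L_def by (rule branch_derivative(4)[OF J])
      also have "\<dots> \<le> K * (\<theta> ^ n / c\<^sub>0)" using diam_cy[OF cyx] K_pos by (intro mult_left_mono) auto
      finally show "\<bar>L x - L y\<bar> \<le> \<epsilon>" using n by simp
    qed
  qed
  show "0 < s\<^sub>0" by (rule s0(1))
  show "(\<integral>\<^sup>+x. ennreal (exp (s\<^sub>0 * \<bar>L x\<bar>)) \<partial>M) < \<infinity>" by (rule L_exp_moment)
  show "0 < \<theta>" "\<theta> < 1" using theta_bounds by auto
  show "measure M (cylset M T dig w) \<le> 2 / c\<^sub>0 * \<theta> ^ length w" for w
    unfolding cylset_M measure_M[OF cylset_M_sets] by (rule leb_P_le)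
qed

section \<open>Invariant measures and Kolmogorov-Sinai entropy\<close>

lemma cyl_eq: "G.cyl w = P w X" by (rule cylset_M)

lemma space_unit: "space unit_borel = {0<..1}" by (simp add: space_restrict_space)

lemma sets_unit: "A \<in> sets unit_borel \<longleftrightarrow> A \<in> sets borel \<and> A \<subseteq> {0<..1}"
  by (auto simp: sets_restrict_space_iff)

text \<open>By invariance the preimage of \<open>(0,1]\<close> has full measure, and so have all iterated preimages.\<close>

lemma invariant_AE_X:
  assumes inv: "invariant_prob T \<nu>"
  shows "X \<in> sets \<nu>" "AE x in \<nu>. x \<in> X"
proof -
  have ps: "prob_space \<nu>" and sets: "sets \<nu> = sets unit_borel"
    and ti: "\<And>A. A \<in> sets \<nu> \<Longrightarrow> T -` A \<inter> space \<nu> \<in> sets \<nu> \<and> emeasure \<nu> (T -` A \<inter> space \<nu>) = emeasure \<nu> A"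
    using inv unfolding invariant_prob_def by auto
  interpret prob_space \<nu> by (rule ps)
  have sp: "space \<nu> = {0<..1}" using sets_eq_imp_space_eq[OF sets] space_unit by simp
  show Xs: "X \<in> sets \<nu>" unfolding sets sets_unit using X_subset by auto
  define A where "A n = {x. \<forall>i\<le>n. (T ^^ i) x \<in> {0<..1}}" for n
  have A_Suc: "A (Suc n) = T -` A n \<inter> space \<nu>" for n
  proof (rule set_eqI)
    fix x
    have "x \<in> A (Suc n) \<longleftrightarrow> (\<forall>i<Suc (Suc n). (T ^^ i) x \<in> {0<..1})" unfolding A_def less_Suc_eq_le by simp
    also have "\<dots> \<longleftrightarrow> x \<in> {0<..1} \<and> (\<forall>i<Suc n. (T ^^ i) (T x) \<in> {0<..1})"
      unfolding All_less_Suc2[of "Suc n"] by (simp add: funpow_swap1)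
    also have "\<dots> \<longleftrightarrow> x \<in> T -` A n \<inter> space \<nu>" unfolding A_def less_Suc_eq_le sp by auto
    finally show "x \<in> A (Suc n) \<longleftrightarrow> x \<in> T -` A n \<inter> space \<nu>" .
  qed
  have A: "A n \<in> sets \<nu> \<and> emeasure \<nu> (A n) = 1" for n
  proof (induction n)
    case 0
    have "A 0 = space \<nu>" by (auto simp: A_def sp)
    then show ?case using emeasure_space_1 by simp
  next
    case (Suc n)
    then show ?case using ti[of "A n"] unfolding A_Suc by auto
  qed
  have "AE x in \<nu>. x \<in> A n" for n
    using A[of n] AE_in_set_eq_1[of "A n"] by (simp add: emeasure_eq_measure)
  then have "AE x in \<nu>. \<forall>n. x \<in> A n" by (simp add: AE_all_countable)
  then show "AE x in \<nu>. x \<in> X"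
    by eventually_elim (auto simp: A_def X_def)
qed

text \<open>The restriction of an invariant measure to \<open>X\<close>, where it carries all its mass and where digits
  are defined along orbits.\<close>

definition core :: "real measure \<Rightarrow> real measure" where "core \<nu> = restrict_space \<nu> X"

context
  fixes \<nu> :: "real measure"
  assumes inv: "invariant_prob T \<nu>"
begin

interpretation nu: prob_space \<nu> using inv by (simp add: invariant_prob_def)

lemma sets_nu: "sets \<nu> = sets unit_borel" using inv by (simp add: invariant_prob_def)

lemma space_nu: "space \<nu> = {0<..1}" using sets_eq_imp_space_eq[OF sets_nu] space_unit by simp

lemma sets_core: "sets (core \<nu>) = sets M"
proof (rule set_eqI)
  fix A
  have "A \<in> sets (core \<nu>) \<longleftrightarrow> A \<subseteq> X \<and> A \<in> sets \<nu>"
    unfolding core_def using invariant_AE_X(1)[OF inv] sets.sets_into_space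
    by (subst sets_restrict_space_iff) (auto intro: sets.Int)
  then show "A \<in> sets (core \<nu>) \<longleftrightarrow> A \<in> sets M"
    unfolding sets_nu sets_unit sets_M using X_subset by auto
qed

lemma space_core: "space (core \<nu>) = X"
  using sets_eq_imp_space_eq[OF sets_core] by simp

lemma measure_core:
  assumes A: "A \<in> sets \<nu>"
  shows "measure (core \<nu>) (A \<inter> X) = measure \<nu> A"
proof -
  have Xs: "X \<inter> space \<nu> \<in> sets \<nu>" using invariant_AE_X(1)[OF inv] by auto
  have "measure (core \<nu>) (A \<inter> X) = measure \<nu> (A \<inter> X)"
    unfolding core_def by (rule measure_restrict_space[OF Xs]) auto
  also have "\<dots> = measure \<nu> A"
    using A invariant_AE_X[OF inv] by (intro nu.finite_measure_eq_AE) auto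
  finally show ?thesis .
qed

lemma prob_space_core: "prob_space (core \<nu>)"
proof
  have Xs: "X \<inter> space \<nu> \<in> sets \<nu>" using invariant_AE_X(1)[OF inv] by auto
  have "emeasure (core \<nu>) (space (core \<nu>)) = emeasure \<nu> X"
    unfolding space_core unfolding core_def by (rule emeasure_restrict_space[OF Xs]) auto
  also have "\<dots> = 1" using invariant_AE_X[OF inv] nu.emeasure_eq_1_AE by blast
  finally show "emeasure (core \<nu>) (space (core \<nu>)) = 1" .
qed

lemma integral_core:
  assumes f: "f \<in> borel_measurable \<nu>"
  shows "(LINT x|core \<nu>. f x) = (LINT x|\<nu>. f x :: real)"
    and "integrable (core \<nu>) f \<longleftrightarrow> integrable \<nu> f"
proof -
  have Xs: "X \<inter> space \<nu> \<in> sets \<nu>" "X \<in> sets \<nu>" using invariant_AE_X(1)[OF inv] by auto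
  have m: "(\<lambda>x. indicator X x *\<^sub>R f x) \<in> borel_measurable \<nu>" using f Xs by measurable
  have ae: "AE x in \<nu>. indicator X x *\<^sub>R f x = f x"
    using invariant_AE_X(2)[OF inv] by eventually_elim simp
  have "(LINT x|core \<nu>. f x) = (LINT x|\<nu>. indicator X x *\<^sub>R f x)"
    unfolding core_def by (rule integral_restrict_space[OF Xs(1)])
  also have "\<dots> = (LINT x|\<nu>. f x)"
    by (rule integral_cong_AE[OF m f ae])
  finally show "(LINT x|core \<nu>. f x) = (LINT x|\<nu>. f x)" .
  have "integrable (core \<nu>) f \<longleftrightarrow> integrable \<nu> (\<lambda>x. indicator X x *\<^sub>R f x)"
    unfolding core_def by (rule integrable_restrict_space[OF Xs(1)])
  also have "\<dots> \<longleftrightarrow> integrable \<nu> f" by (rule integrable_cong_AE[OF m f ae])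
  finally show "integrable (core \<nu>) f \<longleftrightarrow> integrable \<nu> f" .
qed

lemma core_labelled:
  assumes l: "\<And>i. {x \<in> X. l x = i} \<in> sets M" and less: "\<And>x. x \<in> X \<Longrightarrow> l x < (r :: nat)"
  shows "labelled_mpt (core \<nu>) T l r"
proof (intro labelled_mpt.intro labelled_mpt_axioms.intro prob_space_core)
  show "T \<in> core \<nu> \<rightarrow>\<^sub>M core \<nu>"
    using T_measurable_M by (simp cong: measurable_cong_sets add: sets_core)
  show "l \<in> core \<nu> \<rightarrow>\<^sub>M count_space UNIV"
  proof (rule measurableI)
    fix S :: "nat set"
    have "l -` S \<inter> space (core \<nu>) = (\<Union>i\<in>S. {x \<in> X. l x = i})" by (auto simp: space_core)
    also have "\<dots> \<in> sets (core \<nu>)" unfolding sets_core using l by (intro sets.countable_UN'') auto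
    finally show "l -` S \<inter> space (core \<nu>) \<in> sets (core \<nu>)" .
  qed simp
  show "x \<in> space (core \<nu>) \<Longrightarrow> l x < r" for x using less by (simp add: space_core)
  fix A assume "A \<in> sets (core \<nu>)"
  then have A: "A \<in> sets \<nu>" "A \<subseteq> X" unfolding sets_core sets_M sets_nu sets_unit using X_subset by auto
  have TA: "T -` A \<inter> space \<nu> \<in> sets \<nu>" "emeasure \<nu> (T -` A \<inter> space \<nu>) = emeasure \<nu> A"
    using inv A(1) unfolding invariant_prob_def by auto
  have "{x \<in> space (core \<nu>). T x \<in> A} = (T -` A \<inter> space \<nu>) \<inter> X"
    using X_subset by (auto simp: space_core space_nu)
  then have "measure (core \<nu>) {x \<in> space (core \<nu>). T x \<in> A} = measure \<nu> (T -` A \<inter> space \<nu>)"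
    using measure_core[OF TA(1)] by simp
  also have "\<dots> = measure \<nu> A" using TA(2) by (simp add: measure_def)
  also have "\<dots> = measure (core \<nu>) A" using measure_core[OF A(1)] A(2) by (simp add: Int_absorb2)
  finally show "measure (core \<nu>) {x \<in> space (core \<nu>). T x \<in> A} = measure (core \<nu>) A" .
qed

text \<open>The cells of the joins of the partition \<open>p ` {..<r}\<close>, indexed by words of labels.\<close>

definition join_cell :: "(nat \<Rightarrow> real set) \<Rightarrow> nat list \<Rightarrow> real set" where
  "join_cell p w = {x \<in> space \<nu>. \<forall>i<length w. (T ^^ i) x \<in> p (w ! i)}"

lemma join_cell_sets:
  assumes p: "\<And>i. i < r \<Longrightarrow> p i \<in> sets \<nu>"
  shows "set w \<subseteq> {..<r} \<Longrightarrow> join_cell p w \<in> sets \<nu>"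
proof (induction w)
  case Nil
  then show ?case by (simp add: join_cell_def)
next
  case (Cons a w)
  have a: "p a \<in> sets \<nu>" "p a \<subseteq> space \<nu>" using Cons.prems p[of a] sets.sets_into_space by auto
  have IH: "join_cell p w \<in> sets \<nu>" using Cons by auto
  have step: "x \<in> join_cell p (a # w) \<longleftrightarrow> x \<in> space \<nu> \<and> x \<in> p a \<and> (\<forall>i<length w. (T ^^ i) (T x) \<in> p (w ! i))" for x
    by (simp add: join_cell_def All_less_Suc2 funpow_swap1)
  show ?case
  proof (cases w)
    case Nil
    then have "join_cell p (a # w) = p a" using step a by auto
    then show ?thesis using a by simp
  next
    case (Cons b v)
    have "T x \<in> space \<nu>" if "\<forall>i<length w. (T ^^ i) (T x) \<in> p (w ! i)" for x
      using that[rule_format, of 0] Cons p[of b] Cons.prems sets.sets_into_space by fastforce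
    then have "join_cell p (a # w) = p a \<inter> (T -` join_cell p w \<inter> space \<nu>)"
      using step a by (auto simp: join_cell_def)
    moreover have "T -` join_cell p w \<inter> space \<nu> \<in> sets \<nu>"
      using inv IH unfolding invariant_prob_def by blast
    ultimately show ?thesis using a by simp
  qed
qed

lemma dynamical_join_eq:
  "dynamical_join T \<nu> n (p ` {..<r}) = join_cell p ` words r n"
proof
  show "dynamical_join T \<nu> n (p ` {..<r}) \<subseteq> join_cell p ` words r n"
  proof
    fix D assume "D \<in> dynamical_join T \<nu> n (p ` {..<r})"
    then obtain C where C: "C \<in> {..<n} \<rightarrow>\<^sub>E p ` {..<r}" "D = {x \<in> space \<nu>. \<forall>i<n. (T ^^ i) x \<in> C i}"
      by (auto simp: dynamical_join_def)
    have "\<forall>i\<in>{..<n}. \<exists>j. j < r \<and> C i = p j"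
    proof
      fix i assume "i \<in> {..<n}"
      then have "C i \<in> p ` {..<r}" using PiE_mem[OF C(1)] by blast
      then show "\<exists>j. j < r \<and> C i = p j" by auto
    qed
    then obtain j where j: "\<forall>i\<in>{..<n}. j i < r \<and> C i = p (j i)" by (rule bchoice[THEN exE])
    let ?w = "map j [0..<n]"
    have "?w \<in> words r n" using j by (auto simp: words_def)
    moreover have "D = join_cell p ?w" unfolding C(2) join_cell_def using j by auto
    ultimately show "D \<in> join_cell p ` words r n" by blast
  qed
  show "join_cell p ` words r n \<subseteq> dynamical_join T \<nu> n (p ` {..<r})"
  proof
    fix D assume "D \<in> join_cell p ` words r n"
    then obtain w where w: "w \<in> words r n" "D = join_cell p w" by auto
    let ?C = "\<lambda>i\<in>{..<n}. p (w ! i)"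
    have "?C \<in> {..<n} \<rightarrow>\<^sub>E p ` {..<r}"
    proof (rule restrict_PiE_iff[THEN iffD2], rule ballI)
      fix i assume "i \<in> {..<n}"
      then have "w ! i \<in> set w" using w by (auto simp: words_def)
      then show "p (w ! i) \<in> p ` {..<r}" using w by (auto simp: words_def)
    qed
    moreover have "D = {x \<in> space \<nu>. \<forall>i<n. (T ^^ i) x \<in> ?C i}"
      unfolding w(2) join_cell_def using w(1) by (auto simp: words_def)
    ultimately show "D \<in> dynamical_join T \<nu> n (p ` {..<r})" unfolding dynamical_join_def by blast
  qed
qed

text \<open>Different words may give the same cell on \<open>(0,1]\<close>, but only an empty one on \<open>X\<close>; such cells
  contribute \<open>0\<close> to the entropy, and the sum over cells is the sum over words.\<close>

lemma partition_entropy_eq: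
  assumes p: "\<And>i. i < r \<Longrightarrow> p i \<in> sets \<nu>"
    and l: "\<And>x i. x \<in> X \<Longrightarrow> i < r \<Longrightarrow> x \<in> p i \<longleftrightarrow> l x = i"
    and lm: "labelled_mpt (core \<nu>) T l r"
  shows "partition_entropy \<nu> (dynamical_join T \<nu> n (p ` {..<r})) = labelled_mpt.cell_entropy (core \<nu>) T l r n"
proof -
  interpret N: labelled_mpt "core \<nu>" T l r by (rule lm)
  have cell: "join_cell p w \<inter> X = N.cell w" if w: "w \<in> words r n" for w
  proof -
    have wi: "w ! i < r" if "i < length w" for i
      using subsetD[of "set w" "{..<r}", OF _ nth_mem[OF that]] w by (simp add: words_def)
    have "itin T l (length w) x = w \<longleftrightarrow> (\<forall>i<length w. (T ^^ i) x \<in> p (w ! i))" if x: "x \<in> X" for x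
      using l[OF X_iterate[OF x] wi] by (auto simp: list_eq_iff_nth_eq nth_itin)
    then show ?thesis using X_subset by (auto simp: join_cell_def N.cell_def space_core space_nu)
  qed
  have m: "measure \<nu> (join_cell p w) = measure (core \<nu>) (N.cell w)" if w: "w \<in> words r n" for w
    using measure_core[OF join_cell_sets[of r p w, OF p]] cell[OF w] w by (simp add: words_def)
  let ?f = "\<lambda>A. measure \<nu> A * ln (measure \<nu> A)"
  have "(\<Sum>A\<in>join_cell p ` words r n. ?f A) = (\<Sum>w\<in>words r n. ?f (join_cell p w))"
  proof (rule sum.reindex_nontrivial[unfolded comp_def])
    fix w w' assume w: "w \<in> words r n" "w' \<in> words r n" "w \<noteq> w'" "join_cell p w = join_cell p w'"
    have "N.cell w = N.cell w'" using cell w by metis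
    moreover have "N.cell w \<inter> N.cell w' = {}" using w by (auto simp: N.cell_def words_def)
    ultimately have "N.cell w = {}" by simp
    then show "?f (join_cell p w) = 0" using m[OF w(1)] by simp
  qed simp
  then show ?thesis
    unfolding partition_entropy_def dynamical_join_eq N.cell_entropy_def
    using m by (simp add: sum_negf)
qed

text \<open>A partition that almost attains the supremum is turned into labels by numbering its sets.\<close>

lemma KS_entropy_imp_entropy_ge:
  assumes KS: "\<And>\<epsilon>. \<epsilon> > 0 \<Longrightarrow> ereal (c' - \<epsilon>) \<le> KS_entropy T \<nu>"
  shows "G.entropy_ge (core \<nu>) c'"
  unfolding G.entropy_ge_def
proof (intro allI impI)
  fix \<epsilon> :: real assume \<epsilon>: "0 < \<epsilon>"
  have "ereal (c' - \<epsilon>) < ereal (c' - \<epsilon> / 2)" using \<epsilon> by simp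
  also have "\<dots> \<le> KS_entropy T \<nu>" using \<epsilon> by (intro KS) simp
  finally obtain P where P: "finite_partition \<nu> P"
    and lim: "c' - \<epsilon> < lim (\<lambda>n. partition_entropy \<nu> (dynamical_join T \<nu> n P) / real n)"
    unfolding KS_entropy_def less_SUP_iff by auto
  have fin: "finite P" and Ps: "P \<subseteq> sets \<nu>" and part: "partition_on (space \<nu>) P"
    using P by (auto simp: finite_partition_def)
  define r where "r = card P"
  obtain p where bij: "bij_betw p {0..<card P} P" using ex_bij_betw_nat_finite[OF fin] by blast
  have Pp: "P = p ` {..<r}" and inj: "inj_on p {..<r}"
    using bij by (auto simp: bij_betw_def r_def atLeast0LessThan)
  have disj: "i = j" if "i < r" "j < r" "x \<in> p i" "x \<in> p j" for i j x
  proof -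
    have "p i \<in> P" "p j \<in> P" using that Pp by auto
    then have "p i = p j" using part that unfolding partition_on_def disjoint_def by blast
    then show ?thesis using inj that by (auto dest: inj_onD)
  qed
  define l where "l x = (THE i. i < r \<and> x \<in> p i)" for x
  have ex: "\<exists>i. i < r \<and> x \<in> p i" if "x \<in> X" for x
  proof -
    have "x \<in> \<Union>P" using part that X_subset unfolding partition_on_def space_nu by auto
    then show ?thesis using Pp by auto
  qed
  have leq: "l x = i" if "i < r" "x \<in> p i" for x i
    unfolding l_def using disj that by (intro the_equality) auto
  have l: "x \<in> p i \<longleftrightarrow> l x = i" if x: "x \<in> X" and i: "i < r" for x i
    using ex[OF x] leq i by metis
  have less: "l x < r" if "x \<in> X" for x using ex[OF that] leq by metis
  have ps: "p i \<in> sets \<nu>" if "i < r" for i using Ps Pp that by auto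
  have lm: "labelled_mpt (core \<nu>) T l r"
  proof (rule core_labelled[OF _ less])
    fix i
    show "{x \<in> X. l x = i} \<in> sets M"
    proof (cases "i < r")
      case True
      then have "{x \<in> X. l x = i} = p i \<inter> X" using l by auto
      then show ?thesis using ps[OF True] X_sets unfolding sets_nu sets_unit sets_M by auto
    next
      case False
      then have "{x \<in> X. l x = i} = {}" using less by auto
      show ?thesis unfolding \<open>{x \<in> X. l x = i} = {}\<close> by (rule sets.empty_sets)
    qed
  qed
  interpret N: labelled_mpt "core \<nu>" T l r by (rule lm)
  obtain h where h: "(\<lambda>n. N.cell_entropy n / real n) \<longlonglongrightarrow> h" "\<And>n. n \<ge> 1 \<Longrightarrow> h \<le> N.cell_entropy n / real n"
    using N.cell_entropy_limit by blast
  have "lim (\<lambda>n. partition_entropy \<nu> (dynamical_join T \<nu> n P) / real n) = h"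
    unfolding Pp using partition_entropy_eq[OF ps l lm] h(1) by (simp add: limI)
  then have "c' - \<epsilon> \<le> N.cell_entropy n / real n" if "n \<ge> 1" for n using lim h(2)[OF that] by simp
  then have "real n * (c' - \<epsilon>) \<le> N.cell_entropy n" if "n \<ge> 1" for n
    using that by (simp add: field_simps)
  then show "\<exists>l r. labelled_mpt (core \<nu>) T l r \<and> (\<forall>n\<ge>1. real n * (c' - \<epsilon>) \<le> labelled_mpt.cell_entropy (core \<nu>) T l r n)"
    using lm by blast
qed

text \<open>The digits below \<open>N\<close>, and all others together, define a partition of \<open>(0,1]\<close> into \<open>N + 1\<close> sets.\<close>

lemma KS_entropy_ge_digits:
  assumes h: "(\<lambda>n. labelled_mpt.cell_entropy (core \<nu>) T (\<lambda>x. min (dig x) N) (Suc N) n / real n) \<longlonglongrightarrow> h"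
  shows "ereal h \<le> KS_entropy T \<nu>"
proof -
  define p where "p i = {x \<in> {0<..1}. min (dig x) N = i}" for i
  have pu: "p i \<in> sets unit_borel" for i
  proof -
    have "p i = dig -` {a. min a N = i} \<inter> space unit_borel" by (auto simp: p_def space_unit)
    then show ?thesis using measurable_sets[OF dig_measurable_unit, of "{a. min a N = i}"] by simp
  qed
  have ps: "p i \<in> sets \<nu>" for i using pu sets_nu by simp
  have l: "x \<in> p i \<longleftrightarrow> min (dig x) N = i" if "x \<in> X" for x i using that X_subset by (auto simp: p_def)
  have lm: "labelled_mpt (core \<nu>) T (\<lambda>x. min (dig x) N) (Suc N)"
  proof (rule core_labelled)
    fix i
    have "{x \<in> X. min (dig x) N = i} = p i \<inter> X" using l by auto
    then show "{x \<in> X. min (dig x) N = i} \<in> sets M"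
      using pu[of i] X_sets unfolding sets_unit sets_M by auto
  qed auto
  have ne: "p i \<noteq> {}" if "i < Suc N" for i
  proof -
    have "hi i \<in> J i" using lo_less_hi[of i] by (simp add: J_eq)
    then have "hi i \<in> p i" using that J_subset[of i] dig_eq[of "hi i" i] by (auto simp: p_def)
    then show ?thesis by blast
  qed
  have "finite_partition \<nu> (p ` {..<Suc N})"
    unfolding finite_partition_def partition_on_def
  proof (intro conjI)
    show "p ` {..<Suc N} \<subseteq> sets \<nu>" using ps by auto
    show "\<Union> (p ` {..<Suc N}) = space \<nu>"
    proof (intro equalityI subsetI)
      fix x assume "x \<in> space \<nu>"
      then have "x \<in> p (min (dig x) N)" by (simp add: p_def space_nu)
      moreover have "min (dig x) N \<in> {..<Suc N}" by simp
      ultimately show "x \<in> \<Union> (p ` {..<Suc N})" by blast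
    qed (auto simp: p_def space_nu)
    show "disjoint (p ` {..<Suc N})" by (auto simp: disjoint_def p_def)
    show "{} \<notin> p ` {..<Suc N}" using ne by (metis (no_types, lifting) imageE lessThan_iff)
  qed simp
  then have "ereal (lim (\<lambda>n. partition_entropy \<nu> (dynamical_join T \<nu> n (p ` {..<Suc N})) / real n)) \<le> KS_entropy T \<nu>"
    unfolding KS_entropy_def by (intro SUP_upper) simp
  moreover have "lim (\<lambda>n. partition_entropy \<nu> (dynamical_join T \<nu> n (p ` {..<Suc N})) / real n) = h"
    using partition_entropy_eq[OF ps l lm] h by (simp add: limI)
  ultimately show ?thesis by simp
qed

lemma lyapunov_core:
  "lyapunov_exponent d T \<nu> = (LINT x|core \<nu>. L x)"
  "integrable \<nu> (\<lambda>x. ln \<bar>iter_deriv d T 1 x\<bar>) \<longleftrightarrow> integrable (core \<nu>) L"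
proof -
  have m: "L \<in> borel_measurable \<nu>" using L_measurable_unit by (simp cong: measurable_cong_sets add: sets_nu)
  have e: "L = (\<lambda>x. ln \<bar>iter_deriv d T 1 x\<bar>)" by (simp add: fun_eq_iff L_def dT_def)
  show "lyapunov_exponent d T \<nu> = (LINT x|core \<nu>. L x)"
    unfolding integral_core(1)[OF m] lyapunov_exponent_def by (simp add: e)
  show "integrable \<nu> (\<lambda>x. ln \<bar>iter_deriv d T 1 x\<bar>) \<longleftrightarrow> integrable (core \<nu>) L"
    unfolding integral_core(2)[OF m] by (simp add: e)
qed

end

text \<open>The measure \<open>acim\<close> as a measure on \<open>(0,1]\<close>, to compete with the equilibrium measure.\<close>

definition acim_unit :: "real measure" where "acim_unit = distr G.acim unit_borel (\<lambda>x. x)"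

lemma id_measurable: "(\<lambda>x. x) \<in> G.acim \<rightarrow>\<^sub>M unit_borel"
proof (rule measurableI)
  fix A assume "A \<in> sets unit_borel"
  then show "(\<lambda>x. x) -` A \<inter> space G.acim \<in> sets G.acim"
    unfolding sets_unit using X_sets by (auto simp: sets_M)
qed (use X_subset in \<open>auto simp: space_restrict_space\<close>)

lemma emeasure_acim_unit: "A \<in> sets unit_borel \<Longrightarrow> emeasure acim_unit A = emeasure G.acim (A \<inter> X)"
  unfolding acim_unit_def by (subst emeasure_distr[OF id_measurable]) auto

lemma invariant_acim_unit: "invariant_prob T acim_unit"
  unfolding invariant_prob_def
proof (intro conjI ballI)
  show "prob_space acim_unit"
    unfolding acim_unit_def by (rule prob_space.prob_space_distr[OF G.prob_space_acim id_measurable])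
  show "sets acim_unit = sets unit_borel" by (simp add: acim_unit_def)
  have sp: "space acim_unit = {0<..1}" by (simp add: acim_unit_def space_unit)
  fix A assume "A \<in> sets acim_unit"
  then have A: "A \<in> sets unit_borel" by (simp add: acim_unit_def)
  have e: "T -` A \<inter> space acim_unit = (\<Union>a. P [a] A)"
    unfolding sp using J_dig J_subset by (auto simp del: greaterThanAtMost_iff)
  have "(\<Union>a. P [a] A) \<in> sets unit_borel"
    unfolding sets_unit
  proof
    show "(\<Union>a. P [a] A) \<in> sets borel" using A P_sets[of A] unfolding sets_unit by (intro sets.countable_UN) blast
    show "(\<Union>a. P [a] A) \<subseteq> {0<..1}" using J_subset by auto
  qed
  then show TA: "T -` A \<inter> space acim_unit \<in> sets acim_unit" unfolding e by (simp add: acim_unit_def)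
  have TA': "T -` A \<inter> space acim_unit \<in> sets unit_borel" using TA by (simp add: acim_unit_def)
  have AX: "A \<inter> X \<in> sets M" using A X_sets unfolding sets_unit by (auto simp: sets_M)
  have eq: "(T -` A \<inter> space acim_unit) \<inter> X = {x \<in> space M. T x \<in> A \<inter> X}"
    using X_subset X_T by (auto simp: sp)
  have TX: "{x \<in> space M. T x \<in> A \<inter> X} \<in> sets M"
    using measurable_sets[OF T_measurable_M AX] by (simp add: vimage_def Int_def conj_commute)
  show "emeasure acim_unit (T -` A \<inter> space acim_unit) = emeasure acim_unit A"
    unfolding emeasure_acim_unit[OF A] emeasure_acim_unit[OF TA'] eq
    using G.acim_invariant[OF AX] AX TX by (simp add: G.emeasure_acim G.measure_acim)
qed

lemma core_acim_unit: "core acim_unit = G.acim"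
proof (rule measure_eqI)
  show s: "sets (core acim_unit) = sets G.acim" using sets_core[OF invariant_acim_unit] by simp
  fix A assume "A \<in> sets (core acim_unit)"
  then have A: "A \<in> sets M" using s by simp
  then have Au: "A \<in> sets unit_borel" "A \<subseteq> X" unfolding sets_unit sets_M using X_subset by auto
  have "X \<inter> space acim_unit \<in> sets acim_unit" using invariant_AE_X(1)[OF invariant_acim_unit] by auto
  then have "emeasure (core acim_unit) A = emeasure acim_unit A"
    unfolding core_def using Au by (intro emeasure_restrict_space)
  then show "emeasure (core acim_unit) A = emeasure G.acim A"
    using emeasure_acim_unit[OF Au(1)] Au(2) by (simp add: Int_absorb2)
qed

lemma admissible_acim_unit: "admissible_measure d T acim_unit"
  unfolding admissible_measure_def
  using invariant_acim_unit lyapunov_core(2)[OF invariant_acim_unit] G.integrable_acim_L core_acim_unit by simp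

lemma KS_entropy_acim_unit:
  assumes "\<epsilon> > 0"
  shows "ereal (lyapunov_exponent d T acim_unit - \<epsilon>) \<le> KS_entropy T acim_unit"
proof -
  obtain N h where h: "(\<lambda>n. labelled_mpt.cell_entropy G.acim T (\<lambda>x. min (dig x) N) (Suc N) n / real n) \<longlonglongrightarrow> h"
    "(LINT x|G.acim. L x) - \<epsilon> \<le> h"
    using G.acim_entropy_ge[OF assms] by blast
  have "ereal h \<le> KS_entropy T acim_unit"
    using h(1) by (intro KS_entropy_ge_digits[OF invariant_acim_unit, of N]) (simp add: core_acim_unit)
  moreover have "ereal (lyapunov_exponent d T acim_unit - \<epsilon>) \<le> ereal h"
    using h(2) lyapunov_core(1)[OF invariant_acim_unit] core_acim_unit by simp
  ultimately show ?thesis by (rule order_trans[rotated])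
qed

text \<open>Maximality against \<open>acim_unit\<close> shows that the entropy of \<open>\<nu>\<close> is at least its Lyapunov exponent,
  and this property characterizes \<open>acim\<close>.\<close>

theorem core_equilibrium:
  assumes eq: "equilibrium_measure d T \<nu>"
  shows "core \<nu> = G.acim"
proof -
  have adm: "admissible_measure d T \<nu>" using eq by (simp add: equilibrium_measure_def)
  then have inv: "invariant_prob T \<nu>" by (simp add: admissible_measure_def)
  have iL: "integrable (core \<nu>) L"
    using adm lyapunov_core(2)[OF inv] by (simp add: admissible_measure_def)
  have max: "KS_entropy T acim_unit - ereal (lyapunov_exponent d T acim_unit)
          \<le> KS_entropy T \<nu> - ereal (lyapunov_exponent d T \<nu>)"
    using eq admissible_acim_unit by (simp add: equilibrium_measure_def)
  have "ereal (lyapunov_exponent d T \<nu> - \<epsilon>) \<le> KS_entropy T \<nu>" if "\<epsilon> > 0" for \<epsilon>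
  proof -
    have "ereal (lyapunov_exponent d T acim_unit - \<epsilon>) - ereal (lyapunov_exponent d T acim_unit)
      \<le> KS_entropy T acim_unit - ereal (lyapunov_exponent d T acim_unit)"
      by (intro ereal_minus_mono KS_entropy_acim_unit that) simp
    also note max
    finally have "ereal (- \<epsilon>) \<le> KS_entropy T \<nu> - ereal (lyapunov_exponent d T \<nu>)" by simp
    then show ?thesis by (cases "KS_entropy T \<nu>") auto
  qed
  then have "G.entropy_ge (core \<nu>) (LINT x|core \<nu>. L x)"
    unfolding lyapunov_core(1)[OF inv] by (rule KS_entropy_imp_entropy_ge[OF inv])
  then show ?thesis
    by (rule G.equilibrium_unique[OF sets_core[OF inv] prob_space_core[OF inv] iL])
qed

end

section \<open>Boundary points as words\<close>

text \<open>The first \<open>m k\<close> of the negligible sets are removed from \<open>B k\<close>, where \<open>m k\<close> tends to infinity so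
  slowly that their total proportion still tends to \<open>0\<close>.\<close>

lemma diagonal_selection:
  fixes B :: "nat \<Rightarrow> 'b set" and N :: "nat \<Rightarrow> nat \<Rightarrow> 'b set"
  assumes fin: "\<And>k. finite (B k)" and ne: "\<forall>\<^sub>F k in sequentially. B k \<noteq> {}"
    and sub: "\<And>j k. N j k \<subseteq> B k"
    and negl: "\<And>j. (\<lambda>k. real (card (N j k)) / real (card (B k))) \<longlonglongrightarrow> 0"
  shows "\<exists>A. (\<forall>k. A k \<subseteq> B k) \<and> (\<lambda>k. real (card (A k)) / real (card (B k))) \<longlonglongrightarrow> 1 \<and>
    (\<forall>j. \<forall>\<^sub>F k in sequentially. A k \<inter> N j k = {})"
proof -
  define a where "a j k = (\<Sum>i<j. real (card (N i k)) / real (card (B k)))" for j k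
  have a: "a j \<longlonglongrightarrow> 0" for j
    using tendsto_sum[of "{..<j}", OF negl] by (simp add: a_def[abs_def])
  \<comment> \<open>contains \<open>0\<close>, and eventually every given \<open>j\<close>; its maximum \<open>m k\<close> is the number of sets to remove\<close>
  define I where "I k = {j. j \<le> k \<and> a j k \<le> 1 / (real j + 1)}" for k
  define m where "m k = Max (I k)" for k
  have finI: "finite (I k)" for k by (rule finite_subset[of _ "{..k}"]) (auto simp: I_def)
  have "0 \<in> I k" for k by (simp add: I_def a_def)
  then have "m k \<in> I k" for k unfolding m_def using finI by (intro Max_in) auto
  then have am: "a (m k) k \<le> 1 / (real (m k) + 1)" for k by (simp add: I_def)
  have m_ge: "\<forall>\<^sub>F k in sequentially. j \<le> m k" for j
  proof -
    have "\<forall>\<^sub>F k in sequentially. a j k < 1 / (real j + 1)" using a by (intro order_tendstoD(2)) auto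
    then show ?thesis using eventually_ge_at_top[of j]
      by eventually_elim (auto simp: m_def I_def intro!: Max_ge[OF finI[unfolded I_def]])
  qed
  then have "filterlim m at_top sequentially" by (simp add: filterlim_at_top)
  then have lim: "(\<lambda>k. 1 / (real (m k) + 1)) \<longlonglongrightarrow> 0"
    by (rule filterlim_compose[rotated]) real_asymp
  define A where "A k = B k - (\<Union>i<m k. N i k)" for k
  have ratio: "1 - 1 / (real (m k) + 1) \<le> real (card (A k)) / real (card (B k))" if "B k \<noteq> {}" for k
  proof -
    have c: "0 < real (card (B k))" using that fin by (simp add: card_gt_0_iff)
    have "card (\<Union>i<m k. N i k) \<le> (\<Sum>i<m k. card (N i k))" by (rule card_UN_le) simp
    then have "real (card (\<Union>i<m k. N i k)) \<le> (\<Sum>i<m k. real (card (N i k)))"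
      by (metis of_nat_le_iff of_nat_sum)
    also have "\<dots> = a (m k) k * real (card (B k))"
      using c by (simp add: a_def flip: sum_divide_distrib)
    finally have u: "real (card (\<Union>i<m k. N i k)) \<le> a (m k) k * real (card (B k))" .
    have "card (A k) = card (B k) - card (\<Union>i<m k. N i k)"
      unfolding A_def using sub by (intro card_Diff_subset finite_subset[OF _ fin]) auto
    moreover have "card (\<Union>i<m k. N i k) \<le> card (B k)"
      using sub by (intro card_mono fin) auto
    ultimately have "real (card (A k)) = real (card (B k)) - real (card (\<Union>i<m k. N i k))" by simp
    then have "(1 - a (m k) k) * real (card (B k)) \<le> real (card (A k))" using u by (simp add: algebra_simps)
    then have "1 - a (m k) k \<le> real (card (A k)) / real (card (B k))" using c by (simp add: pos_le_divide_eq)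
    then show ?thesis using am[of k] by simp
  qed
  have "(\<lambda>k. real (card (A k)) / real (card (B k))) \<longlonglongrightarrow> 1"
  proof (rule tendsto_sandwich)
    show "\<forall>\<^sub>F k in sequentially. 1 - 1 / (real (m k) + 1) \<le> real (card (A k)) / real (card (B k))"
      using ne by eventually_elim (rule ratio)
    show "\<forall>\<^sub>F k in sequentially. real (card (A k)) / real (card (B k)) \<le> 1"
      using fin by (intro always_eventually allI) (auto simp: A_def divide_le_eq_1 card_gt_0_iff intro!: card_mono)
    show "(\<lambda>k. 1 - 1 / (real (m k) + 1)) \<longlonglongrightarrow> 1" using tendsto_diff[OF tendsto_const lim, of 1] by simp
  qed simp
  moreover have "\<forall>\<^sub>F k in sequentially. A k \<inter> N j k = {}" for j
    using m_ge[of "Suc j"] by eventually_elim (auto simp: A_def)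
  ultimately show ?thesis by (intro exI[of _ A]) (auto simp: A_def)
qed

context emr
begin

abbreviation "word b \<equiv> itin T dig (code_length T b) b"

lemma code_lengthI: "(\<And>i. i < n \<Longrightarrow> (T ^^ i) x \<in> {0<..1}) \<Longrightarrow> (T ^^ n) x = 0 \<Longrightarrow> code_length T x = n"
proof -
  assume i: "\<And>i. i < n \<Longrightarrow> (T ^^ i) x \<in> {0<..1}" and z: "(T ^^ n) x = 0"
  have "n \<le> m" if "(T ^^ m) x = 0" for m
  proof (rule leI)
    show "\<not> m < n" using i[of m] that by auto
  qed
  then show "code_length T x = n" unfolding code_length_def using z by (intro Least_equality)
qed

lemma boundary_point:
  assumes "b \<in> boundary_points T"
  shows "1 \<le> code_length T b" "i < code_length T b \<Longrightarrow> (T ^^ i) b \<in> {0<..1}" "b \<in> P (word b) {0}"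
    "b \<in> cy (word b)"
proof -
  obtain n where n: "1 \<le> n" "\<And>i. i < n \<Longrightarrow> (T ^^ i) b \<in> {0<..1}" "(T ^^ n) b = 0"
    using assms by (auto simp: boundary_points_def simp del: greaterThanAtMost_iff)
  have l: "code_length T b = n" using n(2,3) by (rule code_lengthI)
  show "1 \<le> code_length T b" "i < code_length T b \<Longrightarrow> (T ^^ i) b \<in> {0<..1}" using n l by auto
  show "b \<in> P (word b) {0}" unfolding l using n(2) by (rule P_code) (simp_all add: n(3))
  then show "b \<in> cy (word b)" using P_in_cy[of "{0}"] by auto
qed

lemma boundary_pointI:
  assumes x: "x \<in> P u {0}" and u: "u \<noteq> []"
  shows "x \<in> boundary_points T" "code_length T x = length u" "word x = u"
proof -
  have i: "(T ^^ i) x \<in> {0<..1}" if "i < length u" for i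
    using x that J_subset[of "u ! i"] by (auto simp: P_iff simp del: greaterThanAtMost_iff)
  have z: "(T ^^ length u) x = 0" using P_funpow[OF x] by simp
  show "x \<in> boundary_points T"
    unfolding boundary_points_def using i z u by (intro CollectI exI[of _ "length u"]) (simp add: Suc_le_eq)
  show l: "code_length T x = length u" using i z by (rule code_lengthI)
  show "word x = u" unfolding l by (rule P_code_unique[OF x])
qed

lemma word_inj: "inj_on (\<lambda>b. word b) (boundary_points T)"
proof (rule inj_onI)
  fix b b' assume b: "b \<in> boundary_points T" "b' \<in> boundary_points T" and ww: "word b = word b'"
  have "(T ^^ length (word b)) b = 0" using P_funpow[OF boundary_point(3)[OF b(1)]] by simp
  moreover have "(T ^^ length (word b)) b' = 0"
    using P_funpow[OF boundary_point(3)[OF b(2)]] unfolding ww by simp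
  moreover have "b' \<in> cy (word b)" using boundary_point(4)[OF b(2)] ww by simp
  ultimately show "b = b'" using inj_onD[OF P_inj[of "word b"]] boundary_point(4)[OF b(1)] by simp
qed

lemma boundary_derivative:
  assumes b: "b \<in> boundary_points T"
  shows "\<bar>iter_deriv d T (code_length T b) b\<bar> = Dn (code_length T b) b"
  using iter_deriv_eq[OF boundary_point(4)[OF b]] boundary_point(1)[OF b] by (metis length_itin length_0_conv not_one_le_zero)

lemma q_eq: "G.q w = leb (P w X)"
  by (simp add: cyl_eq measure_M[OF cylset_M_sets])

lemma leb_P_X_pos: "0 < leb (P w X)"
  by (rule leb_P_pos) (use X_unit leb_X in auto)

text \<open>Distortion in the form that relates derivatives along a word with the measure of its cylinder.\<close>

lemma Dn_q_bounds:
  assumes x: "x \<in> cy w"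
  shows "1 \<le> exp K\<^sub>1 * (Dn (length w) x * leb (P w X))" "Dn (length w) x * leb (P w X) \<le> exp K\<^sub>1"
proof -
  have D: "0 < Dn (length w) x" by (rule Dn_pos[OF x])
  have "\<bar>ln (Dn (length w) x * leb (P w X)) - ln 1\<bar> \<le> K\<^sub>1"
    using leb_P_Dn[OF x] D leb_P_X_pos[of w] by (simp add: ln_mult_pos)
  then have "exp (- K\<^sub>1) * 1 \<le> Dn (length w) x * leb (P w X)" "Dn (length w) x * leb (P w X) \<le> exp K\<^sub>1 * 1"
    using D leb_P_X_pos by (intro ln_dist_bounds; simp)+
  then show "1 \<le> exp K\<^sub>1 * (Dn (length w) x * leb (P w X))" "Dn (length w) x * leb (P w X) \<le> exp K\<^sub>1"
    using exp_minus_mult_le[of K\<^sub>1 1] by simp_all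
qed

lemma word_big:
  assumes b: "b \<in> boundary_points_below d T k"
  shows "word b \<in> G.big (exp K\<^sub>1 * real k)"
proof -
  have bp: "b \<in> boundary_points T" and "Dn (code_length T b) b < real k"
    using b boundary_derivative by (auto simp: boundary_points_below_def)
  then have D: "Dn (length (word b)) b < real k" by simp
  have "1 \<le> exp K\<^sub>1 * (Dn (length (word b)) b * leb (P (word b) X))"
    by (rule Dn_q_bounds[OF boundary_point(4)[OF bp]])
  also have "\<dots> \<le> exp K\<^sub>1 * (real k * leb (P (word b) X))"
    using D leb_P_X_pos[of "word b"] by (intro mult_left_mono mult_right_mono) auto
  finally have "1 \<le> exp K\<^sub>1 * real k * leb (P (word b) X)" by (simp add: mult.assoc)
  moreover have "0 < real k" using D Dn_pos[OF boundary_point(4)[OF bp]] by simp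
  ultimately show ?thesis
    unfolding G.big_def mem_Collect_eq q_eq by (subst pos_divide_le_eq) (auto simp: mult.commute)
qed

lemma finite_below: "finite (boundary_points_below d T k)"
proof (cases "k = 0")
  case True
  then show ?thesis by (simp add: boundary_points_below_def not_less)
next
  case False
  have "finite ((\<lambda>b. word b) ` boundary_points_below d T k)"
    using word_big False by (intro finite_subset[OF _ G.finite_big[of "exp K\<^sub>1 * real k"]]) auto
  moreover have "inj_on (\<lambda>b. word b) (boundary_points_below d T k)"
    by (rule inj_on_subset[OF word_inj]) (auto simp: boundary_points_below_def)
  ultimately show ?thesis by (rule finite_imageD)
qed

text \<open>Pulling back along arbitrary words is possible for points in the open interval only, as \<open>1\<close> need
  not be attained by a branch on its half-open domain. If the only zero found is \<open>1\<close>, the right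
  endpoint of the next branch is mapped to \<open>0\<close> or to \<open>1\<close>, hence reaches \<open>0\<close> as well.\<close>

lemma interior_boundary_point:
  assumes "boundary_points T \<noteq> {}"
  shows "\<exists>p\<in>boundary_points T. p \<in> {0<..<1}"
proof -
  obtain b where b: "b \<in> boundary_points T" using assms by auto
  obtain n where n: "1 \<le> n" "\<And>i. i < n \<Longrightarrow> (T ^^ i) b \<in> {0<..1}" "(T ^^ n) b = 0"
    using b by (auto simp: boundary_points_def simp del: greaterThanAtMost_iff)
  obtain m where m: "n = Suc m" using n(1) by (cases n) auto
  define y where "y = (T ^^ m) b"
  have y: "y \<in> {0<..1}" "T y = 0" using n m by (auto simp: y_def)
  have one: "z \<in> boundary_points T" if "z \<in> {0<..1}" "T z = 0" for z
    unfolding boundary_points_def using that by (intro CollectI exI[of _ 1]) simp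
  show ?thesis
  proof (cases "y < 1")
    case True
    then show ?thesis using one y by auto
  next
    case False
    then have T1: "T 1 = 0" using y by simp
    define z where "z = hi 1"
    have z: "z \<in> {0<..<1}" "z \<in> J 1"
      using d_pos[of 2] d_strict[of 1 2] d_1 lo_less_hi[of 1] by (auto simp: z_def J_eq numeral_2_eq_2)
    have "T z \<notin> {0<..<1}"
    proof
      assume "T z \<in> {0<..<1}"
      then obtain x where x: "x \<in> {lo 1<..<hi 1}" "T x = T z" using branch_derivative(6)[of 1] by (metis imageE)
      have "x \<in> J 1" "x < z" using x by (auto simp: J_eq z_def)
      then show False using branch_derivative(5)[of 1] z(2) x(2) by (metis less_irrefl)
    qed
    moreover have "T z \<in> {0..1}" using z by (intro T_range) auto
    ultimately consider "T z = 0" | "T z = 1" by fastforce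
    then have "z \<in> boundary_points T"
    proof cases
      case 1
      then show ?thesis using one z by auto
    next
      case 2
      have "(T ^^ i) z \<in> {0<..1}" if "i < 2" for i
      proof -
        from that consider "i = 0" | "i = 1" by linarith
        then show ?thesis by cases (use z 2 in auto)
      qed
      moreover have "(T ^^ 2) z = 0" using 2 T1 by (simp add: eval_nat_numeral)
      ultimately show ?thesis unfolding boundary_points_def by (intro CollectI exI[of _ 2]) simp
    qed
    then show ?thesis using z by auto
  qed
qed

text \<open>The boundary point \<open>p\<close> is pulled back along each word; the code of the new boundary point is the
  word followed by the code of \<open>p\<close>, so different words give different points, and the derivative
  is multiplied by a constant.\<close>

lemma card_below_ge:
  assumes "boundary_points T \<noteq> {}"
  shows "\<exists>c2>0. \<forall>k. card (G.big (c2 * real k)) \<le> card (boundary_points_below d T k)"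
proof -
  obtain p where p: "p \<in> boundary_points T" "p \<in> {0<..<1}" using interior_boundary_point[OF assms] by blast
  let ?D = "Dn (code_length T p) p"
  have D: "0 < ?D" using Dn_pos[OF boundary_point(4)[OF p(1)]] by simp
  define c2 where "c2 = 1 / (2 * exp K\<^sub>1 * ?D)"
  have c2: "0 < c2" using D by (simp add: c2_def)
  have "\<exists>x. x \<in> cy w \<and> (T ^^ length w) x = p" for w using P_onto[OF p(2), of w] by auto
  then obtain g where g: "\<And>w. g w \<in> cy w" "\<And>w. (T ^^ length w) (g w) = p" by metis
  have gP: "g w \<in> P (w @ word p) {0}" for w
    using g[of w] boundary_point(3)[OF p(1)] by (simp add: P_append P_iff)
  have ne: "w @ word p \<noteq> []" for w using boundary_point(1)[OF p(1)] by (metis append_is_Nil_conv length_0_conv length_itin not_one_le_zero)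
  have "card (G.big (c2 * real k)) \<le> card (boundary_points_below d T k)" for k
  proof (cases "k = 0")
    case True
    \<comment> \<open>\<open>1 / 0 = 0\<close>, so every word is in \<open>big 0\<close>; an infinite set has cardinality \<open>0\<close>\<close>
    have "infinite (G.big 0)"
    proof -
      have "range (\<lambda>n. replicate n (0::nat)) \<subseteq> G.big 0" by (auto simp: G.big_def)
      moreover have "infinite (range (\<lambda>n. replicate n (0::nat)))"
        by (rule range_inj_infinite) (metis injI length_replicate)
      ultimately show ?thesis using finite_subset by blast
    qed
    then show ?thesis using True by simp
  next
    case False
    have "inj_on g (G.big (c2 * real k))"
    proof (rule inj_onI)
      fix w w' assume "g w = g w'"
      then have "word (g w) = word (g w')" by (rule arg_cong)
      then have "w @ word p = w' @ word p" by (simp only: boundary_pointI(3)[OF gP ne])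
      then show "w = w'" by simp
    qed
    moreover have "g ` G.big (c2 * real k) \<subseteq> boundary_points_below d T k"
    proof (rule image_subsetI)
      fix w assume w: "w \<in> G.big (c2 * real k)"
      have bp: "g w \<in> boundary_points T" and len: "code_length T (g w) = length w + code_length T p"
        using boundary_pointI[OF gP[of w] ne] by simp_all
      have "1 / (c2 * real k) \<le> leb (P w X)" using w by (simp add: G.big_def q_eq)
      then have "1 \<le> c2 * real k * leb (P w X)" using c2 False by (simp add: pos_divide_le_eq mult.commute)
      then have "Dn (length w) (g w) * 1 \<le> Dn (length w) (g w) * (c2 * real k * leb (P w X))"
        using Dn_pos[OF g(1)[of w]] by (intro mult_left_mono) auto
      also have "\<dots> = c2 * real k * (Dn (length w) (g w) * leb (P w X))" by (simp add: mult_ac)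
      also have "\<dots> \<le> c2 * real k * exp K\<^sub>1"
        using Dn_q_bounds(2)[OF g(1)[of w]] c2 by (intro mult_left_mono) auto
      finally have "Dn (length w) (g w) * ?D \<le> c2 * real k * exp K\<^sub>1 * ?D"
        using D by (intro mult_right_mono) auto
      also have "\<dots> = real k / 2" using D by (simp add: c2_def)
      also have "\<dots> < real k" using False by simp
      finally have "Dn (code_length T (g w)) (g w) < real k" unfolding len Dn_add g(2) .
      then show "g w \<in> boundary_points_below d T k"
        using bp boundary_derivative[OF bp] by (simp add: boundary_points_below_def)
    qed
    ultimately show ?thesis using finite_below by (rule card_inj_on_le)
  qed
  then show ?thesis using c2 by blast
qed

lemma below_nonempty:
  assumes "boundary_points T \<noteq> {}"
  shows "\<forall>\<^sub>F k in sequentially. boundary_points_below d T k \<noteq> {}"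
proof -
  obtain b where b: "b \<in> boundary_points T" using assms by auto
  have "\<forall>\<^sub>F k in sequentially. \<bar>iter_deriv d T (code_length T b) b\<bar> < real k"
    using filterlim_real_sequentially unfolding filterlim_at_top_dense by blast
  then show ?thesis by eventually_elim (use b in \<open>auto simp: boundary_points_below_def\<close>)
qed

text \<open>An observable \<open>S\<close> of boundary points that differs by at most \<open>C\<close> from Birkhoff sums on the
  cylinder of the code: for long codes \<open>C\<close> is less than half of the admitted deviation, so a
  deviating point has a bad code.\<close>

lemma deviation_negligible:
  assumes ne: "boundary_points T \<noteq> {}"
    and f: "f \<in> borel_measurable M" "G.concentrates f" and \<epsilon>: "0 < \<epsilon>"
    and close: "\<And>b x. b \<in> boundary_points T \<Longrightarrow> x \<in> P (word b) X \<Longrightarrow> \<bar>S b - birk T f (code_length T b) x\<bar> \<le> C"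
  shows "(\<lambda>k. real (card {b \<in> boundary_points_below d T k.
      real (code_length T b) * \<epsilon> \<le> \<bar>S b - real (code_length T b) * (LINT x|G.acim. f x)\<bar>})
    / real (card (boundary_points_below d T k))) \<longlonglongrightarrow> 0"
proof -
  obtain c2 where c2: "0 < c2" and ge: "\<And>k. card (G.big (c2 * real k)) \<le> card (boundary_points_below d T k)"
    using card_below_ge[OF ne] by blast
  obtain n1 where n1: "2 * C / \<epsilon> < real n1" using reals_Archimedean2 by blast
  let ?N = "\<lambda>k. {b \<in> boundary_points_below d T k.
      real (code_length T b) * \<epsilon> \<le> \<bar>S b - real (code_length T b) * (LINT x|G.acim. f x)\<bar>}"
  let ?B = "\<lambda>k. {w \<in> G.big (exp K\<^sub>1 * real k). length w < n1 \<or> G.bad f (\<epsilon> / 2) w}"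
  have le: "card (?N k) \<le> card (?B k)" if k: "0 < k" for k
  proof (rule card_inj_on_le)
    show "inj_on (\<lambda>b. word b) (?N k)"
      by (rule inj_on_subset[OF word_inj]) (auto simp: boundary_points_below_def)
    show "finite (?B k)" using k by (intro finite_subset[OF _ G.finite_big[of "exp K\<^sub>1 * real k"]]) auto
    show "(\<lambda>b. word b) ` ?N k \<subseteq> ?B k"
    proof (rule image_subsetI)
      fix b assume b: "b \<in> ?N k"
      let ?n = "code_length T b"
      have bp: "b \<in> boundary_points T" using b by (auto simp: boundary_points_below_def)
      have "G.bad f (\<epsilon> / 2) (word b)" if n: "\<not> length (word b) < n1"
        unfolding G.bad_def
      proof
        fix x assume "x \<in> G.cyl (word b)"
        then have c: "\<bar>S b - birk T f ?n x\<bar> \<le> C" using close[OF bp] by (simp add: cyl_eq)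
        have "2 * C / \<epsilon> < real ?n" using n n1 by simp
        then have "C < real ?n * (\<epsilon> / 2)" using \<epsilon> by (simp add: field_simps)
        moreover have "real ?n * \<epsilon> \<le> \<bar>S b - real ?n * (LINT x|G.acim. f x)\<bar>" using b by simp
        ultimately have "real ?n * (\<epsilon> / 2) \<le> \<bar>birk T f ?n x - real ?n * (LINT x|G.acim. f x)\<bar>"
          using c by argo
        then show "real (length (word b)) * (\<epsilon> / 2)
            \<le> \<bar>birk T f (length (word b)) x - real (length (word b)) * (LINT x|G.acim. f x)\<bar>"
          by simp
      qed
      then show "word b \<in> ?B k" using word_big[of b k] b by blast
    qed
  qed
  have pos: "\<forall>\<^sub>F k in sequentially. 0 < k \<and> 0 < card (G.big (c2 * real k))"
  proof -
    have "\<forall>\<^sub>F k in sequentially. 1 / c2 < real k"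
      using filterlim_real_sequentially unfolding filterlim_at_top_dense by blast
    then show ?thesis
    proof eventually_elim
      case (elim k)
      then have 1: "1 \<le> c2 * real k" and k: "0 < k" using c2 by (auto simp: field_simps intro: gr0I)
      have "[] \<in> G.big (c2 * real k)"
        using 1 leb_X by (simp add: G.big_def q_eq divide_le_eq_1)
      then show ?case using k c2 G.finite_big[of "c2 * real k"] by (auto simp: card_gt_0_iff)
    qed
  qed
  show ?thesis
  proof (rule tendsto_sandwich[OF _ _ tendsto_const])
    show "(\<lambda>k. real (card (?B k)) / real (card (G.big (c2 * real k)))) \<longlonglongrightarrow> 0"
      using f \<epsilon> c2 by (intro G.bad_words_negligible) auto
    show "\<forall>\<^sub>F k in sequentially. real (card (?N k)) / real (card (boundary_points_below d T k))
        \<le> real (card (?B k)) / real (card (G.big (c2 * real k)))"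
      using pos by eventually_elim (use le ge in \<open>auto intro!: frac_le\<close>)
  qed simp
qed

section \<open>Orbit averages along boundary points\<close>

lemma cy_unit: "v \<noteq> [] \<Longrightarrow> cy v \<subseteq> {0<..1}"
  using J_subset by (cases v) auto

lemma cy_sets: "v \<noteq> [] \<Longrightarrow> cy v \<in> sets unit_borel"
  using cy_unit[of v] P_sets[of "{0..1}" v] by (simp add: sets_unit)

text \<open>Visits to a cylinder are occurrences of its word in the code, as long as the occurrence is
  complete.\<close>

lemma occurs_iff:
  assumes x: "x \<in> P w E" and E: "E \<subseteq> {0..1}" and i: "i + length v \<le> length w"
  shows "(T ^^ i) x \<in> cy v \<longleftrightarrow> take (length v) (drop i w) = v"
proof -
  define u where "u = take (length v) (drop i w)"
  have lu: "length u = length v" unfolding u_def length_take length_drop using i by arith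
  have w: "w = take i w @ u @ drop (length v) (drop i w)" by (simp only: u_def append_take_drop_id)
  have "x \<in> P (take i w) (P u (P (drop (length v) (drop i w)) E))"
    using x by (subst (asm) w) (simp add: P_append)
  then have "(T ^^ length (take i w)) x \<in> P u (P (drop (length v) (drop i w)) E)" by (rule P_funpow)
  then have y: "(T ^^ i) x \<in> P u (P (drop (length v) (drop i w)) E)" using i by (simp add: min_absorb2)
  then have yc: "(T ^^ i) x \<in> cy u" using P_in_cy[OF P_subset_unit[OF E], of u] by blast
  have "u = v" if "(T ^^ i) x \<in> cy v"
    by (rule trans[OF sym[OF P_code_unique[OF yc, unfolded lu]] P_code_unique[OF that]])
  then show ?thesis using yc unfolding u_def by auto
qed

text \<open>Points with the same code visit a cylinder at the same times, except possibly during the last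
  \<open>length v\<close> steps, when the code ends before the word does.\<close>

lemma visits_close:
  assumes b: "b \<in> boundary_points T" and x: "x \<in> P (word b) X"
  shows "\<bar>birk T (indicator (cy v)) (code_length T b) b - birk T (indicator (P v X)) (code_length T b) x\<bar>
    \<le> real (length v)"
proof -
  let ?n = "code_length T b"
  let ?g = "indicator (cy v) :: real \<Rightarrow> real" and ?h = "indicator (P v X) :: real \<Rightarrow> real"
  have sum_indicator: "(\<Sum>i<n. indicator S i) = real (card ({..<n} \<inter> S))" for S and n :: nat
    by (simp add: indicator_def sum.If_cases)
  have xX: "x \<in> X" using P_X_subset[OF order_refl] x by blast
  have hx: "?h ((T ^^ i) x) = ?g ((T ^^ i) x)" for i
  proof -
    have "(T ^^ i) x \<in> P v X \<longleftrightarrow> (T ^^ i) x \<in> cy v"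
    proof
      show "(T ^^ i) x \<in> P v X \<Longrightarrow> (T ^^ i) x \<in> cy v" using P_in_cy[OF X_unit] by blast
      assume "(T ^^ i) x \<in> cy v"
      moreover have "(T ^^ length v) ((T ^^ i) x) \<in> X" using xX X_iterate by blast
      ultimately show "(T ^^ i) x \<in> P v X" unfolding P_iff by blast
    qed
    then show ?thesis by (simp add: indicator_def)
  qed
  have same: "?g ((T ^^ i) b) = ?g ((T ^^ i) x)" if "i + length v \<le> ?n" for i
    using occurs_iff[OF boundary_point(3)[OF b], of i v] occurs_iff[OF x X_unit, of i v] that
    by (simp add: indicator_def)
  have "\<bar>birk T ?g ?n b - birk T ?h ?n x\<bar> = \<bar>\<Sum>i<?n. ?g ((T ^^ i) b) - ?g ((T ^^ i) x)\<bar>"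
    by (simp add: birk_def hx sum_subtractf)
  also have "\<dots> \<le> (\<Sum>i<?n. \<bar>?g ((T ^^ i) b) - ?g ((T ^^ i) x)\<bar>)" by (rule sum_abs)
  also have "\<dots> \<le> (\<Sum>i<?n. indicator {?n - length v..<?n} i)"
  proof (rule sum_mono)
    fix i assume i: "i \<in> {..<?n}"
    show "\<bar>?g ((T ^^ i) b) - ?g ((T ^^ i) x)\<bar> \<le> indicator {?n - length v..<?n} i"
    proof (cases "i + length v \<le> ?n")
      case True
      then show ?thesis using same by simp
    next
      case False
      then show ?thesis using i by (auto simp: indicator_def)
    qed
  qed
  also have "\<dots> = real (card ({..<?n} \<inter> {?n - length v..<?n}))"
    by (rule sum_indicator)
  also have "card ({..<?n} \<inter> {?n - length v..<?n}) \<le> card {?n - length v..<?n}" by (intro card_mono) auto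
  finally show ?thesis by simp
qed

lemma log_derivative_close:
  assumes b: "b \<in> boundary_points T" and x: "x \<in> P (word b) X"
  shows "\<bar>ln \<bar>iter_deriv d T (code_length T b) b\<bar> - birk T L (code_length T b) x\<bar> \<le> K\<^sub>1"
proof -
  let ?w = "word b"
  have xc: "x \<in> cy ?w" using x P_in_cy[OF X_unit] by blast
  have "\<bar>ln (Dn (length ?w) b) - ln (Dn (length ?w) x)\<bar> \<le> K\<^sub>1 * \<bar>(T ^^ length ?w) b - (T ^^ length ?w) x\<bar>"
    by (rule distortion[OF boundary_point(4)[OF b] xc])
  also have "\<dots> \<le> K\<^sub>1 * 1"
  proof -
    have "(T ^^ length ?w) b \<in> {0..1}" "(T ^^ length ?w) x \<in> {0..1}"
      using P_funpow[OF boundary_point(4)[OF b]] P_funpow[OF xc] by blast+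
    then have "\<bar>(T ^^ length ?w) b - (T ^^ length ?w) x\<bar> \<le> 1" unfolding atLeastAtMost_iff by linarith
    then show ?thesis using K1_pos by (intro mult_left_mono) auto
  qed
  finally show ?thesis using boundary_derivative[OF b] birk_L[OF x] by simp
qed

lemma orbit_measure_facts:
  assumes b: "b \<in> boundary_points T"
  shows "prob_space (orbit_measure T b)" "sets (orbit_measure T b) = sets unit_borel"
    "v \<noteq> [] \<Longrightarrow> measure (orbit_measure T b) (cy v)
       = birk T (indicator (cy v)) (code_length T b) b / real (code_length T b)"
proof -
  let ?n = "code_length T b" and ?U = "uniform_count_measure {..<code_length T b}"
  have n: "{..<?n} \<noteq> {}" using boundary_point(1)[OF b] by (auto simp: lessThan_empty_iff)
  have m: "(\<lambda>i. (T ^^ i) b) \<in> ?U \<rightarrow>\<^sub>M unit_borel"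
    using boundary_point(2)[OF b]
    by (auto simp: measurable_def space_unit space_uniform_count_measure sets_uniform_count_measure
        simp del: greaterThanAtMost_iff)
  interpret U: prob_space ?U using n by (intro prob_space_uniform_count_measure) auto
  show "prob_space (orbit_measure T b)" unfolding orbit_measure_def by (rule U.prob_space_distr[OF m])
  show "sets (orbit_measure T b) = sets unit_borel" by (simp add: orbit_measure_def)
  assume v: "v \<noteq> []"
  have "measure (orbit_measure T b) (cy v) = measure ?U ((\<lambda>i. (T ^^ i) b) -` cy v \<inter> space ?U)"
    unfolding orbit_measure_def by (rule measure_distr[OF m cy_sets[OF v]])
  also have "\<dots> = real (card {i\<in>{..<?n}. (T ^^ i) b \<in> cy v}) / real ?n"
    by (subst measure_uniform_count_measure)
      (auto simp: space_uniform_count_measure intro!: arg_cong[where f = card])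
  also have "real (card {i\<in>{..<?n}. (T ^^ i) b \<in> cy v}) = birk T (indicator (cy v)) ?n b"
    by (simp add: birk_def indicator_def sum.If_cases Int_def)
  finally show "measure (orbit_measure T b) (cy v) = birk T (indicator (cy v)) ?n b / real ?n" .
qed

text \<open>Nonempty words only, since cylinders of nonempty words are contained in \<open>(0,1]\<close>, where \<open>f\<close> is
  continuous.\<close>

definition osc_le :: "(real \<Rightarrow> real) \<Rightarrow> real \<Rightarrow> nat list \<Rightarrow> bool" where
  "osc_le f \<epsilon> v \<longleftrightarrow> v \<noteq> [] \<and> (\<forall>x\<in>cy v. \<forall>y\<in>cy v. \<bar>f x - f y\<bar> \<le> \<epsilon>)"

lemma osc_small_ex:
  assumes f: "continuous_on {0<..1} f" and \<epsilon>: "0 < \<epsilon>" and x: "x \<in> X"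
  shows "\<exists>v. osc_le f \<epsilon> v \<and> x \<in> cy v"
proof -
  have x1: "x \<in> {0<..1}" using x X_subset by blast
  obtain r where r: "0 < r" "\<And>y. y \<in> {0<..1} \<Longrightarrow> dist y x < r \<Longrightarrow> dist (f y) (f x) < \<epsilon> / 2"
    using f[unfolded continuous_on_iff, rule_format, OF x1, of "\<epsilon> / 2"] \<epsilon> by auto
  have "(\<lambda>n. \<theta> ^ n / c\<^sub>0) \<longlonglongrightarrow> 0 / c\<^sub>0"
    using theta_bounds c0_pos by (intro tendsto_intros LIMSEQ_power_zero) auto
  then have "\<forall>\<^sub>F n in sequentially. \<theta> ^ n / c\<^sub>0 < r" using r(1) by (intro order_tendstoD(2)) auto
  then have "\<forall>\<^sub>F n in sequentially. \<theta> ^ n / c\<^sub>0 < r \<and> 1 \<le> n" using eventually_ge_at_top[of 1] by (rule eventually_conj)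
  then have "\<exists>n. \<theta> ^ n / c\<^sub>0 < r \<and> 1 \<le> n" by (rule eventually_happens'[OF sequentially_bot])
  then obtain n where n: "\<theta> ^ n / c\<^sub>0 < r" "1 \<le> n" by blast
  define v where "v = itin T dig n x"
  have v: "v \<noteq> []" "length v = n" using n(2) by (auto simp: v_def itin_def)
  have "(T ^^ n) x \<in> {0..1}" using X_iterate_unit[OF x, of n] by auto
  then have xv: "x \<in> cy v" unfolding v_def using X_iterate_unit[OF x] by (intro P_code)
  have near: "\<bar>f y - f x\<bar> < \<epsilon> / 2" if "y \<in> cy v" for y
    using r(2)[of y] cy_unit[OF v(1)] that diam_cy[OF that xv] n(1) v(2) by (auto simp: dist_real_def)
  have "\<bar>f y - f z\<bar> \<le> \<epsilon>" if "y \<in> cy v" "z \<in> cy v" for y z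
    using near[OF that(1)] near[OF that(2)] by linarith
  then show ?thesis using v xv by (auto simp: osc_le_def)
qed

text \<open>Keeping only the shortest words of small oscillation makes their cylinders disjoint.\<close>

definition minimal_osc :: "(real \<Rightarrow> real) \<Rightarrow> real \<Rightarrow> nat list \<Rightarrow> bool" where
  "minimal_osc f \<epsilon> v \<longleftrightarrow> osc_le f \<epsilon> v \<and> (\<forall>k<length v. \<not> osc_le f \<epsilon> (take k v))"

lemma minimal_osc_disjoint:
  assumes u: "minimal_osc f \<epsilon> u" and v: "minimal_osc f \<epsilon> v" and x: "x \<in> cy u" "x \<in> cy v"
  shows "u = v"
proof -
  have prefix: "u = v" if le: "length u \<le> length v" and m: "minimal_osc f \<epsilon> u" "minimal_osc f \<epsilon> v"
      and x: "x \<in> cy u" "x \<in> cy v" for u v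
  proof -
    have "take (length u) (itin T dig (length v) x) = itin T dig (length u) x"
      using le by (rule take_itin)
    then have t: "take (length u) v = u"
      unfolding P_code_unique[OF x(1)] P_code_unique[OF x(2)] .
    have "\<not> length u < length v" using m t by (auto simp: minimal_osc_def)
    then have eq: "length u = length v" using le by simp
    show ?thesis using t unfolding eq by simp
  qed
  show ?thesis
  proof (cases "length u \<le> length v")
    case True
    then show ?thesis by (rule prefix) fact+
  next
    case False
    then have "length v \<le> length u" by simp
    then have "v = u" by (rule prefix) fact+
    then show ?thesis ..
  qed
qed

lemma minimal_osc_ex:
  assumes f: "continuous_on {0<..1} f" and \<epsilon>: "0 < \<epsilon>" and x: "x \<in> X"
  shows "\<exists>v. minimal_osc f \<epsilon> v \<and> x \<in> cy v"
proof -
  obtain v where v: "osc_le f \<epsilon> v" "x \<in> cy v" using osc_small_ex[OF assms] by blast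
  define k where "k = (LEAST k. osc_le f \<epsilon> (take k v))"
  have k: "osc_le f \<epsilon> (take k v)" unfolding k_def by (rule LeastI[of _ "length v"]) (simp add: v)
  have less: "\<not> osc_le f \<epsilon> (take j v)" if "j < k" for j using not_less_Least that unfolding k_def by blast
  have kl: "k \<le> length v" unfolding k_def by (rule Least_le) (simp add: v)
  have "minimal_osc f \<epsilon> (take k v)" using k less kl by (auto simp: minimal_osc_def min_def)
  moreover have "x \<in> cy (take k v)" using cy_take[OF kl] v(2) by blast
  ultimately show ?thesis by blast
qed

text \<open>The countably many cylinders of minimal words cover \<open>X\<close>, so finitely many of them carry almost
  all the mass.\<close>

lemma minimal_osc_finite:
  assumes f: "continuous_on {0<..1} f" and \<epsilon>: "0 < \<epsilon>"
    and N: "prob_space N" "sets N = sets unit_borel" "measure N X = 1"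
  shows "\<exists>W. finite W \<and> (\<forall>v\<in>W. minimal_osc f \<epsilon> v) \<and> 1 - \<epsilon> \<le> (\<Sum>v\<in>W. measure N (cy v))"
proof -
  interpret N: prob_space N by fact
  define W where "W n = {v. minimal_osc f \<epsilon> v \<and> to_nat v < n}" for n
  have fin: "finite (W n)" for n
    by (rule finite_subset[of _ "to_nat -` {..<n}"]) (auto simp: W_def intro!: finite_vimageI)
  have ms: "cy v \<in> N.events" if "minimal_osc f \<epsilon> v" for v
    unfolding N(2) using that by (intro cy_sets) (auto simp: minimal_osc_def osc_le_def)
  let ?A = "\<lambda>n. \<Union>v\<in>W n. cy v"
  have A: "?A n \<in> N.events" for n using fin ms by (intro sets.finite_UN) (auto simp: W_def)
  have "(\<lambda>n. N.prob (?A n)) \<longlonglongrightarrow> N.prob (\<Union>n. ?A n)"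
  proof (rule N.finite_Lim_measure_incseq)
    show "range ?A \<subseteq> N.events" using A by blast
    show "incseq ?A" by (rule incseq_SucI) (force simp: W_def)
  qed
  moreover have "1 \<le> N.prob (\<Union>n. ?A n)"
  proof -
    have "X \<subseteq> (\<Union>n. ?A n)"
    proof
      fix x assume "x \<in> X"
      then obtain v where v: "minimal_osc f \<epsilon> v" "x \<in> cy v" using minimal_osc_ex[OF f \<epsilon>] by blast
      then have "v \<in> W (Suc (to_nat v))" by (simp add: W_def)
      then show "x \<in> (\<Union>n. ?A n)" using v(2) by blast
    qed
    then have "N.prob X \<le> N.prob (\<Union>n. ?A n)" using A by (intro N.finite_measure_mono) auto
    then show ?thesis using N(3) by simp
  qed
  ultimately have "\<forall>\<^sub>F n in sequentially. 1 - \<epsilon> < N.prob (?A n)" using \<epsilon> by (intro order_tendstoD(1)) auto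
  then have "\<exists>n. 1 - \<epsilon> < N.prob (?A n)" by (rule eventually_happens'[OF sequentially_bot])
  then obtain n where n: "1 - \<epsilon> < N.prob (?A n)" by blast
  also have "\<dots> \<le> (\<Sum>v\<in>W n. N.prob (cy v))"
    using fin ms by (intro N.finite_measure_subadditive_finite) (auto simp: W_def)
  finally show ?thesis using fin by (intro exI[of _ "W n"]) (auto simp: W_def)
qed

text \<open>On the cylinders in \<open>W\<close> the function is replaced by its values at sample points; outside it is
  bounded by \<open>B\<close>, and the mass there is \<open>1\<close> minus the mass of the cylinders.\<close>

lemma step_approximation:
  assumes N: "prob_space N" "sets N = sets unit_borel"
    and f: "f \<in> borel_measurable unit_borel" "\<And>x. x \<in> {0<..1} \<Longrightarrow> \<bar>f x\<bar> \<le> B"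
    and W: "finite W" "\<And>v. v \<in> W \<Longrightarrow> minimal_osc f \<epsilon> v" and \<epsilon>: "0 < \<epsilon>"
    and t: "\<And>v. v \<in> W \<Longrightarrow> t v \<in> cy v"
  shows "\<bar>(LINT x|N. f x) - (\<Sum>v\<in>W. f (t v) * measure N (cy v))\<bar>
    \<le> \<epsilon> + B * (1 - (\<Sum>v\<in>W. measure N (cy v)))"
proof -
  interpret N: prob_space N by fact
  have sp: "space N = {0<..1}" using sets_eq_imp_space_eq[OF N(2)] space_unit by simp
  have f_m [measurable]: "f \<in> borel_measurable N" using f(1) by (simp cong: measurable_cong_sets add: N(2))
  have cs: "cy v \<in> N.events" if "v \<in> W" for v
    unfolding N(2) using W(2)[OF that] by (intro cy_sets) (auto simp: minimal_osc_def osc_le_def)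
  let ?s = "\<lambda>x. \<Sum>v\<in>W. f (t v) * indicator (cy v) x" and ?h = "\<lambda>x. \<Sum>v\<in>W. indicator (cy v) x :: real"
  have f_int: "integrable N f"
    by (rule N.integrable_const_bound[of _ B]) (use f(2) sp in auto)
  have i_int: "integrable N (indicator (cy v) :: real \<Rightarrow> real)" if "v \<in> W" for v
    using cs[OF that] by (simp add: N.emeasure_finite less_top[symmetric])
  have s_int: "integrable N ?s" and h_int: "integrable N ?h" using i_int by auto
  have pt: "\<bar>f x - ?s x\<bar> \<le> \<epsilon> + B * (1 - ?h x)" if x: "x \<in> space N" for x
  proof (cases "\<exists>v\<in>W. x \<in> cy v")
    case True
    then obtain v where v: "v \<in> W" "x \<in> cy v" by blast
    have ind: "indicator (cy u) x = (if u = v then 1 else 0 :: real)" if "u \<in> W" for u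
    proof (cases "x \<in> cy u")
      case True
      then show ?thesis using minimal_osc_disjoint[OF W(2)[OF that] W(2)[OF v(1)] _ v(2)] by simp
    next
      case False
      then show ?thesis using v(2) by (cases "u = v") simp_all
    qed
    have "?s x = (\<Sum>u\<in>W. if u = v then f (t u) else 0)" by (intro sum.cong) (auto simp: ind)
    then have s: "?s x = f (t v)" using W(1) v(1) by simp
    have "?h x = (\<Sum>u\<in>W. if u = v then 1 else 0)" by (intro sum.cong) (auto simp: ind)
    then have h: "?h x = 1" using W(1) v(1) by simp
    have "\<bar>f x - f (t v)\<bar> \<le> \<epsilon>" using W(2)[OF v(1)] v(2) t[OF v(1)] by (auto simp: minimal_osc_def osc_le_def)
    then show ?thesis unfolding s h by simp
  next
    case False
    then have "?s x = 0" "?h x = 0" by (auto intro!: sum.neutral)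
    then show ?thesis using f(2)[of x] x sp \<epsilon> by auto
  qed
  have "\<bar>LINT x|N. f x - ?s x\<bar> \<le> (LINT x|N. \<bar>f x - ?s x\<bar>)" by (rule integral_abs_bound)
  also have "\<dots> \<le> (LINT x|N. \<epsilon> + B * (1 - ?h x))"
    using f_int s_int h_int pt by (intro integral_mono) auto
  also have "\<dots> = \<epsilon> + B * (1 - (LINT x|N. ?h x))"
    using h_int by (simp add: N.prob_space)
  also have "(LINT x|N. ?h x) = (\<Sum>v\<in>W. N.prob (cy v))" using i_int cs by simp
  also have "(LINT x|N. f x - ?s x) = (LINT x|N. f x) - (\<Sum>v\<in>W. f (t v) * N.prob (cy v))"
    using f_int s_int i_int cs by simp
  finally show ?thesis .
qed

text \<open>Both integrals are close to step function integrals by \<open>step_approximation\<close>. Its error for \<open>N k\<close>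
  converges to that for \<open>\<nu>\<close>, since the mass outside of finitely many cylinders is determined by
  the masses of the cylinders; tightness comes for free.\<close>

lemma weak_star_conv_cylinders:
  assumes N: "\<forall>\<^sub>F k in sequentially. prob_space (N k) \<and> sets (N k) = sets unit_borel"
    and \<nu>: "prob_space \<nu>" "sets \<nu> = sets unit_borel" "measure \<nu> X = 1"
    and conv: "\<And>v. v \<noteq> [] \<Longrightarrow> (\<lambda>k. measure (N k) (cy v)) \<longlonglongrightarrow> measure \<nu> (cy v)"
  shows "weak_star_conv N \<nu>"
  unfolding weak_star_conv_def
proof (intro allI impI, elim conjE)
  fix f :: "real \<Rightarrow> real" assume f: "continuous_on {0<..1} f" and bd: "bounded (f ` {0<..1})"
  obtain B where B: "0 < B" "\<And>x. x \<in> {0<..1} \<Longrightarrow> \<bar>f x\<bar> \<le> B"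
    using bd unfolding bounded_pos by auto
  have fm: "f \<in> borel_measurable unit_borel" using f by (rule borel_measurable_continuous_on_restrict)
  show "(\<lambda>k. LINT x|N k. f x) \<longlonglongrightarrow> (LINT x|\<nu>. f x)"
  proof (rule LIMSEQ_I)
    fix e :: real assume e: "0 < e"
    define \<epsilon> where "\<epsilon> = e / (3 + 2 * B)"
    have \<epsilon>: "0 < \<epsilon>" using e B by (simp add: \<epsilon>_def)
    obtain W where W: "finite W" "\<And>v. v \<in> W \<Longrightarrow> minimal_osc f \<epsilon> v"
      and mass: "1 - \<epsilon> \<le> (\<Sum>v\<in>W. measure \<nu> (cy v))"
      using minimal_osc_finite[OF f \<epsilon> \<nu>] by blast
    have Wne: "v \<noteq> []" if "v \<in> W" for v using W(2)[OF that] by (simp add: minimal_osc_def osc_le_def)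
    have "\<exists>t. t \<in> cy v" for v using P_onto[of "1 / 2" v] by auto
    then obtain t where t: "\<And>v. t v \<in> cy v" by metis
    let ?S = "\<lambda>N. \<Sum>v\<in>W. f (t v) * measure N (cy v)" and ?H = "\<lambda>N. \<Sum>v\<in>W. measure N (cy v)"
    let ?u = "\<lambda>k. (\<epsilon> + B * (1 - ?H (N k))) + (\<epsilon> + B * (1 - ?H \<nu>)) + \<bar>?S (N k) - ?S \<nu>\<bar>"
    have "?u \<longlonglongrightarrow> (\<epsilon> + B * (1 - ?H \<nu>)) + (\<epsilon> + B * (1 - ?H \<nu>)) + \<bar>?S \<nu> - ?S \<nu>\<bar>"
      using conv Wne by (intro tendsto_intros) auto
    moreover have "(\<epsilon> + B * (1 - ?H \<nu>)) + (\<epsilon> + B * (1 - ?H \<nu>)) + \<bar>?S \<nu> - ?S \<nu>\<bar> < e"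
    proof -
      have "B * (1 - ?H \<nu>) \<le> B * \<epsilon>" using mass B by (intro mult_left_mono) auto
      moreover have "(3 + 2 * B) * \<epsilon> = e" using B by (simp add: \<epsilon>_def)
      then have "2 * \<epsilon> + 2 * (B * \<epsilon>) < e" using \<epsilon> by (simp add: algebra_simps)
      ultimately show ?thesis by simp
    qed
    ultimately have "\<forall>\<^sub>F k in sequentially. ?u k < e" by (rule order_tendstoD(2))
    with N have "\<forall>\<^sub>F k in sequentially. norm ((LINT x|N k. f x) - (LINT x|\<nu>. f x)) < e"
    proof eventually_elim
      case (elim k)
      have "\<bar>(LINT x|N k. f x) - ?S (N k)\<bar> \<le> \<epsilon> + B * (1 - ?H (N k))"
        using elim(1) by (intro step_approximation[OF _ _ fm B(2) W \<epsilon> t]) auto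
      moreover have "\<bar>(LINT x|\<nu>. f x) - ?S \<nu>\<bar> \<le> \<epsilon> + B * (1 - ?H \<nu>)"
        by (rule step_approximation[OF \<nu>(1,2) fm B(2) W \<epsilon> t])
      ultimately show ?case using elim(2) unfolding real_norm_def by linarith
    qed
    then show "\<exists>no. \<forall>n\<ge>no. norm ((LINT x|N n. f x) - (LINT x|\<nu>. f x)) < e"
      by (simp add: eventually_sequentially)
  qed
qed

text \<open>\<open>None\<close> stands for the logarithm of the derivative and \<open>Some v\<close> for the number of visits to the
  cylinder of \<open>v\<close>, so that there are countably many observables.\<close>

fun observable :: "nat list option \<Rightarrow> real \<Rightarrow> real" where
  "observable None b = ln \<bar>iter_deriv d T (code_length T b) b\<bar>"
| "observable (Some v) b = birk T (indicator (cy v)) (code_length T b) b"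

fun observable_mean :: "nat list option \<Rightarrow> real" where
  "observable_mean None = (LINT x|G.acim. L x)"
| "observable_mean (Some v) = measure G.acim (P v X)"

lemma observable_negligible:
  assumes ne: "boundary_points T \<noteq> {}" and \<epsilon>: "0 < \<epsilon>"
  shows "(\<lambda>k. real (card {b \<in> boundary_points_below d T k.
      real (code_length T b) * \<epsilon> \<le> \<bar>observable j b - real (code_length T b) * observable_mean j\<bar>})
    / real (card (boundary_points_below d T k))) \<longlonglongrightarrow> 0"
proof (cases j)
  case None
  have "G.concentrates L" using G.concentrates[OF G.s_pos G.exp_cyl_approx_L] .
  then show ?thesis
    unfolding None observable.simps observable_mean.simps
    by (rule deviation_negligible[OF ne L_measurable_M _ \<epsilon>]) (rule log_derivative_close)
next
  case (Some v)
  have "G.concentrates (indicator (P v X))"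
    using G.concentrates[OF G.s_pos G.exp_cyl_approx_indicator[of _ v]] by (simp only: cyl_eq)
  moreover have m: "indicator (P v X) \<in> borel_measurable M"
    using cylset_M_sets by (rule borel_measurable_indicator)
  moreover have "(LINT x|G.acim. indicator (P v X) x) = measure G.acim (P v X)"
    using cylset_M_sets[of v] by (simp add: P_X_subset Int_absorb2)
  ultimately show ?thesis
    unfolding Some observable.simps observable_mean.simps
    using deviation_negligible[OF ne m _ \<epsilon> visits_close] by (simp only:)
qed

text \<open>The sets \<open>A k\<close> avoid, from some \<open>k\<close> on, the points at which a given observable deviates by a
  given \<open>1 / (m + 1)\<close> from its mean. For the cylinder indicators this is convergence of
  frequencies, hence weak convergence; for \<open>log \<bar>T'\<bar>\<close> it is the second claim.\<close>

theorem typical_boundary_points: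
  assumes ne: "boundary_points T \<noteq> {}" and eq: "equilibrium_measure d T \<mu>\<^sub>1"
  shows "\<exists>A :: nat \<Rightarrow> real set.
     (\<forall>k. A k \<subseteq> boundary_points_below d T k) \<and>
     (\<lambda>k. real (card (A k)) / real (card (boundary_points_below d T k))) \<longlonglongrightarrow> 1 \<and>
     (\<forall>b :: nat \<Rightarrow> real. (\<forall>\<^sub>F k in sequentially. b k \<in> A k) \<longrightarrow>
        weak_star_conv (\<lambda>k. orbit_measure T (b k)) \<mu>\<^sub>1 \<and>
        (\<lambda>k. ln \<bar>iter_deriv d T (code_length T (b k)) (b k)\<bar> / real (code_length T (b k)))
          \<longlonglongrightarrow> lyapunov_exponent d T \<mu>\<^sub>1)"
proof -
  have inv: "invariant_prob T \<mu>\<^sub>1" using eq by (simp add: equilibrium_measure_def admissible_measure_def)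
  have core: "core \<mu>\<^sub>1 = G.acim" by (rule core_equilibrium[OF eq])
  define test where "test i = (from_nat i :: nat list option \<times> nat)" for i
  define dev where "dev = (\<lambda>(j, m). {b \<in> boundary_points T. real (code_length T b) * (1 / real (Suc m))
      \<le> \<bar>observable j b - real (code_length T b) * observable_mean j\<bar>})"
  define N where "N i k = boundary_points_below d T k \<inter> dev (test i)" for i k
  have "(\<lambda>k. real (card (N i k)) / real (card (boundary_points_below d T k))) \<longlonglongrightarrow> 0" for i
  proof -
    obtain j m where jm: "test i = (j, m)" by (cases "test i")
    have "N i k = {b \<in> boundary_points_below d T k. real (code_length T b) * (1 / real (Suc m))
      \<le> \<bar>observable j b - real (code_length T b) * observable_mean j\<bar>}" for k
      unfolding N_def jm dev_def boundary_points_below_def by auto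
    then show ?thesis using observable_negligible[OF ne, of "1 / real (Suc m)" j] by (simp only: zero_less_divide_1_iff of_nat_0_less_iff zero_less_Suc)
  qed
  then obtain A where A: "\<And>k. A k \<subseteq> boundary_points_below d T k"
    and ratio: "(\<lambda>k. real (card (A k)) / real (card (boundary_points_below d T k))) \<longlonglongrightarrow> 1"
    and avoid: "\<And>i. \<forall>\<^sub>F k in sequentially. A k \<inter> N i k = {}"
    using diagonal_selection[OF finite_below below_nonempty[OF ne], of N] by (auto simp: N_def)
  have lim: "(\<lambda>k. observable j (b k) / real (code_length T (b k))) \<longlonglongrightarrow> observable_mean j"
    if b: "\<forall>\<^sub>F k in sequentially. b k \<in> A k" for b j
  proof (rule LIMSEQ_I)
    fix e :: real assume "0 < e"
    then obtain m where m: "inverse (real (Suc m)) < e" using reals_Archimedean by blast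
    have te: "test (to_nat (j, m)) = (j, m)" by (simp add: test_def)
    have "\<forall>\<^sub>F k in sequentially. norm (observable j (b k) / real (code_length T (b k)) - observable_mean j) < e"
      using b avoid[of "to_nat (j, m)"]
    proof eventually_elim
      case (elim k)
      let ?n = "real (code_length T (b k))"
      have bp: "b k \<in> boundary_points T" and notin: "b k \<notin> dev (j, m)"
        using elim A[of k] by (auto simp: N_def te boundary_points_below_def)
      have n: "0 < ?n" using boundary_point(1)[OF bp] by simp
      have "\<bar>observable j (b k) - ?n * observable_mean j\<bar> < ?n * (1 / real (Suc m))"
        using notin bp by (simp add: dev_def not_le del: of_nat_Suc)
      also have "\<dots> < ?n * e" using m n by (intro mult_strict_left_mono) (simp_all add: inverse_eq_divide del: of_nat_Suc)
      finally have "\<bar>observable j (b k) - ?n * observable_mean j\<bar> / ?n < e" using n by (simp add: pos_divide_less_eq mult.commute)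
      moreover have "observable j (b k) / ?n - observable_mean j = (observable j (b k) - ?n * observable_mean j) / ?n"
        using n by (simp add: diff_divide_distrib)
      ultimately show ?case using n by (simp only: real_norm_def abs_divide abs_of_pos)
    qed
    then show "\<exists>no. \<forall>k\<ge>no. norm (observable j (b k) / real (code_length T (b k)) - observable_mean j) < e"
      by (simp add: eventually_sequentially)
  qed
  have conc: "weak_star_conv (\<lambda>k. orbit_measure T (b k)) \<mu>\<^sub>1 \<and>
      (\<lambda>k. ln \<bar>iter_deriv d T (code_length T (b k)) (b k)\<bar> / real (code_length T (b k)))
        \<longlonglongrightarrow> lyapunov_exponent d T \<mu>\<^sub>1"
    if b: "\<forall>\<^sub>F k in sequentially. b k \<in> A k" for b
  proof
    have bp: "\<forall>\<^sub>F k in sequentially. b k \<in> boundary_points T"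
      using b by eventually_elim (use A in \<open>auto simp: boundary_points_below_def\<close>)
    show "(\<lambda>k. ln \<bar>iter_deriv d T (code_length T (b k)) (b k)\<bar> / real (code_length T (b k)))
        \<longlonglongrightarrow> lyapunov_exponent d T \<mu>\<^sub>1"
      using lim[OF b, of None] unfolding lyapunov_core(1)[OF inv] core by simp
    show "weak_star_conv (\<lambda>k. orbit_measure T (b k)) \<mu>\<^sub>1"
    proof (rule weak_star_conv_cylinders)
      show "\<forall>\<^sub>F k in sequentially. prob_space (orbit_measure T (b k)) \<and> sets (orbit_measure T (b k)) = sets unit_borel"
        using bp by eventually_elim (auto simp: orbit_measure_facts)
      show "prob_space \<mu>\<^sub>1" "sets \<mu>\<^sub>1 = sets unit_borel" using inv by (auto simp: invariant_prob_def)
      have XX: "X \<in> sets \<mu>\<^sub>1" by (rule invariant_AE_X(1)[OF inv])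
      interpret C: prob_space "core \<mu>\<^sub>1" by (rule prob_space_core[OF inv])
      show "measure \<mu>\<^sub>1 X = 1" using measure_core[OF inv XX] C.prob_space by (simp add: space_core[OF inv])
      fix v :: "nat list" assume v: "v \<noteq> []"
      have "cy v \<inter> X = P v X"
      proof
        show "cy v \<inter> X \<subseteq> P v X" using X_iterate by (auto simp: P_iff)
        show "P v X \<subseteq> cy v \<inter> X" using P_in_cy[OF X_unit] P_X_subset[OF order_refl] by blast
      qed
      then have \<mu>: "measure \<mu>\<^sub>1 (cy v) = observable_mean (Some v)"
        using measure_core[OF inv, of "cy v"] cy_sets[OF v] by (simp add: sets_nu[OF inv] core)
      have "\<forall>\<^sub>F k in sequentially. observable (Some v) (b k) / real (code_length T (b k)) = measure (orbit_measure T (b k)) (cy v)"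
        using bp by eventually_elim (simp add: orbit_measure_facts(3)[OF _ v])
      then show "(\<lambda>k. measure (orbit_measure T (b k)) (cy v)) \<longlonglongrightarrow> measure \<mu>\<^sub>1 (cy v)"
        unfolding \<mu> by (rule Lim_transform_eventually[OF lim[OF b]])
    qed
  qed
  then show ?thesis using A ratio by blast
qed

end

theorem theorem1p5:
  fixes d :: "nat \<Rightarrow> real" and T :: "real \<Rightarrow> real" and \<mu>\<^sub>1 :: "real measure"
  assumes "superlinear_EMR_map d T"
    and "boundary_points T \<noteq> {}"
    and "equilibrium_measure d T \<mu>\<^sub>1"
  shows "\<exists>A :: nat \<Rightarrow> real set.
     (\<forall>k. A k \<subseteq> boundary_points_below d T k) \<and>
     (\<lambda>k. real (card (A k)) / real (card (boundary_points_below d T k))) \<longlonglongrightarrow> 1 \<and>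
     (\<forall>b :: nat \<Rightarrow> real. (\<forall>\<^sub>F k in sequentially. b k \<in> A k) \<longrightarrow>
        weak_star_conv (\<lambda>k. orbit_measure T (b k)) \<mu>\<^sub>1 \<and>
        (\<lambda>k. ln \<bar>iter_deriv d T (code_length T (b k)) (b k)\<bar> / real (code_length T (b k)))
          \<longlonglongrightarrow> lyapunov_exponent d T \<mu>\<^sub>1)"
proof -
  obtain \<xi> n0 K c \<alpha> where "1 < \<xi>" "1 \<le> n0"
      "\<And>x. (\<And>i. i < n0 \<Longrightarrow> (T ^^ i) x \<in> branch_interiors d) \<Longrightarrow> \<xi> \<le> \<bar>deriv (T ^^ n0) x\<bar>"
    and "0 < K" "\<And>n x y z. 1 \<le> n \<Longrightarrow> x \<in> interior (branch_dom d n) \<Longrightarrow> y \<in> interior (branch_dom d n) \<Longrightarrow>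
      z \<in> interior (branch_dom d n) \<Longrightarrow> \<bar>deriv (deriv T) x\<bar> \<le> K * (\<bar>deriv T y\<bar> * \<bar>deriv T z\<bar>)"
    and "0 < c" "1 < \<alpha>"
      "\<And>n x. 1 \<le> n \<Longrightarrow> x \<in> interior (branch_dom d n) \<Longrightarrow> c * real n powr \<alpha> \<le> \<bar>deriv T x\<bar>"
    using assms(1) unfolding superlinear_EMR_map_def EMR_map_def by metis
  then interpret emr d T K \<xi> c \<alpha> n0
    using assms(1) by unfold_locales (auto simp: superlinear_EMR_map_def EMR_map_def)
  show ?thesis by (rule typical_boundary_points[OF assms(2,3)])
qed

end
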